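(* Let $K_0\subset\mathbb{R}^3$ be a smooth compact mean-convex domain. There exist constants $\bar\delta>0$ and $C=C(K_0)<\infty$ such that if $\mathcal{K}$ is a $(\delta,\mathcal{H})$-flow with $\delta\le\bar\delta$, with initial condition $K_0$, and with $H_{\mathrm{neck}}\ge C$, and $\mathcal{L}$ is the level set flow with the same initial condition $K_0$, then $$d_{\mathrm{H}}(\mathcal{K},\mathcal{L})\le C\,H_{\mathrm{neck}}^{-1},$$ where $d_{\mathrm{H}}$ denotes the Hausdorff distance of the space-time tracks.
   Context: Notation. For a domain $K\subset\mathbb{R}^3$, $A$ is the second fundamental form of $\partial K$, $\lambda_1\le\lambda_2$ are the principal curvatures and $H=\lambda_1+\lambda_2$ the mean curvature (signs chosen so that convex domains have $\lambda_i\ge 0$); $B(p,r)$ is the open ball. The initial domain is mean-convex in the sense that $H>0$ on $\partial K_0$. Fixed data. A standard cap is a smooth convex domain $K^{\mathrm{st}}\subset\mathbb{R}^3$ that coincides with a solid round half-cylinder of radius $1$ outside a ball of radius $10$. A suitable standard cap $K^{\mathrm{st}}$, a suitable cap separation parameter $\Gamma<\infty$, constants $C_\ell<\infty$ ($\ell=0,1,2,\dots$) and a function $\delta'(\delta)$ with $\delta'(\delta)\to 0$ as $\delta\to 0$ are fixed. $\delta$-flow. A $\delta$-flow $\mathcal{K}$ is a collection of finitely many smooth mean-convex mean curvature flows $\{K_t^i\subseteq\mathbb{R}^3\}_{t\in[t_{i-1},t_i]}$ ($i=1,\dots,k$; $t_0<\dots<t_k$) such that: (a) for each $i=1,\dots,k-1$,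 the final time slices of some collection of disjoint strong $\delta$-necks are replaced by pairs of standard caps, giving a domain $K^\sharp_{t_i}\subseteq K^i_{t_i}=:K^-_{t_i}$; (b) the initial time slice of the next flow, $K^{i+1}_{t_i}=:K^+_{t_i}$, is obtained from $K^\sharp_{t_i}$ by discarding some connected components; (c) there is $r_\sharp=r_\sharp(\mathcal{K})>0$ such that all necks in (a) have radius $r\in[\frac12 r_\sharp,2r_\sharp]$. Strong $\delta$-neck. A $\delta$-flow $\{K_t\}_{t\in I}$ has a strong $\delta$-neck with center $p$ and radius $r$ at time $t_0\in I$ if $\{r^{-1}(K_{t_0+r^2t}-p)\}_{t\in(-1,0]}$ is $\delta$-close in $C^{\lfloor 1/\delta\rfloor}$ in $B(0,1/\delta)\times(-1,0]$ to the evolution of a solid round cylinder $D^2\times\mathbb{R}$ with radius $1$ at $t=0$. Replacing a $\delta$-neck by standard caps. The final time slice of a strong $\delta$-neck ($\delta\le\frac{1}{100\Gamma}$) with center $p$ and radius $r$ is replaced by a pair of standard caps if the presurgery domain $K^-$ is replaced by a postsurgery domain $K^\sharp\subseteq K^-$ such that: (a) the modification takes place inside a ball $B=B(p,5\Gamma r)$; (b) $\sup_{\partial K^\sharp\cap B}|\nabla^\ell A|\le C_\ell r^{-1-\ell}$ for $\ell=0,1,2,\dots$; (c) for every $p_\sharp\in\partial K^\sharp\cap B$ with $\lambda_1(p_\sharp)<0$ there is $p_-\in\partial K^-\cap B$ with $\frac{\lambda_1}{H}(p_-)\le\frac{\lambda_1}{H}(p_\sharp)$; (d) the domain $r^{-1}(K^\sharp-p)$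 is $\delta'(\delta)$-close in $B(0,10\Gamma)$ to a pair of disjoint standard caps that are at distance $\Gamma$ from the origin. $(\delta,\mathcal{H})$-flow. Here $\mathcal{H}=(H_{\mathrm{thick}},H_{\mathrm{neck}},H_{\mathrm{trigger}})$ is a triple of curvature scales. A $(\delta,\mathcal{H})$-flow is a $\delta$-flow $\{K_t\subset\mathbb{R}^3\}_{t\ge 0}$ with smooth compact mean-convex initial condition $K_0\subset\mathbb{R}^3$ such that: (a) $H\le H_{\mathrm{trigger}}$ everywhere, and surgery and/or discarding occurs precisely at times $t$ when $H=H_{\mathrm{trigger}}$ somewhere; (b) the collection of necks in item (a) of the definition of $\delta$-flow is a minimal collection of solid $\delta$-necks of curvature $H_{\mathrm{neck}}$ which separate the set $\{H=H_{\mathrm{trigger}}\}$ from $\{H\le H_{\mathrm{thick}}\}$ in $K_t^-$; (c) $K_t^+$ is obtained from $K_t^\sharp$ by discarding precisely those connected components with $H>\frac{1}{10}H_{\mathrm{neck}}$ everywhere, and for each pair of facing surgery caps, precisely one is discarded; (d) if a strong $\delta$-neck from (b) also is a strong $\hat\delta$-neck for some $\hat\delta<\delta$, then property (d) of replacing a neck by standard caps also holds with $\hat\delta$ instead of $\delta$. Space-time tracks. A $\delta$-flow is identified with its space-time track $\mathcal{K}=\bigcup_t K_t\times\{t\}\subset\mathbb{R}^3\times\mathbb{R}$, where $K_{t_i}:=K_{t_i}^-$ at surgery times. The level set flow $\mathcal{L}$ of $K_0$ is likewise identified with its space-time track (it is the maximal family of closed sets starting at $K_0$ that satisfies the avoidance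 principle with smooth compact mean curvature flows). *)

theory Defs
  imports "HOL-Analysis.Analysis"
begin

type_synonym R3 = "real^3"

section \<open>Smooth functions\<close>

text \<open>\<open>nderiv [v\<^sub>1, \<dots>, v\<^sub>k] f\<close> is the iterated directional derivative of \<open>f\<close> along
  \<open>v\<^sub>k\<close>, \<dots>, \<open>v\<^sub>1\<close>.\<close>

primrec nderiv :: "'a::real_normed_vector list \<Rightarrow> ('a \<Rightarrow> 'b::real_normed_vector) \<Rightarrow> 'a \<Rightarrow> 'b" where
  "nderiv [] f = f"
| "nderiv (v # vs) f = (\<lambda>x. frechet_derivative (nderiv vs f) (at x) v)"

text \<open>Only meant for open \<open>U\<close>.\<close>

definition smooth_on :: "'a::real_normed_vector set \<Rightarrow> ('a \<Rightarrow> 'b::real_normed_vector) \<Rightarrow> bool" where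
  "smooth_on U f \<longleftrightarrow> (\<forall>vs. \<forall>x\<in>U. nderiv vs f differentiable (at x))"

definition Ck_norm_le :: "nat \<Rightarrow> real \<Rightarrow> 'a::euclidean_space set \<Rightarrow> ('a \<Rightarrow> 'b::real_normed_vector) \<Rightarrow> bool" where
  "Ck_norm_le k \<epsilon> S f \<longleftrightarrow>
     (\<forall>vs. set vs \<subseteq> Basis \<and> length vs \<le> k \<longrightarrow> (\<forall>x\<in>S. norm (nderiv vs f x) \<le> \<epsilon>))"

definition gradient :: "('a::real_inner \<Rightarrow> real) \<Rightarrow> 'a \<Rightarrow> 'a" where
  "gradient f x = (THE D. GDERIV f x :> D)"

section \<open>Smooth domains and their curvature\<close>

definition defining_function :: "R3 set \<Rightarrow> R3 \<Rightarrow> (R3 \<Rightarrow> real) \<Rightarrow> bool" where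
  "defining_function K p f \<longleftrightarrow>
     (\<exists>U. open U \<and> p \<in> U \<and> smooth_on U f \<and>
        (\<forall>x\<in>U. (x \<in> K \<longleftrightarrow> f x \<le> 0) \<and> gradient f x \<noteq> 0))"

text \<open>Domains are closed and need not be connected; the empty domain is allowed (a flow after its
  extinction).\<close>

definition smooth_domain :: "R3 set \<Rightarrow> bool" where
  "smooth_domain K \<longleftrightarrow> closed K \<and> (\<forall>p\<in>frontier K. \<exists>f. defining_function K p f)"

definition outer_normal :: "R3 set \<Rightarrow> R3 \<Rightarrow> R3" where
  "outer_normal K p = (THE \<nu>. \<exists>f. defining_function K p f \<and> \<nu> = sgn (gradient f p))"

text \<open>\<open>A(v,w) = \<langle>D\<^sub>v \<nu>, w\<rangle>\<close> with \<open>\<nu>\<close> the outer normal, so that convex domains have \<open>A \<ge> 0\<close>.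
  The derivative within the surface is determined only on tangent vectors; all uses below are
  restricted to these.\<close>

definition second_ff :: "R3 set \<Rightarrow> R3 \<Rightarrow> R3 \<Rightarrow> R3 \<Rightarrow> real" where
  "second_ff K p v w =
     frechet_derivative (outer_normal K) (at p within frontier K) v \<bullet> w"

definition principal_curvatures :: "R3 set \<Rightarrow> R3 \<Rightarrow> real set" where
  "principal_curvatures K p =
     {\<kappa>. \<exists>v. v \<noteq> 0 \<and> v \<bullet> outer_normal K p = 0 \<and>
           (\<forall>w. w \<bullet> outer_normal K p = 0 \<longrightarrow> second_ff K p v w = \<kappa> * (v \<bullet> w))}"

definition lambda1 :: "R3 set \<Rightarrow> R3 \<Rightarrow> real" where
  "lambda1 K p = Min (principal_curvatures K p)"

definition lambda2 :: "R3 set \<Rightarrow> R3 \<Rightarrow> real" where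
  "lambda2 K p = Max (principal_curvatures K p)"

definition mean_curv :: "R3 set \<Rightarrow> R3 \<Rightarrow> real" where
  "mean_curv K p = lambda1 K p + lambda2 K p"

definition mean_convex :: "R3 set \<Rightarrow> bool" where
  "mean_convex K \<longleftrightarrow> (\<forall>x\<in>frontier K. mean_curv K x > 0)"

definition tan_proj :: "R3 set \<Rightarrow> R3 \<Rightarrow> R3 \<Rightarrow> R3" where
  "tan_proj K p v = v - (v \<bullet> outer_normal K p) *\<^sub>R outer_normal K p"

text \<open>\<open>cov_sff K l p [w\<^sub>1, \<dots>, w\<^sub>l, v, w]\<close> is \<open>(\<nabla>\<^sup>l A)\<^sub>p\<close>, with arguments projected to the tangent
  plane at \<open>p\<close>. For \<open>v\<close> tangent at \<open>p\<close>, the field \<open>x \<mapsto> tan_proj K x v\<close> has vanishing covariant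
  derivative at \<open>p\<close>; hence differentiating the tensor evaluated on such fields gives the
  Levi-Civita derivative.\<close>

primrec cov_sff :: "R3 set \<Rightarrow> nat \<Rightarrow> R3 \<Rightarrow> R3 list \<Rightarrow> real" where
  "cov_sff K 0 p vs = second_ff K p (tan_proj K p (vs ! 0)) (tan_proj K p (vs ! 1))"
| "cov_sff K (Suc l) p vs =
     frechet_derivative (\<lambda>x. cov_sff K l x (map (tan_proj K p) (tl vs)))
       (at p within frontier K) (tan_proj K p (hd vs))"

text \<open>Because of the projections, summing over the standard basis of the ambient space gives the
  tensor norm on the tangent plane.\<close>

definition norm_cov_sff :: "R3 set \<Rightarrow> nat \<Rightarrow> R3 \<Rightarrow> real" where
  "norm_cov_sff K l p =
     sqrt (\<Sum>vs\<in>{vs. length vs = l + 2 \<and> set vs \<subseteq> Basis}. (cov_sff K l p vs)\<^sup>2)"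

section \<open>Mean curvature flow\<close>

text \<open>Locally in space-time \<open>K\<^sub>s = {F(\<cdot>,s) \<le> 0}\<close>, and the outward normal velocity
  \<open>- \<partial>\<^sub>s F / |\<nabla>F|\<close> equals \<open>- H\<close>. Since \<open>F\<close> lives on a full neighbourhood, the flow is
  smooth up to the endpoints of \<open>I\<close>. Such an \<open>F\<close> is required at every point of space, not only
  at boundary points, so that no component can appear or vanish suddenly.\<close>

definition smooth_mcf :: "real set \<Rightarrow> (real \<Rightarrow> R3 set) \<Rightarrow> bool" where
  "smooth_mcf I K \<longleftrightarrow>
     (\<forall>t\<in>I. \<forall>p. \<exists>W F. open W \<and> (p, t) \<in> W \<and> smooth_on W F \<and>
        (\<forall>x s. (x, s) \<in> W \<and> s \<in> I \<longrightarrow>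
           (x \<in> K s \<longleftrightarrow> F (x, s) \<le> 0) \<and>
           (F (x, s) = 0 \<longrightarrow>
              gradient (\<lambda>y. F (y, s)) x \<noteq> 0 \<and>
              deriv (\<lambda>\<tau>. F (x, \<tau>)) s =
                norm (gradient (\<lambda>y. F (y, s)) x) * mean_curv (K s) x)))"

text \<open>The barriers are the evolving closed embedded surfaces \<open>frontier (M t)\<close>, each such surface in
  space being the boundary of a compact domain \<open>M t\<close>.\<close>

definition avoids_smooth_flows :: "(real \<Rightarrow> R3 set) \<Rightarrow> bool" where
  "avoids_smooth_flows L \<longleftrightarrow>
     (\<forall>a b M. 0 \<le> a \<and> a \<le> b \<and> smooth_mcf {a..b} M \<and> bounded (\<Union>t\<in>{a..b}. M t) \<and>
        L a \<inter> frontier (M a) = {} \<longrightarrow> (\<forall>t\<in>{a..b}. L t \<inter> frontier (M t) = {}))"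

definition weak_set_flow_from :: "R3 set \<Rightarrow> (real \<Rightarrow> R3 set) \<Rightarrow> bool" where
  "weak_set_flow_from K0 L \<longleftrightarrow> (\<forall>t\<ge>0. closed (L t)) \<and> L 0 = K0 \<and> avoids_smooth_flows L"

definition level_set_flow :: "R3 set \<Rightarrow> (real \<Rightarrow> R3 set) \<Rightarrow> bool" where
  "level_set_flow K0 L \<longleftrightarrow>
     weak_set_flow_from K0 L \<and> (\<forall>L'. weak_set_flow_from K0 L' \<longrightarrow> (\<forall>t\<ge>0. L' t \<subseteq> L t))"

section \<open>Closeness of domains and flows\<close>

text \<open>\<open>K\<close> is \<open>\<epsilon>\<close>-close in \<open>C\<^sup>k\<close> to \<open>M\<close> in \<open>B(0,R)\<close> if a diffeomorphism \<open>\<phi>\<close> of \<open>B(0,R)\<close> onto its image,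
  \<open>\<epsilon>\<close>-close to the identity in \<open>C\<^sup>k\<close>, carries \<open>K\<close> into \<open>M\<close> and the complement of \<open>K\<close> into
  that of \<open>M\<close>.\<close>

definition domain_close :: "real \<Rightarrow> nat \<Rightarrow> real \<Rightarrow> R3 set \<Rightarrow> R3 set \<Rightarrow> bool" where
  "domain_close \<epsilon> k R K M \<longleftrightarrow>
     (\<exists>\<phi>. smooth_on (ball 0 R) \<phi> \<and> inj_on \<phi> (ball 0 R) \<and>
        (\<forall>x\<in>ball 0 R. bij (frechet_derivative \<phi> (at x))) \<and>
        Ck_norm_le k \<epsilon> (ball 0 R) (\<lambda>x. \<phi> x - x) \<and>
        (\<forall>x\<in>ball 0 R. x \<in> K \<longleftrightarrow> \<phi> x \<in> M))"

text \<open>The same in \<open>B(0,R) \<times> (-1,0]\<close>, with a smooth family of diffeomorphisms; the \<open>C\<^sup>k\<close> norm takes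
  all space-time derivatives.\<close>

definition flow_close :: "real \<Rightarrow> nat \<Rightarrow> real \<Rightarrow> (real \<Rightarrow> R3 set) \<Rightarrow> (real \<Rightarrow> R3 set) \<Rightarrow> bool" where
  "flow_close \<epsilon> k R K M \<longleftrightarrow>
     (\<exists>W (\<phi> :: R3 \<times> real \<Rightarrow> R3). open W \<and> ball 0 R \<times> {-1<..0} \<subseteq> W \<and> smooth_on W \<phi> \<and>
        Ck_norm_le k \<epsilon> (ball 0 R \<times> {-1<..0}) (\<lambda>z. \<phi> z - fst z) \<and>
        (\<forall>t\<in>{-1<..0}. inj_on (\<lambda>x. \<phi> (x, t)) (ball 0 R) \<and>
           (\<forall>x\<in>ball 0 R. bij (frechet_derivative (\<lambda>y. \<phi> (y, t)) (at x)) \<and>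
              (x \<in> K t \<longleftrightarrow> \<phi> (x, t) \<in> M t))))"

definition rescale :: "R3 \<Rightarrow> real \<Rightarrow> R3 set \<Rightarrow> R3 set" where
  "rescale p r K = (\<lambda>x. (1 / r) *\<^sub>R (x - p)) ` K"

section \<open>Standard caps\<close>

definition half_cylinder :: "R3 \<Rightarrow> R3 \<Rightarrow> R3 set" where
  "half_cylinder a e = {x. 0 \<le> (x - a) \<bullet> e \<and> norm ((x - a) - ((x - a) \<bullet> e) *\<^sub>R e) \<le> 1}"

definition standard_cap :: "R3 set \<Rightarrow> bool" where
  "standard_cap K \<longleftrightarrow> smooth_domain K \<and> convex K \<and>
     (\<exists>a e c. norm e = 1 \<and> K - ball c 10 = half_cylinder a e - ball c 10)"

definition rigid_copy :: "R3 set \<Rightarrow> R3 set \<Rightarrow> bool" where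
  "rigid_copy K S \<longleftrightarrow> (\<exists>f v. orthogonal_transformation f \<and> S = (\<lambda>x. v + f x) ` K)"

text \<open>The data fixed once and for all: standard cap, cap separation parameter \<open>\<Gamma>\<close>, the constants
  \<open>C\<^sub>l\<close>, and the function \<open>\<delta>'\<close>.\<close>

record surgery_data =
  cap :: "R3 set"
  cap_sep :: real
  curv_const :: "nat \<Rightarrow> real"
  cap_delta :: "real \<Rightarrow> real"

definition valid_surgery_data :: "surgery_data \<Rightarrow> bool" where
  "valid_surgery_data P \<longleftrightarrow>
     standard_cap (cap P) \<and> cap_sep P > 0 \<and>
     (\<forall>\<delta>>0. cap_delta P \<delta> > 0) \<and> (cap_delta P \<longlongrightarrow> 0) (at_right 0)"

text \<open>As for necks, \<open>\<delta>'\<close>-close is understood in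
  \<open>C\<^sup>k\<close>, \<open>k = \<lfloor>1/\<delta>'\<rfloor>\<close>.\<close>

definition close_to_caps :: "surgery_data \<Rightarrow> real \<Rightarrow> R3 \<Rightarrow> real \<Rightarrow> R3 set \<Rightarrow> bool" where
  "close_to_caps P \<delta> p r Ks \<longleftrightarrow>
     (\<exists>S1 S2. rigid_copy (cap P) S1 \<and> rigid_copy (cap P) S2 \<and> S1 \<inter> S2 = {} \<and>
        infdist 0 S1 = cap_sep P \<and> infdist 0 S2 = cap_sep P \<and>
        domain_close (cap_delta P \<delta>) (nat \<lfloor>1 / cap_delta P \<delta>\<rfloor>) (10 * cap_sep P)
          (rescale p r Ks) (S1 \<union> S2))"

text \<open>Simultaneous replacement of the necks in \<open>N\<close>, a set of pairs (center, radius), turning the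
  presurgery domain \<open>Km\<close> into the postsurgery domain \<open>Ks\<close>.\<close>

definition replaced_by_caps ::
    "surgery_data \<Rightarrow> real \<Rightarrow> (R3 \<times> real) set \<Rightarrow> R3 set \<Rightarrow> R3 set \<Rightarrow> bool" where
  "replaced_by_caps P \<delta> N Km Ks \<longleftrightarrow>
     smooth_domain Ks \<and> Ks \<subseteq> Km \<and>
     Ks - (\<Union>(p, r)\<in>N. ball p (5 * cap_sep P * r)) =
       Km - (\<Union>(p, r)\<in>N. ball p (5 * cap_sep P * r)) \<and>
     (\<forall>(p, r)\<in>N.
        \<delta> \<le> 1 / (100 * cap_sep P) \<and>
        (\<forall>l. \<forall>x\<in>frontier Ks \<inter> ball p (5 * cap_sep P * r).
           norm_cov_sff Ks l x \<le> curv_const P l / r ^ (1 + l)) \<and>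
        (\<forall>x\<in>frontier Ks \<inter> ball p (5 * cap_sep P * r). lambda1 Ks x < 0 \<longrightarrow>
           (\<exists>y\<in>frontier Km \<inter> ball p (5 * cap_sep P * r).
              lambda1 Km y / mean_curv Km y \<le> lambda1 Ks x / mean_curv Ks x)) \<and>
        close_to_caps P \<delta> p r Ks)"

section \<open>Flows with surgery\<close>

text \<open>The smooth flows \<open>slice K i\<close>, \<open>1 \<le> i \<le> num_flows K\<close>, live on \<open>[stime K (i-1), stime K i]\<close>.
  The last time may be infinite, for flows that exist for all later times. For
  \<open>1 \<le> i < num_flows K\<close>, \<open>necks K i\<close> are the (center, radius) pairs of the necks replaced at time
  \<open>stime K i\<close> and \<open>sharp K i\<close> is the resulting domain, before components are discarded.\<close>

record surgery_flow =
  num_flows :: nat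
  stime :: "nat \<Rightarrow> ereal"
  slice :: "nat \<Rightarrow> real \<Rightarrow> R3 set"
  necks :: "nat \<Rightarrow> (R3 \<times> real) set"
  sharp :: "nat \<Rightarrow> R3 set"

definition piece_interval :: "surgery_flow \<Rightarrow> nat \<Rightarrow> real set" where
  "piece_interval K i = {t. stime K (i - 1) \<le> ereal t \<and> ereal t \<le> stime K i}"

definition flow_interval :: "surgery_flow \<Rightarrow> real set" where
  "flow_interval K = {t. stime K 0 \<le> ereal t \<and> ereal t \<le> stime K (num_flows K)}"

definition surgery_time :: "surgery_flow \<Rightarrow> nat \<Rightarrow> real" where
  "surgery_time K i = real_of_ereal (stime K i)"

definition pre_domain :: "surgery_flow \<Rightarrow> nat \<Rightarrow> R3 set" where
  "pre_domain K i = slice K i (surgery_time K i)"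

definition post_domain :: "surgery_flow \<Rightarrow> nat \<Rightarrow> R3 set" where
  "post_domain K i = slice K (Suc i) (surgery_time K i)"

text \<open>At surgery times this is the presurgery domain.\<close>

definition domain_at :: "surgery_flow \<Rightarrow> real \<Rightarrow> R3 set" where
  "domain_at K t = slice K (LEAST i. 1 \<le> i \<and> ereal t \<le> stime K i) t"

definition round_cylinder :: "R3 \<Rightarrow> real \<Rightarrow> R3 set" where
  "round_cylinder e \<rho> = {x. norm (x - (x \<bullet> e) *\<^sub>R e) \<le> \<rho>}"

definition strong_neck :: "surgery_flow \<Rightarrow> real \<Rightarrow> R3 \<Rightarrow> real \<Rightarrow> real \<Rightarrow> bool" where
  "strong_neck K \<delta> p r t0 \<longleftrightarrow>
     r > 0 \<and> {t0 - r\<^sup>2 <.. t0} \<subseteq> flow_interval K \<and>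
     (\<exists>e. norm e = 1 \<and>
        flow_close \<delta> (nat \<lfloor>1 / \<delta>\<rfloor>) (1 / \<delta>)
          (\<lambda>t. rescale p r (domain_at K (t0 + r\<^sup>2 * t)))
          (\<lambda>t. round_cylinder e (sqrt (1 - 2 * t))))"

definition solid_neck :: "R3 set \<Rightarrow> real \<Rightarrow> R3 \<times> real \<Rightarrow> R3 set" where
  "solid_neck Km \<delta> n = Km \<inter> ball (fst n) (snd n / \<delta>)"

definition delta_flow :: "surgery_data \<Rightarrow> real \<Rightarrow> surgery_flow \<Rightarrow> bool" where
  "delta_flow P \<delta> K \<longleftrightarrow>
     0 < \<delta> \<and> 1 \<le> num_flows K \<and> stime K 0 \<noteq> -\<infinity> \<and>
     (\<forall>i\<in>{1..num_flows K}.
        stime K (i - 1) < stime K i \<and>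
        smooth_mcf (piece_interval K i) (slice K i) \<and>
        (\<forall>t\<in>piece_interval K i. mean_convex (slice K i t))) \<and>
     (\<forall>i\<in>{1..<num_flows K}.
        (\<forall>(p, r)\<in>necks K i. strong_neck K \<delta> p r (surgery_time K i)) \<and>
        pairwise (\<lambda>m n. disjnt (solid_neck (pre_domain K i) \<delta> m) (solid_neck (pre_domain K i) \<delta> n))
          (necks K i) \<and>
        replaced_by_caps P \<delta> (necks K i) (pre_domain K i) (sharp K i) \<and>
        (\<exists>\<C>\<subseteq>components (sharp K i). post_domain K i = \<Union>\<C>)) \<and>
     (\<exists>rs>0. \<forall>i\<in>{1..<num_flows K}. \<forall>(p, r)\<in>necks K i. rs / 2 \<le> r \<and> r \<le> 2 * rs)"

definition necks_separate :: "R3 set \<Rightarrow> real \<Rightarrow> (R3 \<times> real) set \<Rightarrow> R3 set \<Rightarrow> R3 set \<Rightarrow> bool" where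
  "necks_separate Km \<delta> N X Y \<longleftrightarrow>
     (\<forall>S\<subseteq>Km. connected S \<and> S \<inter> X \<noteq> {} \<and> S \<inter> Y \<noteq> {} \<longrightarrow>
        S \<inter> (\<Union>n\<in>N. solid_neck Km \<delta> n) \<noteq> {})"

definition surgery_or_discarding_at :: "surgery_flow \<Rightarrow> real \<Rightarrow> bool" where
  "surgery_or_discarding_at K t \<longleftrightarrow>
     (\<exists>i\<in>{1..<num_flows K}. stime K i = ereal t \<and>
        (necks K i \<noteq> {} \<or> post_domain K i \<noteq> sharp K i))"

record curvature_scales =
  H_thick :: real
  H_neck :: real
  H_trigger :: real

text \<open>A round cylinder of radius \<open>r\<close> has mean curvature \<open>1/r\<close>, so a neck of curvature \<open>H_neck\<close> is one
  of radius \<open>1 / H_neck\<close>. The pair of facing caps at a neck consists of the two components of the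
  postsurgery domain in the ball where it is close to two standard caps.\<close>

definition delta_H_flow :: "surgery_data \<Rightarrow> real \<Rightarrow> curvature_scales \<Rightarrow> surgery_flow \<Rightarrow> bool" where
  "delta_H_flow P \<delta> \<H> K \<longleftrightarrow>
     delta_flow P \<delta> K \<and>
     0 < H_thick \<H> \<and> 0 < H_neck \<H> \<and> 0 < H_trigger \<H> \<and>
     stime K 0 = 0 \<and> stime K (num_flows K) = \<infinity> \<and>
     smooth_domain (domain_at K 0) \<and> compact (domain_at K 0) \<and> mean_convex (domain_at K 0) \<and>
     (\<forall>i\<in>{1..num_flows K}. \<forall>t\<in>piece_interval K i. \<forall>x\<in>frontier (slice K i t).
        mean_curv (slice K i t) x \<le> H_trigger \<H>) \<and>
     (\<forall>t\<ge>0. surgery_or_discarding_at K t \<longleftrightarrow>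
        (\<exists>x\<in>frontier (domain_at K t). mean_curv (domain_at K t) x = H_trigger \<H>)) \<and>
     (\<forall>i\<in>{1..<num_flows K}.
        (\<forall>(p, r)\<in>necks K i. r = 1 / H_neck \<H>) \<and>
        (let Km = pre_domain K i;
             X = {x \<in> frontier Km. mean_curv Km x = H_trigger \<H>};
             Y = {x \<in> frontier Km. mean_curv Km x \<le> H_thick \<H>}
         in necks_separate Km \<delta> (necks K i) X Y \<and>
            (\<forall>N'. N' \<subset> necks K i \<longrightarrow> \<not> necks_separate Km \<delta> N' X Y)) \<and>
        post_domain K i =
          \<Union>{A \<in> components (sharp K i).
              \<not> (\<forall>x\<in>A \<inter> frontier (sharp K i). mean_curv (sharp K i) x > H_neck \<H> / 10)} \<and>
        (\<forall>(p, r)\<in>necks K i. \<exists>A B.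
           components (sharp K i \<inter> ball p (10 * cap_sep P * r)) = {A, B} \<and> A \<noteq> B \<and>
           A \<subseteq> post_domain K i \<and> B \<inter> post_domain K i = {}) \<and>
        (\<forall>(p, r)\<in>necks K i. \<forall>\<delta>h. 0 < \<delta>h \<and> \<delta>h < \<delta> \<and> strong_neck K \<delta>h p r (surgery_time K i) \<longrightarrow>
           close_to_caps P \<delta>h p r (sharp K i)))"

section \<open>Space-time tracks and Hausdorff distance\<close>

definition track :: "real set \<Rightarrow> (real \<Rightarrow> R3 set) \<Rightarrow> (R3 \<times> real) set" where
  "track I K = {(x, t). t \<in> I \<and> x \<in> K t}"

definition hausdorff_dist :: "'a::metric_space set \<Rightarrow> 'a set \<Rightarrow> ennreal" where
  "hausdorff_dist A B =
     max (SUP a\<in>A. INF b\<in>B. ennreal (dist a b)) (SUP b\<in>B. INF a\<in>A. ennreal (dist a b))"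

end

theory Submission
 imports Defs "HOL-Analysis.Analysis"
begin

text \<open>A surgery flow avoids smooth flows, so it is a weak set flow and lies inside the level set flow
 \<open>L\<close>. Conversely fix \<open>d = 20 / H_neck\<close> and a delay \<open>\<tau>\<close> of order \<open>d\<close>. As the initial domain is mean convex,
 after time \<open>\<tau>\<close> the level set flow has moved a distance \<open>d\<close> into \<open>K0\<close>. The property that all balls of radius
 \<open>d\<close> about points of \<open>L (t + \<tau>)\<close> lie in \<open>K t\<close> survives smooth evolution, because translates of a smooth
 flow by vectors shorter than \<open>d\<close> are barriers, and it survives surgery, because a ball of radius \<open>d\<close>
 neither meets a neck of radius \<open>1 / H_neck\<close> nor fits into a component of large curvature.

 That \<open>L\<close> leaves the boundary of \<open>K0\<close> at once needs exterior barriers at saddle points: these are thin tori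
 of revolution with a dented meridian, whose short time evolution is constructed by a contraction
 argument for Fourier series.\<close>

text \<open>Only smooth flows whose frontier is disjoint from \<open>L 0\<close> at the start act as
  barriers, so the smooth flow of \<open>K0\<close> itself, which touches \<open>L 0\<close>, says
  nothing until \<open>L\<close> has left the boundary. Spheres outside \<open>K0\<close> shrink
  away from it; a compact barrier that advances must have a saddle of negative mean curvature facing
  \<open>K0\<close>, hence the dented torus. Once \<open>L s\<close> lies in the interior for one
  small \<open>s\<close>, the flow of \<open>K0\<close> delayed by \<open>s\<close> is a barrier,
  and a lower bound \<open>h\<close> of its mean curvature turns the delay \<tau> into the depth
  \<open>h \<tau>\<close>. The dent is a ripple of frequency 4000 and amplitude
  \<open>(1 + b) / (4000^2 - 1)\<close>. Its second derivative is of order one and reverses the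
  curvature, while value and slope are so small that the leading coefficient of the quasilinear
  equation differs from 1 by at most 1/8. The equation is then a perturbation of the heat equation,
  and the contraction closes because, mode by mode, two space derivatives of the Duhamel integral
  cost only the factor 1. The number 20: a component containing a ball of radius \<open>d\<close>
  has mean curvature at most \<open>2 / d\<close> somewhere, and \<open>2 / d = H_neck / 10\<close>
  is the threshold for discarding.\<close>

abbreviation (input) scaleR_ascii (infixr "*#" 75) where "r *# x == r *\<^sub>R x"
abbreviation (input) inner_ascii (infixl "*." 70) where "x *. y == x \<bullet> y"
abbreviation (input) seqlim_ascii (infixr "---->" 60) where "X ----> L == X \<longlonglongrightarrow> L"

section \<open>Fourier series with absolutely summable coefficients\<close>

text \<open>Fourier coefficients are functions of time on the whole line and not on an interval
  \<open>{0..T}\<close>: the type then does not depend on the time \<open>T\<close> that the fixed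
  point argument selects, and the operators below clip time where necessary.\<close>

type_synonym tfun = "real \<Rightarrow>\<^sub>C complex"

lemma norm_apply_bcontfun_le: "norm (apply_bcontfun f t) <= norm (f :: 'a::topological_space \<Rightarrow>\<^sub>C 'b::real_normed_vector)"
 using dist_bounded[of f t 0] by simp

lemma norm_bcontfun_leI:
 fixes f :: "'a::topological_space \<Rightarrow>\<^sub>C 'b::real_normed_vector"
 assumes "!!t. norm (apply_bcontfun f t) <= b" shows "norm f <= b"
 using dist_bound[of f 0 b] assms by simp

setup_lifting type_definition_bcontfun

lift_definition tmul :: "tfun => tfun => tfun" is "%f g t. f t * g t"
proof -
 fix f g :: "real => complex" assume f: "f \<in> bcontfun" and g: "g \<in> bcontfun"
 obtain B where B: "!!t. norm (f t) <= B" using f by (auto simp: bcontfun_def bounded_iff)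
 obtain C where C: "!!t. norm (g t) <= C" using g by (auto simp: bcontfun_def bounded_iff)
 have "norm (f t * g t) <= B * C" for t
 unfolding norm_mult using B[of t] C[of t] norm_ge_zero order_trans by (intro mult_mono) blast+
 then show "(%t. f t * g t) \<in> bcontfun"
 using f g unfolding bcontfun_def by (auto intro!: continuous_intros simp: bounded_iff)
qed

lemma norm_tmul_le: "norm (tmul f g) <= norm f * norm g"
proof (rule norm_bcontfun_leI)
 fix t show "norm (apply_bcontfun (tmul f g) t) <= norm f * norm g"
 unfolding tmul.rep_eq norm_mult
 by (intro mult_mono norm_apply_bcontfun_le) auto
qed

lemma bilinear_tmul: "bounded_bilinear tmul"
proof
 show "EX K. ALL a b. norm (tmul a b) <= norm a * norm b * K"
 by (rule exI[of _ 1]) (simp add: norm_tmul_le)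
qed (rule bcontfun_eqI, simp add: tmul.rep_eq plus_bcontfun.rep_eq scaleR_bcontfun.rep_eq algebra_simps)+

interpretation tmul: bounded_bilinear tmul by (rule bilinear_tmul)

text \<open>The ratio is tuned to the ripple: \<open>wt 4000\<close> stays below 3, while any ratio
  above 1 absorbs every polynomial factor that differentiation in space produces.\<close>

definition wt :: "int => real" where "wt n = (1 + 1/4000) ^ nat \<bar>n\<bar>"

lemma wt_ge1: "1 <= wt n" unfolding wt_def by (rule one_le_power) simp
lemma wt_pos: "0 < wt n" using wt_ge1[of n] by linarith
lemma wt_nonneg: "0 <= wt n" using wt_pos[of n] by linarith
lemma wt_0[simp]: "wt 0 = 1" by (simp add: wt_def)
lemma wt_minus: "wt (- n) = wt n" by (simp add: wt_def)
text \<open>Submultiplicativity is what keeps the weighted space closed under convolution.\<close>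

lemma wt_add: "wt (m + n) <= wt m * wt n"
 unfolding wt_def power_add[symmetric] by (rule power_increasing) auto

definition wsummable :: "(int => tfun) => bool" where
 "wsummable c \<longleftrightarrow> (%n. wt n * norm (c n)) summable_on UNIV"

lemma wsummable_comparison:
 assumes "wsummable d" "!!n. norm (c n) <= K * norm (d n)"
 shows "wsummable c"
 unfolding wsummable_def
proof (rule summable_on_comparison_test)
 show "(%n. K * (wt n * norm (d n))) summable_on UNIV"
 using assms(1) unfolding wsummable_def by (rule summable_on_cmult_right)
 show "wt n * norm (c n) <= K * (wt n * norm (d n))" for n
 using mult_left_mono[OF assms(2), of "wt n"] wt_pos[of n] by (simp add: algebra_simps)
 show "0 <= wt n * norm (c n)" for n using wt_pos[of n] by simp
qed

lemma wsummable_add: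
 assumes "wsummable c" "wsummable d" shows "wsummable (%n. c n + d n)"
 unfolding wsummable_def
proof (rule summable_on_comparison_test)
 show "(%n. wt n * norm (c n) + wt n * norm (d n)) summable_on UNIV"
 using assms unfolding wsummable_def by (rule summable_on_add)
 show "wt n * norm (c n + d n) <= wt n * norm (c n) + wt n * norm (d n)" for n
 using mult_left_mono[OF norm_triangle_ineq, of "wt n" "c n" "d n"] wt_pos[of n] by (simp add: algebra_simps)
 show "0 <= wt n * norm (c n + d n)" for n using wt_pos[of n] by simp
qed

lemma wsummable_scaleR: "wsummable c ==> wsummable (%n. r *# c n)"
 by (rule wsummable_comparison[of c _ "\<bar>r\<bar>"]) simp_all

lemma wsummable_diff:
 assumes "wsummable c" "wsummable d" shows "wsummable (%n. c n - d n)"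
 using wsummable_add[OF assms(1) wsummable_scaleR[OF assms(2), of "-1"]] by simp

text \<open>The weighted Wiener algebra over \<open>tfun\<close>. Its norm adds up the sizes of
  single coefficients, so products and Fourier multipliers are estimated with explicit
  constants.\<close>

typedef wien = "{c. wsummable c}" morphisms coef Wien
 by (rule exI[of _ "%_. 0"]) (simp add: wsummable_def)

setup_lifting type_definition_wien

instantiation wien :: real_vector
begin
lift_definition zero_wien :: wien is "%_. 0" by (simp add: wsummable_def)
lift_definition plus_wien :: "wien => wien => wien" is "%c d n. c n + d n" by (rule wsummable_add)
lift_definition minus_wien :: "wien => wien => wien" is "%c d n. c n - d n" by (rule wsummable_diff)
lift_definition uminus_wien :: "wien => wien" is "%c n. - c n" by (simp add: wsummable_def)
lift_definition scaleR_wien :: "real => wien => wien" is "%r c n. r *# c n" by (rule wsummable_scaleR)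
instance by standard (transfer; simp add: fun_eq_iff scaleR_add_right scaleR_add_left)+
end

lemma wsummable_coef: "wsummable (coef x)" using coef[of x] by simp

lemma summable_coef: "(%n. wt n * norm (coef x n)) summable_on UNIV"
 using wsummable_coef unfolding wsummable_def .

instantiation wien :: real_normed_vector
begin
definition norm_wien :: "wien => real" where "norm_wien x = (\<Sum>\<^sub>\<infinity>n. wt n * norm (coef x n))"
definition dist_wien :: "wien => wien => real" where "dist_wien x y = norm (x - y)"
definition sgn_wien :: "wien => wien" where "sgn_wien x = x /\<^sub>R norm x"
definition uniformity_wien :: "(wien \<times> wien) filter" where
 "uniformity_wien = (INF e\<in>{0 <..}. principal {(x, y). dist x y < e})"
definition open_wien :: "wien set => bool" where
 "open_wien U = (\<forall>x\<in>U. eventually (%(x', y). x' = x --> y \<in> U) uniformity)"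
instance
proof
 fix x y :: wien and r :: real
 have nn: "0 <= wt n * norm (coef x n)" for n using wt_pos[of n] by simp
 have "norm x = 0 ==> coef x n = 0" for n
 proof -
 assume "norm x = 0"
 then have "wt n * norm (coef x n) = 0"
 unfolding norm_wien_def using nonneg_infsum_le_0D[OF _ summable_coef, of x n] nn by simp
 then show "coef x n = 0" using wt_pos[of n] by simp
 qed
 moreover have "norm (0::wien) = 0" unfolding norm_wien_def zero_wien.rep_eq by simp
 ultimately show "(norm x = 0) = (x = 0)"
 by (metis coef_inject zero_wien.rep_eq ext)
 have "norm (x + y) <= (\<Sum>\<^sub>\<infinity>n. wt n * norm (coef x n) + wt n * norm (coef y n))"
 unfolding norm_wien_def
 proof (rule infsum_mono[OF summable_coef summable_on_add[OF summable_coef summable_coef]])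
 fix n show "wt n * norm (coef (x + y) n) <= wt n * norm (coef x n) + wt n * norm (coef y n)"
 using mult_left_mono[OF norm_triangle_ineq, of "wt n" "coef x n" "coef y n"] wt_pos[of n]
 by (simp add: algebra_simps plus_wien.rep_eq)
 qed
 then show "norm (x + y) <= norm x + norm y"
 unfolding norm_wien_def by (simp add: infsum_add summable_coef)
 have "norm (r *# x) = (\<Sum>\<^sub>\<infinity>n. \<bar>r\<bar> * (wt n * norm (coef x n)))"
 unfolding norm_wien_def scaleR_wien.rep_eq by (simp add: algebra_simps)
 then show "norm (r *# x) = \<bar>r\<bar> * norm x"
 unfolding norm_wien_def by (simp add: infsum_cmult_right')
qed (simp_all add: dist_wien_def sgn_wien_def uniformity_wien_def open_wien_def)
end

lemma norm_wien_leI: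
 assumes "!!F. finite F ==> (\<Sum>n\<in>F. wt n * norm (coef x n)) <= B"
 shows "norm x <= B"
 unfolding norm_wien_def by (rule infsum_le_finite_sums[OF summable_coef]) (use assms in auto)

lemma finite_sum_le_norm_wien: "finite F ==> (\<Sum>n\<in>F. wt n * norm (coef x n)) <= norm x"
 unfolding norm_wien_def
 by (rule finite_sum_le_infsum[OF summable_coef]) (auto intro!: mult_nonneg_nonneg wt_nonneg)

lemma wt_norm_coef_le: "wt n * norm (coef x n) <= norm x"
 using finite_sum_le_norm_wien[of "{n}" x] by simp

lemma norm_coef_le: "norm (coef x n) <= norm x"
 using wt_norm_coef_le[of n x] mult_right_mono[OF wt_ge1[of n], of "norm (coef x n)"] by simp

text \<open>The coefficients converge one at a time; the Cauchy bound survives in every finite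
  partial sum of the weighted norm, and from there it passes to the whole series.\<close>

instance wien :: banach
proof
 fix X :: "nat => wien" assume C: "Cauchy X"
 have "Cauchy (%j. coef (X j) n)" for n
 unfolding Cauchy_def dist_norm
 proof (intro allI impI)
 fix e :: real assume "0 < e"
 then obtain M where "\<forall>i\<ge>M. \<forall>k\<ge>M. norm (X i - X k) < e" using C unfolding Cauchy_def dist_norm by blast
 then have "\<forall>i\<ge>M. \<forall>k\<ge>M. norm (coef (X i) n - coef (X k) n) < e"
 using le_less_trans[OF norm_coef_le[of "X _ - X _" n]] unfolding minus_wien.rep_eq by blast
 then show "EX M. \<forall>i\<ge>M. \<forall>k\<ge>M. norm (coef (X i) n - coef (X k) n) < e" by blast
 qed
 then have "ALL n. EX l. (%j. coef (X j) n) ----> l"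
 using Cauchy_convergent convergentD by blast
 then obtain l where l: "!!n. (%j. coef (X j) n) ----> l n"
 by metis
 have fin: "(\<Sum>n\<in>F. wt n * norm (coef (X j) n - l n)) <= e"
 if "finite F" and M: "\<forall>i\<ge>M. \<forall>k\<ge>M. norm (X i - X k) < e" and "j >= M" for F e M j
 proof (rule LIMSEQ_le_const2)
 show "(%k. \<Sum>n\<in>F. wt n * norm (coef (X j) n - coef (X k) n)) ----> (\<Sum>n\<in>F. wt n * norm (coef (X j) n - l n))"
 by (intro tendsto_intros l)
 show "EX N. \<forall>k\<ge>N. (\<Sum>n\<in>F. wt n * norm (coef (X j) n - coef (X k) n)) <= e"
 proof (intro exI[of _ M] allI impI)
 fix k assume "M <= k"
 then have "norm (X j - X k) < e" using M \<open>j >= M\<close> by blast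
 then show "(\<Sum>n\<in>F. wt n * norm (coef (X j) n - coef (X k) n)) <= e"
 using finite_sum_le_norm_wien[OF \<open>finite F\<close>, of "X j - X k"] by (simp add: minus_wien.rep_eq)
 qed
 qed
 obtain M1 where M1: "\<forall>i\<ge>M1. \<forall>k\<ge>M1. norm (X i - X k) < 1"
 using C unfolding Cauchy_def dist_norm by (meson zero_less_one)
 have "wsummable (%n. coef (X M1) n - l n)"
 unfolding wsummable_def
 by (rule nonneg_bdd_above_summable_on)
 (use fin[OF _ M1 order_refl] in \<open>auto intro!: bdd_aboveI[of _ 1] mult_nonneg_nonneg wt_nonneg\<close>)
 from wsummable_diff[OF wsummable_coef[of "X M1"] this] have wl: "wsummable l" by simp
 have "X ----> Wien l"
 unfolding LIMSEQ_iff
 proof (intro allI impI)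
 fix r :: real assume "0 < r"
 then obtain M where M: "\<forall>i\<ge>M. \<forall>k\<ge>M. norm (X i - X k) < r/2"
 using C unfolding Cauchy_def dist_norm by (meson half_gt_zero)
 have "norm (X j - Wien l) < r" if "j >= M" for j
 proof -
 have "norm (X j - Wien l) <= r/2"
 by (rule norm_wien_leI) (use fin[OF _ M that] wl in \<open>simp add: minus_wien.rep_eq Wien_inverse\<close>)
 then show ?thesis using \<open>0 < r\<close> by simp
 qed
 then show "EX M. \<forall>j\<ge>M. norm (X j - Wien l) < r" by blast
 qed
 then show "convergent X" by (rule convergentI)
qed

instance bcontfun :: (metric_space, banach) banach ..

section \<open>Convolution product and evaluation of Fourier series\<close>

lemma summable_int_conv:
 fixes a b :: "int => real"
 assumes a: "a summable_on UNIV" "!!n. 0 <= a n" and b: "b summable_on UNIV" "!!n. 0 <= b n"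
 shows "(%(n,m). a m * b (n - m)) summable_on UNIV"
 and "infsum (%(n,m). a m * b (n - m)) UNIV = infsum a UNIV * infsum b UNIV"
proof -
 have s: "(%(m,k). a m * b k) summable_on UNIV \<times> UNIV"
 proof (rule summable_on_SigmaI)
 show "((%y. case (x, y) of (m, k) => a m * b k) has_sum (a x * infsum b UNIV)) UNIV" for x
 using has_sum_cmult_right[OF has_sum_infsum[OF b(1)], of "a x"] by simp
 show "(%x. a x * infsum b UNIV) summable_on UNIV"
 by (rule summable_on_cmult_left[OF a(1)])
 qed (use a b in auto)
 \<comment> \<open>This shear of the index lattice turns the double series of a convolution into the
   double series of a product, to which Fubini applies.\<close>
 have bij: "bij_betw (%(n::int,m). (m, n - m)) UNIV (UNIV \<times> UNIV)"
 by (rule bij_betwI[of _ _ _ "%(m,k). (m + k, m)"]) auto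
 have e: "(%(n,m). a m * b (n - m)) = (%x. (%(m,k). a m * b k) ((%(n,m). (m, n - m)) x))"
 by auto
 show "(%(n,m). a m * b (n - m)) summable_on UNIV"
 unfolding e by (subst summable_on_reindex_bij_betw[OF bij]) (rule s)
 have "infsum (%(n,m). a m * b (n - m)) UNIV = infsum (%(m,k). a m * b k) (UNIV \<times> UNIV)"
 unfolding e by (rule infsum_reindex_bij_betw[OF bij])
 also have "... = (\<Sum>\<^sub>\<infinity>m. \<Sum>\<^sub>\<infinity>k. a m * b k)"
 using infsum_Sigma_banach[OF s] by simp
 also have "... = infsum a UNIV * infsum b UNIV"
 by (simp add: infsum_cmult_right' infsum_cmult_left')
 finally show "infsum (%(n,m). a m * b (n - m)) UNIV = infsum a UNIV * infsum b UNIV" .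
qed

lemma infsum_int_conv_complex:
 fixes a b :: "int => complex"
 assumes a: "(%n. norm (a n)) summable_on UNIV" and b: "(%n. norm (b n)) summable_on UNIV"
 shows "infsum a UNIV * infsum b UNIV = (\<Sum>\<^sub>\<infinity>n. \<Sum>\<^sub>\<infinity>m. a m * b (n - m))"
proof -
 have "(%x. norm ((%(n,m). a m * b (n - m)) x)) summable_on UNIV"
 using summable_int_conv(1)[OF a _ b] by (simp add: norm_mult case_prod_unfold)
 then have s0: "(%(n,m). a m * b (n - m)) summable_on (UNIV \<times> UNIV)"
 using Infinite_Sum.abs_summable_summable by simp
 have bij: "bij_betw (%(n::int,m). (m, n - m)) UNIV (UNIV \<times> UNIV)"
 by (rule bij_betwI[of _ _ _ "%(m,k). (m + k, m)"]) auto
 have e: "(%(n,m). a m * b (n - m)) = (%x. (%(m,k). a m * b k) ((%(n,m). (m, n - m)) x))"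
 by auto
 have s: "(%(m,k). a m * b k) summable_on (UNIV \<times> UNIV)"
 using s0[unfolded UNIV_Times_UNIV] unfolding e summable_on_reindex_bij_betw[OF bij] .
 have "(\<Sum>\<^sub>\<infinity>n. \<Sum>\<^sub>\<infinity>m. a m * b (n - m)) = infsum (%(n,m). a m * b (n - m)) (UNIV \<times> UNIV)"
 using infsum_Sigma_banach[OF s0] by simp
 also have "... = infsum (%(m,k). a m * b k) (UNIV \<times> UNIV)"
 unfolding e UNIV_Times_UNIV[where 'a=int and 'b=int] by (rule infsum_reindex_bij_betw[OF bij, unfolded UNIV_Times_UNIV])
 also have "... = (\<Sum>\<^sub>\<infinity>m. \<Sum>\<^sub>\<infinity>k. a m * b k)"
 using infsum_Sigma_banach[OF s] by simp
 also have "... = infsum a UNIV * infsum b UNIV"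
 by (simp add: infsum_cmult_right' infsum_cmult_left')
 finally show ?thesis by simp
qed

lemma wconv_summable:
 "(%(n,m). wt n * norm (tmul (coef x m) (coef y (n - m)))) summable_on UNIV"
 "infsum (%(n,m). wt n * norm (tmul (coef x m) (coef y (n - m)))) UNIV <= norm x * norm y"
proof -
 let ?g = "%(n,m). (wt m * norm (coef x m)) * (wt (n - m) * norm (coef y (n - m)))"
 note s = summable_int_conv[OF summable_coef[of x] _ summable_coef[of y]]
 have g: "?g summable_on UNIV" by (rule s(1)) (auto intro!: mult_nonneg_nonneg wt_nonneg)
 have le: "wt n * norm (tmul (coef x m) (coef y (n - m))) <= ?g (n,m)" for n m
 proof -
 have "wt n * norm (tmul (coef x m) (coef y (n - m))) <= (wt m * wt (n - m)) * (norm (coef x m) * norm (coef y (n - m)))"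
 using wt_add[of m "n - m"] by (intro mult_mono norm_tmul_le) (auto intro: mult_nonneg_nonneg wt_nonneg)
 then show ?thesis by (simp add: algebra_simps)
 qed
 show sm: "(%(n,m). wt n * norm (tmul (coef x m) (coef y (n - m)))) summable_on UNIV"
 by (rule summable_on_comparison_test[OF g]) (use le in \<open>auto intro!: mult_nonneg_nonneg wt_nonneg\<close>)
 have "infsum (%(n,m). wt n * norm (tmul (coef x m) (coef y (n - m)))) UNIV <= infsum ?g UNIV"
 by (rule infsum_mono[OF sm g]) (use le in auto)
 also have "... = norm x * norm y"
 unfolding norm_wien_def by (rule s(2)) (auto intro!: mult_nonneg_nonneg wt_nonneg)
 finally show "infsum (%(n,m). wt n * norm (tmul (coef x m) (coef y (n - m)))) UNIV <= norm x * norm y" .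
qed

lemma wconv_summable_inner:
 "(%m. norm (tmul (coef x m) (coef y (n - m)))) summable_on UNIV"
proof -
 have "(%m. wt n * norm (tmul (coef x m) (coef y (n - m)))) summable_on UNIV"
 using summable_on_SigmaD1[where A=UNIV and B="%_. UNIV" and x=n
 and f="%n m. wt n * norm (tmul (coef x m) (coef y (n - m)))"] wconv_summable(1)[of x y]
 by simp
 then have "(%m. inverse (wt n) * (wt n * norm (tmul (coef x m) (coef y (n - m))))) summable_on UNIV"
 by (rule summable_on_cmult_right)
 then show ?thesis using wt_pos[of n] by (simp add: mult.assoc[symmetric])
qed

definition wconv :: "wien => wien => int => tfun" where
 "wconv x y n = (\<Sum>\<^sub>\<infinity>m. tmul (coef x m) (coef y (n - m)))"

lemma wconv_bound:
 "wt n * norm (wconv x y n) <= (\<Sum>\<^sub>\<infinity>m. wt n * norm (tmul (coef x m) (coef y (n - m))))"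
proof -
 have "norm (wconv x y n) <= (\<Sum>\<^sub>\<infinity>m. norm (tmul (coef x m) (coef y (n - m))))"
 unfolding wconv_def by (rule norm_infsum_bound[OF wconv_summable_inner])
 then have "wt n * norm (wconv x y n) <= wt n * (\<Sum>\<^sub>\<infinity>m. norm (tmul (coef x m) (coef y (n - m))))"
 by (rule mult_left_mono[OF _ wt_nonneg])
 then show ?thesis by (simp add: infsum_cmult_right')
qed

lemma wconv_outer:
 "(%n. \<Sum>\<^sub>\<infinity>m. wt n * norm (tmul (coef x m) (coef y (n - m)))) summable_on UNIV"
 "(\<Sum>\<^sub>\<infinity>n. \<Sum>\<^sub>\<infinity>m. wt n * norm (tmul (coef x m) (coef y (n - m)))) <= norm x * norm y"
proof -
 have s: "(%(n,m). wt n * norm (tmul (coef x m) (coef y (n - m)))) summable_on (UNIV \<times> UNIV)"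
 using wconv_summable(1) by simp
 show "(%n. \<Sum>\<^sub>\<infinity>m. wt n * norm (tmul (coef x m) (coef y (n - m)))) summable_on UNIV"
 using summable_on_Sigma_banach[OF s] by simp
 show "(\<Sum>\<^sub>\<infinity>n. \<Sum>\<^sub>\<infinity>m. wt n * norm (tmul (coef x m) (coef y (n - m)))) <= norm x * norm y"
 using infsum_Sigma_banach[OF s] wconv_summable(2)[of x y] by simp
qed

lift_definition wmult :: "wien => wien => wien" (infixl "\<star>" 70) is wconv
 unfolding wsummable_def
 by (rule summable_on_comparison_test[OF wconv_outer(1) wconv_bound]) (simp add: wt_nonneg)

lemma norm_wmult_le: "norm (x \<star> y) <= norm x * norm y"
proof -
 have "norm (x \<star> y) <= (\<Sum>\<^sub>\<infinity>n. \<Sum>\<^sub>\<infinity>m. wt n * norm (tmul (coef x m) (coef y (n - m))))"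
 unfolding norm_wien_def
 by (rule infsum_mono[OF summable_coef wconv_outer(1)]) (simp add: wmult.rep_eq wconv_bound)
 then show ?thesis using wconv_outer(2)[of x y] by linarith
qed

lemma wconv_summable_inner': "(%m. tmul (coef x m) (coef y (n - m))) summable_on UNIV"
 using Infinite_Sum.abs_summable_summable[OF wconv_summable_inner] .

lemma bilinear_wmult: "bounded_bilinear (\<star>)"
proof
 fix a a' b b' :: wien and r :: real
 have e: "x = y" if "!!n. coef x n = coef y n" for x y using that by (metis coef_inject ext)
 show "(a + a') \<star> b = a \<star> b + a' \<star> b"
 by (rule e) (simp add: wmult.rep_eq wconv_def plus_wien.rep_eq tmul.add_left infsum_add wconv_summable_inner')
 show "a \<star> (b + b') = a \<star> b + a \<star> b'"
 by (rule e) (simp add: wmult.rep_eq wconv_def plus_wien.rep_eq tmul.add_right infsum_add wconv_summable_inner')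
 show "(r *# a) \<star> b = r *# (a \<star> b)"
 by (rule e) (simp add: wmult.rep_eq wconv_def scaleR_wien.rep_eq tmul.scaleR_left infsum_scaleR_right)
 show "a \<star> (r *# b) = r *# (a \<star> b)"
 by (rule e) (simp add: wmult.rep_eq wconv_def scaleR_wien.rep_eq tmul.scaleR_right infsum_scaleR_right)
 show "EX K. ALL a b. norm (a \<star> b) <= norm a * norm b * K"
 by (rule exI[of _ 1]) (simp add: norm_wmult_le)
qed

interpretation wmult: bounded_bilinear "(\<star>)" by (rule bilinear_wmult)

lemma wien_eqI: "(!!n. coef x n = coef y n) ==> x = y" by (metis coef_inject ext)

definition wev :: "wien => real => real => complex" where
 "wev x s t = (\<Sum>\<^sub>\<infinity>n. apply_bcontfun (coef x n) t * cis (of_int n * s))"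

lemma summable_norm_coef: "(%n. norm (coef x n)) summable_on UNIV"
 by (rule summable_on_comparison_test[OF summable_coef[of x]])
 (use mult_right_mono[OF wt_ge1] in fastforce)+

lemma summable_norm_coef_apply: "(%n. norm (apply_bcontfun (coef x n) t)) summable_on UNIV"
 by (rule summable_on_comparison_test[OF summable_norm_coef[of x]]) (auto simp: norm_apply_bcontfun_le)

lemma wev_summable: "(%n. apply_bcontfun (coef x n) t * cis (of_int n * s)) summable_on UNIV"
 by (rule Infinite_Sum.abs_summable_summable) (simp add: norm_mult summable_norm_coef_apply)

lemma bounded_linear_apply_bcontfun:
 "bounded_linear (%f :: 'a::topological_space \<Rightarrow>\<^sub>C 'b::real_normed_vector. apply_bcontfun f t)"
 by (rule bounded_linear_intro[of _ 1])
 (auto simp: plus_bcontfun.rep_eq scaleR_bcontfun.rep_eq norm_apply_bcontfun_le)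

lemma wev_add: "wev (x + y) s t = wev x s t + wev y s t"
 unfolding wev_def by (simp add: plus_wien.rep_eq plus_bcontfun.rep_eq ring_distribs infsum_add wev_summable)

lemma wev_scaleR: "wev (r *# x) s t = of_real r * wev x s t"
 unfolding wev_def by (simp add: scaleR_wien.rep_eq scaleR_bcontfun.rep_eq scaleR_conv_of_real mult.assoc infsum_cmult_right')

text \<open>With this, every algebraic identity between elements of \<open>wien\<close> becomes a
  pointwise identity of functions; that is how the fixed point equation is read as a differential
  equation.\<close>

lemma wev_mult: "wev (x \<star> y) s t = wev x s t * wev y s t"
proof -
 have "wev x s t * wev y s t = (\<Sum>\<^sub>\<infinity>n. \<Sum>\<^sub>\<infinity>m. (apply_bcontfun (coef x m) t * cis (of_int m * s)) *
 (apply_bcontfun (coef y (n - m)) t * cis (of_int (n - m) * s)))"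
 unfolding wev_def by (rule infsum_int_conv_complex) (simp_all add: norm_mult summable_norm_coef_apply)
 also have "... = (\<Sum>\<^sub>\<infinity>n. apply_bcontfun (wconv x y n) t * cis (of_int n * s))"
 proof (rule infsum_cong)
 fix n
 have c: "cis (of_int n * s) = cis (of_int m * s) * cis (of_int (n - m) * s)" for m
 by (simp add: cis_mult algebra_simps)
 have "apply_bcontfun (wconv x y n) t = (\<Sum>\<^sub>\<infinity>m. apply_bcontfun (tmul (coef x m) (coef y (n - m))) t)"
 unfolding wconv_def
 using infsumI[OF has_sum_bounded_linear[OF bounded_linear_apply_bcontfun has_sum_infsum[OF wconv_summable_inner']]]
 by metis
 then have "apply_bcontfun (wconv x y n) t * cis (of_int n * s) =
 (\<Sum>\<^sub>\<infinity>m. apply_bcontfun (tmul (coef x m) (coef y (n - m))) t * cis (of_int n * s))"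
 by (simp add: infsum_cmult_left')
 also have "... = (\<Sum>\<^sub>\<infinity>m. (apply_bcontfun (coef x m) t * cis (of_int m * s)) *
 (apply_bcontfun (coef y (n - m)) t * cis (of_int (n - m) * s)))"
 proof (rule infsum_cong)
 fix m
 show "apply_bcontfun (tmul (coef x m) (coef y (n - m))) t * cis (of_int n * s) =
 (apply_bcontfun (coef x m) t * cis (of_int m * s)) * (apply_bcontfun (coef y (n - m)) t * cis (of_int (n - m) * s))"
 unfolding tmul.rep_eq c[of m] by (rule mult.commute[THEN trans]) (simp only: ac_simps)
 qed
 finally show "(\<Sum>\<^sub>\<infinity>m. (apply_bcontfun (coef x m) t * cis (of_int m * s)) *
 (apply_bcontfun (coef y (n - m)) t * cis (of_int (n - m) * s))) = apply_bcontfun (wconv x y n) t * cis (of_int n * s)" by simp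
 qed
 finally show ?thesis unfolding wev_def by (simp add: wmult.rep_eq)
qed

section \<open>The heat equation mode by mode, and complex conjugation\<close>

lift_definition tscale :: "complex => tfun => tfun" is "%z f t. z * f t"
proof -
 fix z :: complex and f :: "real => complex" assume f: "f \<in> bcontfun"
 then obtain B where "!!t. norm (f t) <= B" by (auto simp: bcontfun_def bounded_iff)
 then have "norm (z * f t) <= norm z * B" for t unfolding norm_mult by (simp add: mult_left_mono)
 then show "(%t. z * f t) \<in> bcontfun"
 using f by (auto simp: bcontfun_def bounded_iff intro!: continuous_intros)
qed

lift_definition tcnj :: "tfun => tfun" is "%f t. cnj (f t)"
 by (auto simp: bcontfun_def bounded_iff intro!: continuous_intros)

lemma norm_tscale_le: "norm (tscale z f) <= norm z * norm f"
 by (rule norm_bcontfun_leI) (simp add: tscale.rep_eq norm_mult norm_apply_bcontfun_le mult_left_mono)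

lemma norm_tcnj: "norm (tcnj f) = norm f"
proof (rule antisym)
 show "norm (tcnj f) <= norm f"
 by (rule norm_bcontfun_leI) (simp add: tcnj.rep_eq norm_apply_bcontfun_le)
 show "norm f <= norm (tcnj f)"
 by (rule norm_bcontfun_leI) (metis complex_mod_cnj norm_apply_bcontfun_le tcnj.rep_eq)
qed

text \<open>Duhamel integral: the solution of \<open>y' = - a y + f\<close> with
  \<open>y 0 = 0\<close>. For \<open>a = n^2\<close> it is the \<open>n\<close>-th Fourier mode of
  the inhomogeneous heat equation.\<close>

definition heat_conv :: "real => (real => complex) => real => complex" where
 "heat_conv a f u = of_real (exp (- a * u)) * integral {0..u} (%s. of_real (exp (a * s)) * f s)"

lemma heat_conv_deriv:
 assumes f: "continuous_on UNIV f" and u: "u \<in> {0..T}"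
 shows "(heat_conv a f has_vector_derivative (- of_real a * heat_conv a f u + f u)) (at u within {0..T})"
proof -
 have c: "continuous_on {0..T} (%s. of_real (exp (a * s)) * f s)"
 using f by (intro continuous_intros) (auto intro: continuous_on_subset)
 have i: "((%u. integral {0..u} (%s. of_real (exp (a * s)) * f s)) has_vector_derivative
 of_real (exp (a * u)) * f u) (at u within {0..T})"
 by (rule integral_has_vector_derivative[OF c u])
 have e: "((%u. of_real (exp (- a * u)) :: complex) has_vector_derivative of_real (- a * exp (- a * u))) (at u within {0..T})"
 by (intro has_vector_derivative_of_real) (auto intro!: derivative_eq_intros simp: has_real_derivative_iff_has_vector_derivative[symmetric])
 have m: "of_real (exp (- a * u)) * (of_real (exp (a * u)) * f u) = f u"
 by (simp add: mult.assoc[symmetric] of_real_mult[symmetric] exp_add[symmetric] del: of_real_mult)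
 have "((%u. of_real (exp (- a * u)) * integral {0..u} (%s. of_real (exp (a * s)) * f s)) has_vector_derivative
 f u + of_real (- a * exp (- a * u)) * integral {0..u} (%s. of_real (exp (a * s)) * f s)) (at u within {0..T})"
 using has_vector_derivative_mult[OF e i] unfolding m .
 moreover have "f u + of_real (- a * exp (- a * u)) * integral {0..u} (%s. of_real (exp (a * s)) * f s) = - of_real a * heat_conv a f u + f u"
 unfolding heat_conv_def by simp
 ultimately show ?thesis unfolding heat_conv_def[abs_def] by (simp only:)
qed

text \<open>The second bound integrates the kernel exactly: \<open>a\<close> times its integral is
  \<open>1 - exp (- a u)\<close>, hence at most 1. This is maximal regularity with constant 1; the
  first bound is small for short times instead.\<close>

lemma heat_conv_bound:
 assumes f: "continuous_on UNIV f" "!!s. norm (f s) <= B" and a: "0 <= a" and u: "0 <= u"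
 shows "norm (heat_conv a f u) <= u * B" "a * norm (heat_conv a f u) <= B"
proof -
 have B: "0 <= B" using f(2)[of 0] norm_ge_zero[of "f 0"] by linarith
 have c: "(%s. of_real (exp (a * s)) * f s) integrable_on {0..u}"
 using f by (intro integrable_continuous_real continuous_intros) (auto intro: continuous_on_subset)
 have c': "(%s. exp (a * s) * B) integrable_on {0..u}"
 by (intro integrable_continuous_real continuous_intros)
 have n: "norm (integral {0..u} (%s. of_real (exp (a * s)) * f s)) <= integral {0..u} (%s. exp (a * s) * B)"
 by (rule integral_norm_bound_integral[OF c c']) (simp add: norm_mult f mult_left_mono)
 have h: "norm (heat_conv a f u) <= exp (- a * u) * integral {0..u} (%s. exp (a * s) * B)"
 unfolding heat_conv_def norm_mult using mult_left_mono[OF n, of "exp (- a * u)"] by simp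
 have "integral {0..u} (%s. exp (a * s) * B) <= integral {0..u} (%s. exp (a * u) * B)"
 by (rule integral_le[OF c']) (auto intro!: mult_right_mono mult_left_mono a B)
 also have "... = u * (exp (a * u) * B)" using u by simp
 finally have "exp (- a * u) * integral {0..u} (%s. exp (a * s) * B) <= exp (- a * u) * (u * (exp (a * u) * B))"
 by (rule mult_left_mono) simp
 also have "... = u * B" by (simp add: exp_minus field_simps)
 finally show "norm (heat_conv a f u) <= u * B" using h by linarith
 have "((%s. exp (a * s) * B * a) has_integral (exp (a * u) * B - exp (a * 0) * B)) {0..u}"
 by (rule fundamental_theorem_of_calculus[OF u])
 (auto intro!: derivative_eq_intros simp: has_real_derivative_iff_has_vector_derivative[symmetric])
 from integral_unique[OF this] have I: "integral {0..u} (%s. exp (a * s) * B) * a = exp (a * u) * B - B"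
 unfolding integral_mult_left by simp
 have "a * norm (heat_conv a f u) <= a * (exp (- a * u) * integral {0..u} (%s. exp (a * s) * B))"
 by (rule mult_left_mono[OF h a])
 also have "... = exp (- a * u) * (exp (a * u) * B - B)" unfolding I[symmetric] by simp
 also have "... = B - exp (- a * u) * B" by (simp add: exp_minus field_simps)
 also have "... <= B" using B by simp
 finally show "a * norm (heat_conv a f u) <= B" .
qed

definition clip :: "real => real => real" where "clip T t = max 0 (min t T)"

text \<open>Clipping time freezes the solution outside the interval, which makes it bounded and
  continuous on the whole line. The absolute value of \<open>T\<close> makes the definition
  total.\<close>

lift_definition duhamel :: "real => int => tfun => tfun" is
 "%T n f t. heat_conv ((of_int n)\<^sup>2) f (clip \<bar>T\<bar> t)"
proof -
 fix T :: real and n :: int and f :: "real => complex" assume f: "f \<in> bcontfun"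
 obtain B where B: "!!t. norm (f t) <= B" using f by (auto simp: bcontfun_def bounded_iff)
 have c: "continuous_on UNIV f" using f by (simp add: bcontfun_def)
 have cl: "clip \<bar>T\<bar> t \<in> {0..\<bar>T\<bar>}" for t by (simp add: clip_def)
 have "continuous_on {0..\<bar>T\<bar>} (heat_conv ((of_int n)\<^sup>2) f)"
 using heat_conv_deriv[OF c] by (meson continuous_on_eq_continuous_within has_vector_derivative_continuous)
 then have "continuous_on UNIV (%t. heat_conv ((of_int n)\<^sup>2) f (clip \<bar>T\<bar> t))"
 by (rule continuous_on_compose2) (use cl in \<open>auto simp: clip_def intro!: continuous_intros\<close>)
 moreover have "norm (heat_conv ((of_int n)\<^sup>2) f (clip \<bar>T\<bar> t)) <= \<bar>T\<bar> * B" for t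
 proof -
 have "norm (heat_conv ((of_int n)\<^sup>2) f (clip \<bar>T\<bar> t)) <= clip \<bar>T\<bar> t * B"
 by (rule heat_conv_bound(1)[OF c B]) (use cl[of t] in auto)
 also have "... <= \<bar>T\<bar> * B" using cl[of t] order_trans[OF norm_ge_zero B[of 0]] by (intro mult_right_mono) auto
 finally show ?thesis .
 qed
 ultimately show "(%t. heat_conv ((of_int n)\<^sup>2) f (clip \<bar>T\<bar> t)) \<in> bcontfun"
 by (auto simp: bcontfun_def bounded_iff)
qed

lemma norm_duhamel_le:
 assumes "0 <= T"
 shows "norm (duhamel T n f) <= T * norm f" "(of_int n)\<^sup>2 * norm (duhamel T n f) <= norm f"
 "\<bar>of_int n\<bar> * norm (duhamel T n f) <= sqrt T * norm f"
proof -
 have cl: "clip \<bar>T\<bar> t \<in> {0..T}" for t using assms by (simp add: clip_def)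
 have b: "norm (apply_bcontfun (duhamel T n f) t) <= clip \<bar>T\<bar> t * norm f"
 "(of_int n)\<^sup>2 * norm (apply_bcontfun (duhamel T n f) t) <= norm f" for t
 unfolding duhamel.rep_eq using heat_conv_bound[OF continuous_on_apply_bcontfun norm_apply_bcontfun_le, of "(of_int n)\<^sup>2" "clip \<bar>T\<bar> t"] cl[of t] by auto
 show 1: "norm (duhamel T n f) <= T * norm f"
 proof (rule norm_bcontfun_leI)
 fix t show "norm (apply_bcontfun (duhamel T n f) t) <= T * norm f"
 using order_trans[OF b(1)[of t] mult_right_mono[OF _ norm_ge_zero, of _ T]] cl[of t] by auto
 qed
 show 2: "(of_int n)\<^sup>2 * norm (duhamel T n f) <= norm f"
 proof (cases "n = 0")
 case False
 then have "norm (duhamel T n f) <= norm f / (of_int n)\<^sup>2"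
 by (intro norm_bcontfun_leI) (use b(2) in \<open>simp add: pos_le_divide_eq mult.commute\<close>)
 then show ?thesis using False by (simp add: pos_le_divide_eq mult.commute)
 qed simp
 \<comment> \<open>The bound for one derivative is the geometric mean of the bounds for none and for
   two.\<close>
 have "(\<bar>of_int n\<bar> * norm (duhamel T n f))\<^sup>2 = ((of_int n)\<^sup>2 * norm (duhamel T n f)) * norm (duhamel T n f)"
 by (simp add: power2_eq_square algebra_simps)
 also have "... <= norm f * (T * norm f)" by (rule mult_mono[OF 2 1]) auto
 also have "... = (sqrt T * norm f)\<^sup>2" using assms by (simp add: power2_eq_square algebra_simps)
 finally show "\<bar>of_int n\<bar> * norm (duhamel T n f) <= sqrt T * norm f"
 by (rule power2_le_imp_le) (use assms in simp)
qed

lemma heat_conv_add: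
 assumes "continuous_on UNIV f" "continuous_on UNIV g"
 shows "heat_conv a (%s. f s + g s) u = heat_conv a f u + heat_conv a g u"
proof -
 have "(%s. complex_of_real (exp (a * s)) * f s) integrable_on {0..u}" "(%s. complex_of_real (exp (a * s)) * g s) integrable_on {0..u}"
 using assms by (auto intro!: integrable_continuous_real continuous_intros intro: continuous_on_subset)
 then show ?thesis unfolding heat_conv_def by (simp add: integral_add ring_distribs)
qed

lemma heat_conv_mult: "heat_conv a (%s. c * f s) u = c * heat_conv a f u"
 unfolding heat_conv_def by (simp add: mult.left_commute)

lemma heat_conv_cnj: "heat_conv a (%s. cnj (f s)) u = cnj (heat_conv a f u)"
proof -
 have "integral {0..u} (%s. complex_of_real (exp (a * s)) * cnj (f s)) = integral {0..u} (%s. cnj (of_real (exp (a * s)) * f s))"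
 by simp
 also have "... = cnj (integral {0..u} (%s. of_real (exp (a * s)) * f s))" by (rule integral_cnj[symmetric])
 finally show ?thesis unfolding heat_conv_def by simp
qed

text \<open>The Fourier multiplier of the \<open>j\<close>-th derivative in the space
  variable.\<close>

definition Dpow :: "nat => int => complex" where "Dpow j n = (\<i> * of_int n) ^ j"

text \<open>The \<open>j\<close>-th space derivative of the solution of the heat equation with
  source \<open>x\<close> and zero initial value. Weighted summability, and with it the meaning of
  \<open>Wien\<close>, is available for \<open>0 <= T\<close> and \<open>j <= 2\<close>.\<close>

definition heat_op :: "real => nat => wien => wien" where
 "heat_op T j x = Wien (%n. tscale (Dpow j n) (duhamel T n (coef x n)))"

text \<open>Orders 0 and 1 gain a factor that is small with \<open>T\<close>. Order 2 gains nothing,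
  so the coefficient in front of it has to be small on its own account.\<close>

definition gainc :: "real => nat => real" where
 "gainc T j = (if j = 0 then T else if j = 1 then sqrt T else 1)"

lemma norm_heat_coef:
 assumes "0 <= T" "j <= 2"
 shows "norm (tscale (Dpow j n) (duhamel T n f)) <= gainc T j * norm f"
proof -
 have "norm (tscale (Dpow j n) (duhamel T n f)) <= \<bar>of_int n\<bar> ^ j * norm (duhamel T n f)"
 using norm_tscale_le[of "Dpow j n" "duhamel T n f"] by (simp add: Dpow_def norm_power norm_mult)
 moreover have "j = 0 | j = 1 | j = 2" using assms(2) by auto
 ultimately show ?thesis using norm_duhamel_le[OF assms(1), of n f] by (auto simp: gainc_def)
qed

lemma coef_heat_op:
 assumes "0 <= T" "j <= 2"
 shows "coef (heat_op T j x) n = tscale (Dpow j n) (duhamel T n (coef x n))"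
proof -
 have "wsummable (%n. tscale (Dpow j n) (duhamel T n (coef x n)))"
 by (rule wsummable_comparison[OF wsummable_coef norm_heat_coef[OF assms]])
 then show ?thesis unfolding heat_op_def by (simp add: Wien_inverse)
qed

lemma norm_wien_comparison:
 assumes "!!n. norm (coef x n) <= K * norm (coef y n)"
 shows "norm x <= K * norm y"
proof -
 have "norm x <= (\<Sum>\<^sub>\<infinity>n. K * (wt n * norm (coef y n)))"
 unfolding norm_wien_def
 by (rule infsum_mono[OF summable_coef summable_on_cmult_right[OF summable_coef]])
 (use mult_left_mono[OF assms wt_nonneg] in \<open>simp add: algebra_simps\<close>)
 then show ?thesis unfolding norm_wien_def by (simp add: infsum_cmult_right')
qed

lemma norm_heat_op_le: "0 <= T ==> j <= 2 ==> norm (heat_op T j x) <= gainc T j * norm x"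
 by (rule norm_wien_comparison) (simp add: coef_heat_op norm_heat_coef)

lemma heat_op_diff:
 assumes "0 <= T" "j <= 2" shows "heat_op T j (x - y) = heat_op T j x - heat_op T j y"
proof -
 have d: "heat_conv a (%s. f s - g s) u = heat_conv a f u - heat_conv a g u"
 if "continuous_on UNIV f" "continuous_on UNIV g" for a f g u
 using heat_conv_add[of f "%s. -1 * g s" a u] heat_conv_mult[of a "-1" g u] that by (simp add: continuous_intros)
 show ?thesis
 by (rule wien_eqI, rule bcontfun_eqI)
 (simp add: assms coef_heat_op minus_wien.rep_eq minus_bcontfun.rep_eq tscale.rep_eq duhamel.rep_eq d right_diff_distrib)
qed

text \<open>The involution that corresponds to conjugating the represented function; its fixed
  points represent real-valued functions.\<close>

lift_definition wcnj :: "wien => wien" is "%c n. tcnj (c (- n))"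
proof -
 fix c assume "wsummable c"
 then show "wsummable (%n. tcnj (c (- n)))"
 unfolding wsummable_def norm_tcnj
 using summable_on_reindex_bij_betw[of uminus UNIV UNIV "%n. wt n * norm (c n)"]
 by (simp add: wt_minus bij_uminus)
qed

lemma wcnj_diff: "wcnj (x - y) = wcnj x - wcnj y"
 by (rule wien_eqI, rule bcontfun_eqI) (simp add: wcnj.rep_eq minus_wien.rep_eq minus_bcontfun.rep_eq tcnj.rep_eq)

lemma wcnj_add: "wcnj (x + y) = wcnj x + wcnj y"
 by (rule wien_eqI, rule bcontfun_eqI) (simp add: wcnj.rep_eq plus_wien.rep_eq plus_bcontfun.rep_eq tcnj.rep_eq)

lemma wcnj_scaleR: "wcnj (r *# x) = r *# wcnj x"
 by (rule wien_eqI, rule bcontfun_eqI) (simp add: wcnj.rep_eq scaleR_wien.rep_eq scaleR_bcontfun.rep_eq tcnj.rep_eq)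

lemma norm_wcnj: "norm (wcnj x) = norm x"
 unfolding norm_wien_def wcnj.rep_eq norm_tcnj
 using infsum_reindex_bij_betw[of uminus UNIV UNIV "%n. wt n * norm (coef x n)"]
 by (simp add: wt_minus bij_uminus)

lemma bounded_linear_wcnj: "bounded_linear wcnj"
 by (rule bounded_linear_intro[of _ 1]) (simp_all add: wcnj_add wcnj_scaleR norm_wcnj)

lemma bounded_linear_tcnj: "bounded_linear tcnj"
 by (rule bounded_linear_intro[of _ 1])
 (simp_all add: norm_tcnj, (rule bcontfun_eqI, simp add: tcnj.rep_eq plus_bcontfun.rep_eq scaleR_bcontfun.rep_eq)+)

lemma wcnj_wmult: "wcnj (x \<star> y) = wcnj x \<star> wcnj y"
proof (rule wien_eqI)
 fix n
 have "coef (wcnj (x \<star> y)) n = (\<Sum>\<^sub>\<infinity>m. tcnj (tmul (coef x m) (coef y (- n - m))))"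
 unfolding wcnj.rep_eq wmult.rep_eq wconv_def
 using infsumI[OF has_sum_bounded_linear[OF bounded_linear_tcnj has_sum_infsum[OF wconv_summable_inner'[of x y "-n"]]]]
 by simp
 also have "... = (\<Sum>\<^sub>\<infinity>m. tcnj (tmul (coef x (- m)) (coef y (- n - (- m)))))"
 by (rule infsum_reindex_bij_betw[of uminus UNIV UNIV, symmetric]) (rule bij_uminus)
 also have "... = coef (wcnj x \<star> wcnj y) n"
 unfolding wmult.rep_eq wconv_def
 by (rule infsum_cong, rule bcontfun_eqI) (simp add: tcnj.rep_eq tmul.rep_eq wcnj.rep_eq algebra_simps)
 finally show "coef (wcnj (x \<star> y)) n = coef (wcnj x \<star> wcnj y) n" .
qed

lemma wcnj_heat_op:
 assumes "0 <= T" "j <= 2" shows "wcnj (heat_op T j x) = heat_op T j (wcnj x)"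
proof (rule wien_eqI, rule bcontfun_eqI)
 fix n t
 have d: "cnj (Dpow j (- n)) = Dpow j n" by (simp add: Dpow_def)
 have "apply_bcontfun (coef (wcnj (heat_op T j x)) n) t = Dpow j n * cnj (heat_conv ((of_int n)\<^sup>2) (coef x (- n)) (clip \<bar>T\<bar> t))"
 by (simp add: assms wcnj.rep_eq coef_heat_op tcnj.rep_eq tscale.rep_eq duhamel.rep_eq d)
 then show "apply_bcontfun (coef (wcnj (heat_op T j x)) n) t = apply_bcontfun (coef (heat_op T j (wcnj x)) n) t"
 by (simp add: assms coef_heat_op wcnj.rep_eq tscale.rep_eq duhamel.rep_eq heat_conv_cnj[symmetric] tcnj.rep_eq)
qed

lemma wev_cnj: "wev (wcnj x) s t = cnj (wev x s t)"
proof -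
 have "wev (wcnj x) s t = (\<Sum>\<^sub>\<infinity>n. cnj (apply_bcontfun (coef x (- n)) t * cis (of_int (- n) * s)))"
 unfolding wev_def wcnj.rep_eq tcnj.rep_eq by (simp add: cis_cnj)
 also have "... = (\<Sum>\<^sub>\<infinity>n. cnj (apply_bcontfun (coef x n) t * cis (of_int n * s)))"
 by (rule infsum_reindex_bij_betw[of uminus UNIV UNIV]) (rule bij_uminus)
 also have "... = cnj (wev x s t)" unfolding wev_def by (rule infsum_cnj)
 finally show ?thesis .
qed

section \<open>Trigonometric monomials and the heat evolution of the initial ripple\<close>

definition mono :: "int => tfun => wien" where "mono m f = Wien (%n. if n = m then f else 0)"

lemma coef_mono: "coef (mono m f) n = (if n = m then f else 0)"
proof -
 have "(%n. wt n * norm (if n = m then f else 0)) summable_on UNIV"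
 by (rule finite_nonzero_values_imp_summable_on) (rule finite_subset[of _ "{m}"], auto)
 then show ?thesis unfolding mono_def by (simp add: Wien_inverse wsummable_def)
qed

lemma infsum_single: "(\<Sum>\<^sub>\<infinity>n::int. if n = m then a else 0) = (a :: 'a :: {comm_monoid_add, t2_space})"
 using infsum_cong_neutral[of "{m}" UNIV "%n. if n = m then a else 0" "%n. if n = m then a else 0"] by simp

lemma norm_mono: "norm (mono m f) = wt m * norm f"
proof -
 have "norm (mono m f) = (\<Sum>\<^sub>\<infinity>n. if n = m then wt m * norm f else 0)"
 unfolding norm_wien_def coef_mono by (rule infsum_cong) simp
 then show ?thesis unfolding infsum_single .
qed

lemma wev_mono: "wev (mono m f) s t = apply_bcontfun f t * cis (of_int m * s)"
proof -
 have "wev (mono m f) s t = (\<Sum>\<^sub>\<infinity>n. if n = m then apply_bcontfun f t * cis (of_int m * s) else 0)"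
 unfolding wev_def coef_mono by (rule infsum_cong) (simp add: zero_bcontfun.rep_eq)
 then show ?thesis unfolding infsum_single .
qed

lemma wcnj_mono: "wcnj (mono m f) = mono (- m) (tcnj f)"
 by (rule wien_eqI, rule bcontfun_eqI) (auto simp: wcnj.rep_eq coef_mono tcnj.rep_eq zero_bcontfun.rep_eq)

lift_definition tdecay :: "real => tfun" is "%a t. of_real (exp (- \<bar>a\<bar> * max 0 t))"
 by (auto simp: bcontfun_def bounded_iff intro!: continuous_intros exI[of _ 1])

lemma norm_tdecay_le: "norm (tdecay a) <= 1"
 by (rule norm_bcontfun_leI) (auto simp: tdecay.rep_eq)

text \<open>The \<open>j\<close>-th space derivative of the homogeneous heat evolution with initial
  value twice the real part of \<open>c * cis (4000 s)\<close>; the second mode is the conjugate of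
  the first.\<close>

definition ylin :: "complex => nat => wien" where
 "ylin c j = mono 4000 (tscale (Dpow j 4000 * c) (tdecay (4000\<^sup>2))) + mono (- 4000) (tscale (Dpow j (- 4000) * cnj c) (tdecay (4000\<^sup>2)))"

lemma wt_4000: "wt 4000 <= 3"
proof -
 have "(1 + 1/4000 :: real) ^ 4000 <= exp (1/4000) ^ 4000"
 by (rule power_mono[OF exp_ge_add_one_self]) simp
 also have "... = exp 1" by (simp add: exp_of_nat_mult[symmetric])
 also have "... <= 3" by (rule exp_le)
 finally show ?thesis by (simp add: wt_def)
qed

lemma norm_ylin_le: "norm (ylin c j) <= 6 * 4000 ^ j * norm c"
proof -
 have 1: "norm (mono m (tscale (Dpow j m * d) (tdecay (4000\<^sup>2)))) <= 3 * (4000 ^ j * norm c)"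
 if "m = 4000 | m = - 4000" "norm d = norm c" for m d
 proof -
 have "wt m <= 3" using wt_4000 wt_minus[of 4000] that by auto
 moreover have "norm (tscale (Dpow j m * d) (tdecay (4000\<^sup>2))) <= 4000 ^ j * norm c"
 using norm_tscale_le[of "Dpow j m * d" "tdecay (4000\<^sup>2)"] that
 mult_left_mono[OF norm_tdecay_le[of "4000\<^sup>2"], of "norm (Dpow j m * d)"]
 by (auto simp: Dpow_def norm_mult norm_power intro: order_trans)
 ultimately show ?thesis unfolding norm_mono by (intro mult_mono) auto
 qed
 have "norm (ylin c j) <= 3 * (4000 ^ j * norm c) + 3 * (4000 ^ j * norm c)"
 unfolding ylin_def by (rule order_trans[OF norm_triangle_ineq add_mono[OF 1 1]]) auto
 then show ?thesis by (simp add: algebra_simps)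
qed

lemma wcnj_ylin: "wcnj (ylin c j) = ylin c j"
proof -
 have a: "tcnj (tscale z (tdecay a)) = tscale (cnj z) (tdecay a)" for z a
 by (rule bcontfun_eqI) (simp add: tcnj.rep_eq tscale.rep_eq tdecay.rep_eq)
 have d: "cnj (Dpow j n) = Dpow j (- n)" for n by (simp add: Dpow_def)
 show ?thesis unfolding ylin_def wcnj_add wcnj_mono a by (simp add: d add.commute)
qed

definition wone :: wien where "wone = mono 0 (const_bcontfun 1)"
definition wcos :: wien where "wcos = mono 1 (const_bcontfun (1/2)) + mono (- 1) (const_bcontfun (1/2))"
definition wsin :: wien where "wsin = mono 1 (const_bcontfun (- \<i>/2)) + mono (- 1) (const_bcontfun (\<i>/2))"

lemma wt_1: "wt 1 <= 2" "wt (- 1) <= 2" by (simp_all add: wt_def)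

lemma norm_const_bcontfun_le: "norm (const_bcontfun c :: tfun) <= norm c"
 by (rule norm_bcontfun_leI) (simp add: const_bcontfun.rep_eq)

lemma norm_wone: "norm wone <= 1"
 unfolding wone_def norm_mono using norm_const_bcontfun_le[of 1] by simp

lemma norm_mono_const: "wt m <= 2 ==> norm c = 1/2 ==> norm (mono m (const_bcontfun c)) <= 1"
 unfolding norm_mono using mult_mono[of "wt m" 2 "norm (const_bcontfun c :: tfun)" "1/2"] norm_const_bcontfun_le[of c] by simp

lemma norm_wcos: "norm wcos <= 2" and norm_wsin: "norm wsin <= 2"
proof -
 show "norm wcos <= 2" unfolding wcos_def
 using order_trans[OF norm_triangle_ineq add_mono[OF norm_mono_const[OF wt_1(1), of "1/2"] norm_mono_const[OF wt_1(2), of "1/2"]]] by simp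
 show "norm wsin <= 2" unfolding wsin_def
 using order_trans[OF norm_triangle_ineq add_mono[OF norm_mono_const[OF wt_1(1), of "-\<i>/2"] norm_mono_const[OF wt_1(2), of "\<i>/2"]]]
 by (simp add: norm_divide)
qed

lemma tcnj_const: "tcnj (const_bcontfun c) = const_bcontfun (cnj c)"
 by (rule bcontfun_eqI) (simp add: tcnj.rep_eq const_bcontfun.rep_eq)

lemma wcnj_elems: "wcnj wone = wone" "wcnj wcos = wcos" "wcnj wsin = wsin"
 by (simp_all add: wone_def wcos_def wsin_def wcnj_add wcnj_mono tcnj_const add.commute)

lemma wev_elems: "wev wone s t = 1" "wev wcos s t = of_real (cos s)" "wev wsin s t = of_real (sin s)"
 by (simp_all add: wone_def wcos_def wsin_def wev_add wev_mono const_bcontfun.rep_eq complex_eq_iff)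

section \<open>The nonlinear terms of the profile equation and their estimates\<close>

type_synonym wvec = "wien \<times> wien \<times> wien \<times> wien"

definition py :: "wvec => wien" where "py v = fst v"
definition py' :: "wvec => wien" where "py' v = fst (snd v)"
definition pp :: "wvec => wien" where "pp v = fst (snd (snd v))"
definition pg :: "wvec => wien" where "pg v = snd (snd (snd v))"

definition unitv :: "wvec => bool" where
 "unitv v \<longleftrightarrow> norm (py v) <= 1 & norm (py' v) <= 1 & norm (pp v) <= 1 & norm (pg v) <= 1"

definition dvec :: "wvec => wvec => real" where
 "dvec v w = norm (py v - py w) + norm (py' v - py' w) + norm (pp v - pp w) + norm (pg v - pg w)"

text \<open>Bounded and Lipschitz on the unit box. The class is closed under sums and products, so
  every polynomial expression has some Lipschitz constant, whose size does not matter because it is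
  later beaten by a small \<open>T\<close>.\<close>

definition lipb :: "(wvec => wien) => bool" where
 "lipb h \<longleftrightarrow> (EX B L. 0 <= B & 0 <= L & (ALL v w. unitv v --> unitv w --> norm (h v) <= B & norm (h v - h w) <= L * dvec v w))"

lemma dvec_nonneg: "0 <= dvec v w" by (simp add: dvec_def)

lemma lipb_const: "lipb (%_. c)"
 unfolding lipb_def by (rule exI[of _ "norm c"], rule exI[of _ 0]) simp

lemma lipb_proj: "lipb py" "lipb py'" "lipb pp" "lipb pg"
proof -
 have *: "lipb h" if "!!v. unitv v ==> norm (h v) <= 1" "!!v w. norm (h v - h w) <= dvec v w" for h
 unfolding lipb_def using that by (intro exI[of _ 1]) simp
 show "lipb py" "lipb py'" "lipb pp" "lipb pg"
 by (rule *; simp add: unitv_def dvec_def)+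
qed

lemma lipb_add:
 assumes "lipb h" "lipb k" shows "lipb (%v. h v + k v)"
proof -
 obtain B L where h: "0 <= B" "0 <= L" "!!v w. unitv v ==> unitv w ==> norm (h v) <= B & norm (h v - h w) <= L * dvec v w"
 using assms(1) unfolding lipb_def by blast
 obtain C M where k: "0 <= C" "0 <= M" "!!v w. unitv v ==> unitv w ==> norm (k v) <= C & norm (k v - k w) <= M * dvec v w"
 using assms(2) unfolding lipb_def by blast
 show ?thesis unfolding lipb_def
 proof (rule exI[of _ "B + C"], rule exI[of _ "L + M"], intro conjI allI impI)
 fix v w assume u: "unitv v" "unitv w"
 show "norm (h v + k v) <= B + C"
 using norm_triangle_ineq[of "h v" "k v"] h(3)[OF u] k(3)[OF u] by linarith
 have "norm ((h v - h w) + (k v - k w)) <= L * dvec v w + M * dvec v w"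
 using norm_triangle_ineq[of "h v - h w" "k v - k w"] h(3)[OF u] k(3)[OF u] by linarith
 then show "norm (h v + k v - (h w + k w)) <= (L + M) * dvec v w" by (simp add: algebra_simps)
 qed (use h k in auto)
qed

lemma lipb_mult:
 assumes "lipb h" "lipb k" shows "lipb (%v. h v \<star> k v)"
proof -
 obtain B L where h: "0 <= B" "0 <= L" "!!v w. unitv v ==> unitv w ==> norm (h v) <= B & norm (h v - h w) <= L * dvec v w"
 using assms(1) unfolding lipb_def by blast
 obtain C M where k: "0 <= C" "0 <= M" "!!v w. unitv v ==> unitv w ==> norm (k v) <= C & norm (k v - k w) <= M * dvec v w"
 using assms(2) unfolding lipb_def by blast
 show ?thesis unfolding lipb_def
 proof (rule exI[of _ "B * C"], rule exI[of _ "L * C + B * M"], intro conjI allI impI)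
 fix v w assume u: "unitv v" "unitv w"
 show "norm (h v \<star> k v) <= B * C"
 by (rule order_trans[OF norm_wmult_le mult_mono]) (use h k u in auto)
 have e: "h v \<star> k v - h w \<star> k w = (h v - h w) \<star> k v + h w \<star> (k v - k w)"
 by (simp add: wmult.diff_left wmult.diff_right)
 have "norm ((h v - h w) \<star> k v) <= (L * dvec v w) * C"
 by (rule order_trans[OF norm_wmult_le mult_mono]) (use h k u dvec_nonneg in auto)
 moreover have "norm (h w \<star> (k v - k w)) <= B * (M * dvec v w)"
 by (rule order_trans[OF norm_wmult_le mult_mono]) (use h k u dvec_nonneg in auto)
 ultimately have "norm (h v \<star> k v - h w \<star> k w) <= (L * dvec v w) * C + B * (M * dvec v w)"
 unfolding e using norm_triangle_ineq[of "(h v - h w) \<star> k v" "h w \<star> (k v - k w)"] by linarith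
 then show "norm (h v \<star> k v - h w \<star> k w) <= (L * C + B * M) * dvec v w" by (simp add: algebra_simps)
 qed (use h k in auto)
qed

lemma lipb_scaleR: "lipb h ==> lipb (%v. r *# h v)"
proof -
 assume "lipb h"
 then obtain B L where h: "0 <= B" "0 <= L" "!!v w. unitv v ==> unitv w ==> norm (h v) <= B & norm (h v - h w) <= L * dvec v w"
 unfolding lipb_def by blast
 show "lipb (%v. r *# h v)" unfolding lipb_def
 proof (rule exI[of _ "\<bar>r\<bar> * B"], rule exI[of _ "\<bar>r\<bar> * L"], intro conjI allI impI)
 fix v w assume u: "unitv v" "unitv w"
 show "norm (r *# h v) <= \<bar>r\<bar> * B" using h(3)[OF u] by (simp add: mult_left_mono)
 have "norm (r *# h v - r *# h w) = \<bar>r\<bar> * norm (h v - h w)" by (metis norm_scaleR scaleR_diff_right)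
 then show "norm (r *# h v - r *# h w) <= \<bar>r\<bar> * L * dvec v w"
 using mult_left_mono[of "norm (h v - h w)" "L * dvec v w" "\<bar>r\<bar>"] h(3)[OF u] by (simp add: mult.assoc)
 qed (use h in auto)
qed

lemma lipb_minus: "lipb h ==> lipb (%v. - h v)"
 using lipb_scaleR[of h "-1"] by simp

lemma lipb_diff: "lipb h ==> lipb k ==> lipb (%v. h v - k v)"
 using lipb_add[OF _ lipb_minus, of h k] by simp

lemmas lipb_intros = lipb_const lipb_proj lipb_add lipb_mult lipb_scaleR lipb_minus lipb_diff

text \<open>With \<open>q = 1 + y\<close>, \<open>p = 1 / (q\<^sup>2 + q'\<^sup>2) = 1 + pp\<close> and \<open>g = 1 / (q + \<kappa> cos) = 1 + pg\<close>, these are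
 \<open>q\<^sup>2 - 1\<close>, \<open>q\<^sup>4 - 1\<close>, \<open>p q\<^sup>4 - 1\<close>, \<open>q\<^sup>2 + q'\<^sup>2 - 1\<close> and \<open>q + \<kappa> cos - 1\<close>.\<close>
definition sq2 :: "wvec => wien" where "sq2 v = py v + py v + py v \<star> py v"
definition sq4 :: "wvec => wien" where "sq4 v = sq2 v + sq2 v + sq2 v \<star> sq2 v"
definition lead :: "wvec => wien" where "lead v = pp v + sq4 v + pp v \<star> sq4 v"
definition den1 :: "wvec => wien" where "den1 v = sq2 v + py' v \<star> py' v"
definition den2 :: "real => wvec => wien" where "den2 ka v = py v + ka *# wcos"
text \<open>The terms of the equation without second derivative, that is
  \<open>p q^5 + \<kappa> q^2 g (q cos - q' sin)\<close>.\<close>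

definition lower :: "real => wvec => wien" where
 "lower ka v = ((wone + pp v) \<star> (wone + sq4 v)) \<star> (wone + py v)
 + ka *# (((wone + sq2 v) \<star> (wone + pg v)) \<star> ((wone + py v) \<star> wcos - py' v \<star> wsin))"

lemma lipb_parts: "lipb sq2" "lipb sq4" "lipb lead" "lipb den1" "lipb (den2 ka)" "lipb (lower ka)"
proof -
 show 2: "lipb sq2" unfolding sq2_def[abs_def] by (intro lipb_intros)
 show 4: "lipb sq4" unfolding sq4_def[abs_def] by (intro lipb_intros 2)
 show "lipb lead" unfolding lead_def[abs_def] by (intro lipb_intros 4)
 show "lipb den1" unfolding den1_def[abs_def] by (intro lipb_intros 2)
 show "lipb (den2 ka)" unfolding den2_def[abs_def] by (intro lipb_intros)
 show "lipb (lower ka)" unfolding lower_def[abs_def] by (intro lipb_intros 2 4)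
qed

lemma norm_add3_mult_le:
 assumes "norm x <= a" "norm y <= b" shows "norm (x + y + x \<star> y) <= a + b + a * b"
proof -
 have "norm (x \<star> y) <= a * b"
 by (rule order_trans[OF norm_wmult_le mult_mono]) (use assms norm_ge_zero order_trans in blast)+
 then show ?thesis
 using norm_triangle_ineq[of "x + y" "x \<star> y"] norm_triangle_ineq[of x y] assms by linarith
qed

definition smallv :: "wvec => bool" where
 "smallv v \<longleftrightarrow> norm (py v) <= 1/240 & norm (py' v) <= 1/240 & norm (pp v) <= 1/24 & norm (pg v) <= 1/24"

lemma smallv_unitv: "smallv v ==> unitv v" by (auto simp: smallv_def unitv_def)

text \<open>Here explicit sizes do matter: 1/8 is the coefficient of the only term that gains
  nothing from a small \<open>T\<close>, and 1/50 makes the iteration for the two reciprocals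
  contract.\<close>

lemma small_bounds:
 assumes v: "smallv v" and k: "0 <= ka" "ka <= 1/1000"
 shows "norm (sq2 v) <= 1/100" "norm (sq4 v) <= 1/40" "norm (lead v) <= 1/8" "norm (den1 v) <= 1/50"
 "norm (den2 ka v) <= 1/50" "norm (lower ka v) <= 2"
proof -
 have y: "norm (py v) <= 1/240" "norm (py' v) <= 1/240" "norm (pp v) <= 1/24" "norm (pg v) <= 1/24"
 using v by (auto simp: smallv_def)
 show 2: "norm (sq2 v) <= 1/100"
 unfolding sq2_def by (rule order_trans[OF norm_add3_mult_le[OF y(1) y(1)]]) simp
 show 4: "norm (sq4 v) <= 1/40"
 unfolding sq4_def by (rule order_trans[OF norm_add3_mult_le[OF 2 2]]) simp
 show "norm (lead v) <= 1/8"
 unfolding lead_def by (rule order_trans[OF norm_add3_mult_le[OF y(3) 4]]) simp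
 have "norm (py' v \<star> py' v) <= 1/240 * (1/240)"
 by (rule order_trans[OF norm_wmult_le mult_mono]) (use y in auto)
 then show "norm (den1 v) <= 1/50"
 unfolding den1_def using norm_triangle_ineq[of "sq2 v" "py' v \<star> py' v"] 2 by simp
 have "norm (ka *# wcos) <= 1/1000 * 2"
 unfolding norm_scaleR by (rule mult_mono) (use k norm_wcos in auto)
 then show "norm (den2 ka v) <= 1/50"
 unfolding den2_def using norm_triangle_ineq[of "py v" "ka *# wcos"] y by simp
 have o: "norm (wone + x) <= 1 + a" if "norm x <= a" for x a
 using norm_triangle_ineq[of wone x] norm_wone that by linarith
 have m: "norm (x \<star> y) <= a * b" if "norm x <= a" "norm y <= b" for x y a b
 by (rule order_trans[OF norm_wmult_le mult_mono]) (use that norm_ge_zero order_trans in blast)+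
 have a: "norm (((wone + pp v) \<star> (wone + sq4 v)) \<star> (wone + py v)) <= (1 + 1/24) * (1 + 1/40) * (1 + 1/240)"
 by (intro m o y 4)
 have c: "norm ((wone + py v) \<star> wcos - py' v \<star> wsin) <= (1 + 1/240) * 2 + 1/240 * 2"
 by (rule order_trans[OF norm_triangle_ineq4 add_mono]) (intro m o y norm_wcos norm_wsin)+
 have "norm (((wone + sq2 v) \<star> (wone + pg v)) \<star> ((wone + py v) \<star> wcos - py' v \<star> wsin)) <= (1 + 1/100) * (1 + 1/24) * ((1 + 1/240) * 2 + 1/240 * 2)"
 by (intro m o y 2 c)
 then have "norm (ka *# (((wone + sq2 v) \<star> (wone + pg v)) \<star> ((wone + py v) \<star> wcos - py' v \<star> wsin))) <= 1/1000 * ((1 + 1/100) * (1 + 1/24) * ((1 + 1/240) * 2 + 1/240 * 2))"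
 unfolding norm_scaleR by (intro mult_mono) (use k in auto)
 then show "norm (lower ka v) <= 2"
 unfolding lower_def using a by (intro order_trans[OF norm_triangle_ineq]) simp
qed

lemma wcnj_parts:
 assumes "wcnj (py v) = py v" "wcnj (py' v) = py' v" "wcnj (pp v) = pp v" "wcnj (pg v) = pg v"
 shows "wcnj (lead v) = lead v" "wcnj (den1 v) = den1 v" "wcnj (den2 ka v) = den2 ka v" "wcnj (lower ka v) = lower ka v"
 by (simp_all add: lead_def den1_def den2_def lower_def sq4_def sq2_def assms wcnj_add wcnj_diff wcnj_wmult wcnj_scaleR wcnj_elems)

section \<open>Solving the profile equation by contraction\<close>

lemma contraction_fixpoint3:
 fixes Ph :: "'a::banach \<times> 'a \<times> 'a => 'a \<times> 'a \<times> 'a"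
 assumes D: "closed D" "D ~= {}" "!!u. u \<in> D ==> Ph u \<in> D" and La: "La > 0"
 and lip: "!!u v. u \<in> D ==> v \<in> D ==>
 norm (fst (Ph u) - fst (Ph v)) + La * norm (fst (snd (Ph u)) - fst (snd (Ph v))) + La * norm (snd (snd (Ph u)) - snd (snd (Ph v)))
 <= 1/4 * (norm (fst u - fst v) + La * norm (fst (snd u) - fst (snd v)) + La * norm (snd (snd u) - snd (snd v)))"
 obtains u where "u \<in> D" "Ph u = u"
proof -
 \<comment> \<open>Rescaling the last two components realises the weighted sum norm within the given
   product norm. A sum of three component norms is at most three times the product norm, which is
   why the factor 1/4 becomes 3/4.\<close>
 define sc :: "real => 'a \<times> 'a \<times> 'a => 'a \<times> 'a \<times> 'a" where
 "sc r u = (fst u, r *# fst (snd u), r *# snd (snd u))" for r u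
 have inv: "sc La (sc (inverse La) u) = u" "sc (inverse La) (sc La u) = u" for u
 using La by (simp_all add: sc_def)
 define E where "E = sc (inverse La) -` D"
 have "continuous_on UNIV (sc (inverse La))" unfolding sc_def[abs_def] by (intro continuous_intros)
 then have "closed E" unfolding E_def using D(1) by (simp add: closed_vimage)
 moreover have "E ~= {}"
 proof -
 obtain d where "d \<in> D" using D(2) by blast
 then have "sc La d \<in> E" unfolding E_def by (simp add: inv)
 then show ?thesis by blast
 qed
 moreover have "(%u. sc La (Ph (sc (inverse La) u))) ` E <= E"
 by (rule image_subsetI) (simp only: E_def vimage_eq inv D(3))
 moreover have "dist (sc La (Ph (sc (inverse La) u))) (sc La (Ph (sc (inverse La) v))) <= 3/4 * dist u v" if "u \<in> E" "v \<in> E" for u v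
 proof -
 let ?u = "sc (inverse La) u" and ?v = "sc (inverse La) v"
 have uv: "?u \<in> D" "?v \<in> D" using that by (auto simp: E_def)
 have n3: "norm x <= norm (fst x) + norm (fst (snd x)) + norm (snd (snd x))" for x :: "'a \<times> 'a \<times> 'a"
 using norm_Pair_le[of "fst x" "snd x"] norm_Pair_le[of "fst (snd x)" "snd (snd x)"] by simp
 have le: "norm (fst x) <= norm x" "norm (fst (snd x)) <= norm x" "norm (snd (snd x)) <= norm x" for x :: "'a \<times> 'a \<times> 'a"
 using norm_fst_le[of "fst x" "snd x"] norm_snd_le[of "snd x" "fst x"] norm_fst_le[of "fst (snd x)" "snd (snd x)"] norm_snd_le[of "snd (snd x)" "fst (snd x)"]
 by (auto intro: order_trans)
 have le3: "1/4 * (a + b + c) <= 3/4 * n" if "a <= n" "b <= n" "c <= n" for a b c n :: real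
 using that by (simp add: field_simps)
 have s: "norm (r *# a - r *# b) = \<bar>r\<bar> * norm (a - b)" for r and a b :: 'a
 by (metis norm_scaleR scaleR_diff_right)
 have "dist (sc La (Ph ?u)) (sc La (Ph ?v)) <= norm (fst (Ph ?u) - fst (Ph ?v)) + La * norm (fst (snd (Ph ?u)) - fst (snd (Ph ?v))) + La * norm (snd (snd (Ph ?u)) - snd (snd (Ph ?v)))"
 using n3[of "sc La (Ph ?u) - sc La (Ph ?v)"] La by (simp add: dist_norm sc_def s)
 also have "... <= 1/4 * (norm (fst ?u - fst ?v) + La * norm (fst (snd ?u) - fst (snd ?v)) + La * norm (snd (snd ?u) - snd (snd ?v)))"
 by (rule lip[OF uv])
 also have "... = 1/4 * (norm (fst (u - v)) + norm (fst (snd (u - v))) + norm (snd (snd (u - v))))"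
 using La by (simp add: sc_def s mult.assoc[symmetric])
 also have "... <= 3/4 * dist u v"
 unfolding dist_norm using le3[OF le[of "u - v"]] .
 finally show ?thesis .
 qed
 ultimately obtain u where u: "u \<in> E" "sc La (Ph (sc (inverse La) u)) = u"
 using Banach_fix[of E "3/4" "%u. sc La (Ph (sc (inverse La) u))"] by (auto simp: complete_eq_closed)
 then have "sc (inverse La) u \<in> D" "Ph (sc (inverse La) u) = sc (inverse La) u"
 unfolding E_def vimage_eq by (simp, metis inv(2))
 then show ?thesis by (rule that)
qed

definition pvec :: "complex => real => wien \<times> wien \<times> wien => wvec" where
 "pvec c T u = (ylin c 0 + heat_op T 0 (fst u), ylin c 1 + heat_op T 1 (fst u), fst (snd u), snd (snd u))"

text \<open>The unknowns are the source \<open>z\<close> of the heat equation satisfied by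
  \<open>y\<close>, and the two reciprocals minus 1. The latter solve
  \<open>x = - (d + d x)\<close>, that is \<open>(1 + d) (1 + x) = 1\<close>, so that the map is
  polynomial in all its arguments. In the first component the term \<open>1 * y''\<close> has been
  moved to the heat operator, which leaves the small coefficient \<open>lead\<close>.\<close>

definition pde_map :: "complex => real => real => wien \<times> wien \<times> wien => wien \<times> wien \<times> wien" where
 "pde_map c ka T u = (lead (pvec c T u) \<star> (ylin c 2 + heat_op T 2 (fst u)) + lower ka (pvec c T u),
 - (den1 (pvec c T u) + den1 (pvec c T u) \<star> fst (snd u)),
 - (den2 ka (pvec c T u) + den2 ka (pvec c T u) \<star> snd (snd u)))"

lemma lipbD:
 assumes "lipb h" obtains L where "L >= 1" "!!v w. unitv v ==> unitv w ==> norm (h v - h w) <= L * dvec v w"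
proof -
 obtain B L where h: "0 <= B" "0 <= L" "!!v w. unitv v ==> unitv w ==> norm (h v) <= B & norm (h v - h w) <= L * dvec v w"
 using assms unfolding lipb_def by blast
 have "norm (h v - h w) <= (L + 1) * dvec v w" if "unitv v" "unitv w" for v w
 using h(3)[OF that] dvec_nonneg[of v w] by (simp add: distrib_right)
 then show ?thesis using that[of "L + 1"] h by auto
qed

text \<open>The denominators involve only \<open>y\<close> and \<open>y'\<close>. Erasing the other
  components makes their Lipschitz estimate see only these two, whose differences carry the small
  factor \<open>r\<close>.\<close>

definition vy :: "wvec => wvec" where "vy v = (py v, py' v, 0, 0)"

lemma vy: "unitv v ==> unitv (vy v)" "dvec (vy v) (vy w) = norm (py v - py w) + norm (py' v - py' w)"
 "den1 (vy v) = den1 v" "den2 ka (vy v) = den2 ka v"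
 by (simp_all add: vy_def unitv_def dvec_def den1_def den2_def sq2_def py_def py'_def pp_def pg_def)

lemma norm_den_step_le:
 assumes "norm d <= 1/50" "norm x' <= 1/24"
 shows "norm (- (d + d \<star> x) - - (d' + d' \<star> x')) <= 1/50 * norm (x - x') + 2 * norm (d - d')"
proof -
 have e: "- (d + d \<star> x) - - (d' + d' \<star> x') = - (d \<star> (x - x')) + - ((d - d') + (d - d') \<star> x')"
 by (simp add: wmult.diff_left wmult.diff_right)
 have "norm (d \<star> (x - x')) <= 1/50 * norm (x - x')"
 by (rule order_trans[OF norm_wmult_le mult_right_mono]) (use assms in auto)
 moreover have "norm ((d - d') \<star> x') <= norm (d - d') * 1"
 by (rule order_trans[OF norm_wmult_le mult_left_mono]) (use assms in auto)
 ultimately show ?thesis unfolding e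
 using norm_triangle_ineq[of "- (d \<star> (x - x'))" "- ((d - d') + (d - d') \<star> x')"]
 norm_triangle_ineq[of "d - d'" "(d - d') \<star> x'"] by (simp only: norm_minus_cancel)
qed

theorem pde_fixpoint:
 assumes ka: "0 <= ka" "ka <= 1/1000" and c: "norm c <= 1 / (4000\<^sup>2 - 1)"
 obtains T u where "0 < T" "pde_map c ka T u = u" "smallv (pvec c T u)"
 "wcnj (fst u) = fst u" "wcnj (fst (snd u)) = fst (snd u)" "wcnj (snd (snd u)) = snd (snd u)"
proof -
 obtain L1 where L1: "L1 >= 1" "!!v w. unitv v ==> unitv w ==> norm (lead v - lead w) <= L1 * dvec v w"
 using lipbD[OF lipb_parts(3)] by blast
 obtain L2 where L2: "L2 >= 1" "!!v w. unitv v ==> unitv w ==> norm (lower ka v - lower ka w) <= L2 * dvec v w"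
 using lipbD[OF lipb_parts(6)] by blast
 obtain L3 where L3: "L3 >= 1" "!!v w. unitv v ==> unitv w ==> norm (den1 v - den1 w) <= L3 * dvec v w"
 using lipbD[OF lipb_parts(4)] by blast
 obtain L4 where L4: "L4 >= 1" "!!v w. unitv v ==> unitv w ==> norm (den2 ka v - den2 ka w) <= L4 * dvec v w"
 using lipbD[OF lipb_parts(5)] by blast
 define L where "L = 23 * L1 + L2 + 2 * L3 + 2 * L4"
 have L: "L >= 1" "23 * L1 + L2 <= L" "2 * L3 <= L" "2 * L4 <= L" using L1 L2 L3 L4 by (auto simp: L_def)
 \<comment> \<open>The first component reacts to the last two with constant \<open>L\<close>, while
   these react to themselves with 1/50 only. With the weight \<open>8 * L\<close> on them the cross
   terms cost at most a quarter of the weighted distance.\<close>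
 define La where "La = 8 * L"
 define r where "r = 1 / (16 * 480 * L * (1 + 16 * L))"
 have "r * (16 * 480 * L * (1 + 16 * L)) = 1"
 proof -
 have "16 * 480 * L * (1 + 16 * L) > 0" using L(1) by (intro mult_pos_pos) auto
 then show ?thesis unfolding r_def by (metis less_numeral_extra(3) nonzero_eq_divide_eq)
 qed
 then have r1: "7680 * (r * (L * (1 + 16 * L))) = 1" by (simp add: algebra_simps)
 have r: "0 < r" unfolding r_def using L(1) by (intro divide_pos_pos mult_pos_pos) auto
 have LL: "1 * 1 <= L * (1 + 16 * L)" by (rule mult_mono) (use L(1) in auto)
 have r': "r * 16 <= 1/480" using mult_left_mono[OF LL, of r] r r1 by linarith
 have r2: "2 * r * L * (1 + 16 * L) <= 1/8" using r1 r by (simp add: algebra_simps)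
 \<comment> \<open>As \<open>r\<close> is small, both gains \<open>T\<close> and
   \<open>sqrt T\<close> are at most \<open>r\<close>; and \<open>r\<close> was chosen such that all
   contributions through \<open>y\<close> and \<open>y'\<close> add up to at most 1/8.\<close>
 define T where "T = r\<^sup>2"
 have T: "0 < T" "sqrt T = r" "T <= r" using r r' by (auto simp: T_def power2_eq_square)
 \<comment> \<open>The radius 16 leaves room: the first component of an image is at most
   \<open>1/8 * 23 + 2\<close>, where \<open>23 = 7 + 16\<close> bounds the second derivative. The
   conjugation conditions make the solution real.\<close>
 define D where "D = {u. norm (fst u) <= 16 & norm (fst (snd u)) <= 1/24 & norm (snd (snd u)) <= 1/24 &
 wcnj (fst u) = fst u & wcnj (fst (snd u)) = fst (snd u) & wcnj (snd (snd u)) = snd (snd u)}"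
 have g: "gainc T 0 <= r" "gainc T 1 <= r" "gainc T 2 = 1" using T by (auto simp: gainc_def)
 have hb: "norm (heat_op T 0 x) <= r * norm x" "norm (heat_op T 1 x) <= r * norm x" "norm (heat_op T 2 x) <= norm x" for x
 proof -
 have T0: "0 <= T" using T by simp
 show "norm (heat_op T 0 x) <= r * norm x"
 by (rule order_trans[OF norm_heat_op_le mult_right_mono[OF g(1) norm_ge_zero]]) (use T0 in auto)
 show "norm (heat_op T 1 x) <= r * norm x"
 by (rule order_trans[OF norm_heat_op_le mult_right_mono[OF g(2) norm_ge_zero]]) (use T0 in auto)
 show "norm (heat_op T 2 x) <= norm x" using norm_heat_op_le[OF T0, of 2 x] g(3) by simp
 qed
 \<comment> \<open>The high frequency pays off: value and slope of the ripple are tiny, and only its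
   second derivative is of order one.\<close>
 have yl: "norm (ylin c 0) <= 1/480" "norm (ylin c 1) <= 1/480" "norm (ylin c 2) <= 7"
 using norm_ylin_le[of c 0] norm_ylin_le[of c 1] norm_ylin_le[of c 2] c by (simp_all del: One_nat_def)
 have small: "smallv (pvec c T u)" if "u \<in> D" for u
 proof -
 have "r * norm (fst u) <= r * 16" using that r by (auto simp: D_def)
 then have "norm (heat_op T 0 (fst u)) <= 1/480" "norm (heat_op T 1 (fst u)) <= 1/480" using hb[of "fst u"] r' by linarith+
 then show ?thesis
 using that yl norm_triangle_ineq[of "ylin c 0" "heat_op T 0 (fst u)"] norm_triangle_ineq[of "ylin c 1" "heat_op T 1 (fst u)"]
 by (auto simp: smallv_def pvec_def py_def py'_def pp_def pg_def D_def)
 qed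
 have y2: "norm (ylin c 2 + heat_op T 2 (fst u)) <= 23" if "u \<in> D" for u
 using norm_triangle_ineq[of "ylin c 2" "heat_op T 2 (fst u)"] yl(3) hb(3)[of "fst u"] that by (auto simp: D_def)
 have real: "wcnj (py (pvec c T u)) = py (pvec c T u)" "wcnj (py' (pvec c T u)) = py' (pvec c T u)"
 "wcnj (pp (pvec c T u)) = pp (pvec c T u)" "wcnj (pg (pvec c T u)) = pg (pvec c T u)" if "u \<in> D" for u
 using that T by (simp_all add: D_def pvec_def py_def py'_def pp_def pg_def wcnj_add wcnj_ylin wcnj_heat_op)
 have clD: "closed D"
 proof -
 have cw: "continuous_on UNIV wcnj" using bounded_linear_wcnj by (simp add: linear_continuous_on)
 have c1: "continuous_on UNIV (%u::wien\<times>wien\<times>wien. wcnj (h u))" if "continuous_on UNIV h" for h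
 using continuous_on_compose2[OF cw that] by simp
 show ?thesis unfolding D_def
 by (intro closed_Collect_conj closed_Collect_le closed_Collect_eq continuous_intros c1)
 qed
 have "0 \<in> D" by (simp add: D_def wcnj_scaleR[of 0 0, simplified])
 then have neD: "D ~= {}" by blast
 have inD: "pde_map c ka T u \<in> D" if u: "u \<in> D" for u
 proof -
 let ?v = "pvec c T u"
 note sb = small_bounds[OF small[OF u] ka]
 note rl = wcnj_parts[OF real[OF u]]
 have "norm (lead ?v \<star> (ylin c 2 + heat_op T 2 (fst u))) <= 1/8 * 23"
 by (rule order_trans[OF norm_wmult_le mult_mono]) (use sb y2[OF u] in auto)
 then have 1: "norm (lead ?v \<star> (ylin c 2 + heat_op T 2 (fst u)) + lower ka ?v) <= 16"
 using norm_triangle_ineq[of "lead ?v \<star> (ylin c 2 + heat_op T 2 (fst u))" "lower ka ?v"] sb(6) by linarith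
 have 2: "norm (- (d + d \<star> x)) <= 1/24" if "norm d <= 1/50" "norm x <= 1/24" for d x
 proof -
 have "norm (d \<star> x) <= 1/50 * (1/24)"
 by (rule order_trans[OF norm_wmult_le mult_mono]) (use that in auto)
 then show ?thesis unfolding norm_minus_cancel using norm_triangle_ineq[of d "d \<star> x"] that by linarith
 qed
 have m: "wcnj (- x) = - wcnj x" for x using wcnj_scaleR[of "-1" x] by simp
 have x: "norm (fst (snd u)) <= 1/24" "norm (snd (snd u)) <= 1/24"
 "wcnj (fst u) = fst u" "wcnj (fst (snd u)) = fst (snd u)" "wcnj (snd (snd u)) = snd (snd u)"
 using u by (auto simp: D_def)
 show ?thesis
 unfolding D_def pde_map_def
 using 1 2[OF sb(4) x(1)] 2[OF sb(5) x(2)] T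
 by (simp add: m wcnj_add wcnj_diff wcnj_wmult rl x wcnj_ylin wcnj_heat_op)
 qed
 have lip: "norm (fst (pde_map c ka T u) - fst (pde_map c ka T v)) + La * norm (fst (snd (pde_map c ka T u)) - fst (snd (pde_map c ka T v)))
 + La * norm (snd (snd (pde_map c ka T u)) - snd (snd (pde_map c ka T v)))
 <= 1/4 * (norm (fst u - fst v) + La * norm (fst (snd u) - fst (snd v)) + La * norm (snd (snd u) - snd (snd v)))"
 if uv: "u \<in> D" "v \<in> D" for u v
 proof -
 let ?v = "pvec c T u" and ?w = "pvec c T v"
 define a where "a = norm (fst u - fst v)"
 define b where "b = norm (fst (snd u) - fst (snd v))"
 define d where "d = norm (snd (snd u) - snd (snd v))"
 note sv = small_bounds[OF small[OF uv(1)] ka]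
 note U = smallv_unitv[OF small[OF uv(1)]] smallv_unitv[OF small[OF uv(2)]]
 have nn: "0 <= a" "0 <= b" "0 <= d" by (auto simp: a_def b_def d_def)
 have dy: "norm (py ?v - py ?w) <= r * a" "norm (py' ?v - py' ?w) <= r * a"
 using hb[of "fst u - fst v"] heat_op_diff[of T _ "fst u" "fst v"] T
 by (simp_all add: pvec_def py_def py'_def a_def del: One_nat_def)
 have dv: "dvec ?v ?w <= 2 * r * a + b + d"
 using dy by (simp add: dvec_def pp_def pg_def pvec_def b_def d_def)
 have dl: "norm (lead ?v - lead ?w) <= L1 * (2 * r * a + b + d)"
 using order_trans[OF L1(2)[OF U] mult_left_mono[OF dv]] L1(1) by simp
 have dlo: "norm (lower ka ?v - lower ka ?w) <= L2 * (2 * r * a + b + d)"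
 using order_trans[OF L2(2)[OF U] mult_left_mono[OF dv]] L2(1) by simp
 have dvy: "dvec (vy ?v) (vy ?w) <= 2 * r * a" unfolding vy using dy by simp
 have dd1: "norm (den1 ?v - den1 ?w) <= L3 * (2 * r * a)"
 using order_trans[OF L3(2)[OF vy(1)[OF U(1)] vy(1)[OF U(2)], unfolded vy(3,4)] mult_left_mono[OF dvy]] L3(1) by simp
 have dd2: "norm (den2 ka ?v - den2 ka ?w) <= L4 * (2 * r * a)"
 using order_trans[OF L4(2)[OF vy(1)[OF U(1)] vy(1)[OF U(2)], unfolded vy(3,4)] mult_left_mono[OF dvy]] L4(1) by simp
 have e1: "fst (pde_map c ka T u) - fst (pde_map c ka T v) =
 lead ?v \<star> (heat_op T 2 (fst u) - heat_op T 2 (fst v)) + (lead ?v - lead ?w) \<star> (ylin c 2 + heat_op T 2 (fst v))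
 + (lower ka ?v - lower ka ?w)"
 by (simp add: pde_map_def wmult.diff_left wmult.diff_right wmult.add_right)
 have "norm (lead ?v \<star> (heat_op T 2 (fst u) - heat_op T 2 (fst v))) <= 1/8 * a"
 by (rule order_trans[OF norm_wmult_le mult_mono])
 (use sv(3) hb(3)[of "fst u - fst v"] heat_op_diff[of T 2 "fst u" "fst v"] T in \<open>auto simp: a_def\<close>)
 moreover have "norm ((lead ?v - lead ?w) \<star> (ylin c 2 + heat_op T 2 (fst v))) <= (L1 * (2 * r * a + b + d)) * 23"
 by (rule order_trans[OF norm_wmult_le mult_mono]) (use dl y2[OF uv(2)] L1(1) nn r in auto)
 ultimately have n1: "norm (fst (pde_map c ka T u) - fst (pde_map c ka T v)) <= 1/8 * a + (L1 * (2 * r * a + b + d)) * 23 + L2 * (2 * r * a + b + d)"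
 unfolding e1 using dlo by (intro order_trans[OF norm_triangle_ineq add_mono] order_trans[OF norm_triangle_ineq add_mono])
 have "(L1 * (2 * r * a + b + d)) * 23 + L2 * (2 * r * a + b + d) = (23 * L1 + L2) * (2 * r * a + b + d)" by (simp add: algebra_simps)
 also have "... <= L * (2 * r * a + b + d)" by (rule mult_right_mono[OF L(2)]) (use nn r in auto)
 finally have n1': "norm (fst (pde_map c ka T u) - fst (pde_map c ka T v)) <= 1/8 * a + L * (2 * r * a + b + d)" using n1 by linarith
 have xs: "norm (fst (snd v)) <= 1/24" "norm (snd (snd v)) <= 1/24" using uv(2) by (auto simp: D_def)
 have "norm (fst (snd (pde_map c ka T u)) - fst (snd (pde_map c ka T v))) <= 1/50 * b + 2 * norm (den1 ?v - den1 ?w)"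
 unfolding pde_map_def b_def using norm_den_step_le[OF sv(4) xs(1)] by simp
 also have "... <= 1/50 * b + 2 * L3 * (2 * r * a)" using dd1 by linarith
 also have "... <= 1/50 * b + L * (2 * r * a)" using mult_right_mono[OF L(3), of "2 * r * a"] nn r by simp
 finally have n2: "norm (fst (snd (pde_map c ka T u)) - fst (snd (pde_map c ka T v))) <= 1/50 * b + L * (2 * r * a)" .
 have "norm (snd (snd (pde_map c ka T u)) - snd (snd (pde_map c ka T v))) <= 1/50 * d + 2 * norm (den2 ka ?v - den2 ka ?w)"
 unfolding pde_map_def d_def using norm_den_step_le[OF sv(5) xs(2)] by simp
 also have "... <= 1/50 * d + 2 * L4 * (2 * r * a)" using dd2 by linarith
 also have "... <= 1/50 * d + L * (2 * r * a)" using mult_right_mono[OF L(4), of "2 * r * a"] nn r by simp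
 finally have n3: "norm (snd (snd (pde_map c ka T u)) - snd (snd (pde_map c ka T v))) <= 1/50 * d + L * (2 * r * a)" .
 have "norm (fst (pde_map c ka T u) - fst (pde_map c ka T v)) + La * norm (fst (snd (pde_map c ka T u)) - fst (snd (pde_map c ka T v)))
 + La * norm (snd (snd (pde_map c ka T u)) - snd (snd (pde_map c ka T v)))
 <= (1/8 * a + L * (2 * r * a + b + d)) + La * (1/50 * b + L * (2 * r * a)) + La * (1/50 * d + L * (2 * r * a))"
 by (intro add_mono mult_left_mono n1' n2 n3) (use L(1) in \<open>auto simp: La_def\<close>)
 also have "... = 1/8 * a + (2 * r * L * (1 + 16 * L)) * a + (L + 8 * L / 50) * (b + d)"
 unfolding La_def by (simp add: algebra_simps)
 also have "... <= 1/8 * a + 1/8 * a + (2 * L) * (b + d)"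
 by (intro add_mono mult_right_mono order_refl r2) (use nn L(1) in auto)
 also have "... = 1/4 * (a + La * b + La * d)" unfolding La_def by (simp add: algebra_simps)
 finally show ?thesis unfolding a_def b_def d_def .
 qed
 have La: "La > 0" using L(1) by (simp add: La_def)
 obtain u where u: "u \<in> D" "pde_map c ka T u = u"
 using contraction_fixpoint3[OF clD neD inD La lip] by blast
 show ?thesis by (rule that[OF T(1) u(2) small[OF u(1)]]) (use u(1) in \<open>auto simp: D_def\<close>)
qed

section \<open>Calculus of smooth functions\<close>

lemma has_derivative_nderiv:
 "smooth_on U f ==> x \<in> U ==> (nderiv vs f has_derivative (%v. nderiv (v # vs) f x)) (at x)"
 unfolding smooth_on_def nderiv.simps by (simp add: frechet_derivative_works[symmetric])

lemma has_derivative_smooth: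
 "smooth_on U f ==> x \<in> U ==> (f has_derivative (%v. nderiv [v] f x)) (at x)"
 using has_derivative_nderiv[of U f x "[]"] by simp

lemma nderiv_append: "nderiv (vs @ ws) f = nderiv vs (nderiv ws f)"
 by (induction vs) simp_all

lemma smooth_on_nderiv: "smooth_on U f ==> smooth_on U (nderiv vs f)"
 unfolding smooth_on_def nderiv_append[symmetric] by blast

lemma smooth_on_subset: "smooth_on U f ==> V <= U ==> smooth_on V f"
 unfolding smooth_on_def by blast

lemma continuous_nderiv: "smooth_on U f ==> x \<in> U ==> isCont (nderiv vs f) x"
 by (rule has_derivative_continuous[OF has_derivative_nderiv])

lemma continuous_on_nderiv: "smooth_on U f ==> continuous_on U (nderiv vs f)"
 by (simp add: continuous_at_imp_continuous_on continuous_nderiv)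

text \<open>A coinduction principle: in a family closed under directional derivatives every member
  is smooth. Each closure property below comes down to finding a family that the product or chain
  rule does not leave.\<close>

lemma smooth_on_family:
 assumes U: "open U"
 and F: "!!f. f \<in> F ==> EX f'. (\<forall>x\<in>U. (f has_derivative (%v. f' v x)) (at x)) & (ALL v. f' v \<in> F)"
 and f: "f \<in> F"
 shows "smooth_on U f"
proof -
 have ex: "\<exists>g\<in>F. \<forall>x\<in>U. nderiv vs f x = g x" for vs
 proof (induction vs)
 case (Cons v vs)
 then obtain g where g: "g \<in> F" "!!x. x \<in> U ==> nderiv vs f x = g x" by blast
 from F[OF g(1)] obtain g' where g': "!!x. x \<in> U ==> (g has_derivative (%v. g' v x)) (at x)" "!!v. g' v \<in> F"
 by blast
 have "nderiv (v # vs) f x = g' v x" if "x \<in> U" for x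
 proof -
 have "(nderiv vs f has_derivative (%v. g' v x)) (at x)"
 by (rule has_derivative_transform_within_open[OF g'(1)[OF that] U that]) (simp add: g)
 then show ?thesis by (simp add: frechet_derivative_at[symmetric])
 qed
 then show ?case using g'(2) by blast
 qed (use f in auto)
 show ?thesis unfolding smooth_on_def
 proof (intro allI ballI)
 fix vs x assume x: "x \<in> U"
 obtain g where g: "g \<in> F" "!!x. x \<in> U ==> nderiv vs f x = g x" using ex by blast
 from F[OF g(1)] x obtain D where "(g has_derivative D) (at x)" by blast
 then have "(nderiv vs f has_derivative D) (at x)"
 by (rule has_derivative_transform_within_open[OF _ U x]) (simp add: g)
 then show "nderiv vs f differentiable at x" unfolding differentiable_def by blast
 qed
qed

lemma smooth_onI_deriv:
 assumes U: "open U" and d: "!!x. x \<in> U ==> (f has_derivative (%v. f' v x)) (at x)" and s: "!!v. smooth_on U (f' v)"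
 shows "smooth_on U f"
proof (rule smooth_on_family[OF U, where F="insert f {g. smooth_on U g}"])
 fix h assume h: "h \<in> insert f {g. smooth_on U g}"
 show "EX f'. (\<forall>x\<in>U. (h has_derivative (%v. f' v x)) (at x)) & (ALL v. f' v \<in> insert f {g. smooth_on U g})"
 proof (cases "h = f")
 case True
 then show ?thesis using d s by (intro exI[of _ f']) simp
 next
 case False
 then have "smooth_on U h" using h by simp
 then show ?thesis
 by (intro exI[of _ "%v. nderiv [v] h"] conjI ballI allI insertI2 CollectI)
 (rule has_derivative_smooth smooth_on_nderiv; assumption)+
 qed
qed simp

lemma smooth_on_const: "smooth_on U (%_. c)"
proof -
 have "EX d. nderiv vs (%_::'a. c) = (%_. d)" for vs :: "'a list" by (induction vs) (auto simp: frechet_derivative_const)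
 then have "nderiv vs (%_::'a. c) differentiable at x" for vs x by (metis differentiable_const)
 then show ?thesis unfolding smooth_on_def by blast
qed

lemma smooth_on_linear: "bounded_linear A ==> open U ==> smooth_on U A"
 by (rule smooth_onI_deriv[where f'="%v x. A v"]) (auto intro: bounded_linear_imp_has_derivative smooth_on_const)

text \<open>Sums of bilinear terms in arbitrary derivatives of the factors: the smallest shape that
  the Leibniz rule preserves.\<close>

inductive_set bilin_family :: "('b::real_normed_vector => 'c::real_normed_vector => 'd::real_normed_vector) => ('a::real_normed_vector => 'b) => ('a => 'c) => ('a => 'd) set"
 for p f g where
 base: "(%x. p (nderiv vs f x) (nderiv ws g x)) \<in> bilin_family p f g"
| add: "h \<in> bilin_family p f g ==> k \<in> bilin_family p f g ==> (%x. h x + k x) \<in> bilin_family p f g"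

lemma smooth_on_bilinear:
 assumes p: "bounded_bilinear p" and U: "open U" and f: "smooth_on U f" and g: "smooth_on U g"
 shows "smooth_on U (%x. p (f x) (g x))"
proof (rule smooth_on_family[OF U, where F="bilin_family p f g"])
 show "(%x. p (f x) (g x)) \<in> bilin_family p f g" using bilin_family.base[of p "[]" f "[]" g] by simp
 fix h assume "h \<in> bilin_family p f g"
 then show "EX f'. (\<forall>x\<in>U. (h has_derivative (%v. f' v x)) (at x)) & (ALL v. f' v \<in> bilin_family p f g)"
 proof induction
 case (base vs ws)
 show ?case
 by (intro exI[of _ "%v x. p (nderiv vs f x) (nderiv (v # ws) g x) + p (nderiv (v # vs) f x) (nderiv ws g x)"] ballI conjI allI
 bounded_bilinear.FDERIV[OF p] has_derivative_nderiv[OF f] has_derivative_nderiv[OF g] bilin_family.intros)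
 next
 case (add h k)
 then obtain h' k' where "(\<forall>x\<in>U. (h has_derivative (%v. h' v x)) (at x)) & (ALL v. h' v \<in> bilin_family p f g)"
 "(\<forall>x\<in>U. (k has_derivative (%v. k' v x)) (at x)) & (ALL v. k' v \<in> bilin_family p f g)" by blast
 then show ?case
 by (intro exI[of _ "%v x. h' v x + k' v x"]) (auto intro!: has_derivative_add bilin_family.add)
 qed
qed

lemma smooth_on_add:
 assumes U: "open U" and f: "smooth_on U f" and g: "smooth_on U g"
 shows "smooth_on U (%x. f x + g x)"
proof (rule smooth_on_family[OF U, where F="{h. EX f g. smooth_on U f & smooth_on U g & h = (%x. f x + g x)}"])
 fix h assume "h \<in> {h. EX f g. smooth_on U f & smooth_on U g & h = (%x. f x + g x)}"
 then obtain f g where h: "smooth_on U f" "smooth_on U g" "h = (%x. f x + g x)" by blast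
 show "EX f'. (\<forall>x\<in>U. (h has_derivative (%v. f' v x)) (at x)) & (ALL v. f' v \<in> {h. EX f g. smooth_on U f & smooth_on U g & h = (%x. f x + g x)})"
 proof (intro exI[of _ "%v x. nderiv [v] f x + nderiv [v] g x"] conjI ballI allI)
 fix x assume x: "x \<in> U"
 show "(h has_derivative (%v. nderiv [v] f x + nderiv [v] g x)) (at x)"
 unfolding h(3) by (intro has_derivative_add has_derivative_smooth[OF h(1) x] has_derivative_smooth[OF h(2) x])
 next
 fix v
 show "(%x. nderiv [v] f x + nderiv [v] g x) \<in> {h. EX f g. smooth_on U f & smooth_on U g & h = (%x. f x + g x)}"
 using smooth_on_nderiv[OF h(1), of "[v]"] smooth_on_nderiv[OF h(2), of "[v]"] by blast
 qed
qed (use f g in blast)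

lemmas smooth_on_mult = smooth_on_bilinear[OF bounded_bilinear_mult]
lemmas smooth_on_scaleR = smooth_on_bilinear[OF bounded_bilinear_scaleR]

lemma smooth_on_diff:
 assumes U: "open U" and f: "smooth_on U f" and g: "smooth_on U g"
 shows "smooth_on U (%x. f x - g x)"
 using smooth_on_add[OF U f smooth_on_scaleR[OF U smooth_on_const g], of "-1"] by simp

inductive_set comp_family :: "'a::real_normed_vector set => ('b::euclidean_space => 'c::real_normed_vector) => ('a => 'b) => ('a => 'c) set"
 for U g f where
 base: "smooth_on U c ==> (%x. c x *# nderiv ws g (f x)) \<in> comp_family U g f"
| add: "h \<in> comp_family U g f ==> k \<in> comp_family U g f ==> (%x. h x + k x) \<in> comp_family U g f"

lemma comp_family_sum: "finite I ==> (!!i. i \<in> I ==> h i \<in> comp_family U g f) ==> (%x. \<Sum>i\<in>I. h i x) \<in> comp_family U g f"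
proof (induction I rule: finite_induct)
 case empty then show ?case using comp_family.base[OF smooth_on_const[of U 0], of "[]" g f] by simp
next
 case (insert i I) then show ?case by (simp add: comp_family.add)
qed

lemma smooth_on_compose:
 fixes f :: "'a::real_normed_vector => 'b::euclidean_space"
 assumes U: "open U" and f: "smooth_on U f" and g: "smooth_on V g" and fV: "f ` U <= V"
 shows "smooth_on U (%x. g (f x))"
proof (rule smooth_on_family[OF U, where F="comp_family U g f"])
 show "(%x. g (f x)) \<in> comp_family U g f"
 using comp_family.base[OF smooth_on_const[of U 1], of "[]" g f] by simp
 fix h assume "h \<in> comp_family U g f"
 then show "EX f'. (\<forall>x\<in>U. (h has_derivative (%v. f' v x)) (at x)) & (ALL v. f' v \<in> comp_family U g f)"
 proof induction
 case (base c ws)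
 \<comment> \<open>The chain rule differentiates \<open>g\<close> in the direction
   \<open>nderiv [v] f x\<close>, which varies with \<open>x\<close>. Expanding it in the basis
   gives smooth coefficients times derivatives of \<open>g\<close> in fixed directions, and these
   stay in the family.\<close>
 have lin: "nderiv (w # ws) g y = (\<Sum>b\<in>Basis. (w *. b) *# nderiv (b # ws) g y)" if "y \<in> V" for w y
 proof -
 interpret bounded_linear "%w. nderiv (w # ws) g y"
 using has_derivative_bounded_linear[OF has_derivative_nderiv[OF g that]] .
 have "nderiv (w # ws) g y = nderiv ((\<Sum>b\<in>Basis. (w *. b) *# b) # ws) g y" by (simp only: euclidean_representation)
 also have "... = (\<Sum>b\<in>Basis. (w *. b) *# nderiv (b # ws) g y)" unfolding sum scaleR ..
 finally show ?thesis .
 qed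
 let ?D = "%v x. (\<Sum>b\<in>Basis. (c x * (nderiv [v] f x *. b)) *# nderiv (b # ws) g (f x)) + nderiv [v] c x *# nderiv ws g (f x)"
 have d1: "((%x. c x *# nderiv ws g (f x)) has_derivative (%v. ?D v x)) (at x)" if x: "x \<in> U" for x
 proof -
 have y: "f x \<in> V" using x fV by blast
 have 1: "((%x. nderiv ws g (f x)) has_derivative (%v. nderiv (nderiv [v] f x # ws) g (f x))) (at x)"
 using has_derivative_compose[OF has_derivative_smooth[OF f x] has_derivative_nderiv[OF g y]] .
 have "((%x. c x *# nderiv ws g (f x)) has_derivative
 (%v. c x *# nderiv (nderiv [v] f x # ws) g (f x) + nderiv [v] c x *# nderiv ws g (f x))) (at x)"
 by (rule has_derivative_scaleR[OF has_derivative_smooth[OF base x] 1])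
 moreover have "(%v. c x *# nderiv (nderiv [v] f x # ws) g (f x) + nderiv [v] c x *# nderiv ws g (f x)) = (%v. ?D v x)"
 by (rule ext, subst lin[OF y]) (simp only: scaleR_sum_right scaleR_scaleR)
 ultimately show ?thesis by (simp only:)
 qed
 have d2: "?D v \<in> comp_family U g f" for v
 proof (intro comp_family.add comp_family_sum comp_family.base finite_Basis)
 fix b :: 'b
 show "smooth_on U (%x. c x * (nderiv [v] f x *. b))"
 by (intro smooth_on_mult[OF U base] smooth_on_bilinear[OF bounded_bilinear_inner U] smooth_on_nderiv[OF f] smooth_on_const)
 show "smooth_on U (nderiv [v] c)" by (rule smooth_on_nderiv[OF base])
 qed
 show ?case by (intro exI[of _ ?D] conjI ballI allI d1 d2)
 next
 case (add h k)
 from add.IH obtain h' k' where hk: "!!x. x \<in> U ==> (h has_derivative (%v. h' v x)) (at x)" "!!v. h' v \<in> comp_family U g f"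
 "!!x. x \<in> U ==> (k has_derivative (%v. k' v x)) (at x)" "!!v. k' v \<in> comp_family U g f" by blast
 show ?case
 by (intro exI[of _ "%v x. h' v x + k' v x"] conjI ballI allI has_derivative_add comp_family.add hk)
 qed
qed

lemma smooth_on_realI:
 fixes f :: "real => real"
 assumes U: "open U" and d: "!!x. x \<in> U ==> (f has_real_derivative f' x) (at x)" and s: "smooth_on U f'"
 shows "smooth_on U f"
proof (rule smooth_onI_deriv[OF U, where f'="%v x. f' x * v"])
 show "(f has_derivative (%v. f' x * v)) (at x)" if "x \<in> U" for x
 using d[OF that] by (simp add: has_field_derivative_def)
 show "smooth_on U (%x. f' x * v)" for v by (rule smooth_on_mult[OF U s smooth_on_const])
qed

text \<open>For functions such as \<open>inverse\<close> and \<open>sqrt\<close>, whose successive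
  derivatives run through one sequence up to constant factors.\<close>

lemma smooth_on_real_family:
 fixes f :: "real => real"
 assumes U: "open U" and F: "!!f. f \<in> F ==> \<exists>f'\<in>F. EX c. \<forall>x\<in>U. (f has_real_derivative c * f' x) (at x)" and f: "f \<in> F"
 shows "smooth_on U f"
proof (rule smooth_on_family[OF U, where F="{h. EX c. \<exists>f\<in>F. h = (%x. c * f x)}"])
 fix h assume "h \<in> {h. EX c. \<exists>f\<in>F. h = (%x. c * f x)}"
 then obtain c f where h: "f \<in> F" "h = (%x. c * f x)" by blast
 obtain f' d where f': "f' \<in> F" "\<forall>x\<in>U. (f has_real_derivative d * f' x) (at x)" using F[OF h(1)] by blast
 show "EX f'. (\<forall>x\<in>U. (h has_derivative (%v. f' v x)) (at x)) & (ALL v. f' v \<in> {h. EX c. \<exists>f\<in>F. h = (%x. c * f x)})"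
 proof (rule exI[of _ "%v x. (c * d * v) * f' x"], intro ballI conjI allI)
 fix x assume "x \<in> U"
 then have "(h has_real_derivative c * (d * f' x)) (at x)" unfolding h(2) by (intro DERIV_cmult) (use f' in blast)
 then have "(h has_derivative (*) (c * (d * f' x))) (at x)" by (simp only: has_field_derivative_def)
 moreover have "(*) (c * (d * f' x)) = (%v. (c * d * v) * f' x)" by (rule ext) (simp only: ac_simps)
 ultimately show "(h has_derivative (%v. (c * d * v) * f' x)) (at x)" by (simp only:)
 qed (use f' in blast)
qed (use f in \<open>auto intro!: exI[of _ 1]\<close>)

lemma smooth_on_inverse_real: "smooth_on (- {0}) (inverse :: real => real)"
proof (rule smooth_on_real_family[where F="range (%n x. inverse x ^ Suc n)"])
 show "inverse \<in> range (%n (x::real). inverse x ^ Suc n)" by (rule range_eqI[of _ _ 0]) simp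
 fix f :: "real => real" assume "f \<in> range (%n x. inverse x ^ Suc n)"
 then obtain n where n: "f = (%x. inverse x ^ Suc n)" by blast
 have "(f has_real_derivative - real (Suc n) * inverse x ^ Suc (Suc n)) (at x)" if "x ~= 0" for x
 unfolding n by (rule DERIV_cong[OF DERIV_power_Suc[OF DERIV_inverse[OF that]]]) (simp add: algebra_simps)
 then show "\<exists>f'\<in>range (%n x. inverse x ^ Suc n). EX c. \<forall>x\<in>- {0}. (f has_real_derivative c * f' x) (at x)"
 by (intro bexI[OF _ rangeI[of _ "Suc n"]] exI[of _ "- real (Suc n)"]) auto
qed (simp add: open_Compl)

lemma smooth_on_inverse:
 assumes "open U" "smooth_on U f" "!!x. x \<in> U ==> f x ~= 0"
 shows "smooth_on U (%x. inverse (f x :: real))"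
 by (rule smooth_on_compose[OF assms(1,2) smooth_on_inverse_real]) (use assms(3) in auto)

lemma smooth_on_divide:
 assumes "open U" "smooth_on U f" "smooth_on U g" "!!x. x \<in> U ==> g x ~= 0"
 shows "smooth_on U (%x. f x / (g x :: real))"
 unfolding divide_inverse by (intro smooth_on_mult smooth_on_inverse assms)

lemma smooth_on_sqrt_real: "smooth_on {0<..} sqrt"
proof (rule smooth_on_real_family[where F="range (%n x. sqrt x * inverse x ^ n)"])
 show "sqrt \<in> range (%n (x::real). sqrt x * inverse x ^ n)" by (rule range_eqI[of _ _ 0]) simp
 fix f :: "real => real" assume "f \<in> range (%n x. sqrt x * inverse x ^ n)"
 then obtain n where n: "f = (%x. sqrt x * inverse x ^ n)" by blast
 have "(f has_real_derivative (1/2 - real n) * (sqrt x * inverse x ^ Suc n)) (at x)" if "x > 0" for x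
 proof -
 have s: "inverse (sqrt x) = sqrt x * inverse x" using that by (simp add: field_simps real_sqrt_mult_self)
 have p: "real n * (inverse x ^ (n - Suc 0) * (inverse x * inverse x)) = real n * inverse x ^ Suc n"
 by (cases n) auto
 have "(f has_real_derivative (inverse (sqrt x) / 2) * inverse x ^ n + (real n * inverse x ^ (n - Suc 0) * (- (inverse x * inverse x))) * sqrt x) (at x)"
 unfolding n
 by (rule DERIV_mult'[THEN DERIV_cong, OF DERIV_real_sqrt[OF that] DERIV_power[OF DERIV_inverse]])
 (use that in \<open>auto simp: power2_eq_square algebra_simps\<close>)
 also have "(inverse (sqrt x) / 2) * inverse x ^ n + (real n * inverse x ^ (n - Suc 0) * (- (inverse x * inverse x))) * sqrt x
 = (1/2) * (sqrt x * inverse x ^ Suc n) - (real n * (inverse x ^ (n - Suc 0) * (inverse x * inverse x))) * sqrt x"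
 unfolding s by (simp add: algebra_simps)
 also have "... = (1/2 - real n) * (sqrt x * inverse x ^ Suc n)" unfolding p by (simp add: algebra_simps)
 finally show ?thesis .
 qed
 then show "\<exists>f'\<in>range (%n x. sqrt x * inverse x ^ n). EX c. \<forall>x\<in>{0<..}. (f has_real_derivative c * f' x) (at x)"
 by (intro bexI[OF _ rangeI[of _ "Suc n"]] exI[of _ "1/2 - real n"]) auto
qed simp

lemma smooth_on_sqrt:
 assumes "open U" "smooth_on U f" "!!x. x \<in> U ==> f x > 0"
 shows "smooth_on U (%x. sqrt (f x))"
 by (rule smooth_on_compose[OF assms(1,2) smooth_on_sqrt_real]) (use assms(3) in auto)

lemma smooth_on_id: "open U ==> smooth_on U (%x. x)"
 by (rule smooth_on_linear[OF bounded_linear_ident])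

lemma smooth_on_arctan:
 assumes "open U" "smooth_on U f" shows "smooth_on U (%x. arctan (f x))"
proof (rule smooth_on_compose[OF assms, where V=UNIV])
 have "(1::real) + x * x ~= 0" for x :: real by (smt (verit) zero_le_square)
 then have "smooth_on UNIV (%x::real. inverse (1 + x * x))"
 by (intro smooth_on_inverse smooth_on_add smooth_on_mult smooth_on_const smooth_on_id) auto
 then show "smooth_on UNIV arctan"
 by (rule smooth_on_realI[OF open_UNIV, rotated]) (simp add: DERIV_arctan power2_eq_square[symmetric])
qed auto

lemma has_derivative_affine: "bounded_linear A ==> ((%x. A x + b) has_derivative A) (at x within S)"
 using has_derivative_add[OF bounded_linear_imp_has_derivative has_derivative_const] by fastforce

lemma nderiv_affine:
 assumes A: "bounded_linear A" and V: "open V" and f: "smooth_on V f"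
 shows "A x + b \<in> V ==> nderiv vs (%x. f (A x + b)) x = nderiv (map A vs) f (A x + b)"
proof (induction vs arbitrary: x)
 case (Cons v vs)
 have op: "open ((%x. A x + b) -` V)"
 by (intro open_vimage V continuous_intros linear_continuous_on A)
 have "((%x. nderiv (map A vs) f (A x + b)) has_derivative (%v. nderiv (A v # map A vs) f (A x + b))) (at x)"
 using has_derivative_compose[of "%x. A x + b" A x UNIV "nderiv (map A vs) f", OF has_derivative_affine[OF A] has_derivative_nderiv[OF f Cons.prems]] .
 then have "(nderiv vs (%x. f (A x + b)) has_derivative (%v. nderiv (A v # map A vs) f (A x + b))) (at x)"
 by (rule has_derivative_transform_within_open[OF _ op]) (use Cons in auto)
 then show ?case by (simp add: frechet_derivative_at[symmetric])
qed simp

lemma smooth_on_affine: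
 assumes A: "bounded_linear A" and V: "open V" and f: "smooth_on V f"
 shows "smooth_on ((%x. A x + b) -` V) (%x. f (A x + b))"
proof (rule smooth_on_family[where F="range (%vs x. nderiv vs f (A x + b))"])
 show "open ((%x. A x + b) -` V)"
 by (intro open_vimage V continuous_intros linear_continuous_on A)
 show "(%x. f (A x + b)) \<in> range (%vs x. nderiv vs f (A x + b))" by (rule range_eqI[of _ _ "[]"]) simp
 fix h assume "h \<in> range (%vs x. nderiv vs f (A x + b))"
 then obtain vs where h: "h = (%x. nderiv vs f (A x + b))" by blast
 have "((%x. nderiv vs f (A x + b)) has_derivative (%v. nderiv (A v # vs) f (A x + b))) (at x)" if "A x + b \<in> V" for x
 using has_derivative_compose[of "%x. A x + b" A x UNIV "nderiv vs f", OF has_derivative_affine[OF A] has_derivative_nderiv[OF f that]] .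
 then show "EX f'. (\<forall>x\<in>(%x. A x + b) -` V. (h has_derivative (%v. f' v x)) (at x)) & (ALL v. f' v \<in> range (%vs x. nderiv vs f (A x + b)))"
 unfolding h by (intro exI[of _ "%v x. nderiv (A v # vs) f (A x + b)"] conjI ballI allI rangeI) auto
qed

section \<open>Evolution of the profile of a thin torus\<close>

text \<open>In the induction step the base is split into two square roots: one absorbs the factor
  \<open>m\<close> by Bernoulli's inequality, the other the remaining power.\<close>

lemma power_le_exponential:
 assumes "1 < thx" shows "\<exists>C\<ge>0. \<forall>m::nat. real m ^ j <= C * thx ^ m"
 using assms
proof (induction j arbitrary: thx)
 case 0 then show ?case by (intro exI[of _ 1]) simp
next
 case (Suc j)
 define phx where "phx = sqrt thx"
 have ph: "1 < phx" "phx * phx = thx" using Suc.prems by (auto simp: phx_def real_sqrt_gt_1_iff)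
 obtain C where C: "C >= 0" "!!m::nat. real m ^ j <= C * phx ^ m" using Suc.IH[OF ph(1)] by blast
 have "real m ^ Suc j <= C / (phx - 1) * thx ^ m" for m :: nat
 proof -
 have "1 + real m * (phx - 1) <= (1 + (phx - 1)) ^ m" by (rule Bernoulli_inequality) (use ph in simp)
 then have "real m <= phx ^ m / (phx - 1)" using ph by (simp add: field_simps)
 then have "real m * real m ^ j <= (phx ^ m / (phx - 1)) * (C * phx ^ m)"
 by (intro mult_mono C) (use ph in auto)
 also have "... = C / (phx - 1) * (phx * phx) ^ m" by (simp add: power_mult_distrib)
 finally show ?thesis unfolding ph(2) by simp
 qed
 then show ?case using C ph by (intro exI[of _ "C / (phx - 1)"]) auto
qed

section \<open>Termwise differentiation and smoothness of the solution\<close>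

lemma norm_Dpow: "norm (Dpow j n) = \<bar>of_int n\<bar> ^ j"
 by (simp add: Dpow_def norm_power norm_mult)

lemma Dpow_Suc: "Dpow (Suc j) n = \<i> * of_int n * Dpow j n" by (simp add: Dpow_def)
lemma Dpow_Suc_Suc: "Dpow (Suc (Suc j)) n = - (of_int n)\<^sup>2 * Dpow j n"
 by (simp add: Dpow_def power2_eq_square algebra_simps)

lemma summable_Dpow_coef: "(%n. norm (Dpow j n) * norm (coef x n)) summable_on UNIV"
proof -
 obtain C where C: "C >= 0" "!!m::nat. real m ^ j <= C * (1 + 1/4000) ^ m"
 using power_le_exponential[of "1 + 1/4000" j] by auto
 show ?thesis
 proof (rule summable_on_comparison_test)
 show "(%n. C * (wt n * norm (coef x n))) summable_on UNIV" by (rule summable_on_cmult_right[OF summable_coef])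
 fix n
 have "norm (Dpow j n) <= C * wt n" using C(2)[of "nat \<bar>n\<bar>"] by (simp add: norm_Dpow wt_def)
 then show "norm (Dpow j n) * norm (coef x n) <= C * (wt n * norm (coef x n))"
 using mult_right_mono[of "norm (Dpow j n)" "C * wt n" "norm (coef x n)"] by (simp add: mult.assoc)
 qed simp
qed

text \<open>The \<open>j\<close>-th space derivative of \<open>wev\<close>. The sum is enumerated by
  natural numbers so that theorems on termwise differentiation of series apply.\<close>

definition wdev :: "nat => wien => real => real => complex" where
 "wdev j x s t = (\<Sum>k. Dpow j (int_decode k) * apply_bcontfun (coef x (int_decode k)) t * cis (of_int (int_decode k) * s))"

lemma summable_Dpow_nat: "summable (%k. norm (Dpow j (int_decode k)) * norm (coef x (int_decode k)))"
 by (rule summable_on_imp_summable) (subst summable_on_reindex_bij_betw[OF bij_int_decode], rule summable_Dpow_coef)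

lemma summable_wdev: "summable (%k. Dpow j (int_decode k) * apply_bcontfun (coef x (int_decode k)) t * cis (of_int (int_decode k) * s))"
 by (rule summable_comparison_test'[OF summable_Dpow_nat[of j x], of 0])
 (simp add: norm_mult norm_apply_bcontfun_le mult_left_mono)

lemma wdev_0: "wdev 0 x s t = wev x s t"
proof -
 have "((%n. apply_bcontfun (coef x n) t * cis (of_int n * s)) has_sum wev x s t) UNIV"
 unfolding wev_def by (rule has_sum_infsum[OF wev_summable])
 then have "((%k. apply_bcontfun (coef x (int_decode k)) t * cis (of_int (int_decode k) * s)) has_sum wev x s t) UNIV"
 by (subst has_sum_reindex_bij_betw[OF bij_int_decode])
 from has_sum_imp_sums[OF this] show ?thesis unfolding wdev_def by (simp add: Dpow_def sums_iff)
qed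

lemma wdev_eq_wev:
 assumes "!!n. coef z n = tscale (Dpow j n) (coef x n)" shows "wdev j x s t = wev z s t"
 unfolding wdev_0[symmetric] unfolding wdev_def by (simp add: assms tscale.rep_eq Dpow_def)

lemma has_derivative_suminf:
 fixes f :: "nat => 'a::real_normed_vector => 'b::banach"
 assumes S: "convex S" and d: "!!n x. x \<in> S ==> (f n has_derivative f' n x) (at x within S)"
 and b: "!!n x h. x \<in> S ==> norm (f' n x h) <= b n * norm h" "summable b"
 and s: "!!x. x \<in> S ==> summable (%n. f n x)" and x: "x \<in> S"
 shows "((%x. \<Sum>n. f n x) has_derivative (%h. \<Sum>n. f' n x h)) (at x within S)"
proof -
 have sf': "summable (%n. f' n x h)" if "x \<in> S" for x h
 by (rule summable_comparison_test'[OF summable_mult2[OF b(2), of "norm h"], of 0]) (use b(1)[OF that] in simp)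
 have "\<forall>\<^sub>F n in sequentially. \<forall>x\<in>S. ALL h. norm (sum (%i. f' i x h) {..<n} - (\<Sum>i. f' i x h)) <= e * norm h"
 if e: "e > 0" for e
 proof -
 have "(%n. \<Sum>i. b (i + n)) ----> 0" using suminf_exist_split2[OF b(2)] .
 then have "\<forall>\<^sub>F n in sequentially. (\<Sum>i. b (i + n)) < e" using e by (rule order_tendstoD)
 then show ?thesis
 proof eventually_elim
 case (elim n)
 show ?case
 proof (intro ballI allI)
 fix x h assume x: "x \<in> S"
 have "norm (sum (%i. f' i x h) {..<n} - (\<Sum>i. f' i x h)) = norm (\<Sum>i. f' (i + n) x h)"
 using suminf_minus_initial_segment[OF sf'[OF x], of n h] by (simp add: norm_minus_commute)
 also have "... <= (\<Sum>i. b (i + n) * norm h)"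
 by (rule norm_suminf_le) (use b(1)[OF x] summable_mult2[OF summable_ignore_initial_segment[OF b(2)]] in auto)
 also have "... = (\<Sum>i. b (i + n)) * norm h" by (rule suminf_mult2[symmetric, OF summable_ignore_initial_segment[OF b(2)]])
 also have "... <= e * norm h" using elim by (intro mult_right_mono) auto
 finally show "norm (sum (%i. f' i x h) {..<n} - (\<Sum>i. f' i x h)) <= e * norm h" .
 qed
 qed
 qed
 from has_derivative_series[OF S d this x summable_sums[OF s[OF x]]]
 obtain g where g: "!!x. x \<in> S ==> (%n. f n x) sums g x" "(g has_derivative (%h. \<Sum>i. f' i x h)) (at x within S)"
 using x by blast
 show ?thesis by (rule has_derivative_transform[OF x _ g(2)]) (use g(1) in \<open>simp add: sums_iff\<close>)
qed

lemma cis_has_derivative: "((%s. cis (a * s)) has_vector_derivative (\<i> * of_real a * cis (a * s))) (at s within S)"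
proof -
 have "((%s. cis (a * s)) has_vector_derivative ((a * 1) *# (\<i> * cis (a * s)))) (at s within S)"
 unfolding has_vector_derivative_def
 by (auto intro!: derivative_eq_intros simp: algebra_simps scaleR_conv_of_real)
 then show ?thesis by (simp add: scaleR_conv_of_real algebra_simps)
qed

lemma wdev_deriv_s: "((%s. wdev j x s t) has_vector_derivative wdev (Suc j) x s t) (at s)"
proof -
 let ?f = "%k s. Dpow j (int_decode k) * apply_bcontfun (coef x (int_decode k)) t * cis (of_int (int_decode k) * s)"
 let ?f' = "%k s. Dpow (Suc j) (int_decode k) * apply_bcontfun (coef x (int_decode k)) t * cis (of_int (int_decode k) * s)"
 have "((%s. \<Sum>k. ?f k s) has_derivative (%h. \<Sum>k. h *# ?f' k s)) (at s within UNIV)"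
 proof (rule has_derivative_suminf[where b="%k. norm (Dpow (Suc j) (int_decode k)) * norm (coef x (int_decode k))"])
 fix k s
 show "(?f k has_derivative (%h. h *# ?f' k s)) (at s within UNIV)"
 using has_vector_derivative_mult_right[OF cis_has_derivative[of "of_int (int_decode k)" s UNIV], of "Dpow j (int_decode k) * apply_bcontfun (coef x (int_decode k)) t"]
 by (simp add: has_vector_derivative_def Dpow_Suc algebra_simps)
 fix h :: real
 show "norm (h *# ?f' k s) <= norm (Dpow (Suc j) (int_decode k)) * norm (coef x (int_decode k)) * norm h"
 using mult_right_mono[OF mult_left_mono[OF norm_apply_bcontfun_le[of "coef x (int_decode k)" t], of "norm (Dpow (Suc j) (int_decode k))"], of "\<bar>h\<bar>"]
 by (simp add: norm_mult algebra_simps)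
 qed (use summable_Dpow_nat summable_wdev in auto)
 moreover have "(\<Sum>k. h *# ?f' k s) = h *# wdev (Suc j) x s t" for h
 unfolding wdev_def by (rule suminf_scaleR_right[OF summable_wdev, symmetric])
 ultimately show ?thesis unfolding has_vector_derivative_def wdev_def[of j, abs_def] by simp
qed

text \<open>In each mode \<open>- n^2\<close> is the multiplier of two space derivatives, so the
  mode equations add up to the heat equation with source \<open>z\<close>. Space and time
  derivatives are treated together because smoothness requires the joint derivative.\<close>

lemma wdev_deriv:
 assumes T: "0 < T" and t: "0 < t" "t < T"
 and a: "!!n t. 0 < t ==> t < T ==> ((apply_bcontfun (coef x n)) has_vector_derivative
 (- (of_int n)\<^sup>2 * apply_bcontfun (coef x n) t + apply_bcontfun (coef z n) t)) (at t)"
 shows "((%(s,t). wdev j x s t) has_derivative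
 (%(h,k). of_real h * wdev (Suc j) x s t + of_real k * (wdev (Suc (Suc j)) x s t + wdev j z s t))) (at (s,t))"
proof -
 let ?N = int_decode
 let ?S = "UNIV \<times> {0<..<T} :: (real \<times> real) set"
 let ?f = "%k p. Dpow j (?N k) * apply_bcontfun (coef x (?N k)) (snd p) * cis (of_int (?N k) * fst p)"
 let ?g = "%i y k p. Dpow i (?N k) * apply_bcontfun (coef y (?N k)) (snd p) * cis (of_int (?N k) * fst p)"
 let ?f' = "%k p h. of_real (fst h) * ?g (Suc j) x k p + of_real (snd h) * (?g (Suc (Suc j)) x k p + ?g j z k p)"
 let ?b = "%k. norm (Dpow (Suc j) (?N k)) * norm (coef x (?N k)) + (norm (Dpow (Suc (Suc j)) (?N k)) * norm (coef x (?N k)) + norm (Dpow j (?N k)) * norm (coef z (?N k)))"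
 have st: "(s,t) \<in> ?S" using t by simp
 have "((%p. \<Sum>k. ?f k p) has_derivative (%h. \<Sum>k. ?f' k (s,t) h)) (at (s,t) within ?S)"
 proof (rule has_derivative_suminf[where b="?b" and S="?S" and x="(s,t)" and f'="?f'"])
 show "convex ?S" by (intro convex_Times) auto
 fix k and p :: "real \<times> real" assume p: "p \<in> ?S"
 have 1: "((%p. apply_bcontfun (coef x (?N k)) (snd p)) has_derivative
 (%h. snd h *# (- (of_int (?N k))\<^sup>2 * apply_bcontfun (coef x (?N k)) (snd p) + apply_bcontfun (coef z (?N k)) (snd p)))) (at p within ?S)"
 using p by (intro has_derivative_compose[of snd snd p ?S "apply_bcontfun (coef x (?N k))", OF _ a[unfolded has_vector_derivative_def]])
 (auto intro!: derivative_eq_intros)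
 have 2: "((%p. cis (of_int (?N k) * fst p)) has_derivative (%h. fst h *# (\<i> * of_real (of_int (?N k)) * cis (of_int (?N k) * fst p)))) (at p within ?S)"
 by (rule has_derivative_compose[of fst fst p ?S, OF _ cis_has_derivative[unfolded has_vector_derivative_def]])
 (auto intro!: derivative_eq_intros)
 have 3: "(?f k has_derivative (%h. Dpow j (?N k) * apply_bcontfun (coef x (?N k)) (snd p) * (fst h *# (\<i> * of_real (of_int (?N k)) * cis (of_int (?N k) * fst p)))
 + (Dpow j (?N k) * (snd h *# (- (of_int (?N k))\<^sup>2 * apply_bcontfun (coef x (?N k)) (snd p) + apply_bcontfun (coef z (?N k)) (snd p)))) * cis (of_int (?N k) * fst p))) (at p within ?S)"
 by (rule has_derivative_mult[OF has_derivative_mult_right[OF 1] 2])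
 have 4: "(%h. Dpow j (?N k) * apply_bcontfun (coef x (?N k)) (snd p) * (fst h *# (\<i> * of_real (of_int (?N k)) * cis (of_int (?N k) * fst p)))
 + (Dpow j (?N k) * (snd h *# (- (of_int (?N k))\<^sup>2 * apply_bcontfun (coef x (?N k)) (snd p) + apply_bcontfun (coef z (?N k)) (snd p)))) * cis (of_int (?N k) * fst p)) = ?f' k p"
 by (rule ext) (simp add: Dpow_Suc Dpow_Suc_Suc[unfolded Dpow_Suc] scaleR_conv_of_real algebra_simps power2_eq_square)
 show "(?f k has_derivative ?f' k p) (at p within ?S)" using 3 unfolding 4 .
 fix h :: "real \<times> real"
 have bd: "norm (?g i y k p) <= norm (Dpow i (?N k)) * norm (coef y (?N k))" for i y
 by (simp add: norm_mult mult_left_mono norm_apply_bcontfun_le)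
 have "norm (?f' k p h) <= \<bar>fst h\<bar> * norm (?g (Suc j) x k p) + \<bar>snd h\<bar> * (norm (?g (Suc (Suc j)) x k p) + norm (?g j z k p))"
 by (rule order_trans[OF norm_triangle_ineq])
 (simp only: norm_mult[of "of_real _"] norm_of_real, intro add_mono mult_left_mono norm_triangle_ineq order_refl abs_ge_zero)
 also have "... <= norm h * (norm (Dpow (Suc j) (?N k)) * norm (coef x (?N k))) + norm h * (norm (Dpow (Suc (Suc j)) (?N k)) * norm (coef x (?N k)) + norm (Dpow j (?N k)) * norm (coef z (?N k)))"
 using norm_fst_le[of "fst h" "snd h"] norm_snd_le[of "snd h" "fst h"]
 by (intro add_mono mult_mono bd) (auto intro!: add_nonneg_nonneg)
 finally show "norm (?f' k p h) <= ?b k * norm h" by (simp add: algebra_simps)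
 next
 show "summable ?b" by (intro summable_add summable_Dpow_nat)
 show "summable (%k. ?f k p)" for p by (rule summable_wdev)
 qed (use st in auto)
 moreover have "(%h. \<Sum>k. ?f' k (s,t) h) = (%(h,k). of_real h * wdev (Suc j) x s t + of_real k * (wdev (Suc (Suc j)) x s t + wdev j z s t))"
 proof (rule ext)
 fix h :: "real \<times> real"
 have sm: "summable (%k. ?g i y k (s,t))" for i y using summable_wdev by simp
 show "(\<Sum>k. ?f' k (s,t) h) = (case h of (h,k) => of_real h * wdev (Suc j) x s t + of_real k * (wdev (Suc (Suc j)) x s t + wdev j z s t))"
 unfolding wdev_def case_prod_unfold
 using suminf_add[OF summable_mult[OF sm] summable_mult[OF summable_add[OF sm sm]], symmetric]
 suminf_mult[OF sm] suminf_mult[OF summable_add[OF sm sm]] suminf_add[OF sm sm, symmetric]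
 by simp
 qed
 moreover have "(%p. \<Sum>k. ?f k p) = (%(s,t). wdev j x s t)" by (rule ext) (simp add: wdev_def case_prod_unfold)
 moreover have "at (s,t) within ?S = at (s,t)" by (rule at_within_open[OF st]) (intro open_Times; simp)
 ultimately show ?thesis by simp
qed

lemma continuous_wev: "continuous_on UNIV (%(s,t). wev x s t)"
proof -
 let ?f = "%k p. Dpow 0 (int_decode k) * apply_bcontfun (coef x (int_decode k)) (snd p) * cis (of_int (int_decode k) * fst p)"
 have u: "uniform_limit UNIV (%n p. \<Sum>k<n. ?f k p) (%p. \<Sum>k. ?f k p) sequentially"
 by (rule Weierstrass_m_test[OF _ summable_Dpow_nat[of 0 x]])
 (simp add: norm_mult norm_apply_bcontfun_le mult_left_mono)
 have "continuous_on UNIV (%p. \<Sum>k. ?f k p)"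
 by (rule uniform_limit_theorem[OF _ u])
 (auto intro!: always_eventually continuous_intros continuous_on_compose2[OF continuous_on_apply_bcontfun[of UNIV]])
 then show ?thesis by (simp add: wdev_0[symmetric] wdev_def case_prod_unfold)
qed

lemma norm_wev_le: "norm (wev x s t) <= norm x"
proof -
 have "norm (wev x s t) <= (\<Sum>\<^sub>\<infinity>n. norm (apply_bcontfun (coef x n) t * cis (of_int n * s)))"
 unfolding wev_def by (rule norm_infsum_bound) (simp add: norm_mult summable_norm_coef_apply)
 also have "... <= norm x" unfolding norm_wien_def
 proof (rule infsum_mono[OF _ summable_coef])
 show "(%n. norm (apply_bcontfun (coef x n) t * cis (of_int n * s))) summable_on UNIV" by (simp add: norm_mult summable_norm_coef_apply)
 fix n show "norm (apply_bcontfun (coef x n) t * cis (of_int n * s)) <= wt n * norm (coef x n)"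
 using mult_mono[OF wt_ge1[of n] norm_apply_bcontfun_le[of "coef x n" t]] wt_nonneg[of n] by (simp add: norm_mult)
 qed
 finally show ?thesis .
qed

text \<open>Expressions in all space derivatives of \<open>x\<close>. The time derivative of
  \<open>wdev j x\<close> is \<open>wdev (j + 2) x + wdev j z\<close>, and for the solution
  \<open>z\<close> is itself such an expression. Hence the family is closed under both derivatives,
  and its members are smooth in space-time.\<close>

inductive_set wfam :: "wien => (real \<times> real) set => (real \<times> real => complex) set" for x D where
 base: "(%p. wdev j x (fst p) (snd p)) \<in> wfam x D"
| const: "(%p. c) \<in> wfam x D"
| cos: "(%p. of_real (cos (fst p))) \<in> wfam x D"
| sin: "(%p. of_real (sin (fst p))) \<in> wfam x D"
| add: "h \<in> wfam x D ==> k \<in> wfam x D ==> (%p. h p + k p) \<in> wfam x D"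
| mult: "h \<in> wfam x D ==> k \<in> wfam x D ==> (%p. h p * k p) \<in> wfam x D"
| inv: "h \<in> wfam x D ==> (!!p. p \<in> D ==> h p ~= 0) ==> (%p. inverse (h p)) \<in> wfam x D"

lemma wfam_minus: "h \<in> wfam x D ==> (%p. - h p) \<in> wfam x D"
 using wfam.mult[OF wfam.const[of "-1"], of h] by simp

lemma has_vector_derivative_inverse_complex:
 assumes h: "(h has_vector_derivative h') (at s)" and nz: "h s ~= (0::complex)"
 shows "((%s. inverse (h s)) has_vector_derivative (- (h' * (inverse (h s) * inverse (h s))))) (at s)"
proof -
 have "((%s. inverse (h s)) has_derivative (%r. - (inverse (h s) * (r *# h') * inverse (h s)))) (at s)"
 by (rule Deriv.has_derivative_inverse[where f=h and x=s, OF nz]) (use h in \<open>simp add: has_vector_derivative_def\<close>)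
 then show ?thesis unfolding has_vector_derivative_def by (simp add: scaleR_conv_of_real algebra_simps)
qed

lemma wfam_deriv_s:
 assumes "h \<in> wfam x D"
 shows "\<exists>k\<in>wfam x D. ALL s t. (s,t) \<in> D --> ((%s. h (s,t)) has_vector_derivative k (s,t)) (at s)"
 using assms
proof induction
 case (base j)
 show ?case by (rule bexI[OF _ wfam.base[of "Suc j"]]) (simp add: wdev_deriv_s)
next
 case (const c) show ?case by (rule bexI[OF _ wfam.const[of 0]]) simp
next
 case cos
 have "((%s. complex_of_real (cos s)) has_vector_derivative of_real (- sin s)) (at s)" for s
 by (intro has_vector_derivative_of_real) (auto intro!: derivative_eq_intros simp: has_real_derivative_iff_has_vector_derivative[symmetric])
 then show ?case by (intro bexI[OF _ wfam_minus[OF wfam.sin]]) simp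
next
 case sin
 have "((%s. complex_of_real (sin s)) has_vector_derivative of_real (cos s)) (at s)" for s
 by (intro has_vector_derivative_of_real) (auto intro!: derivative_eq_intros simp: has_real_derivative_iff_has_vector_derivative[symmetric])
 then show ?case by (intro bexI[OF _ wfam.cos]) simp
next
 case (add h k)
 then obtain h1 k1 where "h1 \<in> wfam x D" "k1 \<in> wfam x D"
 "ALL s t. (s,t) \<in> D --> ((%s. h (s,t)) has_vector_derivative h1 (s,t)) (at s)"
 "ALL s t. (s,t) \<in> D --> ((%s. k (s,t)) has_vector_derivative k1 (s,t)) (at s)" by blast
 then show ?case by (intro bexI[OF _ wfam.add[of h1 _ _ k1]]) (auto intro!: has_vector_derivative_add)
next
 case (mult h k)
 then obtain h1 k1 where *: "h1 \<in> wfam x D" "k1 \<in> wfam x D"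
 "ALL s t. (s,t) \<in> D --> ((%s. h (s,t)) has_vector_derivative h1 (s,t)) (at s)"
 "ALL s t. (s,t) \<in> D --> ((%s. k (s,t)) has_vector_derivative k1 (s,t)) (at s)" by blast
 have "(%p. h p * k1 p + h1 p * k p) \<in> wfam x D" by (intro wfam.intros * mult.hyps)
 then show ?case by (rule bexI[rotated]) (use * in \<open>auto intro!: has_vector_derivative_mult\<close>)
next
 case (inv h)
 then obtain h1 where *: "h1 \<in> wfam x D"
 "ALL s t. (s,t) \<in> D --> ((%s. h (s,t)) has_vector_derivative h1 (s,t)) (at s)" by blast
 have "(%p. - (h1 p * (inverse (h p) * inverse (h p)))) \<in> wfam x D"
 by (intro wfam_minus wfam.mult * wfam.inv inv.hyps)
 then show ?case by (rule bexI[rotated]) (use * inv.hyps in \<open>auto intro!: has_vector_derivative_inverse_complex\<close>)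
qed

text \<open>The space derivatives of \<open>z\<close> agree with those of its expression by
  uniqueness of derivatives; this needs \<open>D\<close> to contain whole lines in the space
  direction.\<close>

lemma wfam_wdev:
 assumes h: "h \<in> wfam x D" and z: "!!s t. (s,t) \<in> D ==> wdev 0 z s t = h (s,t)"
 and D: "!!s t s'. (s,t) \<in> D ==> (s',t) \<in> D"
 shows "\<exists>h\<in>wfam x D. ALL s t. (s,t) \<in> D --> wdev j z s t = h (s,t)"
proof (induction j)
 case 0 show ?case using h z by blast
next
 case (Suc j)
 then obtain k where k: "k \<in> wfam x D" "!!s t. (s,t) \<in> D ==> wdev j z s t = k (s,t)" by blast
 obtain k1 where k1: "k1 \<in> wfam x D" "!!s t. (s,t) \<in> D ==> ((%s. k (s,t)) has_vector_derivative k1 (s,t)) (at s)"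
 using wfam_deriv_s[OF k(1)] by blast
 have "wdev (Suc j) z s t = k1 (s,t)" if st: "(s,t) \<in> D" for s t
 proof -
 have "(%s. wdev j z s t) = (%s. k (s,t))" using k(2) D[OF st] by blast
 then show ?thesis using k1(2)[OF st] wdev_deriv_s[of j z t s] by (metis vector_derivative_unique_at)
 qed
 then show ?case using k1(1) by blast
qed

lemma wfam_smooth:
 assumes T: "0 < T" and D: "D = UNIV \<times> {0<..<T}"
 and a: "!!n t. 0 < t ==> t < T ==> ((apply_bcontfun (coef x n)) has_vector_derivative
 (- (of_int n)\<^sup>2 * apply_bcontfun (coef x n) t + apply_bcontfun (coef z n) t)) (at t)"
 and z: "h0 \<in> wfam x D" "!!s t. (s,t) \<in> D ==> wdev 0 z s t = h0 (s,t)"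
 and h: "h \<in> wfam x D"
 shows "smooth_on D h"
proof (rule smooth_on_family[where F="wfam x D"])
 show "open D" unfolding D by (intro open_Times) auto
 have zj: "\<exists>k\<in>wfam x D. ALL s t. (s,t) \<in> D --> wdev j z s t = k (s,t)" for j
 by (rule wfam_wdev[OF z]) (auto simp: D)
 fix h assume "h \<in> wfam x D"
 then have "\<exists>h1\<in>wfam x D. \<exists>h2\<in>wfam x D. \<forall>p\<in>D. (h has_derivative (%v. of_real (fst v) * h1 p + of_real (snd v) * h2 p)) (at p)"
 proof induction
 case (base j)
 obtain k where k: "k \<in> wfam x D" "!!s t. (s,t) \<in> D ==> wdev j z s t = k (s,t)" using zj by blast
 have "((%p. wdev j x (fst p) (snd p)) has_derivative (%v. of_real (fst v) * wdev (Suc j) x (fst p) (snd p)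
 + of_real (snd v) * (wdev (Suc (Suc j)) x (fst p) (snd p) + k p))) (at p)" if "p \<in> D" for p
 using wdev_deriv[OF T _ _ a, of "snd p" j "fst p"] that k(2)[of "fst p" "snd p"] by (simp add: D case_prod_unfold mem_Times_iff)
 then show ?case
 by (intro bexI[OF _ wfam.base[of "Suc j"]] bexI[OF _ wfam.add[OF wfam.base[of "Suc (Suc j)"] k(1)]]) simp
 next
 case (const c)
 show ?case by (intro bexI[OF _ wfam.const[of 0]]) simp
 next
 case cos
 have "((%p. complex_of_real (cos (fst p))) has_derivative (%v. of_real (fst v) * - of_real (sin (fst p)) + of_real (snd v) * 0)) (at p)" for p :: "real \<times> real"
 by (auto intro!: derivative_eq_intros)
 then show ?case by (intro bexI[OF _ wfam_minus[OF wfam.sin]] bexI[OF _ wfam.const[of 0]]) simp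
 next
 case sin
 have "((%p. complex_of_real (sin (fst p))) has_derivative (%v. of_real (fst v) * of_real (cos (fst p)) + of_real (snd v) * 0)) (at p)" for p :: "real \<times> real"
 by (auto intro!: derivative_eq_intros)
 then show ?case by (intro bexI[OF _ wfam.cos] bexI[OF _ wfam.const[of 0]]) simp
 next
 case (add h k)
 then obtain h1 h2 k1 k2 where *: "h1 \<in> wfam x D" "h2 \<in> wfam x D" "k1 \<in> wfam x D" "k2 \<in> wfam x D"
 "!!p. p\<in>D ==> (h has_derivative (%v. of_real (fst v) * h1 p + of_real (snd v) * h2 p)) (at p)"
 "!!p. p\<in>D ==> (k has_derivative (%v. of_real (fst v) * k1 p + of_real (snd v) * k2 p)) (at p)" by blast
 have "((%p. h p + k p) has_derivative (%v. of_real (fst v) * (h1 p + k1 p) + of_real (snd v) * (h2 p + k2 p))) (at p)" if "p \<in> D" for p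
 by (rule has_derivative_eq_rhs[OF has_derivative_add[OF *(5,6)[OF that]]]) (simp add: fun_eq_iff algebra_simps)
 then show ?case by (intro bexI[OF _ wfam.add[OF *(1,3)]] bexI[OF _ wfam.add[OF *(2,4)]]) simp
 next
 case (mult h k)
 then obtain h1 h2 k1 k2 where *: "h1 \<in> wfam x D" "h2 \<in> wfam x D" "k1 \<in> wfam x D" "k2 \<in> wfam x D"
 "!!p. p\<in>D ==> (h has_derivative (%v. of_real (fst v) * h1 p + of_real (snd v) * h2 p)) (at p)"
 "!!p. p\<in>D ==> (k has_derivative (%v. of_real (fst v) * k1 p + of_real (snd v) * k2 p)) (at p)" by blast
 have "((%p. h p * k p) has_derivative (%v. of_real (fst v) * (h p * k1 p + h1 p * k p) + of_real (snd v) * (h p * k2 p + h2 p * k p))) (at p)" if "p \<in> D" for p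
 by (rule has_derivative_eq_rhs[OF has_derivative_mult[OF *(5,6)[OF that]]]) (simp add: fun_eq_iff algebra_simps)
 then show ?case
 by (intro bexI[OF _ wfam.add[OF wfam.mult[OF mult.hyps(1) *(3)] wfam.mult[OF *(1) mult.hyps(2)]]]
 bexI[OF _ wfam.add[OF wfam.mult[OF mult.hyps(1) *(4)] wfam.mult[OF *(2) mult.hyps(2)]]]) simp
 next
 case (inv h)
 then obtain h1 h2 where *: "h1 \<in> wfam x D" "h2 \<in> wfam x D"
 "!!p. p\<in>D ==> (h has_derivative (%v. of_real (fst v) * h1 p + of_real (snd v) * h2 p)) (at p)" by blast
 have "((%p. inverse (h p)) has_derivative (%v. of_real (fst v) * - (h1 p * (inverse (h p) * inverse (h p))) + of_real (snd v) * - (h2 p * (inverse (h p) * inverse (h p))))) (at p)" if "p \<in> D" for p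
 by (rule has_derivative_eq_rhs[OF Deriv.has_derivative_inverse[where f=h and x=p, OF inv.hyps(2)[OF that] *(3)[OF that]]]) (simp add: fun_eq_iff algebra_simps)
 moreover note ih = wfam.mult[OF wfam.inv[OF inv.hyps] wfam.inv[OF inv.hyps]]
 ultimately show ?case
 by (intro bexI[OF _ wfam_minus[OF wfam.mult[OF *(1) ih]]] bexI[OF _ wfam_minus[OF wfam.mult[OF *(2) ih]]]) simp
 qed
 then obtain h1 h2 where *: "h1 \<in> wfam x D" "h2 \<in> wfam x D"
 "!!p. p\<in>D ==> (h has_derivative (%v. of_real (fst v) * h1 p + of_real (snd v) * h2 p)) (at p)" by blast
 show "EX f'. (\<forall>p\<in>D. (h has_derivative (%v. f' v p)) (at p)) & (ALL v. f' v \<in> wfam x D)"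
 by (intro exI[of _ "%v p. of_real (fst v) * h1 p + of_real (snd v) * h2 p"] conjI ballI allI wfam.intros *)
qed (rule h)

lemma wev_minus: "wev (- x) s t = - wev x s t"
 using wev_scaleR[of "-1" x s t] by simp

lemma wev_diff: "wev (x - y) s t = wev x s t - wev y s t"
 using wev_add[of x "- y" s t] by (simp add: wev_minus)

lemmas wev_simps = wev_add wev_minus wev_diff wev_scaleR wev_mult wev_elems

lemma duhamel_deriv:
 assumes "0 < t" "t < T"
 shows "(apply_bcontfun (duhamel T n f) has_vector_derivative
 (- (of_int n)\<^sup>2 * apply_bcontfun (duhamel T n f) t + apply_bcontfun f t)) (at t)"
proof -
 have c: "clip \<bar>T\<bar> r = r" if "r \<in> {0<..<T}" for r using that by (simp add: clip_def)
 have "(heat_conv ((of_int n)\<^sup>2) (apply_bcontfun f) has_vector_derivative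
 (- of_real ((of_int n)\<^sup>2) * heat_conv ((of_int n)\<^sup>2) (apply_bcontfun f) t + apply_bcontfun f t)) (at t within {0..T})"
 by (rule heat_conv_deriv) (use assms in auto)
 then have "(heat_conv ((of_int n)\<^sup>2) (apply_bcontfun f) has_vector_derivative
 (- of_real ((of_int n)\<^sup>2) * heat_conv ((of_int n)\<^sup>2) (apply_bcontfun f) t + apply_bcontfun f t)) (at t)"
 using assms by (subst (asm) at_within_interior) auto
 then have "(apply_bcontfun (duhamel T n f) has_vector_derivative
 (- of_real ((of_int n)\<^sup>2) * heat_conv ((of_int n)\<^sup>2) (apply_bcontfun f) t + apply_bcontfun f t)) (at t)"
 by (rule has_vector_derivative_transform_within_open[of _ _ _ "{0<..<T}"])
 (use assms c in \<open>auto simp: duhamel.rep_eq\<close>)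
 then show ?thesis using c[of t] assms by (simp add: duhamel.rep_eq)
qed

lemma tdecay_deriv:
 assumes "0 < t" "0 <= a"
 shows "(apply_bcontfun (tscale z (tdecay a)) has_vector_derivative
 (- of_real a * apply_bcontfun (tscale z (tdecay a)) t)) (at t)"
proof -
 have "((%t. complex_of_real (exp (- a * t))) has_vector_derivative of_real (- a * exp (- a * t))) (at t)"
 by (intro has_vector_derivative_of_real) (auto intro!: derivative_eq_intros simp: has_real_derivative_iff_has_vector_derivative[symmetric])
 from has_vector_derivative_mult_right[OF this, of z]
 have "((%t. z * complex_of_real (exp (- a * t))) has_vector_derivative z * of_real (- a * exp (- a * t))) (at t)" .
 then have "(apply_bcontfun (tscale z (tdecay a)) has_vector_derivative z * of_real (- a * exp (- a * t))) (at t)"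
 by (rule has_vector_derivative_transform_within_open[of _ _ _ "{0<..}"])
 (use assms in \<open>auto simp: tscale.rep_eq tdecay.rep_eq\<close>)
 then show ?thesis using assms by (simp add: tscale.rep_eq tdecay.rep_eq algebra_simps)
qed

lemma coef_ylin: "coef (ylin c j) n = (if n = 4000 then tscale (Dpow j n * c) (tdecay (4000\<^sup>2))
 else if n = - 4000 then tscale (Dpow j n * cnj c) (tdecay (4000\<^sup>2)) else 0)"
 by (simp add: ylin_def plus_wien.rep_eq coef_mono)

lemma coef_profile_deriv:
 assumes T: "0 < t" "t < T"
 shows "(apply_bcontfun (coef (ylin c 0 + heat_op T 0 z) n) has_vector_derivative
 (- (of_int n)\<^sup>2 * apply_bcontfun (coef (ylin c 0 + heat_op T 0 z) n) t + apply_bcontfun (coef z n) t)) (at t)"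
proof -
 have D0: "Dpow 0 n = 1" for n by (simp add: Dpow_def)
 have t1: "tscale 1 f = f" for f by (rule bcontfun_eqI) (simp add: tscale.rep_eq)
 have co: "coef (ylin c 0 + heat_op T 0 z) n = coef (ylin c 0) n + duhamel T n (coef z n)"
 using T by (simp add: plus_wien.rep_eq coef_heat_op D0 t1)
 have "(apply_bcontfun (coef (ylin c 0) n) has_vector_derivative (- (of_int n)\<^sup>2 * apply_bcontfun (coef (ylin c 0) n) t)) (at t)"
 proof (cases "n = 4000 | n = - 4000")
 case True
 then have "complex_of_real (4000\<^sup>2) = (of_int n)\<^sup>2" by auto
 then show ?thesis using True tdecay_deriv[OF T(1), of "4000\<^sup>2"] by (auto simp: coef_ylin)
 next
 case False
 have "apply_bcontfun (0 :: tfun) = (%_. 0)" by (rule ext) (simp add: zero_bcontfun.rep_eq)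
 then show ?thesis using False by (simp add: coef_ylin)
 qed
 from has_vector_derivative_add[OF this duhamel_deriv[OF T, of n "coef z n"]]
 show ?thesis unfolding co by (simp add: plus_bcontfun.rep_eq[abs_def] algebra_simps)
qed

lemma coef_profile_Dpow:
 assumes "0 <= T" "j <= 2"
 shows "coef (ylin c j + heat_op T j z) n = tscale (Dpow j n) (coef (ylin c 0 + heat_op T 0 z) n)"
proof (rule bcontfun_eqI)
 fix t
 have D: "Dpow 0 m = 1" for m by (simp add: Dpow_def)
 show "apply_bcontfun (coef (ylin c j + heat_op T j z) n) t = apply_bcontfun (tscale (Dpow j n) (coef (ylin c 0 + heat_op T 0 z) n)) t"
 using assms by (simp add: plus_wien.rep_eq coef_heat_op coef_ylin tscale.rep_eq plus_bcontfun.rep_eq zero_bcontfun.rep_eq algebra_simps D)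
qed

lemma smooth_on_Re: "open U ==> smooth_on U h ==> smooth_on U (%p. Re (h p))"
 by (rule smooth_on_compose[where V=UNIV, OF _ _ smooth_on_linear[OF bounded_linear_Re open_UNIV]]) auto

lemma has_vector_derivative_Re: "(h has_vector_derivative D) F ==> ((%t. Re (h t)) has_vector_derivative Re D) F"
 by (rule bounded_linear.has_vector_derivative[OF bounded_linear_Re])

lemma wev_real: "wcnj x = x ==> wev x s t = of_real (Re (wev x s t))"
 using wev_cnj[of x s t] by (auto simp: complex_eq_iff)

text \<open>Rotationally symmetric mean curvature flow of a thin torus: \<open>q\<close> is the reciprocal of the
 radial distance of the profile curve, as a function of the polar angle around the core, and
 \<open>\<kappa>\<close> is the reciprocal of the core radius.\<close>
theorem profile_evolution:
 assumes ka: "0 <= ka" "ka <= 1/1000" and b: "0 <= b" "b <= 1"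
 obtains T :: real and q q1 q2 :: "real => real => real" where "0 < T"
 "smooth_on (UNIV \<times> {0<..<T}) (%(s,t). q s t)"
 "continuous_on UNIV (%(s,t). q s t)" "continuous_on UNIV (%(s,t). q1 s t)" "continuous_on UNIV (%(s,t). q2 s t)"
 "!!s t. q (s + 2 * pi) t = q s t" "!!s t. 1/2 <= q s t & q s t <= 2"
 "!!s. q s 0 = 1 + (1 + b) / (4000\<^sup>2 - 1) * cos (4000 * (s - s0))"
 "!!s. q1 s 0 = - 4000 * (1 + b) / (4000\<^sup>2 - 1) * sin (4000 * (s - s0))"
 "!!s. q2 s 0 = - 4000\<^sup>2 * (1 + b) / (4000\<^sup>2 - 1) * cos (4000 * (s - s0))"
 "!!s t. ((%s. q s t) has_real_derivative q1 s t) (at s)" "!!s t. ((%s. q1 s t) has_real_derivative q2 s t) (at s)"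
 "!!s t. 0 < t ==> t < T ==> ((%t. q s t) has_real_derivative
 (q s t ^ 4 * (q s t + q2 s t) / ((q s t)\<^sup>2 + (q1 s t)\<^sup>2)
 + ka * (q s t)\<^sup>2 * (q s t * cos s - q1 s t * sin s) / (q s t + ka * cos s))) (at t)"
proof -
 \<comment> \<open>With this amplitude \<open>q + q2 = 1 + e - 4000^2 * e = - b\<close> at
   \<open>s0\<close> and time 0, so the curvature of the profile has the reversed sign there.
   \<open>c\<close> carries half of the amplitude because \<open>ylin\<close> adds the conjugate
   mode.\<close>
 define e where "e = (1 + b) / (4000\<^sup>2 - 1)"
 define c where "c = of_real (e / 2) * cis (- (4000 * s0))"
 have "norm c <= 1 / (4000\<^sup>2 - 1)"
 using b unfolding c_def norm_mult norm_of_real norm_cis by (simp add: e_def)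
 then obtain T u where u: "0 < T" "pde_map c ka T u = u" "smallv (pvec c T u)"
 "wcnj (fst u) = fst u" "wcnj (fst (snd u)) = fst (snd u)" "wcnj (snd (snd u)) = snd (snd u)"
 using pde_fixpoint[OF ka, of c] by blast
 define v where "v = pvec c T u"
 define z where "z = fst u"
 define x where "x = ylin c 0 + heat_op T 0 z"
 define y' where "y' = ylin c 1 + heat_op T 1 z"
 define y'' where "y'' = ylin c 2 + heat_op T 2 z"
 have T0: "0 <= T" using u(1) by simp
 have pv: "py v = x" "py' v = y'" "pp v = fst (snd u)" "pg v = snd (snd u)"
 by (simp_all add: v_def pvec_def py_def py'_def pp_def pg_def x_def y'_def z_def)
 have fx: "z = lead v \<star> y'' + lower ka v" "pp v = - (den1 v + den1 v \<star> pp v)" "pg v = - (den2 ka v + den2 ka v \<star> pg v)"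
 using u(2) unfolding pv by (simp_all add: pde_map_def v_def z_def y''_def prod_eq_iff)
 have rl: "wcnj x = x" "wcnj y' = y'" "wcnj y'' = y''"
 using T0 by (simp_all add: x_def y'_def y''_def z_def wcnj_add wcnj_ylin wcnj_heat_op u)
 have w1: "wdev 1 x s t = wev y' s t" for s t
 unfolding y'_def x_def by (rule wdev_eq_wev) (rule coef_profile_Dpow[OF T0], simp)
 have w2: "wdev 2 x s t = wev y'' s t" for s t
 unfolding y''_def x_def by (rule wdev_eq_wev) (rule coef_profile_Dpow[OF T0], simp)
 define qc where "qc s t = 1 + wev x s t" for s t
 have e2: "1 + wev (sq2 v) s t = qc s t * qc s t" for s t
 by (simp add: sq2_def pv wev_simps qc_def algebra_simps)
 have e4: "1 + wev (sq4 v) s t = qc s t ^ 4" for s t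
 proof -
 have "1 + wev (sq4 v) s t = (1 + wev (sq2 v) s t) * (1 + wev (sq2 v) s t)" by (simp add: sq4_def wev_simps algebra_simps)
 then show ?thesis unfolding e2 by (simp add: power4_eq_xxxx mult.assoc)
 qed
 define dc where "dc s t = qc s t * qc s t + wev y' s t * wev y' s t" for s t
 define gc where "gc s t = qc s t + of_real ka * of_real (cos s)" for s t
 \<comment> \<open>The second fixed point equation says exactly that \<open>1 + pp\<close> is the
   reciprocal of \<open>q^2 + q'^2\<close>; likewise the third for \<open>pg\<close>.\<close>
 have d1: "dc s t * (1 + wev (pp v) s t) = 1" for s t
 proof -
 have "dc s t = 1 + wev (den1 v) s t" using e2[of s t] by (simp add: dc_def den1_def wev_simps pv algebra_simps)
 moreover have "wev (pp v) s t = - (wev (den1 v) s t + wev (den1 v) s t * wev (pp v) s t)"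
 using arg_cong[OF fx(2), of "%a. wev a s t"] by (simp add: wev_simps)
 then have "(1 + wev (den1 v) s t) * (1 + wev (pp v) s t) = 1" by (simp add: algebra_simps)
 ultimately show ?thesis by simp
 qed
 have d2: "gc s t * (1 + wev (pg v) s t) = 1" for s t
 proof -
 have "gc s t = 1 + wev (den2 ka v) s t" by (simp add: gc_def den2_def wev_simps pv qc_def algebra_simps)
 moreover have "wev (pg v) s t = - (wev (den2 ka v) s t + wev (den2 ka v) s t * wev (pg v) s t)"
 using arg_cong[OF fx(3), of "%a. wev a s t"] by (simp add: wev_simps)
 then have "(1 + wev (den2 ka v) s t) * (1 + wev (pg v) s t) = 1" by (simp add: algebra_simps)
 ultimately show ?thesis by simp
 qed
 have nz: "dc s t ~= 0" "gc s t ~= 0" for s t using d1[of s t] d2[of s t] by auto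
 have inv: "1 + wev (pp v) s t = inverse (dc s t)" "1 + wev (pg v) s t = inverse (gc s t)" for s t
 using d1[of s t] d2[of s t] by (metis inverse_unique)+
 have zev: "wev z s t = (inverse (dc s t) * qc s t ^ 4 - 1) * wev y'' s t + (inverse (dc s t) * qc s t ^ 4 * qc s t
 + of_real ka * (qc s t * qc s t * inverse (gc s t) * (qc s t * of_real (cos s) - wev y' s t * of_real (sin s))))" for s t
 proof -
 have "wev (lead v) s t = (1 + wev (pp v) s t) * (1 + wev (sq4 v) s t) - 1" by (simp add: lead_def wev_simps algebra_simps)
 moreover have "wev (lower ka v) s t = ((1 + wev (pp v) s t) * (1 + wev (sq4 v) s t)) * qc s t
 + of_real ka * (((1 + wev (sq2 v) s t) * (1 + wev (pg v) s t)) * (qc s t * of_real (cos s) - wev y' s t * of_real (sin s)))"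
 by (simp add: lower_def wev_simps pv qc_def)
 ultimately show ?thesis
 using arg_cong[OF fx(1), of "%a. wev a s t"] by (simp add: wev_simps e4 e2 inv)
 qed
 define D where "D = (UNIV :: real set) \<times> {0<..<T}"
 let ?Y = "%p. wdev 0 x (fst p) (snd p)" and ?Y1 = "%p. wdev 1 x (fst p) (snd p)" and ?Y2 = "%p. wdev 2 x (fst p) (snd p)"
 define Q where "Q p = 1 + wdev 0 x (fst p) (snd p)" for p
 have QF: "Q \<in> wfam x D" unfolding Q_def[abs_def] by (intro wfam.intros)
 have Qq: "Q (s,t) = qc s t" for s t by (simp add: Q_def qc_def wdev_0)
 define P where "P p = inverse (Q p * Q p + ?Y1 p * ?Y1 p)" for p
 have PF: "P \<in> wfam x D" unfolding P_def[abs_def]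
 by (intro wfam.inv wfam.add wfam.mult QF wfam.base) (use nz(1) in \<open>auto simp: dc_def Qq w1[unfolded One_nat_def]\<close>)
 define G where "G p = inverse (Q p + of_real ka * of_real (cos (fst p)))" for p
 have GF: "G \<in> wfam x D" unfolding G_def[abs_def]
 by (intro wfam.inv wfam.add wfam.mult QF wfam.const wfam.cos) (use nz(2) in \<open>auto simp: gc_def Qq\<close>)
 define h0 where "h0 p = (P p * (Q p * (Q p * (Q p * Q p))) + (-1)) * ?Y2 p + (P p * (Q p * (Q p * (Q p * Q p))) * Q p
 + of_real ka * (Q p * Q p * G p * (Q p * of_real (cos (fst p)) + - (?Y1 p * of_real (sin (fst p))))))" for p
 have h0F: "h0 \<in> wfam x D" unfolding h0_def[abs_def]
 by (intro wfam.add wfam.mult wfam_minus QF PF GF wfam.const wfam.cos wfam.sin wfam.base)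
 have h0: "wdev 0 z s t = h0 (s,t)" for s t
 unfolding wdev_0 zev h0_def by (simp add: P_def G_def Qq w1[unfolded One_nat_def] w2 dc_def gc_def power4_eq_xxxx mult.assoc)
 have a: "((apply_bcontfun (coef x n)) has_vector_derivative
 (- (of_int n)\<^sup>2 * apply_bcontfun (coef x n) t + apply_bcontfun (coef z n) t)) (at t)" if "0 < t" "t < T" for n t
 unfolding x_def by (rule coef_profile_deriv[OF that])
 have sm: "smooth_on D Q"
 by (rule wfam_smooth[OF u(1) D_def a h0F h0 QF])
 have oD: "open D" unfolding D_def by (intro open_Times) auto
 define q where "q s t = 1 + Re (wev x s t)" for s t
 define q1 where "q1 s t = Re (wev y' s t)" for s t
 define q2 where "q2 s t = Re (wev y'' s t)" for s t
 have qc: "qc s t = of_real (q s t)" "wev y' s t = of_real (q1 s t)" "wev y'' s t = of_real (q2 s t)" for s t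
 using wev_real[OF rl(1), of s t] wev_real[OF rl(2), of s t] wev_real[OF rl(3), of s t] by (simp_all add: qc_def q_def q1_def q2_def)
 show ?thesis
 proof (rule that[of T q q1 q2, OF u(1)])
 have "(%(s,t). q s t) = (%p. Re (Q p))" by (rule ext) (simp add: q_def Q_def wdev_0 case_prod_unfold)
 then show "smooth_on (UNIV \<times> {0<..<T}) (%(s,t). q s t)"
 using smooth_on_Re[OF oD sm] unfolding D_def by simp
 show "continuous_on UNIV (%(s,t). q s t)" "continuous_on UNIV (%(s,t). q1 s t)" "continuous_on UNIV (%(s,t). q2 s t)"
 unfolding q_def q1_def q2_def case_prod_unfold
 using continuous_wev[of x] continuous_wev[of y'] continuous_wev[of y'']
 by (auto intro!: continuous_intros simp: case_prod_unfold)
 have "cis (of_int n * (s + 2 * pi)) = cis (of_int n * s)" for n :: int and s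
 proof -
 have "cis (of_int n * (s + 2 * pi)) = cis (of_int n * s) * cis (2 * pi * of_int n)" by (simp add: cis_mult algebra_simps)
 then show ?thesis by (simp add: cis_multiple_2pi)
 qed
 then show "q (s + 2 * pi) t = q s t" for s t by (simp add: q_def wev_def)
 have "norm x <= 1/240" using u(3) by (simp add: smallv_def v_def[symmetric] pv)
 then have "norm (wev x s t) <= 1/240" for s t
 using norm_wev_le[of x s t] by linarith
 then have "\<bar>Re (wev x s t)\<bar> <= 1/240" for s t using abs_Re_le_cmod order_trans by blast
 then have rb: "Re (wev x s t) <= 1/240" "- Re (wev x s t) <= 1/240" for s t unfolding abs_le_iff by auto
 show "1/2 <= q s t & q s t <= 2" for s t unfolding q_def using rb[where s=s and t=t] by simp
 have i0: "wev (ylin c j + heat_op T j z) s 0 = Dpow j 4000 * c * cis (4000 * s) + Dpow j (- 4000) * cnj c * cis (- (4000 * s))" if "j <= 2" for j s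
 proof -
 have "apply_bcontfun (coef (heat_op T j z) n) 0 = 0" for n
 using that T0 by (simp add: coef_heat_op tscale.rep_eq duhamel.rep_eq clip_def heat_conv_def)
 then have "wev (heat_op T j z) s 0 = 0" by (simp add: wev_def)
 then show ?thesis by (simp add: wev_add ylin_def wev_mono tscale.rep_eq tdecay.rep_eq)
 qed
 define th where "th s = 4000 * (s - s0)" for s
 have cc: "c * cis (4000 * s) = of_real (e/2) * cis (th s)" "cnj c * cis (- (4000 * s)) = of_real (e/2) * cis (- th s)" for s
 by (simp_all add: c_def th_def cis_cnj cis_mult mult.assoc algebra_simps)
 have Dp: "Dpow 0 m = 1" "Dpow 1 m = \<i> * of_int m" "Dpow 2 m = - ((of_int m)\<^sup>2)" for m by (simp_all add: Dpow_def power_mult_distrib)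
 have "q s 0 = 1 + e * cos (th s)" for s
 using i0[of 0 s] unfolding q_def x_def by (simp add: Dp cc)
 then show "q s 0 = 1 + (1 + b) / (4000\<^sup>2 - 1) * cos (4000 * (s - s0))" for s by (simp only: e_def th_def)
 have "q1 s 0 = - 4000 * e * sin (th s)" for s
 using i0[of 1 s] unfolding q1_def y'_def Dp by (simp add: mult.assoc cc)
 then show "q1 s 0 = - 4000 * (1 + b) / (4000\<^sup>2 - 1) * sin (4000 * (s - s0))" for s by (simp add: e_def th_def)
 have "q2 s 0 = - (4000\<^sup>2) * e * cos (th s)" for s
 using i0[of 2 s] unfolding q2_def y''_def Dp by (simp add: mult.assoc cc)
 then show "q2 s 0 = - 4000\<^sup>2 * (1 + b) / (4000\<^sup>2 - 1) * cos (4000 * (s - s0))" for s by (simp add: e_def th_def)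
 show "((%s. q s t) has_real_derivative q1 s t) (at s)" for s t
 using has_vector_derivative_Re[OF wdev_deriv_s[of 0 x t s]]
 unfolding q_def q1_def by (auto simp: wdev_0 w1[unfolded One_nat_def] has_real_derivative_iff_has_vector_derivative intro!: derivative_eq_intros)
 show "((%s. q1 s t) has_real_derivative q2 s t) (at s)" for s t
 using has_vector_derivative_Re[OF wdev_deriv_s[of 1 x t s]]
 unfolding q1_def q2_def by (simp add: w1[unfolded One_nat_def] w2[unfolded numeral_2_eq_2] has_real_derivative_iff_has_vector_derivative)
 fix s t assume t: "0 < t" "t < T"
 have "((%(s,t). wdev 0 x s t) has_derivative (%(h,k). of_real h * wdev (Suc 0) x s t + of_real k * (wdev (Suc (Suc 0)) x s t + wdev 0 z s t))) (at (s,t))"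
 by (rule wdev_deriv[OF u(1) t a])
 moreover have "((%t. (s,t)) has_derivative (%k. (0,k))) (at t)" by (auto intro!: derivative_eq_intros)
 ultimately have "((%t. (%(s,t). wdev 0 x s t) (s,t)) has_derivative
 (%k. (%(h,k). of_real h * wdev (Suc 0) x s t + of_real k * (wdev (Suc (Suc 0)) x s t + wdev 0 z s t)) (0,k))) (at t)"
 using has_derivative_compose[of "%t. (s,t)" "%k. (0,k)" t UNIV "%(s,t). wdev 0 x s t"] by blast
 then have "((%t. wdev 0 x s t) has_vector_derivative (wdev (Suc (Suc 0)) x s t + wdev 0 z s t)) (at t)"
 by (simp add: has_vector_derivative_def scaleR_conv_of_real)
 from has_vector_derivative_add[OF has_vector_derivative_const has_vector_derivative_Re[OF this], of 1]
 have "((%t. q s t) has_real_derivative Re (wev y'' s t + wev z s t)) (at t)"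
 unfolding q_def has_real_derivative_iff_has_vector_derivative wdev_0 w2[unfolded numeral_2_eq_2] add_0_left .
 \<comment> \<open>Adding the \<open>y''\<close> of the heat equation cancels the \<open>- 1\<close>
   in \<open>lead\<close> and restores the full leading coefficient.\<close>
 moreover have "wev y'' s t + wev z s t = of_real (q s t ^ 4 * (q s t + q2 s t) / ((q s t)\<^sup>2 + (q1 s t)\<^sup>2)
 + ka * (q s t)\<^sup>2 * (q s t * cos s - q1 s t * sin s) / (q s t + ka * cos s))"
 proof -
 let ?d = "inverse (q s t * q s t + q1 s t * q1 s t)"
 have "wev y'' s t + wev z s t = of_real (q2 s t + ((?d * q s t ^ 4 - 1) * q2 s t + (?d * q s t ^ 4 * q s t
 + ka * (q s t * q s t * inverse (q s t + ka * cos s) * (q s t * cos s - q1 s t * sin s)))))"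
 unfolding zev dc_def gc_def qc by simp
 also have "q2 s t + ((?d * q s t ^ 4 - 1) * q2 s t + (?d * q s t ^ 4 * q s t
 + ka * (q s t * q s t * inverse (q s t + ka * cos s) * (q s t * cos s - q1 s t * sin s))))
 = q s t ^ 4 * (q s t + q2 s t) / ((q s t)\<^sup>2 + (q1 s t)\<^sup>2)
 + ka * (q s t)\<^sup>2 * (q s t * cos s - q1 s t * sin s) / (q s t + ka * cos s)"
 unfolding divide_inverse power2_eq_square by (simp add: algebra_simps)
 finally show ?thesis .
 qed
 ultimately show "((%t. q s t) has_real_derivative (q s t ^ 4 * (q s t + q2 s t) / ((q s t)\<^sup>2 + (q1 s t)\<^sup>2)
 + ka * (q s t)\<^sup>2 * (q s t * cos s - q1 s t * sin s) / (q s t + ka * cos s))) (at t)" by (simp only: Re_complex_of_real)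
 qed
qed

section \<open>Gradients, curves and symmetry of second derivatives\<close>

lemma gradient_eq:
 fixes f :: "'a::euclidean_space => real"
 assumes "(f has_derivative D) (at x)" shows "gradient f x *. v = D v"
proof -
 interpret bounded_linear D using assms by (rule has_derivative_bounded_linear)
 let ?g = "\<Sum>b\<in>Basis. D b *# b"
 have e: "D v = v *. ?g" for v
 proof -
 have "D v = D (\<Sum>b\<in>Basis. (v *. b) *# b)" by (simp only: euclidean_representation)
 also have "... = (\<Sum>b\<in>Basis. (v *. b) * D b)" unfolding sum scaleR by simp
 finally show ?thesis by (simp add: inner_sum_right mult.commute)
 qed
 have "gradient f x = ?g" unfolding gradient_def
 proof (rule the_equality)
 have "(%h. h *. ?g) = D" by (rule ext) (rule e[symmetric])
 then show "GDERIV f x :> ?g" unfolding gderiv_def using assms by (simp only:)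
 fix d assume "GDERIV f x :> d"
 then have "(%h. h *. d) = D" unfolding gderiv_def using assms by (rule has_derivative_unique)
 then have "h *. d = h *. ?g" for h using fun_cong[of _ _ h] e[of h] by fastforce
 then show "d = ?g" using vector_eq_ldot[of d ?g] by blast
 qed
 then show ?thesis using e[of v] by (simp add: inner_commute)
qed

lemma gradient_smooth:
 fixes f :: "'a::euclidean_space => real"
 assumes "smooth_on U f" "x \<in> U" shows "gradient f x *. v = nderiv [v] f x"
 by (rule gradient_eq[OF has_derivative_smooth[OF assms]])

lemma gradient_smooth_sum:
 fixes f :: "'a::euclidean_space => real"
 assumes "smooth_on U f" "x \<in> U" shows "gradient f x = (\<Sum>b\<in>Basis. nderiv [b] f x *# b)"
 unfolding gradient_smooth[OF assms, symmetric] by (rule euclidean_representation[symmetric])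

lemma continuous_gradient:
 fixes f :: "'a::euclidean_space => real"
 assumes U: "open U" and f: "smooth_on U f" and x: "x \<in> U" shows "isCont (gradient f) x"
proof -
 have "isCont (%x. \<Sum>b\<in>Basis. nderiv [b] f x *# b) x"
 by (intro continuous_intros continuous_nderiv[OF f x])
 moreover have "\<forall>\<^sub>F y in nhds x. y \<in> U" using U x by (rule eventually_nhds_in_open)
 then have "\<forall>\<^sub>F y in nhds x. gradient f y = (\<Sum>b\<in>Basis. nderiv [b] f y *# b)"
 by eventually_elim (rule gradient_smooth_sum[OF f])
 ultimately show ?thesis by (subst isCont_cong)
qed

lemma linear_nderiv:
 "smooth_on U f ==> x \<in> U ==> bounded_linear (%v. nderiv (v # vs) f x)"
 using has_derivative_bounded_linear[OF has_derivative_nderiv] .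

lemma nderiv_curve:
 fixes f :: "'a::real_normed_vector => real"
 assumes f: "smooth_on U f" and g: "(g has_vector_derivative g') (at s)" and gs: "g s \<in> U"
 shows "((%s. nderiv vs f (g s)) has_real_derivative nderiv (g' # vs) f (g s)) (at s)"
proof -
 interpret bounded_linear "%v. nderiv (v # vs) f (g s)" by (rule linear_nderiv[OF f gs])
 have "((%s. nderiv vs f (g s)) has_derivative (%h. nderiv ((h *# g') # vs) f (g s))) (at s)"
 by (rule has_derivative_compose[of g "%h. h *# g'" s UNIV "nderiv vs f" "%v. nderiv (v # vs) f (g s)",
 OF g[unfolded has_vector_derivative_def] has_derivative_nderiv[OF f gs]])
 then show ?thesis unfolding has_field_derivative_def scaleR by (simp add: mult_commute_abs)
qed

lemma nderiv_line:
 fixes f :: "'a::real_normed_vector => real"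
 assumes f: "smooth_on U f" and "y + s *# d \<in> U"
 shows "((%s. nderiv vs f (y + s *# d)) has_real_derivative nderiv (d # vs) f (y + s *# d)) (at s)"
proof -
 have "((%s. y + s *# d) has_vector_derivative d) (at s)"
 unfolding has_vector_derivative_def by (auto intro!: derivative_eq_intros)
 then show ?thesis using nderiv_curve[where g="%s. y + s *# d", OF f _ assms(2)] by blast
qed

text \<open>The mixed second difference is evaluated by the mean value theorem in both orders.\<close>
lemma nderiv_commute:
 fixes f :: "'a::real_normed_vector => real"
 assumes U: "open U" and f: "smooth_on U f" and x: "x \<in> U"
 shows "nderiv [v, w] f x = nderiv [w, v] f x"
proof -
 obtain r where r: "r > 0" "ball x r <= U" using openE[OF U x] by blast
 define K where "K = norm v + norm w + 1"
 have K: "K > 0" by (simp add: K_def add_nonneg_pos)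
 have mv: "EX a b. 0 < a & a < h & 0 < b & b < h &
 f (x + h *# v' + h *# w') - f (x + h *# v') - (f (x + h *# w') - f x) = h * h * nderiv [w', v'] f (x + a *# v' + b *# w')"
 if h: "0 < h" and iU: "!!a b. 0 <= a ==> a <= h ==> 0 <= b ==> b <= h ==> x + a *# v' + b *# w' \<in> U" for h v' w'
 proof -
 have d1: "((%s. f (x + s *# v' + h *# w') - f (x + s *# v')) has_real_derivative
 (nderiv [v'] f (x + s *# v' + h *# w') - nderiv [v'] f (x + s *# v'))) (at s)" if "0 <= s" "s <= h" for s
 using nderiv_line[OF f, of "x + h *# w'" s v' "[]"] nderiv_line[OF f, of "x" s v' "[]"] iU[OF that, of h] iU[OF that, of 0] h
 by (intro derivative_eq_intros) (auto simp: algebra_simps)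
 obtain a where a: "0 < a" "a < h" "f (x + h *# v' + h *# w') - f (x + h *# v') - (f (x + 0 *# v' + h *# w') - f (x + 0 *# v'))
 = (h - 0) * (nderiv [v'] f (x + a *# v' + h *# w') - nderiv [v'] f (x + a *# v'))"
 using MVT2[OF h d1] by blast
 have d2: "((%s. nderiv [v'] f (x + a *# v' + s *# w')) has_real_derivative nderiv [w', v'] f (x + a *# v' + s *# w')) (at s)"
 if "0 <= s" "s <= h" for s
 by (rule nderiv_line[OF f]) (use iU[of a s] a that in auto)
 obtain b where b: "0 < b" "b < h" "nderiv [v'] f (x + a *# v' + h *# w') - nderiv [v'] f (x + a *# v' + 0 *# w') = (h - 0) * nderiv [w', v'] f (x + a *# v' + b *# w')"
 using MVT2[OF h d2] by blast
 have "f (x + h *# v' + h *# w') - f (x + h *# v') - (f (x + h *# w') - f x) = h * h * nderiv [w', v'] f (x + a *# v' + b *# w')"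
 using a(3) b(3) by (simp del: nderiv.simps add: algebra_simps)
 then show ?thesis using a b by blast
 qed
 have bd: "\<bar>nderiv [v, w] f x - nderiv [w, v] f x\<bar> <= 2 * e" if e: "e > 0" for e
 proof -
 have nb: "\<exists>d>0. ALL y. dist y x < d --> dist (nderiv vs f y) (nderiv vs f x) < e" for vs
 proof -
 have "(nderiv vs f \<longlongrightarrow> nderiv vs f x) (nhds x)"
 using continuous_nderiv[OF f x, of vs] by (simp add: isCont_def tendsto_at_iff_tendsto_nhds)
 from tendstoD[OF this e] show ?thesis unfolding eventually_nhds_metric .
 qed
 obtain d1 where d1: "d1 > 0" "!!y. dist y x < d1 ==> dist (nderiv [v, w] f y) (nderiv [v, w] f x) < e"
 using nb e by blast
 obtain d2 where d2: "d2 > 0" "!!y. dist y x < d2 ==> dist (nderiv [w, v] f y) (nderiv [w, v] f x) < e"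
 using nb e by blast
 define m where "m = min r (min d1 d2)"
 have m: "m > 0" "m <= r" "m <= d1" "m <= d2" using r d1 d2 by (auto simp: m_def)
 define h where "h = m / (2 * K)"
 have h: "h > 0" "h * K < m" using m K by (auto simp: h_def)
 have near: "dist (x + a *# v + b *# w) x < m" if "0 <= a" "a <= h" "0 <= b" "b <= h" for a b
 proof -
 have "norm (a *# v + b *# w) <= a * norm v + b * norm w" using that by (intro order_trans[OF norm_triangle_ineq]) simp
 also have "... <= h * norm v + h * norm w" using that by (intro add_mono mult_right_mono) auto
 also have "... <= h * K" using h by (simp add: K_def algebra_simps)
 finally show ?thesis using h by (simp add: dist_norm add.assoc)
 qed
 have inU1: "x + a *# v + b *# w \<in> U" if "0 <= a" "a <= h" "0 <= b" "b <= h" for a b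
 using near[OF that] m r by (auto simp: dist_commute)
 have inU2: "x + a *# w + b *# v \<in> U" if "0 <= a" "a <= h" "0 <= b" "b <= h" for a b
 using inU1[OF that(3,4,1,2)] by (simp add: algebra_simps)
 obtain a b where ab: "0 < a" "a < h" "0 < b" "b < h"
 "f (x + h *# v + h *# w) - f (x + h *# v) - (f (x + h *# w) - f x) = h * h * nderiv [w, v] f (x + a *# v + b *# w)"
 using mv[OF h(1) inU1] by blast
 obtain c d where cd: "0 < c" "c < h" "0 < d" "d < h"
 "f (x + h *# w + h *# v) - f (x + h *# w) - (f (x + h *# v) - f x) = h * h * nderiv [v, w] f (x + c *# w + d *# v)"
 using mv[OF h(1) inU2] by blast
 have "h * h * nderiv [w, v] f (x + a *# v + b *# w) = h * h * nderiv [v, w] f (x + c *# w + d *# v)"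
 unfolding ab(5)[symmetric] cd(5)[symmetric] by (simp add: algebra_simps)
 then have eq: "nderiv [w, v] f (x + a *# v + b *# w) = nderiv [v, w] f (x + d *# v + c *# w)"
 using h by (simp del: nderiv.simps add: algebra_simps)
 have "dist (nderiv [w, v] f (x + a *# v + b *# w)) (nderiv [w, v] f x) < e"
 by (rule d2(2)) (use near[of a b] ab m in auto)
 moreover have "dist (nderiv [v, w] f (x + d *# v + c *# w)) (nderiv [v, w] f x) < e"
 by (rule d1(2)) (use near[of d c] cd m in auto)
 ultimately show ?thesis unfolding eq dist_real_def by linarith
 qed
 show ?thesis
 proof (rule ccontr)
 assume "nderiv [v, w] f x ~= nderiv [w, v] f x"
 then show False using bd[of "\<bar>nderiv [v, w] f x - nderiv [w, v] f x\<bar> / 4"] by (simp del: nderiv.simps)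
 qed
qed

lemma linear_nderiv2:
 fixes f :: "'a::real_normed_vector => real"
 assumes U: "open U" and f: "smooth_on U f" and x: "x \<in> U"
 shows "bounded_linear (%w. nderiv [v, w] f x)"
 using linear_nderiv[OF f x, of "[v]"] nderiv_commute[OF U f x] by (simp only:)

section \<open>Curvature of level sets\<close>

definition local_def :: "R3 set => R3 set => (R3 => real) => bool" where
 "local_def K U f \<longleftrightarrow> open U & smooth_on U f & (\<forall>x\<in>U. (x \<in> K \<longleftrightarrow> f x <= 0) & gradient f x ~= 0)"

lemma defining_function_iff: "defining_function K p f \<longleftrightarrow> (EX U. p \<in> U & local_def K U f)"
 unfolding defining_function_def local_def_def by blast

lemma local_defD:
 assumes "local_def K U f"
 shows "open U" "smooth_on U f" "!!x. x \<in> U ==> x \<in> K \<longleftrightarrow> f x <= 0" "!!x. x \<in> U ==> gradient f x ~= 0"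
 using assms unfolding local_def_def by auto

lemma eventually_descent:
 fixes f :: "'a::euclidean_space => real"
 assumes f: "smooth_on U f" "p \<in> U" "f p <= 0" and v: "gradient f p *. v < 0"
 shows "\<forall>\<^sub>F s in at_right 0. f (p + s *# v) < 0"
proof -
 have "((%s. f (p + s *# v)) has_real_derivative gradient f p *. v) (at 0)"
 using nderiv_line[OF f(1), of p 0 v "[]"] f(2) gradient_smooth[OF f(1,2), of v] by simp
 from DERIV_neg_dec_right[OF this v] obtain d where d: "d > 0" "!!h. 0 < h ==> h < d ==> f (p + h *# v) < f p" by auto
 show ?thesis unfolding eventually_at_right_field using d f(3) by (intro exI[of _ d]) force
qed

lemma eventually_ascent:
 fixes f :: "'a::euclidean_space => real"
 assumes f: "smooth_on U f" "p \<in> U" "f p >= 0" and v: "gradient f p *. v > 0"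
 shows "\<forall>\<^sub>F s in at_right 0. f (p + s *# v) > 0"
proof -
 have "((%s. f (p + s *# v)) has_real_derivative gradient f p *. v) (at 0)"
 using nderiv_line[OF f(1), of p 0 v "[]"] f(2) gradient_smooth[OF f(1,2), of v] by simp
 from DERIV_pos_inc_right[OF this v] obtain d where d: "d > 0" "!!h. 0 < h ==> h < d ==> f p < f (p + h *# v)" by auto
 show ?thesis unfolding eventually_at_right_field using d f(3) by (intro exI[of _ d]) force
qed

lemma eventually_line_in:
 fixes p :: "'a::real_normed_vector"
 assumes "open U" "p \<in> U" shows "\<forall>\<^sub>F s in at_right 0. p + s *# v \<in> U"
proof -
 have "((%s. p + s *# v) \<longlongrightarrow> p + 0 *# v) (at_right 0)" by (intro tendsto_intros)
 then show ?thesis using assms topological_tendstoD by fastforce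
qed

lemma smooth_neg_nbhd:
 fixes f :: "'a::real_normed_vector => real"
 assumes "open U" "smooth_on U f" "p \<in> U" "f p < 0"
 obtains r where "r > 0" "!!x. dist x p < r ==> x \<in> U & f x < 0"
proof -
 have "isCont f p" using continuous_nderiv[OF assms(2,3), of "[]"] by simp
 then have "\<forall>\<^sub>F x in nhds p. f x < 0"
 using assms(4) by (intro order_tendstoD(2)) (simp_all add: isCont_def tendsto_at_iff_tendsto_nhds)
 moreover have "\<forall>\<^sub>F x in nhds p. x \<in> U" by (rule eventually_nhds_in_open[OF assms(1,3)])
 ultimately have "\<forall>\<^sub>F x in nhds p. x \<in> U & f x < 0" by eventually_elim simp
 then show ?thesis using that unfolding eventually_nhds_metric by blast
qed

lemma smooth_pos_nbhd:
 fixes f :: "'a::real_normed_vector => real"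
 assumes "open U" "smooth_on U f" "p \<in> U" "f p > 0"
 obtains r where "r > 0" "!!x. dist x p < r ==> x \<in> U & f x > 0"
proof -
 have "isCont f p" using continuous_nderiv[OF assms(2,3), of "[]"] by simp
 then have "\<forall>\<^sub>F x in nhds p. f x > 0"
 using assms(4) by (intro order_tendstoD(1)) (simp_all add: isCont_def tendsto_at_iff_tendsto_nhds)
 moreover have "\<forall>\<^sub>F x in nhds p. x \<in> U" by (rule eventually_nhds_in_open[OF assms(1,3)])
 ultimately have "\<forall>\<^sub>F x in nhds p. x \<in> U & f x > 0" by eventually_elim simp
 then show ?thesis using that unfolding eventually_nhds_metric by blast
qed

lemma frontier_local_def:
 assumes K: "local_def K U f" and p: "p \<in> U" shows "p \<in> frontier K \<longleftrightarrow> f p = 0"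
proof
 note L = local_defD[OF K]
 assume fr: "p \<in> frontier K"
 have "\<not> f p < 0"
 proof
 assume "f p < 0"
 then obtain r where r: "r > 0" "!!x. dist x p < r ==> x \<in> U & f x < 0" using smooth_neg_nbhd[OF L(1,2) p] by blast
 have "ball p r <= K"
 proof
 fix x assume "x \<in> ball p r"
 then have "x \<in> U & f x < 0" using r(2)[of x] by (simp add: dist_commute)
 then show "x \<in> K" using L(3)[of x] by simp
 qed
 then have "p \<in> interior K" using r(1) mem_interior by blast
 then show False using fr by (simp add: frontier_def)
 qed
 moreover have "\<not> f p > 0"
 proof
 assume "f p > 0"
 then obtain r where r: "r > 0" "!!x. dist x p < r ==> x \<in> U & f x > 0" using smooth_pos_nbhd[OF L(1,2) p] by blast
 have "x \<notin> K" if "dist x p < r" for x using r(2)[OF that] L(3)[of x] by auto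
 then have "p \<notin> closure K" using r(1) unfolding closure_approachable by blast
 then show False using fr by (simp add: frontier_def)
 qed
 ultimately show "f p = 0" by simp
next
 note L = local_defD[OF K]
 assume f0: "f p = 0"
 have "p \<in> K" using L(3) p f0 by simp
 have "p \<notin> interior K"
 proof
 assume i: "p \<in> interior K"
 have "gradient f p *. gradient f p > 0" using L(4)[OF p] by simp
 then have "\<forall>\<^sub>F s in at_right 0. f (p + s *# gradient f p) > 0"
 using f0 by (intro eventually_ascent[OF L(2) p]) auto
 with eventually_line_in[OF open_interior i, of "gradient f p"] eventually_line_in[OF L(1) p, of "gradient f p"]
 have "\<forall>\<^sub>F s in at_right (0::real). False"
 proof eventually_elim
 case (elim s)
 have "p + s *# gradient f p \<in> K" using elim(1) interior_subset by blast
 then show False using L(3)[OF elim(2)] elim(3) by simp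
 qed
 then show False by simp
 qed
 then show "p \<in> frontier K" using \<open>p \<in> K\<close> closure_subset unfolding frontier_def by blast
qed

text \<open>Independence of the defining function: if two unit gradients \<open>n\<close> and
  \<open>m\<close> at \<open>p\<close> differed, then in the direction \<open>m - n\<close> one
  function would become negative and the other positive, although both describe the same domain near
  \<open>p\<close>.\<close>

lemma outer_normal_eq:
 assumes K: "local_def K U f" and p: "p \<in> U" "f p = 0" shows "outer_normal K p = sgn (gradient f p)"
 unfolding outer_normal_def
proof (rule the_equality)
 show "EX f'. defining_function K p f' & sgn (gradient f p) = sgn (gradient f' p)"
 using K p(1) defining_function_iff by blast
 fix nux assume "EX g. defining_function K p g & nux = sgn (gradient g p)"
 then obtain g V where g: "local_def K V g" "p \<in> V" "nux = sgn (gradient g p)" unfolding defining_function_iff by blast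
 note L = local_defD[OF K] and M = local_defD[OF g(1)]
 have g0: "g p = 0" using frontier_local_def[OF K p(1)] frontier_local_def[OF g(1,2)] p(2) by simp
 let ?n = "sgn (gradient f p)" and ?m = "sgn (gradient g p)"
 have n1: "norm ?n = 1" "norm ?m = 1" using L(4)[OF p(1)] M(4)[OF g(2)] by (auto simp: norm_sgn)
 show "nux = ?n"
 proof (rule ccontr)
 assume "nux ~= ?n"
 then have ne: "?m ~= ?n" using g(3) by simp
 have lt: "?n *. ?m < 1"
 proof -
 have "?n *. ?n = 1" "?m *. ?m = 1" using n1 by (simp_all add: norm_eq_1)
 then have "(?n - ?m) *. (?n - ?m) = 2 - 2 * (?n *. ?m)" unfolding inner_diff_left inner_diff_right by (simp add: inner_commute)
 moreover have "0 < (?n - ?m) *. (?n - ?m)" using ne by (subst inner_gt_zero_iff) simp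
 ultimately show ?thesis by linarith
 qed
 have gf: "gradient f p = norm (gradient f p) *# ?n" "gradient g p = norm (gradient g p) *# ?m"
 using L(4)[OF p(1)] M(4)[OF g(2)] by (simp_all add: sgn_div_norm)
 have "?n *. ?n = 1" "?m *. ?m = 1" using n1 by (simp_all add: norm_eq_1)
 then have "?n *. (?m - ?n) < 0" "?m *. (?m - ?n) > 0"
 unfolding inner_diff_right using lt by (simp_all add: inner_commute)
 moreover have "gradient f p *. (?m - ?n) = norm (gradient f p) * (?n *. (?m - ?n))" "gradient g p *. (?m - ?n) = norm (gradient g p) * (?m *. (?m - ?n))"
 using arg_cong[OF gf(1), of "%z. z *. (?m - ?n)"] arg_cong[OF gf(2), of "%z. z *. (?m - ?n)"] by (simp_all only: inner_scaleR_left)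
 moreover have "norm (gradient f p) > 0" "norm (gradient g p) > 0" using L(4)[OF p(1)] M(4)[OF g(2)] by auto
 ultimately have "gradient f p *. (?m - ?n) < 0" "gradient g p *. (?m - ?n) > 0"
 by (auto simp only: mult_pos_neg mult_pos_pos)
 then have "\<forall>\<^sub>F s in at_right 0. f (p + s *# (?m - ?n)) < 0" "\<forall>\<^sub>F s in at_right 0. g (p + s *# (?m - ?n)) > 0"
 using p(2) g0 by (auto intro!: eventually_descent[OF L(2) p(1)] eventually_ascent[OF M(2) g(2)])
 with eventually_line_in[OF L(1) p(1), of "?m - ?n"] eventually_line_in[OF M(1) g(2), of "?m - ?n"]
 have "\<forall>\<^sub>F s in at_right (0::real). False"
 proof eventually_elim
 case (elim s)
 then show False using L(3)[OF elim(1)] M(3)[OF elim(2)] by simp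
 qed
 then show False by simp
 qed
qed

section \<open>Tangent frames and the second fundamental form of a level set\<close>

definition orthoframe :: "R3 => R3 => R3 => bool" where
 "orthoframe a b c \<longleftrightarrow> a *. a = 1 & b *. b = 1 & c *. c = 1 & a *. b = 0 & a *. c = 0 & b *. c = 0"

lemma orthoframeD:
 assumes "orthoframe a b c"
 shows "a *. a = 1" "b *. b = 1" "c *. c = 1" "a *. b = 0" "a *. c = 0" "b *. c = 0" "b *. a = 0" "c *. a = 0" "c *. b = 0"
 "norm a = 1" "norm b = 1" "norm c = 1"
 using assms by (auto simp: orthoframe_def inner_commute norm_eq_1)

lemma orthoframe_exists:
 assumes "norm (e :: R3) = 1" obtains a b where "orthoframe a b e"
proof -
 obtain f :: "R3 => R3" where f: "orthogonal_transformation f" "f (axis 1 1) = e"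
 using orthogonal_transformation_exists[of "axis 1 1 :: R3" e] assms by auto
 have i: "f x *. f y = x *. y" for x y using f(1) by (simp add: orthogonal_transformation_def)
 have "orthoframe (f (axis 2 1)) (f (axis 3 1)) (f (axis 1 1))"
 unfolding orthoframe_def i by (simp add: inner_axis_axis)
 then show ?thesis using that f(2) by simp
qed

lemma orthoframe_expand:
 assumes "orthoframe a b c" shows "x = (x *. a) *# a + (x *. b) *# b + (x *. c) *# c"
proof -
 note F = orthoframeD[OF assms]
 have ne: "a ~= b" "a ~= c" "b ~= c" using F by auto
 have "pairwise orthogonal {a,b,c}" using F by (auto simp: pairwise_def orthogonal_def)
 moreover have "0 \<notin> {a,b,c}" using F by auto
 ultimately have ind: "independent {a,b,c}" by (rule pairwise_orthogonal_independent)
 have "dim (UNIV :: R3 set) = 3" by simp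
 then have "UNIV <= span {a,b,c}"
 by (intro card_ge_dim_independent ind) (use ne in auto)
 let ?y = "x - ((x *. a) *# a + (x *. b) *# b + (x *. c) *# c)"
 have o: "orthogonal ?y z" if "z \<in> {a,b,c}" for z
 using that F by (auto simp: orthogonal_def inner_diff_left inner_add_left)
 have "?y \<in> span {a,b,c}" using \<open>UNIV <= span {a,b,c}\<close> by blast
 then have "orthogonal ?y ?y" using o by (rule orthogonal_to_span)
 then have "?y = 0" unfolding orthogonal_self .
 then show ?thesis by (simp only: right_minus_eq)
qed

text \<open>Tilting a tangent ray by \<open>et\<close> to either side of the surface changes the
  sign of \<open>f\<close>, so the intermediate value theorem finds a frontier point in between.
  These points play the part of a local graph.\<close>

lemma tangent_point:
 assumes K: "local_def K U f" and p: "p \<in> U" "f p = 0" and v: "gradient f p *. v = 0" and et: "et > 0"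
 shows "\<forall>\<^sub>F s in at_right 0. EX c. \<bar>c\<bar> <= et * s & p + s *# v + c *# gradient f p \<in> frontier K \<inter> U"
proof -
 note L = local_defD[OF K]
 let ?n = "gradient f p"
 obtain r where r: "r > 0" "ball p r <= U" using openE[OF L(1) p(1)] by blast
 define M where "M = norm v + et * norm ?n + 1"
 have M: "M > 0" using et by (simp add: M_def add_nonneg_pos)
 have nn: "?n *. ?n > 0" using L(4)[OF p(1)] by simp
 have "?n *. (v + et *# ?n) > 0" "?n *. (v - et *# ?n) < 0" using v et nn by (simp_all add: inner_add_right inner_diff_right)
 then have "\<forall>\<^sub>F s in at_right 0. f (p + s *# (v + et *# ?n)) > 0" "\<forall>\<^sub>F s in at_right 0. f (p + s *# (v - et *# ?n)) < 0"
 using p by (auto intro!: eventually_descent[OF L(2)] eventually_ascent[OF L(2)])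
 moreover have "\<forall>\<^sub>F s in at_right 0. s > 0 & s < r / M"
 unfolding eventually_at_right_field using r M by (intro exI[of _ "r / M"]) auto
 ultimately show ?thesis
 proof eventually_elim
 case (elim s)
 have inU: "p + s *# v + c *# ?n \<in> U" if "\<bar>c\<bar> <= et * s" for c
 proof -
 have "norm (s *# v + c *# ?n) <= s * norm v + \<bar>c\<bar> * norm ?n"
 using elim(3) by (intro order_trans[OF norm_triangle_ineq]) simp
 also have "... <= s * norm v + (et * s) * norm ?n" using that by (intro add_mono mult_right_mono) auto
 also have "... <= s * M" using elim(3) by (simp add: M_def algebra_simps)
 also have "... < r" using elim(3) M by (simp add: field_simps)
 finally have "dist (p + s *# v + c *# ?n) p < r" by (simp add: dist_norm add.assoc)
 then show ?thesis using r by (auto simp: dist_commute)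
 qed
 have "continuous_on {- (et * s)..et * s} (%c. f (p + s *# v + c *# ?n))"
 by (rule continuous_on_compose2[OF continuous_on_nderiv[OF L(2), of "[]", simplified]])
 (use inU in \<open>auto intro!: continuous_intros\<close>)
 then have "\<exists>c\<ge>- (et * s). c <= et * s & f (p + s *# v + c *# ?n) = 0"
 using elim et by (intro IVT') (auto simp: algebra_simps)
 then obtain c where c: "- (et * s) <= c" "c <= et * s" "f (p + s *# v + c *# ?n) = 0" by blast
 then have "\<bar>c\<bar> <= et * s" by auto
 then show ?case using frontier_local_def[OF K inU] c(3) inU by blast
 qed
qed

text \<open>A derivative within a surface is determined on tangent vectors only. This determines
  \<open>second_ff\<close> there although \<open>frechet_derivative\<close> makes a choice: frontier
  points approach \<open>p\<close> in every tangent direction, with an arbitrarily small normal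
  error.\<close>

lemma derivative_within_frontier_unique:
 assumes K: "local_def K U f" and p: "p \<in> U" "f p = 0" and v: "gradient f p *. v = 0"
 and A: "(h has_derivative A) (at p within frontier K)" and B: "(h has_derivative B) (at p within frontier K)"
 shows "A v = B v"
proof -
 define L where "L x = A x - B x" for x
 have "((%x. h x - h x) has_derivative L) (at p within frontier K)"
 unfolding L_def by (rule has_derivative_diff[OF A B])
 then have D: "((%x. 0) has_derivative L) (at p within frontier K)" by simp
 interpret L: bounded_linear L using D by (rule has_derivative_bounded_linear)
 let ?n = "gradient f p"
 have bd: "norm (L v) <= et * norm (L ?n) + et * (norm v + et * norm ?n)" if et: "et > 0" for et
 proof -
 obtain d where d: "d > 0" "!!y. y \<in> frontier K ==> norm (y - p) < d ==> norm (L (y - p)) <= et * norm (y - p)"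
 using D[unfolded has_derivative_within_alt] et by force
 define M where "M = norm v + et * norm ?n + 1"
 have M: "M > 0" using et by (simp add: M_def add_nonneg_pos)
 have "\<forall>\<^sub>F s in at_right 0. s > 0 & s < d / M"
 unfolding eventually_at_right_field using d M by (intro exI[of _ "d / M"]) auto
 with tangent_point[OF K p v et] have "\<forall>\<^sub>F s in at_right (0::real). norm (L v) <= et * norm (L ?n) + et * (norm v + et * norm ?n)"
 proof eventually_elim
 case (elim s)
 then obtain c where c: "\<bar>c\<bar> <= et * s" "p + s *# v + c *# ?n \<in> frontier K" by blast
 let ?x = "s *# v + c *# ?n"
 have nx: "norm ?x <= s * (norm v + et * norm ?n)"
 proof -
 have "norm ?x <= s * norm v + \<bar>c\<bar> * norm ?n" using elim by (intro order_trans[OF norm_triangle_ineq]) simp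
 also have "... <= s * norm v + (et * s) * norm ?n" using c by (intro add_mono mult_right_mono) auto
 finally show ?thesis by (simp add: algebra_simps)
 qed
 also have "... < d"
 proof -
 have "s * (norm v + et * norm ?n) <= s * M" using elim by (intro mult_left_mono) (auto simp: M_def)
 also have "... < d" using elim M by (simp add: field_simps)
 finally show ?thesis .
 qed
 finally have lt: "norm ?x < d" .
 have "norm (L ?x) <= et * norm ?x" using d(2)[OF c(2)] lt by (simp add: add.assoc)
 also have "... <= et * (s * (norm v + et * norm ?n))" using nx et by (intro mult_left_mono) auto
 finally have 1: "norm (L ?x) <= et * (s * (norm v + et * norm ?n))" .
 have "s *# L v = L ?x - c *# L ?n" by (simp add: L.add L.scaleR)
 then have "s * norm (L v) = norm (L ?x - c *# L ?n)" using elim by (metis abs_of_pos norm_scaleR)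
 also have "... <= norm (L ?x) + \<bar>c\<bar> * norm (L ?n)" using norm_triangle_ineq4[of "L ?x" "c *# L ?n"] by simp
 also have "... <= et * (s * (norm v + et * norm ?n)) + (et * s) * norm (L ?n)"
 using 1 c by (intro add_mono mult_right_mono) auto
 also have "... = s * (et * norm (L ?n) + et * (norm v + et * norm ?n))" by (simp add: algebra_simps)
 finally show ?case using elim by simp
 qed
 then show ?thesis by simp
 qed
 have "((%et. et * norm (L ?n) + et * (norm v + et * norm ?n)) \<longlongrightarrow> 0 * norm (L ?n) + 0 * (norm v + 0 * norm ?n)) (at_right 0)"
 by (intro tendsto_intros)
 then have "norm (L v) <= 0 * norm (L ?n) + 0 * (norm v + 0 * norm ?n)"
 proof (rule tendsto_lowerbound)
 show "\<forall>\<^sub>F et in at_right 0. norm (L v) <= et * norm (L ?n) + et * (norm v + et * norm ?n)"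
 unfolding eventually_at_right_field by (intro exI[of _ 1]) (use bd in auto)
 qed simp
 then show ?thesis by (simp add: L_def)
qed

text \<open>On the frontier the normal is the gradient divided by its length. Differentiating the
  length only produces a multiple of the gradient, which is orthogonal to the tangent vector
  \<open>w\<close>.\<close>

lemma second_ff_eq:
 assumes K: "local_def K U f" and p: "p \<in> U" "f p = 0" and v: "gradient f p *. v = 0" and w: "gradient f p *. w = 0"
 shows "second_ff K p v w = nderiv [v, w] f p / norm (gradient f p)"
proof -
 note L = local_defD[OF K]
 define g where "g q = (\<Sum>b\<in>Basis. nderiv [b] f q *# b)" for q
 have gq: "gradient f q = g q" if "q \<in> U" for q using gradient_smooth_sum[OF L(2) that] by (simp add: g_def)
 have Dg: "(g has_derivative (%v. \<Sum>b\<in>Basis. nderiv [v, b] f p *# b)) (at p)"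
 unfolding g_def by (intro has_derivative_sum has_derivative_scaleR_left has_derivative_nderiv[OF L(2) p(1)])
 have gp: "g p ~= 0" using L(4)[OF p(1)] gq[OF p(1)] by simp
 have "(%q. inverse (norm (g q))) differentiable at p"
 using Dg gp by (intro differentiable_inverse differentiable_compose[of norm g, OF differentiable_norm_at]) (auto simp: differentiable_def)
 then obtain l where l: "((%q. inverse (norm (g q))) has_derivative l) (at p)" unfolding differentiable_def by blast
 have D: "((%q. inverse (norm (g q)) *# g q) has_derivative
 (%v. inverse (norm (g p)) *# (\<Sum>b\<in>Basis. nderiv [v, b] f p *# b) + l v *# g p)) (at p)" (is "(_ has_derivative ?A) _")
 by (rule has_derivative_scaleR[OF l Dg])
 obtain r where r: "r > 0" "ball p r <= U" using openE[OF L(1) p(1)] by blast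
 have pf: "p \<in> frontier K" using frontier_local_def[OF K p(1)] p(2) by simp
 have A: "(outer_normal K has_derivative ?A) (at p within frontier K)"
 proof (rule has_derivative_transform_within[OF has_derivative_at_withinI[OF D] r(1) pf])
 fix x assume x: "x \<in> frontier K" "dist x p < r"
 then have "x \<in> U" using r(2) by (auto simp: dist_commute)
 then show "inverse (norm (g x)) *# g x = outer_normal K x"
 using outer_normal_eq[OF K] frontier_local_def[OF K] x(1) gq by (simp add: sgn_div_norm)
 qed
 then have "(outer_normal K has_derivative frechet_derivative (outer_normal K) (at p within frontier K)) (at p within frontier K)"
 by (auto simp: frechet_derivative_works[symmetric] differentiable_def)
 then have "frechet_derivative (outer_normal K) (at p within frontier K) v = ?A v"
 by (rule derivative_within_frontier_unique[OF K p v _ A])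
 then have "second_ff K p v w = inverse (norm (g p)) * (\<Sum>b\<in>Basis. nderiv [v, b] f p * (b *. w)) + l v * (g p *. w)"
 unfolding second_ff_def by (simp add: inner_add_left inner_sum_left del: nderiv.simps)
 also have "g p *. w = 0" using w gq[OF p(1)] by simp
 also have "(\<Sum>b\<in>Basis. nderiv [v, b] f p * (b *. w)) = nderiv [v, w] f p"
 proof -
 interpret bounded_linear "%w. nderiv [v, w] f p" by (rule linear_nderiv2[OF L(1,2) p(1)])
 have "nderiv [v, w] f p = nderiv [v, \<Sum>b\<in>Basis. (w *. b) *# b] f p" by (simp only: euclidean_representation)
 also have "... = (\<Sum>b\<in>Basis. (w *. b) *# nderiv [v, b] f p)" unfolding sum scaleR ..
 finally show ?thesis by (simp add: inner_commute mult.commute del: nderiv.simps)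
 qed
 finally show ?thesis using gq[OF p(1)] by (simp add: divide_inverse mult.commute del: nderiv.simps)
qed

text \<open>The eigenvalues of a symmetric \<open>2 \<times> 2\<close> matrix are real, so \<open>Min\<close> and \<open>Max\<close> are
 taken over a nonempty set and add up to the trace.\<close>
lemma principal_curvatures_frame:
 assumes K: "local_def K U f" and p: "p \<in> U" "f p = 0" and fr: "orthoframe e1 e2 e" and e: "gradient f p = m *# e"
 defines "n \<equiv> norm (gradient f p)"
 defines "a \<equiv> nderiv [e1, e1] f p / n" and "b \<equiv> nderiv [e1, e2] f p / n" and "c \<equiv> nderiv [e2, e2] f p / n"
 shows "principal_curvatures K p = {ka. (a - ka) * (c - ka) = b\<^sup>2}"
proof -
 note L = local_defD[OF K]
 note F = orthoframeD[OF fr]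
 have m: "m ~= 0" using L(4)[OF p(1)] e by auto
 have tan: "gradient f p *. v = 0 \<longleftrightarrow> v *. e = 0" for v using m by (simp add: e inner_commute)
 have nor: "v *. outer_normal K p = 0 \<longleftrightarrow> v *. e = 0" for v
 unfolding outer_normal_eq[OF K p] e using m F(12) by (simp add: sgn_scaleR sgn_div_norm sgn_if)
 have te: "gradient f p *. e1 = 0" "gradient f p *. e2 = 0" using F by (simp_all add: tan)
 have n: "n > 0" using L(4)[OF p(1)] by (simp add: n_def)
 let ?B = "%v w. nderiv [v, w] f p"
 have sym: "?B e2 e1 = ?B e1 e2" by (rule nderiv_commute[OF L(1,2) p(1)])
 have B: "second_ff K p (x *# e1 + y *# e2) (x' *# e1 + y' *# e2) = x' * (a * x + b * y) + y' * (b * x + c * y)" for x y x' y'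
 proof -
 have t: "gradient f p *. (x *# e1 + y *# e2) = 0" for x y using te by (simp add: inner_add_right)
 have l1: "?B (x *# e1 + y *# e2) w = x * ?B e1 w + y * ?B e2 w" for w
 proof -
 interpret bounded_linear "%v. ?B v w" by (rule linear_nderiv[OF L(2) p(1)])
 show ?thesis unfolding add scaleR by (simp del: nderiv.simps)
 qed
 have l2: "?B w (x' *# e1 + y' *# e2) = x' * ?B w e1 + y' * ?B w e2" for w
 proof -
 interpret bounded_linear "%v. ?B w v" by (rule linear_nderiv2[OF L(1,2) p(1)])
 show ?thesis unfolding add scaleR by (simp del: nderiv.simps)
 qed
 show ?thesis
 unfolding second_ff_eq[OF K p t t] l1 l2 sym a_def b_def c_def n_def[symmetric]
 using n by (simp add: field_simps del: nderiv.simps)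
 qed
 have tanv: "v *. e = 0 \<longleftrightarrow> (EX x y. v = x *# e1 + y *# e2)" for v
 proof
 assume "v *. e = 0"
 then show "EX x y. v = x *# e1 + y *# e2"
 using orthoframe_expand[OF fr, of v] by (intro exI[of _ "v *. e1"] exI[of _ "v *. e2"]) simp
 qed (use F in \<open>auto simp: inner_add_left\<close>)
 have eig: "ka \<in> principal_curvatures K p \<longleftrightarrow>
 (EX x y. (x ~= 0 | y ~= 0) & a * x + b * y = ka * x & b * x + c * y = ka * y)" for ka
 proof -
 have nz: "x *# e1 + y *# e2 = 0 \<longleftrightarrow> x = 0 & y = 0" for x y
 proof
 assume "x *# e1 + y *# e2 = 0"
 then have "(x *# e1 + y *# e2) *. e1 = 0" "(x *# e1 + y *# e2) *. e2 = 0" by simp_all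
 then show "x = 0 & y = 0" using F by (simp add: inner_add_left)
 qed simp
 have ip: "(x *# e1 + y *# e2) *. (x' *# e1 + y' *# e2) = x * x' + y * y'" for x y x' y'
 using F by (simp add: inner_add_left inner_add_right)
 have "ka \<in> principal_curvatures K p \<longleftrightarrow> (EX x y. (x ~= 0 | y ~= 0) &
 (ALL x' y'. x' * (a * x + b * y) + y' * (b * x + c * y) = ka * (x * x' + y * y')))"
 unfolding principal_curvatures_def mem_Collect_eq nor tanv
 by (auto simp: nz B ip) (metis B ip nz)+
 also have "... \<longleftrightarrow> (EX x y. (x ~= 0 | y ~= 0) & a * x + b * y = ka * x & b * x + c * y = ka * y)"
 proof (intro ex_cong1 conj_cong refl iffI)
 fix x y assume *: "ALL x' y'. x' * (a * x + b * y) + y' * (b * x + c * y) = ka * (x * x' + y * y')"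
 show "a * x + b * y = ka * x & b * x + c * y = ka * y"
 using *[rule_format, of 1 0] *[rule_format, of 0 1] by simp
 next
 fix x y assume "a * x + b * y = ka * x & b * x + c * y = ka * y"
 then show "ALL x' y'. x' * (a * x + b * y) + y' * (b * x + c * y) = ka * (x * x' + y * y')"
 by (simp add: algebra_simps)
 qed
 finally show ?thesis .
 qed
 show ?thesis
 proof (intro set_eqI iffI)
 fix ka assume "ka \<in> principal_curvatures K p"
 then obtain x y where xy: "x ~= 0 | y ~= 0" "(a - ka) * x = - b * y" "(c - ka) * y = - b * x"
 unfolding eig by (auto simp: algebra_simps)
 have "((a - ka) * (c - ka)) * x = (c - ka) * ((a - ka) * x)" by simp
 also have "... = - b * ((c - ka) * y)" unfolding xy(2) by simp
 also have "... = b\<^sup>2 * x" unfolding xy(3) by (simp add: power2_eq_square)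
 finally have 1: "((a - ka) * (c - ka)) * x = b\<^sup>2 * x" .
 have "((a - ka) * (c - ka)) * y = (a - ka) * ((c - ka) * y)" by simp
 also have "... = - b * ((a - ka) * x)" unfolding xy(3) by simp
 also have "... = b\<^sup>2 * y" unfolding xy(2) by (simp add: power2_eq_square)
 finally have "((a - ka) * (c - ka)) * y = b\<^sup>2 * y" .
 with 1 xy(1) show "ka \<in> {ka. (a - ka) * (c - ka) = b\<^sup>2}" by auto
 next
 fix ka assume "ka \<in> {ka. (a - ka) * (c - ka) = b\<^sup>2}"
 then have k: "(a - ka) * (c - ka) = b * b" by (simp add: power2_eq_square)
 show "ka \<in> principal_curvatures K p"
 proof (cases "b = 0")
 case True
 then have "a = ka | c = ka" using k by auto
 then show ?thesis
 proof
 assume "a = ka" then show ?thesis unfolding eig using True by (intro exI[of _ 1] exI[of _ 0]) simp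
 next
 assume "c = ka" then show ?thesis unfolding eig using True by (intro exI[of _ 0] exI[of _ 1]) simp
 qed
 next
 case False
 then show ?thesis unfolding eig using k by (intro exI[of _ b] exI[of _ "ka - a"]) (simp add: algebra_simps)
 qed
 qed
qed

lemma mean_curv_frame:
 assumes K: "local_def K U f" and p: "p \<in> U" "f p = 0" and fr: "orthoframe e1 e2 e" and e: "gradient f p = m *# e"
 shows "mean_curv K p = (nderiv [e1, e1] f p + nderiv [e2, e2] f p) / norm (gradient f p)"
proof -
 define n where "n = norm (gradient f p)"
 define a where "a = nderiv [e1, e1] f p / n"
 define b where "b = nderiv [e1, e2] f p / n"
 define c where "c = nderiv [e2, e2] f p / n"
 have P: "principal_curvatures K p = {ka. (a - ka) * (c - ka) = b\<^sup>2}"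
 unfolding a_def b_def c_def n_def by (rule principal_curvatures_frame[OF K p fr e])
 define d where "d = sqrt ((a - c)\<^sup>2 + 4 * b\<^sup>2)"
 have d: "d >= 0" "d * d = (a - c)\<^sup>2 + 4 * b\<^sup>2" by (auto simp: d_def)
 have "(a - ka) * (c - ka) = b\<^sup>2 \<longleftrightarrow> ka = (a + c - d) / 2 | ka = (a + c + d) / 2" for ka
 proof -
 have "(a - ka) * (c - ka) - b\<^sup>2 = (ka - (a + c - d) / 2) * (ka - (a + c + d) / 2)"
 using d(2) by (simp add: field_simps power2_eq_square)
 then have "(a - ka) * (c - ka) = b\<^sup>2 \<longleftrightarrow> (ka - (a + c - d) / 2) * (ka - (a + c + d) / 2) = 0" by linarith
 also have "... \<longleftrightarrow> ka = (a + c - d) / 2 | ka = (a + c + d) / 2" unfolding mult_eq_0_iff right_minus_eq ..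
 finally show ?thesis .
 qed
 then have "principal_curvatures K p = {(a + c - d) / 2, (a + c + d) / 2}" unfolding P by blast
 moreover have "Min {u, w} = u" "Max {u, w} = w" if "u <= w" for u w :: real using that by auto
 moreover have "(a + c - d) / 2 <= (a + c + d) / 2" using d(1) by (simp add: divide_right_mono)
 ultimately have "mean_curv K p = (a + c - d) / 2 + (a + c + d) / 2"
 unfolding mean_curv_def lambda1_def lambda2_def by (simp only:)
 then have "mean_curv K p = a + c" by (simp add: field_simps)
 then show ?thesis unfolding a_def c_def n_def by (simp add: add_divide_distrib del: nderiv.simps)
qed

section \<open>Second order tests of a level set by curves\<close>

lemma second_deriv_curve:
 fixes f :: "'a::euclidean_space => real"
 assumes U: "open U" and f: "smooth_on U f" and g: "(g has_vector_derivative g' 0) (at 0)" "(g' has_vector_derivative b) (at 0)"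
 and p: "g 0 \<in> U"
 shows "((%s. nderiv [g' s] f (g s)) has_real_derivative (nderiv [g' 0, g' 0] f (g 0) + gradient f (g 0) *. b)) (at 0)"
proof -
 have cont: "isCont g 0" using g(1) by (rule has_vector_derivative_continuous)
 have ev: "\<forall>\<^sub>F s in nhds 0. g s \<in> U"
 using topological_tendstoD[OF cont[unfolded isCont_def tendsto_at_iff_tendsto_nhds] U p] .
 have e: "nderiv [v] f x = (\<Sum>i\<in>Basis. nderiv [i] f x * (v *. i))" if "x \<in> U" for v x
 unfolding gradient_smooth[OF f that, symmetric] by (subst euclidean_inner) simp
 have d: "((%s. \<Sum>i\<in>Basis. nderiv [i] f (g s) * (g' s *. i)) has_real_derivative
 (\<Sum>i\<in>Basis. nderiv [g' 0, i] f (g 0) * (g' 0 *. i) + (b *. i) * nderiv [i] f (g 0))) (at 0)"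
 proof (rule DERIV_sum)
 fix i :: 'a
 have "((%s. g' s *. i) has_real_derivative b *. i) (at 0)"
 using bounded_linear.has_vector_derivative[OF bounded_linear_inner_left g(2)]
 by (simp add: has_real_derivative_iff_has_vector_derivative)
 from DERIV_mult[OF nderiv_curve[OF f g(1) p, of "[i]"] this]
 show "((%s. nderiv [i] f (g s) * (g' s *. i)) has_real_derivative nderiv [g' 0, i] f (g 0) * (g' 0 *. i) + (b *. i) * nderiv [i] f (g 0)) (at 0)"
 by (simp del: nderiv.simps)
 qed
 have "\<forall>\<^sub>F s in nhds 0. nderiv [g' s] f (g s) = (\<Sum>i\<in>Basis. nderiv [i] f (g s) * (g' s *. i))"
 using ev by eventually_elim (rule e)
 then have "((%s. nderiv [g' s] f (g s)) has_real_derivative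
 (\<Sum>i\<in>Basis. nderiv [g' 0, i] f (g 0) * (g' 0 *. i) + (b *. i) * nderiv [i] f (g 0))) (at 0)"
 using d by (subst DERIV_cong_ev[OF refl _ refl])
 moreover have "(\<Sum>i\<in>Basis. nderiv [g' 0, i] f (g 0) * (g' 0 *. i) + (b *. i) * nderiv [i] f (g 0)) = nderiv [g' 0, g' 0] f (g 0) + gradient f (g 0) *. b"
 proof -
 interpret bounded_linear "%w. nderiv [g' 0, w] f (g 0)" by (rule linear_nderiv2[OF U f p])
 have "nderiv [g' 0, g' 0] f (g 0) = nderiv [g' 0, \<Sum>i\<in>Basis. (g' 0 *. i) *# i] f (g 0)" by (simp only: euclidean_representation)
 also have "... = (\<Sum>i\<in>Basis. (g' 0 *. i) *# nderiv [g' 0, i] f (g 0))" unfolding sum scaleR ..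
 finally have 1: "nderiv [g' 0, g' 0] f (g 0) = (\<Sum>i\<in>Basis. nderiv [g' 0, i] f (g 0) * (g' 0 *. i))" by (simp add: mult.commute del: nderiv.simps)
 have 2: "gradient f (g 0) *. b = (\<Sum>i\<in>Basis. (b *. i) * nderiv [i] f (g 0))"
 using e[OF p, of b] gradient_smooth[OF f p, of b] by (simp add: mult.commute del: nderiv.simps)
 show ?thesis using 1 2 by (simp add: sum.distrib del: nderiv.simps)
 qed
 ultimately show ?thesis by (simp only:)
qed

lemma deriv_sign_second:
 fixes h h' :: "real => real"
 assumes d: "\<forall>\<^sub>F s in nhds 0. (h has_real_derivative h' s) (at s)" and h0: "h 0 = 0" "h' 0 = 0"
 and d2: "(h' has_real_derivative D) (at 0)"
 shows "D < 0 ==> \<forall>\<^sub>F s in at_right 0. h s < 0" "D > 0 ==> \<forall>\<^sub>F s in at_right 0. h s > 0"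
proof -
 obtain r where r: "r > 0" "!!s. \<bar>s\<bar> < r ==> (h has_real_derivative h' s) (at s)"
 using d unfolding eventually_nhds_metric by (auto simp: dist_real_def)
 show "\<forall>\<^sub>F s in at_right 0. h s < 0" if D: "D < 0"
 proof -
 obtain d where d: "d > 0" "!!s. 0 < s ==> s < d ==> h' s < 0"
 using DERIV_neg_dec_right[OF d2 D] h0 by auto
 show ?thesis unfolding eventually_at_right_field
 proof (intro exI[of _ "min r d"] conjI allI impI)
 fix s assume s: "0 < s" "s < min r d"
 obtain z where "0 < z" "z < s" "h s - h 0 = (s - 0) * h' z" using MVT2[of 0 s h h'] s r by auto
 then show "h s < 0" using d(2)[of z] s h0 by (simp add: mult_pos_neg)
 qed (use r d in auto)
 qed
 show "\<forall>\<^sub>F s in at_right 0. h s > 0" if D: "D > 0"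
 proof -
 obtain d where d: "d > 0" "!!s. 0 < s ==> s < d ==> h' s > 0"
 using DERIV_pos_inc_right[OF d2 D] h0 by auto
 show ?thesis unfolding eventually_at_right_field
 proof (intro exI[of _ "min r d"] conjI allI impI)
 fix s assume s: "0 < s" "s < min r d"
 obtain z where "0 < z" "z < s" "h s - h 0 = (s - 0) * h' z" using MVT2[of 0 s h h'] s r by auto
 then show "h s > 0" using d(2)[of z] s h0 by simp
 qed (use r d in auto)
 qed
qed

text \<open>Along the parabola the first derivative of \<open>f\<close> vanishes at \<open>q\<close>
  and the second is the Hessian at \<open>v\<close> minus \<open>k\<close> times the slope along
  \<open>e\<close>. All later comparisons of curvatures are made by moving one such parabola from
  one surface to another.\<close>

lemma parabola_sign:
 fixes f :: "'a::euclidean_space => real"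
 assumes U: "open U" and f: "smooth_on U f" and q: "q \<in> U" "f q = 0" and v: "gradient f q *. v = 0"
 shows "nderiv [v, v] f q < k * (gradient f q *. e) ==> \<forall>\<^sub>F s in at_right 0. f (q + s *# v - (k * s\<^sup>2 / 2) *# e) < 0"
 "nderiv [v, v] f q > k * (gradient f q *. e) ==> \<forall>\<^sub>F s in at_right 0. f (q + s *# v - (k * s\<^sup>2 / 2) *# e) > 0"
proof -
 define g where "g s = q + s *# v - (k * s\<^sup>2 / 2) *# e" for s
 define g' where "g' s = v - (k * s) *# e" for s
 have g: "(g has_vector_derivative g' s) (at s)" for s
 unfolding g_def[abs_def] g'_def has_vector_derivative_def
 by (auto intro!: derivative_eq_intros simp: algebra_simps)
 have g2: "(g' has_vector_derivative (- (k *# e))) (at 0)"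
 unfolding g'_def[abs_def] has_vector_derivative_def
 by (auto intro!: derivative_eq_intros simp: algebra_simps)
 have g0: "g 0 = q" "g' 0 = v" by (simp_all add: g_def g'_def)
 have "isCont g 0" using g by (rule has_vector_derivative_continuous)
 then have "(g \<longlongrightarrow> g 0) (nhds 0)" unfolding isCont_def tendsto_at_iff_tendsto_nhds .
 then have "(g \<longlongrightarrow> q) (nhds 0)" by (simp only: g0)
 then have "\<forall>\<^sub>F s in nhds 0. g s \<in> U"
 using topological_tendstoD[OF _ U q(1)] by blast
 then have d: "\<forall>\<^sub>F s in nhds 0. ((%s. f (g s)) has_real_derivative nderiv [g' s] f (g s)) (at s)"
 by eventually_elim (use nderiv_curve[OF f g, of _ "[]"] in simp)
 have d2: "((%s. nderiv [g' s] f (g s)) has_real_derivative (nderiv [v, v] f q + gradient f q *. - (k *# e))) (at 0)"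
 using second_deriv_curve[where g=g and g'=g', OF U f g g2] q g0 by (simp only:)
 have z: "f (g 0) = 0" "nderiv [g' 0] f (g 0) = 0"
 unfolding g0 using q v gradient_smooth[OF f q(1), of v] by (simp_all del: nderiv.simps)
 note S = deriv_sign_second[where h="%s. f (g s)", OF d z d2]
 show "nderiv [v, v] f q < k * (gradient f q *. e) ==> \<forall>\<^sub>F s in at_right 0. f (q + s *# v - (k * s\<^sup>2 / 2) *# e) < 0"
 using S(1) unfolding g_def by (simp del: nderiv.simps)
 show "nderiv [v, v] f q > k * (gradient f q *. e) ==> \<forall>\<^sub>F s in at_right 0. f (q + s *# v - (k * s\<^sup>2 / 2) *# e) > 0"
 using S(2) unfolding g_def by (simp del: nderiv.simps)
qed

text \<open>Differentiating \<open>f (g s) = 0\<close> twice expresses the Hessian along the curve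
  by its acceleration; so curvatures can be read off from curves known to lie in the
  surface.\<close>

lemma nderiv_curve_on_level:
 fixes f :: "'a::euclidean_space => real"
 assumes U: "open U" and f: "smooth_on U f" and g: "!!s. (g has_vector_derivative g' s) (at s)" "(g' has_vector_derivative b) (at 0)"
 and p: "g 0 \<in> U" and z: "\<forall>\<^sub>F s in nhds 0. f (g s) = 0"
 shows "gradient f (g 0) *. g' 0 = 0" "nderiv [g' 0, g' 0] f (g 0) = - (gradient f (g 0) *. b)"
proof -
 have "isCont g 0" using g(1) by (rule has_vector_derivative_continuous)
 then have ev: "\<forall>\<^sub>F s in nhds 0. g s \<in> U"
 using topological_tendstoD[of g "g 0" "nhds 0" U] U p by (simp add: isCont_def tendsto_at_iff_tendsto_nhds)
 have "\<forall>\<^sub>F s in nhds 0. nderiv [g' s] f (g s) = 0"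
 using ev eventually_eventually[THEN iffD2, OF z]
 proof eventually_elim
 case (elim s)
 have "((%s. f (g s)) has_real_derivative nderiv [g' s] f (g s)) (at s)"
 using nderiv_curve[OF f g(1) elim(1), of "[]"] by simp
 moreover have "((%s. f (g s)) has_real_derivative 0) (at s)"
 using DERIV_cong_ev[OF refl elim(2) refl] by simp
 ultimately show ?case by (rule DERIV_unique)
 qed
 then have z': "\<forall>\<^sub>F s in nhds 0. nderiv [g' s] f (g s) = 0" .
 show "gradient f (g 0) *. g' 0 = 0"
 using eventually_nhds_x_imp_x[OF z'] gradient_smooth[OF f p, of "g' 0"] by (simp del: nderiv.simps)
 have "((%s. nderiv [g' s] f (g s)) has_real_derivative 0) (at 0)"
 using DERIV_cong_ev[OF refl z' refl] by (simp del: nderiv.simps)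
 from DERIV_unique[OF second_deriv_curve[where g=g and g'=g', OF U f g(1) g(2) p] this]
 show "nderiv [g' 0, g' 0] f (g 0) = - (gradient f (g 0) *. b)" by linarith
qed

section \<open>Space-time charts of mean curvature flows\<close>

text \<open>\<open>smooth_mcf\<close> without \<open>mean_curv\<close>: the gradient norm times
  \<open>H\<close> is the trace of the Hessian over the tangent plane, whichever orthonormal frame
  is used. Comparison and change of coordinates then concern derivatives of \<open>F\<close>
  only.\<close>

definition mcf_chart :: "real set => (real => R3 set) => (R3 \<times> real) set => (R3 \<times> real => real) => bool" where
 "mcf_chart I K W F \<longleftrightarrow> open W & smooth_on W F &
 (ALL x s. (x, s) \<in> W & s \<in> I --> (x \<in> K s \<longleftrightarrow> F (x, s) <= 0) &
 (F (x, s) = 0 --> gradient (%y. F (y, s)) x ~= 0 &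
 (ALL e1 e2 e m. orthoframe e1 e2 e & gradient (%y. F (y, s)) x = m *# e -->
 nderiv [(0, 1)] F (x, s) = nderiv [(e1, 0), (e1, 0)] F (x, s) + nderiv [(e2, 0), (e2, 0)] F (x, s))))"

lemma bounded_linear_Pair0: "bounded_linear (%y::'a::real_normed_vector. (y, 0::'b::real_normed_vector))"
 by (rule bounded_linear_intro[of _ 1]) (auto simp: norm_Pair)

lemma slice_smooth:
 fixes F :: "R3 \<times> real => real"
 assumes W: "open W" and F: "smooth_on W F"
 shows "open {y. (y, s) \<in> W}" "smooth_on {y. (y, s) \<in> W} (%y. F (y, s))"
 "(y, s) \<in> W ==> nderiv vs (%y. F (y, s)) y = nderiv (map (%v. (v, 0)) vs) F (y, s)"
proof -
 have e: "(y, s) = (y, 0) + (0, s)" for y :: R3 by simp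
 have o: "open ((%y. (y, s)) -` W)" by (intro open_vimage W continuous_intros)
 then show "open {y. (y, s) \<in> W}" by (simp add: vimage_def)
 show "smooth_on {y. (y, s) \<in> W} (%y. F (y, s))"
 using smooth_on_affine[OF bounded_linear_Pair0 W F, of "(0, s)"] by (simp add: vimage_def)
 show "(y, s) \<in> W ==> nderiv vs (%y. F (y, s)) y = nderiv (map (%v. (v, 0)) vs) F (y, s)"
 using nderiv_affine[OF bounded_linear_Pair0 W F, of y "(0, s)" vs] by simp
qed

lemma slice_deriv:
 fixes F :: "R3 \<times> real => real"
 assumes "smooth_on W F" "(x, s) \<in> W"
 shows "((%tax. F (x, tax)) has_real_derivative nderiv [(0, 1)] F (x, s)) (at s)"
proof -
 have "((%tax. (x, tax)) has_vector_derivative (0, 1)) (at s)"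
 unfolding has_vector_derivative_def by (auto intro!: derivative_eq_intros)
 from nderiv_curve[OF assms(1) this assms(2), of "[]"] show ?thesis by simp
qed

lemma slice_local_def:
 fixes F :: "R3 \<times> real => real"
 assumes W: "open W" "smooth_on W F" "(x, s) \<in> W" and K: "!!y. (y, s) \<in> W ==> y \<in> K \<longleftrightarrow> F (y, s) <= 0"
 and g: "gradient (%y. F (y, s)) x ~= 0"
 obtains U where "x \<in> U" "local_def K U (%y. F (y, s))" "U <= {y. (y, s) \<in> W}"
proof -
 note S = slice_smooth[OF W(1,2), where s=s]
 have "isCont (gradient (%y. F (y, s))) x" by (rule continuous_gradient[OF S(1,2)]) (use W in simp)
 then have "\<forall>\<^sub>F y in nhds x. gradient (%y. F (y, s)) y ~= 0"
 using g by (intro tendsto_imp_eventually_ne) (simp_all add: isCont_def tendsto_at_iff_tendsto_nhds)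
 then obtain V where V: "open V" "x \<in> V" "!!y. y \<in> V ==> gradient (%y. F (y, s)) y ~= 0" unfolding eventually_nhds by blast
 show ?thesis
 proof (rule that[of "V \<inter> {y. (y, s) \<in> W}"])
 show "local_def K (V \<inter> {y. (y, s) \<in> W}) (%y. F (y, s))"
 unfolding local_def_def using V S K by (auto intro: smooth_on_subset)
 qed (use V W in auto)
qed

lemma slice_mean_curv:
 fixes F :: "R3 \<times> real => real"
 assumes W: "open W" "smooth_on W F" "(x, s) \<in> W" and K: "!!y. (y, s) \<in> W ==> y \<in> K \<longleftrightarrow> F (y, s) <= 0"
 and z: "F (x, s) = 0" and g: "gradient (%y. F (y, s)) x ~= 0"
 and fr: "orthoframe e1 e2 e" "gradient (%y. F (y, s)) x = m *# e"
 shows "norm (gradient (%y. F (y, s)) x) * mean_curv K x = nderiv [(e1, 0), (e1, 0)] F (x, s) + nderiv [(e2, 0), (e2, 0)] F (x, s)"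
proof -
 obtain U where U: "x \<in> U" "local_def K U (%y. F (y, s))" "U <= {y. (y, s) \<in> W}"
 by (rule slice_local_def[OF W K g])
 show ?thesis
 unfolding mean_curv_frame[OF U(2,1) z fr] slice_smooth(3)[OF W] using g by (simp del: nderiv.simps(2))
qed

lemma orthoframe_of:
 assumes "(g :: R3) ~= 0" obtains e1 e2 where "orthoframe e1 e2 (sgn g)" "g = norm g *# sgn g"
proof -
 have "norm (sgn g) = 1" using assms by (simp add: norm_sgn)
 then obtain e1 e2 where "orthoframe e1 e2 (sgn g)" by (rule orthoframe_exists)
 then show ?thesis using that assms by (simp add: sgn_div_norm)
qed

lemma smooth_mcf_iff: "smooth_mcf I K \<longleftrightarrow> (\<forall>t\<in>I. ALL p. EX W F. (p, t) \<in> W & mcf_chart I K W F)"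
proof -
 have "mcf_chart I K W F \<longleftrightarrow> open W & smooth_on W F &
 (ALL x s. (x, s) \<in> W & s \<in> I -->
 (x \<in> K s \<longleftrightarrow> F (x, s) <= 0) &
 (F (x, s) = 0 -->
 gradient (%y. F (y, s)) x ~= 0 &
 deriv (%tax. F (x, tax)) s =
 norm (gradient (%y. F (y, s)) x) * mean_curv (K s) x))" for W F
 proof (cases "open W & smooth_on W F & (ALL x s. (x, s) \<in> W & s \<in> I --> (x \<in> K s \<longleftrightarrow> F (x, s) <= 0))")
 case True
 have E: "(gradient (%y. F (y, s)) x ~= 0 &
 (ALL e1 e2 e m. orthoframe e1 e2 e & gradient (%y. F (y, s)) x = m *# e -->
 nderiv [(0, 1)] F (x, s) = nderiv [(e1, 0), (e1, 0)] F (x, s) + nderiv [(e2, 0), (e2, 0)] F (x, s)))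
 \<longleftrightarrow> gradient (%y. F (y, s)) x ~= 0 &
 deriv (%tax. F (x, tax)) s = norm (gradient (%y. F (y, s)) x) * mean_curv (K s) x"
 if xs: "(x, s) \<in> W" "s \<in> I" "F (x, s) = 0" for x s
 proof (cases "gradient (%y. F (y, s)) x = 0")
 case False
 have K: "!!y. (y, s) \<in> W ==> y \<in> K s \<longleftrightarrow> F (y, s) <= 0" using True xs by blast
 have d: "deriv (%tax. F (x, tax)) s = nderiv [(0, 1)] F (x, s)"
 using slice_deriv[of W F x s] True xs by (intro DERIV_imp_deriv) blast
 note M = slice_mean_curv[OF _ _ xs(1) K xs(3) False]
 obtain e1 e2 where fr: "orthoframe e1 e2 (sgn (gradient (%y. F (y, s)) x))"
 "gradient (%y. F (y, s)) x = norm (gradient (%y. F (y, s)) x) *# sgn (gradient (%y. F (y, s)) x)"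
 using orthoframe_of[OF False] by blast
 show ?thesis unfolding d
 proof (intro conj_cong refl iffI allI impI)
 assume "ALL e1 e2 e m. orthoframe e1 e2 e & gradient (%y. F (y, s)) x = m *# e -->
 nderiv [(0, 1)] F (x, s) = nderiv [(e1, 0), (e1, 0)] F (x, s) + nderiv [(e2, 0), (e2, 0)] F (x, s)"
 then show "nderiv [(0, 1)] F (x, s) = norm (gradient (%y. F (y, s)) x) * mean_curv (K s) x"
 using M[OF _ _ _ fr] True fr by (simp del: nderiv.simps(2)) blast
 next
 fix e1 e2 e m assume "nderiv [(0, 1)] F (x, s) = norm (gradient (%y. F (y, s)) x) * mean_curv (K s) x"
 "orthoframe e1 e2 e & gradient (%y. F (y, s)) x = m *# e"
 then show "nderiv [(0, 1)] F (x, s) = nderiv [(e1, 0), (e1, 0)] F (x, s) + nderiv [(e2, 0), (e2, 0)] F (x, s)"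
 using M[of e1 e2 e m] True by simp
 qed
 qed simp
 show ?thesis unfolding mcf_chart_def
 by (rule conj_cong[OF refl], rule conj_cong[OF refl], rule iff_allI, rule iff_allI, rule imp_cong[OF refl],
 rule conj_cong[OF refl], rule imp_cong[OF refl], rule E, erule conjunct1, erule conjunct2, assumption)
 next
 case False
 have "\<not> mcf_chart I K W F"
 proof
 assume "mcf_chart I K W F"
 then have "open W" "smooth_on W F" "ALL x s. (x, s) \<in> W & s \<in> I --> (x \<in> K s \<longleftrightarrow> F (x, s) <= 0)"
 unfolding mcf_chart_def by simp_all
 then show False using False by simp
 qed
 moreover have "\<not> (open W & smooth_on W F &
 (ALL x s. (x, s) \<in> W & s \<in> I -->
 (x \<in> K s \<longleftrightarrow> F (x, s) <= 0) &
 (F (x, s) = 0 -->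
 gradient (%y. F (y, s)) x ~= 0 &
 deriv (%tax. F (x, tax)) s =
 norm (gradient (%y. F (y, s)) x) * mean_curv (K s) x)))"
 proof
 assume A: "open W & smooth_on W F &
 (ALL x s. (x, s) \<in> W & s \<in> I -->
 (x \<in> K s \<longleftrightarrow> F (x, s) <= 0) &
 (F (x, s) = 0 -->
 gradient (%y. F (y, s)) x ~= 0 &
 deriv (%tax. F (x, tax)) s =
 norm (gradient (%y. F (y, s)) x) * mean_curv (K s) x))"
 then have "ALL x s. (x, s) \<in> W & s \<in> I --> (x \<in> K s \<longleftrightarrow> F (x, s) <= 0)" by simp
 with A show False using False by simp
 qed
 ultimately show ?thesis by (simp only:)
 qed
 then show ?thesis unfolding smooth_mcf_def by (simp only: conj_left_commute[of "_ \<in> _" "open _"])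
qed

lemma mcf_chartE:
 assumes K: "smooth_mcf I K" "t \<in> I"
 obtains W F where "(p, t) \<in> W" "open W" "smooth_on W F"
 "!!x s. (x, s) \<in> W ==> s \<in> I ==> x \<in> K s \<longleftrightarrow> F (x, s) <= 0"
 "!!x s. (x, s) \<in> W ==> s \<in> I ==> F (x, s) = 0 ==> gradient (%y. F (y, s)) x ~= 0"
 "!!x s e1 e2 e m. (x, s) \<in> W ==> s \<in> I ==> F (x, s) = 0 ==> orthoframe e1 e2 e ==> gradient (%y. F (y, s)) x = m *# e ==>
 nderiv [(0, 1)] F (x, s) = nderiv [(e1, 0), (e1, 0)] F (x, s) + nderiv [(e2, 0), (e2, 0)] F (x, s)"
proof -
 obtain W F where WF: "(p, t) \<in> W" "mcf_chart I K W F" using K unfolding smooth_mcf_iff by meson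
 show ?thesis by (rule that[OF WF(1)]) (use WF(2) in \<open>unfold mcf_chart_def, blast+\<close>)
qed

lemma mcf_chartE':
 assumes K: "smooth_mcf I K" "t \<in> I"
 obtains W F where "(p, t) \<in> W" "open W" "smooth_on W F"
 "!!x s. (x, s) \<in> W ==> s \<in> I ==> x \<in> K s \<longleftrightarrow> F (x, s) <= 0"
 "!!x s. (x, s) \<in> W ==> s \<in> I ==> F (x, s) = 0 ==> gradient (%y. F (y, s)) x ~= 0"
 by (rule mcf_chartE[OF K, of p]) (rule that)

lemma chart_frontier:
 fixes F :: "R3 \<times> real => real"
 assumes W: "open W" "smooth_on W F" and x: "(x, s) \<in> W"
 and K: "!!y. (y, s) \<in> W ==> y \<in> K \<longleftrightarrow> F (y, s) <= 0"
 and g: "F (x, s) = 0 ==> gradient (%y. F (y, s)) x ~= 0"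
 shows "x \<in> frontier K \<longleftrightarrow> F (x, s) = 0"
proof -
 note S = slice_smooth[OF W, where s=s]
 have xs: "x \<in> {y. (y, s) \<in> W}" using x by simp
 consider "F (x, s) = 0" | "F (x, s) < 0" | "F (x, s) > 0" by linarith
 then show ?thesis
 proof cases
 case 1
 obtain U where U: "x \<in> U" "local_def K U (%y. F (y, s))" "U <= {y. (y, s) \<in> W}"
 by (rule slice_local_def[OF W x K g[OF 1]])
 show ?thesis using frontier_local_def[OF U(2,1)] by simp
 next
 case 2
 obtain r where r: "r > 0" "!!y. dist y x < r ==> y \<in> {y. (y, s) \<in> W} & F (y, s) < 0"
 using smooth_neg_nbhd[OF S(1,2) xs 2] by metis
 have "ball x r <= K"
 proof
 fix y assume "y \<in> ball x r"
 then show "y \<in> K" using r(2)[of y] K[of y] by (simp add: dist_commute)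
 qed
 then have "x \<in> interior K" using r(1) mem_interior by metis
 then show ?thesis using 2 by (simp add: frontier_def)
 next
 case 3
 obtain r where r: "r > 0" "!!y. dist y x < r ==> y \<in> {y. (y, s) \<in> W} & F (y, s) > 0"
 using smooth_pos_nbhd[OF S(1,2) xs 3] by metis
 have "y \<notin> K" if "dist y x < r" for y using r(2)[OF that] K[of y] by simp
 then have "x \<notin> closure K" using r(1) unfolding closure_approachable by metis
 then show ?thesis using 3 by (simp add: frontier_def)
 qed
qed

lemma chart_mean_curv:
 fixes F :: "R3 \<times> real => real"
 assumes W: "open W" "smooth_on W F" and x: "(x, s) \<in> W"
 and K: "!!y. (y, s) \<in> W ==> y \<in> K \<longleftrightarrow> F (y, s) <= 0"
 and z: "F (x, s) = 0" and g: "gradient (%y. F (y, s)) x ~= 0"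
 and eq: "!!e1 e2 e m. orthoframe e1 e2 e ==> gradient (%y. F (y, s)) x = m *# e ==>
 nderiv [(0, 1)] F (x, s) = nderiv [(e1, 0), (e1, 0)] F (x, s) + nderiv [(e2, 0), (e2, 0)] F (x, s)"
 shows "nderiv [(0, 1)] F (x, s) = norm (gradient (%y. F (y, s)) x) * mean_curv K x"
proof -
 obtain e1 e2 where fr: "orthoframe e1 e2 (sgn (gradient (%y. F (y, s)) x))"
 "gradient (%y. F (y, s)) x = norm (gradient (%y. F (y, s)) x) *# sgn (gradient (%y. F (y, s)) x)"
 by (rule orthoframe_of[OF g])
 show ?thesis using eq[OF fr] slice_mean_curv[OF W x K z g fr] by (simp only:)
qed

lemma slice_gradient:
 fixes F :: "R3 \<times> real => real"
 assumes W: "open W" "smooth_on W F" "(x, s) \<in> W"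
 shows "gradient (%y. F (y, s)) x *. v = nderiv [(v, 0)] F (x, s)"
 using gradient_smooth[OF slice_smooth(2)[OF W(1,2)], of x s v] slice_smooth(3)[OF W(1,2) W(3), of "[v]"] W(3)
 by (simp del: nderiv.simps)

section \<open>Closedness, persistence, symmetries and speed of smooth flows\<close>

lemma closed_mcf:
 assumes "smooth_mcf I K" "t \<in> I" shows "closed (K t)"
proof -
 have "frontier (K t) <= K t"
 proof
 fix x assume x: "x \<in> frontier (K t)"
 obtain W F where W: "(x, t) \<in> W" "open W" "smooth_on W F"
 "!!y s. (y, s) \<in> W ==> s \<in> I ==> y \<in> K s \<longleftrightarrow> F (y, s) <= 0"
 "!!y s. (y, s) \<in> W ==> s \<in> I ==> F (y, s) = 0 ==> gradient (%z. F (z, s)) y ~= 0"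
 by (rule mcf_chartE'[OF assms, of x]) (rule that)
 have "F (x, t) = 0" using chart_frontier[OF W(2,3,1) W(4)[OF _ assms(2)] W(5)[OF W(1) assms(2)]] x by blast
 then show "x \<in> K t" using W(4)[OF W(1) assms(2)] by simp
 qed
 then show ?thesis using frontier_subset_eq by blast
qed

lemma mcf_track_closed:
 assumes K: "smooth_mcf I K" and t: "t \<in> I" "!!n. tax n \<in> I" and X: "X ----> x" "tax ----> t"
 shows "(!!n. X n \<in> K (tax n)) ==> x \<in> K t" "(!!n. X n \<in> frontier (K (tax n))) ==> x \<in> frontier (K t)"
proof -
 obtain W F where W: "(x, t) \<in> W" "open W" "smooth_on W F"
 "!!y s. (y, s) \<in> W ==> s \<in> I ==> y \<in> K s \<longleftrightarrow> F (y, s) <= 0"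
 "!!y s. (y, s) \<in> W ==> s \<in> I ==> F (y, s) = 0 ==> gradient (%z. F (z, s)) y ~= 0"
 by (rule mcf_chartE'[OF K t(1), of x]) (rule that)
 have Xt: "(%n. (X n, tax n)) ----> (x, t)" by (intro tendsto_Pair X)
 have ev: "\<forall>\<^sub>F n in sequentially. (X n, tax n) \<in> W" by (rule topological_tendstoD[OF Xt W(2,1)])
 have "isCont F (x, t)" using continuous_nderiv[OF W(3,1), of "[]"] by simp
 then have lim: "(%n. F (X n, tax n)) ----> F (x, t)" by (rule isCont_tendsto_compose[OF _ Xt])
 show "x \<in> K t" if h: "!!n. X n \<in> K (tax n)"
 proof -
 have "\<forall>\<^sub>F n in sequentially. F (X n, tax n) <= 0"
 using ev
 proof eventually_elim
 case (elim n)
 show ?case using W(4)[OF elim t(2)] h[of n] by simp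
 qed
 then have "F (x, t) <= 0" using tendsto_upperbound[OF lim] by simp
 then show ?thesis using W(4)[OF W(1) t(1)] by simp
 qed
 show "x \<in> frontier (K t)" if h: "!!n. X n \<in> frontier (K (tax n))"
 proof -
 have "\<forall>\<^sub>F n in sequentially. F (X n, tax n) = 0"
 using ev
 proof eventually_elim
 case (elim n)
 show ?case using chart_frontier[OF W(2,3) elim W(4)[OF _ t(2)] W(5)[OF elim t(2)]] h[of n] by blast
 qed
 then have "(%n. F (X n, tax n)) ----> 0" by (rule tendsto_eventually)
 then have "F (x, t) = 0" using lim LIMSEQ_unique by blast
 then show ?thesis using chart_frontier[OF W(2,3,1) W(4)[OF _ t(1)] W(5)[OF W(1) t(1)]] by blast
 qed
qed

lemma eventually_dist_line:
 fixes x v :: "'a::real_normed_vector"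
 assumes "et > 0" shows "\<forall>\<^sub>F s in at_right 0. dist (x + s *# v) x < et"
proof -
 have "((%s. x + s *# v) \<longlongrightarrow> x + 0 *# v) (at_right 0)" by (intro tendsto_intros)
 then show ?thesis using tendstoD[OF _ assms] by fastforce
qed

text \<open>Near \<open>x\<close> there is a point with \<open>F < 0\<close>, and a strict sign
  persists for nearby times. At a frontier point there is also one with \<open>F > 0\<close>, and a
  connected ball containing both kinds meets the frontier.\<close>

lemma mcf_persist:
 assumes K: "smooth_mcf I K" and t: "t \<in> I" and x: "x \<in> K t" and et: "et > 0"
 shows "\<exists>thx>0. \<forall>s\<in>I. \<bar>s - t\<bar> < thx --> (\<exists>y\<in>K s. dist y x < et)"
 "x \<in> frontier (K t) ==> \<exists>thx>0. \<forall>s\<in>I. \<bar>s - t\<bar> < thx --> (\<exists>y\<in>frontier (K s). dist y x < et)"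
proof -
 obtain W F where W: "(x, t) \<in> W" "open W" "smooth_on W F"
 "!!y s. (y, s) \<in> W ==> s \<in> I ==> y \<in> K s \<longleftrightarrow> F (y, s) <= 0"
 "!!y s. (y, s) \<in> W ==> s \<in> I ==> F (y, s) = 0 ==> gradient (%z. F (z, s)) y ~= 0"
 by (rule mcf_chartE'[OF K t, of x]) (rule that)
 note S = slice_smooth[OF W(2,3), where s=t]
 have xt: "x \<in> {y. (y, t) \<in> W}" using W(1) by simp
 define g where "g = gradient (%z. F (z, t)) x"
 have gg: "g *. g > 0" if "F (x, t) = 0" using W(5)[OF W(1) t that] by (simp add: g_def)
 have neg: "EX z. dist z x < et & (z, t) \<in> W & F (z, t) < 0"
 proof (cases "F (x, t) < 0")
 case True then show ?thesis using W(1) et by (intro exI[of _ x]) simp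
 next
 case False
 then have z: "F (x, t) = 0" using x W(4)[OF W(1) t] by simp
 have "gradient (%z. F (z, t)) x *. (- g) < 0" using gg[OF z] by (simp add: g_def)
 then have "\<forall>\<^sub>F s in at_right 0. F (x + s *# (- g), t) < 0"
 using z by (intro eventually_descent[OF S(2) xt]) simp_all
 with eventually_line_in[OF S(1) xt, of "- g"] eventually_dist_line[OF et, of x "- g"]
 have "\<forall>\<^sub>F s in at_right 0. dist (x + s *# (- g)) x < et & (x + s *# (- g), t) \<in> W & F (x + s *# (- g), t) < 0"
 by eventually_elim simp
 then have "EX s. dist (x + s *# (- g)) x < et & (x + s *# (- g), t) \<in> W & F (x + s *# (- g), t) < 0"
 by (rule eventually_happens'[rotated]) simp
 then show ?thesis by (elim exE) (rule exI)
 qed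
 then obtain z where z: "dist z x < et" "(z, t) \<in> W" "F (z, t) < 0" by (elim exE conjE)
 obtain r where r: "r > 0" "!!p. dist p (z, t) < r ==> p \<in> W & F p < 0"
 by (rule smooth_neg_nbhd[OF W(2,3) z(2,3)]) (rule that)
 have zK: "z \<in> K s" if "s \<in> I" "\<bar>s - t\<bar> < r" for s
 proof -
 have "dist (z, s) (z, t) < r" using that(2) by (simp add: dist_Pair_Pair dist_real_def)
 from r(2)[OF this] show ?thesis using W(4)[OF _ that(1), of z] by simp
 qed
 show "\<exists>thx>0. \<forall>s\<in>I. \<bar>s - t\<bar> < thx --> (\<exists>y\<in>K s. dist y x < et)"
 using r(1) zK z(1) by (intro exI[of _ r] conjI ballI impI) (auto intro!: bexI[of _ z])
 assume fr: "x \<in> frontier (K t)"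
 then have F0: "F (x, t) = 0" using chart_frontier[OF W(2,3,1) W(4)[OF _ t] W(5)[OF W(1) t]] by blast
 have "gradient (%z. F (z, t)) x *. g > 0" using gg[OF F0] by (simp add: g_def)
 then have "\<forall>\<^sub>F s in at_right 0. F (x + s *# g, t) > 0"
 using F0 by (intro eventually_ascent[OF S(2) xt]) simp_all
 with eventually_line_in[OF S(1) xt, of g] eventually_dist_line[OF et, of x g]
 have "\<forall>\<^sub>F s in at_right 0. dist (x + s *# g) x < et & (x + s *# g, t) \<in> W & F (x + s *# g, t) > 0"
 by eventually_elim simp
 then have "EX s. dist (x + s *# g) x < et & (x + s *# g, t) \<in> W & F (x + s *# g, t) > 0"
 by (rule eventually_happens'[rotated]) simp
 then obtain z' where z': "dist z' x < et" "(z', t) \<in> W" "F (z', t) > 0" by (elim exE conjE) (rule that)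
 obtain r' where r': "r' > 0" "!!p. dist p (z', t) < r' ==> p \<in> W & F p > 0"
 by (rule smooth_pos_nbhd[OF W(2,3) z'(2,3)]) (rule that)
 have zK': "z' \<notin> K s" if "s \<in> I" "\<bar>s - t\<bar> < r'" for s
 proof -
 have "dist (z', s) (z', t) < r'" using that(2) by (simp add: dist_Pair_Pair dist_real_def)
 from r'(2)[OF this] show ?thesis using W(4)[OF _ that(1), of z'] by simp
 qed
 show "\<exists>thx>0. \<forall>s\<in>I. \<bar>s - t\<bar> < thx --> (\<exists>y\<in>frontier (K s). dist y x < et)"
 proof (intro exI[of _ "min r r'"] conjI ballI impI)
 fix s assume s: "s \<in> I" "\<bar>s - t\<bar> < min r r'"
 have "ball x et \<inter> K s ~= {}" "ball x et - K s ~= {}"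
 using zK[OF s(1)] zK'[OF s(1)] s(2) z(1) z'(1) by (auto simp: dist_commute)
 then have "ball x et \<inter> frontier (K s) ~= {}"
 by (intro connected_Int_frontier connected_ball)
 then show "\<exists>y\<in>frontier (K s). dist y x < et" by (auto simp: dist_commute)
 qed (use r r' in simp)
qed

text \<open>Parabolic scaling with a rigid motion. It is used with \<open>l = 1\<close> for
  translates of a flow, and with large \<open>l\<close> for shrinking a torus of fixed size to the
  scale at which the domain looks like a saddle.\<close>

lemma mcf_similarity:
 assumes K: "smooth_mcf I K" and Q: "orthogonal_transformation Q" and l: "l > 0"
 shows "smooth_mcf {t. l\<^sup>2 * t + d \<in> I} (%t. {x. l *# Q x + b \<in> K (l\<^sup>2 * t + d)})"
 unfolding smooth_mcf_iff
proof (intro ballI allI)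
 fix t p assume "t \<in> {t. l\<^sup>2 * t + d \<in> I}"
 then have t: "l\<^sup>2 * t + d \<in> I" by simp
 define A where "A z = (l *# Q (fst z), l\<^sup>2 * snd z)" for z :: "R3 \<times> real"
 define B where "B z = A z + (b, d)" for z
 have lQ: "linear Q" using Q by (simp add: orthogonal_transformation_def)
 have blA: "bounded_linear A"
 unfolding A_def[abs_def] using lQ
 by (intro bounded_linear_Pair bounded_linear_scaleR_right[THEN bounded_linear_compose] bounded_linear_mult_right[THEN bounded_linear_compose]
 bounded_linear_compose[OF lQ[unfolded linear_conv_bounded_linear]] bounded_linear_fst bounded_linear_snd)
 obtain W F where W: "(l *# Q p + b, l\<^sup>2 * t + d) \<in> W" "open W" "smooth_on W F"
 "!!y s. (y, s) \<in> W ==> s \<in> I ==> y \<in> K s \<longleftrightarrow> F (y, s) <= 0"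
 "!!y s. (y, s) \<in> W ==> s \<in> I ==> F (y, s) = 0 ==> gradient (%z. F (z, s)) y ~= 0"
 "!!x s e1 e2 e m. (x, s) \<in> W ==> s \<in> I ==> F (x, s) = 0 ==> orthoframe e1 e2 e ==> gradient (%y. F (y, s)) x = m *# e ==>
 nderiv [(0, 1)] F (x, s) = nderiv [(e1, 0), (e1, 0)] F (x, s) + nderiv [(e2, 0), (e2, 0)] F (x, s)"
 by (rule mcf_chartE[OF K t, of "l *# Q p + b"]) (rule that)
 define V where "V = B -` W"
 have BA: "B z = A z + (b, d)" for z by (simp add: B_def)
 have "continuous_on UNIV B" unfolding B_def[abs_def] by (intro continuous_on_add continuous_on_const linear_continuous_on blA)
 then have V: "open V" "smooth_on V (%z. F (B z))"
 using smooth_on_affine[OF blA W(2,3), of "(b, d)"] open_vimage[OF W(2)] unfolding V_def B_def[abs_def] by simp_all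
 have nd: "nderiv vs (%z. F (B z)) z = nderiv (map A vs) F (B z)" if "z \<in> V" for vs z
 using nderiv_affine[OF blA W(2,3), of z "(b, d)" vs] that unfolding V_def B_def by simp
 have Bxs: "B (x, s) = (l *# Q x + b, l\<^sup>2 * s + d)" for x s by (simp add: B_def A_def)
 have A1: "A (v, 0) = l *# (Q v, 0)" "A (0, 1) = l\<^sup>2 *# (0, 1)" for v
 using linear_0[OF lQ] by (simp_all add: A_def)
 have gr: "gradient (%y. F (B (y, s))) x *. v = l * (gradient (%y. F (y, l\<^sup>2 * s + d)) (l *# Q x + b) *. Q v)"
 if xs: "(x, s) \<in> V" for x s v
 proof -
 have iW: "(l *# Q x + b, l\<^sup>2 * s + d) \<in> W" using xs by (simp add: V_def Bxs)
 interpret bounded_linear "%v. nderiv [v] F (l *# Q x + b, l\<^sup>2 * s + d)" by (rule linear_nderiv[OF W(3) iW])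
 show ?thesis
 unfolding slice_gradient[OF V xs] nd[OF xs] slice_gradient[OF W(2,3) iW] by (simp only: list.map A1 Bxs scaleR real_scaleR_def)
 qed
 have "mcf_chart {t. l\<^sup>2 * t + d \<in> I} (%t. {x. l *# Q x + b \<in> K (l\<^sup>2 * t + d)}) V (%z. F (B z))"
 unfolding mcf_chart_def
 proof (intro conjI allI impI V; (elim conjE)?)
 fix x s assume xs: "(x, s) \<in> V" and s: "s \<in> {t. l\<^sup>2 * t + d \<in> I}"
 have iW: "(l *# Q x + b, l\<^sup>2 * s + d) \<in> W" using xs by (simp add: V_def Bxs)
 have sI: "l\<^sup>2 * s + d \<in> I" using s by simp
 show "(x \<in> {x. l *# Q x + b \<in> K (l\<^sup>2 * s + d)}) = (F (B (x, s)) <= 0)"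
 using W(4)[OF iW sI] by (simp add: Bxs)
 assume z: "F (B (x, s)) = 0"
 then have z': "F (l *# Q x + b, l\<^sup>2 * s + d) = 0" by (simp add: Bxs)
 let ?g = "gradient (%y. F (y, l\<^sup>2 * s + d)) (l *# Q x + b)"
 let ?g' = "gradient (%y. F (B (y, s))) x"
 have gn: "?g ~= 0" by (rule W(5)[OF iW sI z'])
 obtain u where u: "Q u = ?g" using orthogonal_transformation_surj[OF Q] by (metis surjD)
 have "?g' *. u ~= 0" unfolding gr[OF xs] u using gn l by simp
 then show "?g' ~= 0" by auto
 fix e1 e2 e m assume fr: "orthoframe e1 e2 e" and m: "?g' = m *# e"
 have Qi: "Q v *. Q w = v *. w" for v w using Q by (simp add: orthogonal_transformation_def)
 have fr': "orthoframe (Q e1) (Q e2) (Q e)" using fr by (simp add: orthoframe_def Qi)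
 have "?g *. Q e1 = 0" "?g *. Q e2 = 0"
 using gr[OF xs, of e1] gr[OF xs, of e2] l orthoframeD[OF fr] unfolding m by simp_all
 then have "?g = (?g *. Q e) *# Q e" using orthoframe_expand[OF fr', of ?g] by simp
 note eq = W(6)[OF iW sI z' fr' this]
 have l1: "nderiv [c *# v] F (l *# Q x + b, l\<^sup>2 * s + d) = c * nderiv [v] F (l *# Q x + b, l\<^sup>2 * s + d)" for c v
 proof -
 interpret bounded_linear "%v. nderiv [v] F (l *# Q x + b, l\<^sup>2 * s + d)" by (rule linear_nderiv[OF W(3) iW])
 show ?thesis by (simp add: scaleR del: nderiv.simps)
 qed
 have l2: "nderiv [c *# v, c *# v] F (l *# Q x + b, l\<^sup>2 * s + d) = c\<^sup>2 * nderiv [v, v] F (l *# Q x + b, l\<^sup>2 * s + d)" for c v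
 proof -
 interpret a: bounded_linear "%u. nderiv [u, c *# w] F (l *# Q x + b, l\<^sup>2 * s + d)" for w by (rule linear_nderiv[OF W(3) iW])
 interpret b: bounded_linear "%w. nderiv [u, w] F (l *# Q x + b, l\<^sup>2 * s + d)" for u by (rule linear_nderiv2[OF W(2,3) iW])
 have "nderiv [c *# v, c *# v] F (l *# Q x + b, l\<^sup>2 * s + d) = c * nderiv [v, c *# v] F (l *# Q x + b, l\<^sup>2 * s + d)"
 by (rule a.scaleR[unfolded real_scaleR_def])
 also have "nderiv [v, c *# v] F (l *# Q x + b, l\<^sup>2 * s + d) = c * nderiv [v, v] F (l *# Q x + b, l\<^sup>2 * s + d)"
 by (rule b.scaleR[unfolded real_scaleR_def])
 finally show ?thesis by (simp add: power2_eq_square del: nderiv.simps)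
 qed
 show "nderiv [(0, 1)] (%z. F (B z)) (x, s) = nderiv [(e1, 0), (e1, 0)] (%z. F (B z)) (x, s) + nderiv [(e2, 0), (e2, 0)] (%z. F (B z)) (x, s)"
 unfolding nd[OF xs] list.map A1 Bxs l1 l2 eq by (simp only: distrib_left)
 qed
 moreover have "(p, t) \<in> V" using W(1) by (simp add: V_def Bxs)
 ultimately show "EX W F. (p, t) \<in> W & mcf_chart {t. l\<^sup>2 * t + d \<in> I} (%t. {x. l *# Q x + b \<in> K (l\<^sup>2 * t + d)}) W F"
 by (intro exI conjI)
qed

lemma smooth_mcf_subset: "smooth_mcf I K ==> J <= I ==> smooth_mcf J K"
proof -
 assume K: "smooth_mcf I K" and J: "J <= I"
 show "smooth_mcf J K" unfolding smooth_mcf_iff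
 proof (intro ballI allI)
 fix t p assume "t \<in> J"
 then obtain W F where WF: "(p, t) \<in> W" "mcf_chart I K W F" using K J unfolding smooth_mcf_iff by (meson subsetD)
 have "mcf_chart J K W F" using WF(2) subsetD[OF J] unfolding mcf_chart_def by (simp del: nderiv.simps)
 then show "EX W F. (p, t) \<in> W & mcf_chart J K W F" using WF(1) by (intro exI conjI)
 qed
qed

lemma mcf_translate:
 assumes "smooth_mcf I K"
 shows "smooth_mcf {t. t - tax \<in> I} (%t. (+) v ` K (t - tax))"
proof -
 have "(+) v ` K s = {x. 1 *# id x + (- v) \<in> K s}" for s
 by (auto simp: image_iff algebra_simps) (metis add.commute add_diff_cancel diff_add_cancel)
 then show ?thesis
 using mcf_similarity[OF assms orthogonal_transformation_id, of 1 "- tax" "- v"] by simp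
qed

lemma chart_rate:
 assumes K: "smooth_mcf I K" and t: "t \<in> I"
 obtains W F where "(p, t) \<in> W" "open W" "smooth_on W F"
 "!!x s. (x, s) \<in> W ==> s \<in> I ==> x \<in> K s \<longleftrightarrow> F (x, s) <= 0"
 "!!x s. (x, s) \<in> W ==> s \<in> I ==> x \<in> frontier (K s) \<longleftrightarrow> F (x, s) = 0"
 "!!x s. (x, s) \<in> W ==> s \<in> I ==> F (x, s) = 0 ==> gradient (%y. F (y, s)) x ~= 0"
 "!!x s. (x, s) \<in> W ==> s \<in> I ==> F (x, s) = 0 ==> nderiv [(0, 1)] F (x, s) = norm (gradient (%y. F (y, s)) x) * mean_curv (K s) x"
proof -
 obtain W F where W: "(p, t) \<in> W" "open W" "smooth_on W F"
 "!!y s. (y, s) \<in> W ==> s \<in> I ==> y \<in> K s \<longleftrightarrow> F (y, s) <= 0"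
 "!!y s. (y, s) \<in> W ==> s \<in> I ==> F (y, s) = 0 ==> gradient (%z. F (z, s)) y ~= 0"
 "!!x s e1 e2 e m. (x, s) \<in> W ==> s \<in> I ==> F (x, s) = 0 ==> orthoframe e1 e2 e ==> gradient (%y. F (y, s)) x = m *# e ==>
 nderiv [(0, 1)] F (x, s) = nderiv [(e1, 0), (e1, 0)] F (x, s) + nderiv [(e2, 0), (e2, 0)] F (x, s)"
 by (rule mcf_chartE[OF K t, of p]) (rule that)
 show ?thesis
 proof (rule that[OF W(1-4) _ W(5)])
 fix x s assume xs: "(x, s) \<in> W" "s \<in> I"
 show "x \<in> frontier (K s) \<longleftrightarrow> F (x, s) = 0"
 by (rule chart_frontier[OF W(2,3) xs(1) W(4)[OF _ xs(2)] W(5)[OF xs]])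
 assume z: "F (x, s) = 0"
 show "nderiv [(0, 1)] F (x, s) = norm (gradient (%y. F (y, s)) x) * mean_curv (K s) x"
 by (rule chart_mean_curv[OF W(2,3) xs(1) W(4)[OF _ xs(2)] z W(5)[OF xs z] W(6)[OF xs z]])
 qed
qed

text \<open>The frontier recedes faster than \<open>h\<close>, so backward in time a point may
  travel with any velocity of length at most \<open>h\<close> without leaving the domain. At the
  supremum \<open>m\<close> of the times spent outside, the path is on the frontier and
  \<open>F\<close> strictly increases along it, so \<open>F\<close> is negative just before
  \<open>m\<close>, a contradiction.\<close>

lemma mcf_speed:
 assumes K: "smooth_mcf I K" and I: "is_interval I" and H: "!!s z. s \<in> I ==> z \<in> frontier (K s) ==> mean_curv (K s) z > h"
 and st: "s \<in> I" "t \<in> I" "s <= t" and u: "norm u <= h" and x: "x \<in> K t"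
 shows "x + (t - s) *# u \<in> K s"
proof (rule ccontr)
 assume neg: "x + (t - s) *# u \<notin> K s"
 define y where "y r = x + (t - r) *# u" for r
 define A where "A = {r. s <= r & r <= t & y r \<notin> K r}"
 have inI: "r \<in> I" if "s <= r" "r <= t" for r using I st that unfolding is_interval_1 by blast
 have sA: "s \<in> A" using neg st by (simp add: A_def y_def)
 have bA: "bdd_above A" by (rule bdd_aboveI[of _ t]) (simp add: A_def)
 define m where "m = Sup A"
 have sm: "s <= m" unfolding m_def by (rule cSup_upper[OF sA bA])
 have mt: "m <= t" unfolding m_def by (rule cSup_least) (use sA in \<open>auto simp: A_def\<close>)
 have mI: "m \<in> I" by (rule inI[OF sm mt])
 have above: "y r \<in> K r" if "m < r" "r <= t" for r

 proof (rule ccontr)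
 assume "y r \<notin> K r"
 then have "r \<in> A" using that sm by (simp add: A_def)
 from cSup_upper[OF this bA] show False using that(1) by (simp add: m_def)
 qed
 have yt: "y t = x" by (simp add: y_def)
 have "m \<notin> A"
 proof (cases "m = t")
 case True then show ?thesis using x yt by (simp add: A_def)
 next
 case False
 define tax where "tax n = m + (t - m) / real (Suc n)" for n
 have tax: "m < tax n" "tax n <= t" for n
 proof -
 have p: "t - m > 0" using False mt by simp
 then show "m < tax n" by (simp add: tax_def)
 have "(t - m) / real (Suc n) <= (t - m) / 1" using p by (intro divide_left_mono) auto
 then show "tax n <= t" by (simp add: tax_def)
 qed
 have lim: "tax ----> m"
 proof -
 have "tax ----> m + 0" unfolding tax_def by (intro tendsto_add tendsto_const LIMSEQ_Suc[OF lim_const_over_n])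
 then show ?thesis by simp
 qed
 have "y m \<in> K m"
 proof (rule mcf_track_closed(1)[OF K mI])
 show "tax n \<in> I" for n using inI tax[of n] sm by (meson less_imp_le order_trans)
 show "(%n. y (tax n)) ----> y m" unfolding y_def by (intro tendsto_intros lim)
 show "tax ----> m" by (rule lim)
 show "y (tax n) \<in> K (tax n)" for n by (rule above[OF tax])
 qed
 then show ?thesis by (simp add: A_def)
 qed
 then have ymK: "y m \<in> K m" using sm mt by (simp add: A_def)
 obtain W F where W: "(y m, m) \<in> W" "open W" "smooth_on W F"
 "!!x s. (x, s) \<in> W ==> s \<in> I ==> x \<in> K s \<longleftrightarrow> F (x, s) <= 0"
 "!!x s. (x, s) \<in> W ==> s \<in> I ==> x \<in> frontier (K s) \<longleftrightarrow> F (x, s) = 0"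
 "!!x s. (x, s) \<in> W ==> s \<in> I ==> F (x, s) = 0 ==> gradient (%y. F (y, s)) x ~= 0"
 "!!x s. (x, s) \<in> W ==> s \<in> I ==> F (x, s) = 0 ==> nderiv [(0, 1)] F (x, s) = norm (gradient (%y. F (y, s)) x) * mean_curv (K s) x"
 by (rule chart_rate[OF K mI, of "y m"]) (rule that)
 define phx where "phx r = F (y r, r)" for r
 have yd: "((%r. (y r, r)) has_vector_derivative (- u, 1)) (at m)"
 unfolding y_def has_vector_derivative_def by (auto intro!: derivative_eq_intros simp: algebra_simps)
 have phd: "(phx has_real_derivative nderiv [(- u, 1)] F (y m, m)) (at m)"
 using nderiv_curve[OF W(3) yd W(1), of "[]"] unfolding phx_def[abs_def] by (simp del: nderiv.simps(2))
 have "isCont (%r. (y r, r)) m" using yd by (rule has_vector_derivative_continuous)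
 then have "((%r. (y r, r)) \<longlongrightarrow> (y m, m)) (nhds m)"
 using tendsto_at_iff_tendsto_nhds[of "%r. (y r, r)" m] by (simp add: isCont_def)
 then have "\<forall>\<^sub>F r in nhds m. (y r, r) \<in> W" by (rule topological_tendstoD[OF _ W(2,1)])
 then obtain d where d: "d > 0" "!!r. \<bar>r - m\<bar> < d ==> (y r, r) \<in> W" unfolding eventually_nhds_metric dist_real_def by blast
 have phm: "phx m <= 0" using W(4)[OF W(1) mI] ymK by (simp add: phx_def)
 \<comment> \<open>\<open>m\<close> is not in \<open>A\<close>, so outside times accumulate at
   \<open>m\<close> strictly from below.\<close>
 have close: "EX r. m - e < r & r < m & s <= r & phx r > 0" if "e > 0" for e
 proof -
 have "m - min e d < Sup A" using that d(1) by (simp add: m_def)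
 then obtain r where r: "r \<in> A" "m - min e d < r" using less_cSup_iff[OF _ bA] sA by blast
 have rm: "r <= m" unfolding m_def by (rule cSup_upper[OF r(1) bA])
 have "r ~= m" using r(1) \<open>m \<notin> A\<close> by blast
 then have "r < m" using rm by simp
 moreover have "(y r, r) \<in> W" using d(2)[of r] r(2) \<open>r < m\<close> by auto
 then have "phx r > 0" using W(4)[OF _ inI, of "y r" r] r(1) by (simp add: phx_def A_def)
 ultimately show ?thesis using r by (intro exI[of _ r]) (auto simp: A_def)
 qed
 have "phx m = 0"
 proof (rule ccontr)
 assume "phx m ~= 0"
 then have "phx m < 0" using phm by simp
 moreover have "isCont phx m" using phd by (rule DERIV_isCont)
 ultimately have "\<forall>\<^sub>F r in at m. phx r < 0" unfolding isCont_def by (rule order_tendstoD(2)[rotated])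
 then obtain e where e: "e > 0" "!!r. r ~= m ==> \<bar>r - m\<bar> < e ==> phx r < 0" unfolding eventually_at dist_real_def by blast
 obtain r where "m - e < r" "r < m" "phx r > 0" using close[OF e(1)] by blast
 then show False using e(2)[of r] by simp
 qed
 then have z: "F (y m, m) = 0" by (simp add: phx_def)
 let ?g = "gradient (%z. F (z, m)) (y m)"
 have g: "?g ~= 0" by (rule W(6)[OF W(1) mI z])
 have Hm: "mean_curv (K m) (y m) > h" by (rule H[OF mI]) (use W(5)[OF W(1) mI] z in simp)
 interpret bl: bounded_linear "%v. nderiv [v] F (y m, m)" by (rule linear_nderiv[OF W(3,1)])
 have "nderiv [(- u, 1)] F (y m, m) = nderiv [(- u, 0)] F (y m, m) + nderiv [(0, 1)] F (y m, m)"
 using bl.add[of "(- u, 0)" "(0, 1)"] by (simp del: nderiv.simps)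
 also have "... = ?g *. (- u) + norm ?g * mean_curv (K m) (y m)"
 unfolding slice_gradient[OF W(2,3,1)] W(7)[OF W(1) mI z] ..
 also have "... > 0"
 proof -
 have "?g *. u <= norm ?g * norm u" by (rule norm_cauchy_schwarz)
 also have "... <= norm ?g * h" by (intro mult_left_mono u) simp
 also have "... < norm ?g * mean_curv (K m) (y m)" using g Hm by simp
 finally show ?thesis by simp
 qed
 finally obtain e where e: "e > 0" "!!h. 0 < h ==> h < e ==> phx (m - h) < phx m"
 using DERIV_pos_inc_left[OF phd] by blast
 obtain r where "m - e < r" "r < m" "phx r > 0" using close[OF e(1)] by blast
 then show False using e(2)[of "m - r"] \<open>phx m = 0\<close> by simp
qed

lemma sphere_mcf:
 assumes R: "R\<^sup>2 > 4 * (b - a)"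
 shows "smooth_mcf {a..b} (%t. cball c (sqrt (R\<^sup>2 - 4 * (t - a))))"
proof -
 define F :: "R3 \<times> real => real" where "F z = (fst z - c) *. (fst z - c) + 4 * (snd z - a) - R\<^sup>2" for z
 have d1: "(F has_derivative (%w. 2 * ((fst z - c) *. fst w) + 4 * snd w)) (at z)" for z
 unfolding F_def[abs_def]
 by (rule has_derivative_eq_rhs, (rule derivative_intros)+) (simp add: fun_eq_iff inner_commute)
 have n1: "nderiv [w] F = (%z. 2 * ((fst z - c) *. fst w) + 4 * snd w)" for w
 by (rule ext) (simp add: frechet_derivative_at[OF d1, symmetric])
 have d2: "((%z. 2 * ((fst z - c) *. fst w) + 4 * snd w) has_derivative (%v. 2 * (fst v *. fst w))) (at z)" for w and z :: "R3 \<times> real"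
 by (auto intro!: derivative_eq_intros)
 have n2: "nderiv [v, w] F z = 2 * (fst v *. fst w)" for v w z
 unfolding nderiv.simps(2)[of v] n1 using frechet_derivative_at[OF d2, of w z] by metis
 have sm: "smooth_on UNIV F"
 unfolding F_def[abs_def]
 by (intro smooth_on_diff smooth_on_add smooth_on_mult smooth_on_const smooth_on_bilinear[OF bounded_bilinear_inner]
 smooth_on_linear bounded_linear_fst bounded_linear_snd open_UNIV)
 have gr: "gradient (%y. F (y, s)) x *. v = 2 * ((x - c) *. v)" for x s v
 using slice_gradient[OF open_UNIV sm, of x s v] unfolding n1 by simp
 have "mcf_chart {a..b} (%t. cball c (sqrt (R\<^sup>2 - 4 * (t - a)))) UNIV F"
 unfolding mcf_chart_def
 proof (intro conjI allI impI open_UNIV sm; (elim conjE)?)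
 fix x s assume s: "s \<in> {a..b}"
 have p: "R\<^sup>2 - 4 * (s - a) > 0" using R s by auto
 have nn: "dist c x = sqrt ((x - c) *. (x - c))" by (metis dist_commute dist_norm norm_eq_sqrt_inner)
 show "(x \<in> cball c (sqrt (R\<^sup>2 - 4 * (s - a)))) = (F (x, s) <= 0)"
 unfolding mem_cball nn real_sqrt_le_iff by (auto simp: F_def)
 assume z: "F (x, s) = 0"
 then have "(x - c) *. (x - c) = R\<^sup>2 - 4 * (s - a)" by (simp add: F_def)
 then have "(x - c) *. (x - c) > 0" using p by linarith
 then have "gradient (%y. F (y, s)) x *. (x - c) ~= 0" unfolding gr by simp
 then show "gradient (%y. F (y, s)) x ~= 0" by auto
 fix e1 e2 e m assume "orthoframe e1 e2 e"
 then show "nderiv [(0, 1)] F (x, s) = nderiv [(e1, 0), (e1, 0)] F (x, s) + nderiv [(e2, 0), (e2, 0)] F (x, s)"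
 unfolding n2 unfolding n1 by (simp add: orthoframeD)
 qed
 then show ?thesis unfolding smooth_mcf_iff by (intro ballI allI exI[of _ UNIV] exI[of _ F]) simp
qed

text \<open>A point in the shrunken ball is swept by a sphere of the flow that starts inside the large ball.\<close>
lemma avoids_no_jump:
 assumes L: "avoids_smooth_flows L" and s: "0 <= s" and h: "0 <= h" "10 * sqrt h < rh" and e: "L s \<inter> ball x rh = {}"
 and y: "dist x y <= rh / 2"
 shows "y \<notin> L (s + h)"
proof (cases "h = 0")
 case True
 have "dist x y < rh" using y h(2) real_sqrt_ge_zero[OF h(1)] zero_le_dist[of x y] by linarith
 then show ?thesis using True e by auto
next
 case False
 then have hp: "h > 0" using h by simp
 \<comment> \<open>The barrier is centred at \<open>y + w\<close> with initial radius
   \<open>sqrt (8 h)\<close>. After time \<open>h\<close> its radius is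
   \<open>sqrt (8 h - 4 h) = 2 sqrt h\<close>, the length of \<open>w\<close>, so its surface then
   contains \<open>y\<close>. At the start it lies within \<open>5 sqrt h\<close> of
   \<open>y\<close>, and \<open>5 sqrt h < rh / 2\<close>.\<close>
 obtain w :: R3 where w: "norm w = 2 * sqrt h" using vector_choose_size[of "2 * sqrt h"] h(1) by auto
 let ?M = "%t. cball (y + w) (sqrt ((sqrt (8 * h))\<^sup>2 - 4 * (t - s)))"
 have m: "smooth_mcf {s..s + h} ?M" by (rule sphere_mcf) (use hp in simp)
 have bd: "bounded (\<Union>t\<in>{s..s + h}. ?M t)"
 by (rule bounded_subset[of "cball (y + w) (sqrt ((sqrt (8 * h))\<^sup>2))"]) (use h in \<open>auto elim!: order_trans intro!: real_sqrt_le_mono\<close>)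
 have s8: "sqrt (8 * h) <= 3 * sqrt h"
 by (rule real_le_lsqrt) (use h in \<open>auto simp: power2_eq_square\<close>)
 have fr: "frontier (?M t) = sphere (y + w) (sqrt ((sqrt (8 * h))\<^sup>2 - 4 * (t - s)))" for t by (simp add: frontier_cball)
 have "?M s <= ball x rh"
 proof
 fix z assume "z \<in> ?M s"
 then have "dist (y + w) z <= 3 * sqrt h" using s8 h by (simp add: abs_of_nonneg)
 moreover have "dist x z <= dist x y + dist y (y + w) + dist (y + w) z"
 using dist_triangle[of x z y] dist_triangle[of y z "y + w"] by linarith
 moreover have "dist y (y + w) = 2 * sqrt h" using w by (simp add: dist_norm)
 ultimately show "z \<in> ball x rh" using y h(2) by simp
 qed
 moreover have "frontier (?M s) <= ?M s" by (simp add: frontier_subset_eq)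
 ultimately have "L s \<inter> frontier (?M s) = {}" using e by blast
 then have "L (s + h) \<inter> frontier (?M (s + h)) = {}"
 using L[unfolded avoids_smooth_flows_def, rule_format, of s "s + h" ?M "s + h"] s h m bd by simp
 moreover have "sqrt ((sqrt (8 * h))\<^sup>2 - 4 * (s + h - s)) = 2 * sqrt h"
 proof -
 have a: "(sqrt (8 * h))\<^sup>2 - 4 * (s + h - s) = 4 * h" using h by simp
 show ?thesis unfolding a by (simp add: real_sqrt_mult)
 qed
 then have "y \<in> frontier (?M (s + h))" unfolding fr using w by (simp add: dist_norm)
 ultimately show ?thesis by blast
qed

section \<open>Avoidance\<close>

lemma nderiv_cmult:
 fixes f :: "'a::real_normed_vector => real"
 assumes U: "open U" and f: "smooth_on U f"
 shows "x \<in> U ==> nderiv vs (%x. c * f x) x = c * nderiv vs f x"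
proof (induction vs arbitrary: x)
 case (Cons v vs)
 have "((%x. c * nderiv vs f x) has_derivative (%v. c * nderiv (v # vs) f x)) (at x)"
 by (rule has_derivative_mult_right[OF has_derivative_nderiv[OF f Cons.prems]])
 then have "(nderiv vs (%x. c * f x) has_derivative (%v. c * nderiv (v # vs) f x)) (at x)"
 by (rule has_derivative_transform_within_open[OF _ U Cons.prems]) (simp add: Cons.IH)
 then show ?case by (simp add: frechet_derivative_at[symmetric])
qed simp

text \<open>The two-vector case of Farkas' lemma: an open half-space inside a closed one forces
  parallel normals. Otherwise the component \<open>p\<close> of \<open>e\<close> orthogonal to
  \<open>g\<close>, taken with a large factor, would violate the inclusion.\<close>

lemma cone_normal:
 fixes g e :: "'a::real_inner"
 assumes g: "g ~= 0" and e: "e ~= 0" and c: "!!u. g *. u < 0 ==> e *. u <= 0"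
 obtains m where "m > 0" "g = m *# e"
proof -
 define p where "p = e - ((e *. g) / (g *. g)) *# g"
 have gg: "g *. g > 0" using g by simp
 have pg: "p *. g = 0" using gg by (simp add: p_def inner_diff_left)
 have ep: "e *. p = p *. p"
 proof -
 have "e = p + ((e *. g) / (g *. g)) *# g" by (simp add: p_def)
 then have "e *. p = p *. p + ((e *. g) / (g *. g)) * (g *. p)" by (metis inner_add_left inner_scaleR_left)
 then show ?thesis using pg by (simp add: inner_commute)
 qed
 have "p = 0"
 proof (rule ccontr)
 assume "p ~= 0"
 then have pp: "p *. p > 0" by simp
 define K where "K = (\<bar>e *. g\<bar> + 1) / (p *. p)"
 have "g *. (K *# p - g) < 0" using pg gg by (simp add: inner_diff_right inner_commute)
 then have "e *. (K *# p - g) <= 0" by (rule c)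
 then have "K * (p *. p) <= e *. g" by (simp add: inner_diff_right ep)
 then show False using pp by (simp add: K_def)
 qed
 then have e2: "e = ((e *. g) / (g *. g)) *# g" by (simp add: p_def)
 have "e *. (- g) <= 0" by (rule c) (use gg in simp)
 moreover have "e *. g ~= 0" using e2 e by auto
 ultimately have eg: "e *. g > 0" by simp
 show ?thesis
 proof (rule that[of "(g *. g) / (e *. g)"])
 show "(g *. g) / (e *. g) > 0" using eg gg by simp
 have "((g *. g) / (e *. g)) *# e = ((g *. g) / (e *. g)) *# (((e *. g) / (g *. g)) *# g)" using e2 by simp
 then show "g = ((g *. g) / (e *. g)) *# e" using eg gg by simp
 qed
qed

lemma dist_line_sq:
 fixes x y u :: "'a::real_inner"
 assumes "y - x = d *# e" "norm e = 1"
 shows "(dist (x + u) y)\<^sup>2 = d\<^sup>2 - 2 * d * (e *. u) + u *. u"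
proof -
 have ee: "e *. e = 1" using assms(2) by (simp add: norm_eq_1)
 have "dist (x + u) y = norm (d *# e - u)" using assms(1) by (simp add: dist_norm norm_minus_commute algebra_simps)
 then have "(dist (x + u) y)\<^sup>2 = (d *# e - u) *. (d *# e - u)" by (simp only: power2_norm_eq_inner)
 then show ?thesis using ee
 by (simp add: inner_diff_left inner_diff_right inner_commute power2_eq_square algebra_simps)
qed

text \<open>A boundary point of \<open>N\<close> closest to an outside point \<open>y\<close> has its outer normal directed towards \<open>y\<close>.\<close>
lemma nearest_normal:
 assumes K: "local_def N U f" and x: "x \<in> U" "f x = 0" and y: "y - x = d *# e" "d > 0" "norm e = 1"
 and near: "!!z. z \<in> N ==> dist z y >= d"
 obtains m where "m > 0" "gradient f x = m *# e"
proof -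
 note L = local_defD[OF K]
 have "e ~= 0" using y(3) by auto
 moreover have "e *. u <= 0" if "gradient f x *. u < 0" for u
 proof (rule ccontr)
 assume neg: "\<not> e *. u <= 0"
 have un: "u *. u + 1 > 0" by (simp add: add_nonneg_pos)
 have "\<forall>\<^sub>F s in at_right 0. s > 0 & s < 2 * d * (e *. u) / (u *. u + 1)"
 unfolding eventually_at_right_field using neg y(2) un by (intro exI[of _ "2 * d * (e *. u) / (u *. u + 1)"]) auto
 moreover have "\<forall>\<^sub>F s in at_right 0. f (x + s *# u) < 0"
 by (rule eventually_descent[OF L(2) x(1) _ that]) (use x(2) in simp)
 moreover note eventually_line_in[OF L(1) x(1), of u]
 ultimately
 have "\<forall>\<^sub>F s in at_right (0::real). False"
 proof (eventually_elim, goal_cases)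
 case (1 s)
 then have "x + s *# u \<in> N" using L(3) by simp
 then have "d <= dist (x + s *# u) y" by (rule near)
 then have "d\<^sup>2 <= (dist (x + s *# u) y)\<^sup>2" using y(2) by (intro power_mono) auto
 also have "... = d\<^sup>2 - 2 * d * (e *. (s *# u)) + (s *# u) *. (s *# u)" by (rule dist_line_sq[OF y(1,3)])
 finally have "s * (2 * d * (e *. u)) <= s * (s * (u *. u))" by (simp add: algebra_simps)
 then have "2 * d * (e *. u) <= s * (u *. u)" using 1 by simp
 also have "... <= s * (u *. u + 1)" using 1 by simp
 also have "... < 2 * d * (e *. u)" using 1 un by (simp add: field_simps)
 finally show False by simp
 qed
 then show False by simp
 qed
 ultimately show ?thesis using cone_normal[OF L(4)[OF x(1)], of e] that by blast
qed

text \<open>Here \<open>x\<close> may lie inside or outside \<open>M\<close>, so the sign of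
  \<open>m\<close> remains open. The competitors for the minimal distance are the frontier points
  supplied by \<open>tangent_point\<close>.\<close>

lemma nearest_frontier_normal:
 assumes K: "local_def M U f" and y: "y \<in> U" "f y = 0" and d: "y - x = d *# e" "d > 0" "norm e = 1"
 and near: "!!z. z \<in> frontier M ==> dist z x >= d"
 obtains m where "m ~= 0" "gradient f y = m *# e"
proof -
 note L = local_defD[OF K]
 let ?h = "gradient f y"
 have tan: "e *. v >= 0" if hv: "?h *. v = 0" for v
 proof (rule ccontr)
 assume neg: "\<not> e *. v >= 0"
 define et where "et = - (e *. v) / (2 * (norm ?h + 1))"
 have h1: "norm ?h + 1 > 0" by (simp add: add_nonneg_pos)
 have et: "et > 0" unfolding et_def by (rule divide_pos_pos) (use neg h1 in auto)
 have eh: "et * norm ?h <= - (e *. v) / 2"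
 proof -
 have "et * norm ?h <= et * (norm ?h + 1)" using et by simp
 also have "... = - (e *. v) / 2" using h1 by (simp add: et_def field_simps)
 finally show ?thesis .
 qed
 define Q where "Q = (norm v + et * norm ?h)\<^sup>2 + 1"
 have Q: "Q > 0" by (simp add: Q_def add_nonneg_pos)
 have "\<forall>\<^sub>F s in at_right 0. s > 0 & s < d * (- (e *. v)) / Q"
 unfolding eventually_at_right_field using neg d(2) Q by (intro exI[of _ "d * (- (e *. v)) / Q"] conjI divide_pos_pos mult_pos_pos) auto
 with tangent_point[OF K y hv et]
 have "\<forall>\<^sub>F s in at_right (0::real). False"
 proof eventually_elim
 case (elim s)
 then obtain c where c: "\<bar>c\<bar> <= et * s" "y + s *# v + c *# ?h \<in> frontier M" by blast
 define w where "w = s *# v + c *# ?h"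
 have "x - y = d *# (- e)" using d(1) by (simp add: algebra_simps)
 then have "(dist (y + w) x)\<^sup>2 = d\<^sup>2 - 2 * d * (- e *. w) + w *. w" by (rule dist_line_sq) (simp add: d)
 moreover have "d <= dist (y + w) x" using near[OF c(2)] by (simp add: w_def add.assoc)
 then have "d\<^sup>2 <= (dist (y + w) x)\<^sup>2" using d(2) by (intro power_mono) auto
 ultimately have 1: "0 <= 2 * d * (e *. w) + w *. w" by simp
 have "e *. w <= s * (e *. v) + \<bar>c\<bar> * norm ?h"
 proof -
 have "\<bar>e *. ?h\<bar> <= norm ?h" using Cauchy_Schwarz_ineq2[of e ?h] d(3) by simp
 then have "c * (e *. ?h) <= \<bar>c\<bar> * norm ?h"
 using abs_le_D1[of "c * (e *. ?h)"] by (simp add: abs_mult mult_left_mono)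
 then show ?thesis by (simp add: w_def inner_add_right)
 qed
 also have "... <= s * (e *. v) + et * s * norm ?h" using mult_right_mono[OF c(1), of "norm ?h"] by simp
 also have "... <= s * (e *. v) + s * (- (e *. v) / 2)" using mult_left_mono[OF eh, of s] elim by (simp add: algebra_simps)
 finally have 2: "e *. w <= s * (e *. v) / 2" by (simp add: algebra_simps)
 have "norm w <= s * norm v + \<bar>c\<bar> * norm ?h" unfolding w_def using elim by (intro order_trans[OF norm_triangle_ineq]) simp
 also have "... <= s * norm v + (et * s) * norm ?h" using c(1) by (intro add_mono mult_right_mono) auto
 finally have nw: "norm w <= s * (norm v + et * norm ?h)" by (simp add: algebra_simps)
 have "w *. w <= (s * (norm v + et * norm ?h))\<^sup>2" using power_mono[OF nw, of 2] by (simp add: power2_norm_eq_inner)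
 also have "... <= s * (s * Q)" using elim by (simp add: Q_def power_mult_distrib power2_eq_square algebra_simps)
 also have "s * (s * Q) < s * (d * (- (e *. v)))"
 proof (rule mult_strict_left_mono)
 show "s * Q < d * (- (e *. v))" using elim Q by (simp add: field_simps)
 qed (use elim in simp)
 finally have "w *. w < s * (d * (- (e *. v)))" .
 moreover have "2 * d * (e *. w) <= d * (s * (e *. v))" using mult_left_mono[OF 2, of "2 * d"] d(2) by simp
 ultimately show False using 1 by (simp add: algebra_simps)
 qed
 then show False by simp
 qed
 have h0: "?h ~= 0" by (rule L(4)[OF y(1)])
 define v where "v = e - ((e *. ?h) / (?h *. ?h)) *# ?h"
 have hv: "?h *. v = 0" using h0 by (simp add: v_def inner_diff_right inner_commute)
 have "e *. v >= 0" by (rule tan[OF hv])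
 moreover have "e *. - v >= 0" by (rule tan) (simp add: hv)
 ultimately have ev: "e *. v = 0" by simp
 have "v *. v = 0" using ev hv by (simp add: v_def inner_diff_left inner_diff_right inner_commute)
 then have e2: "e = ((e *. ?h) / (?h *. ?h)) *# ?h" by (simp add: v_def)
 have ne: "e *. ?h ~= 0" using e2 d(3) by auto
 have "((?h *. ?h) / (e *. ?h)) *# e = ((?h *. ?h) / (e *. ?h)) *# (((e *. ?h) / (?h *. ?h)) *# ?h)" using e2 by simp
 then have "?h = ((?h *. ?h) / (e *. ?h)) *# e" using ne h0 by simp
 then show ?thesis using that[of "(?h *. ?h) / (e *. ?h)"] ne h0 by simp
qed

lemma frontier_between:
 fixes e :: R3
 assumes "(z + a *# e \<in> M) ~= (z + b *# e \<in> M)" "a <= b"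
 obtains c where "a <= c" "c <= b" "z + c *# e \<in> frontier M"
proof -
 let ?S = "(%c. z + c *# e) ` {a..b}"
 have "connected ?S" by (intro connected_continuous_image continuous_intros connected_Icc)
 moreover have "?S \<inter> M ~= {}" "?S - M ~= {}" using assms by force+
 ultimately have "?S \<inter> frontier M ~= {}" by (rule connected_Int_frontier)
 then show ?thesis using that by auto
qed

text \<open>The maximum principle. At the closest pair both tangent planes are orthogonal to
  \<open>e\<close>. Minimality of the distance compares the curvatures of the two surfaces, the
  margin at earlier times compares their normal speeds in the opposite sense, and the flow equation
  makes the two incompatible.\<close>

lemma touching_contradiction:
 assumes N: "smooth_mcf I N" and M: "smooth_mcf I M" and t0: "t0 \<in> I" "a < t0" "{a..t0} <= I" and epx: "epx > 0"
 and xy: "x \<in> N t0" "y \<in> frontier (M t0)" and d: "dist x y = d" "d > 0"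
 and near: "!!x' y'. x' \<in> N t0 ==> y' \<in> frontier (M t0) ==> d <= dist x' y'"
 and before: "!!s x' y'. a <= s ==> s < t0 ==> x' \<in> N s ==> y' \<in> frontier (M s) ==> d + epx * (t0 - s) < dist x' y'"
 shows False
proof -
 define e where "e = (1 / d) *# (y - x)"
 have e: "y - x = d *# e" "norm e = 1" using d by (auto simp: e_def dist_norm norm_minus_commute)
 obtain e1 e2 where fr: "orthoframe e1 e2 e" by (rule orthoframe_exists[OF e(2)])
 note Fr = orthoframeD[OF fr]
 obtain W F where W: "(x, t0) \<in> W" "open W" "smooth_on W F"
 "!!x s. (x, s) \<in> W ==> s \<in> I ==> x \<in> N s \<longleftrightarrow> F (x, s) <= 0"
 "!!x s. (x, s) \<in> W ==> s \<in> I ==> F (x, s) = 0 ==> gradient (%y. F (y, s)) x ~= 0"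
 "!!x s e1 e2 e m. (x, s) \<in> W ==> s \<in> I ==> F (x, s) = 0 ==> orthoframe e1 e2 e ==> gradient (%y. F (y, s)) x = m *# e ==>
 nderiv [(0, 1)] F (x, s) = nderiv [(e1, 0), (e1, 0)] F (x, s) + nderiv [(e2, 0), (e2, 0)] F (x, s)"
 by (rule mcf_chartE[OF N t0(1), of x]) (rule that)
 obtain V G where V: "(y, t0) \<in> V" "open V" "smooth_on V G"
 "!!x s. (x, s) \<in> V ==> s \<in> I ==> x \<in> M s \<longleftrightarrow> G (x, s) <= 0"
 "!!x s. (x, s) \<in> V ==> s \<in> I ==> G (x, s) = 0 ==> gradient (%y. G (y, s)) x ~= 0"
 "!!x s e1 e2 e m. (x, s) \<in> V ==> s \<in> I ==> G (x, s) = 0 ==> orthoframe e1 e2 e ==> gradient (%y. G (y, s)) x = m *# e ==>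
 nderiv [(0, 1)] G (x, s) = nderiv [(e1, 0), (e1, 0)] G (x, s) + nderiv [(e2, 0), (e2, 0)] G (x, s)"
 by (rule mcf_chartE[OF M t0(1), of y]) (rule that)
 have xfr: "x \<in> frontier (N t0)"
 proof (rule ccontr)
 assume "x \<notin> frontier (N t0)"
 then have "x \<in> interior (N t0)" using xy(1) closure_subset unfolding frontier_def by blast
 then obtain r where r: "r > 0" "ball x r <= N t0" unfolding mem_interior by blast
 define de where "de = min (r/2) (d/2)"
 have de: "0 < de" "de < r" "de < d" using r d by (auto simp: de_def)
 have "x + de *# e \<in> N t0" using r de e(2) by (intro subsetD[OF r(2)]) (simp add: dist_norm)
 then have "d <= dist (x + de *# e) y" using near xy(2) by blast
 also have "x + de *# e - y = (de - d) *# e" using e(1) by (simp add: algebra_simps)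
 then have "dist (x + de *# e) y = d - de" using de e(2) by (simp add: dist_norm)
 finally show False using de by simp
 qed
 have F0: "F (x, t0) = 0" using chart_frontier[OF W(2,3,1) W(4)[OF _ t0(1)] W(5)[OF W(1) t0(1)]] xfr by blast
 have G0: "G (y, t0) = 0" using chart_frontier[OF V(2,3,1) V(4)[OF _ t0(1)] V(5)[OF V(1) t0(1)]] xy(2) by blast
 obtain U1 where U1: "x \<in> U1" "local_def (N t0) U1 (%y. F (y, t0))" "U1 <= {y. (y, t0) \<in> W}"
 by (rule slice_local_def[OF W(2,3,1) W(4)[OF _ t0(1)] W(5)[OF W(1) t0(1) F0]])
 obtain U2 where U2: "y \<in> U2" "local_def (M t0) U2 (%y. G (y, t0))" "U2 <= {y. (y, t0) \<in> V}"
 by (rule slice_local_def[OF V(2,3,1) V(4)[OF _ t0(1)] V(5)[OF V(1) t0(1) G0]])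
 obtain m where m: "m > 0" "gradient (%y. F (y, t0)) x = m *# e"
 by (rule nearest_normal[OF U1(2,1) F0 e(1) d(2) e(2)]) (use near xy(2) in auto)
 obtain m' where m': "m' ~= 0" "gradient (%y. G (y, t0)) y = m' *# e"
 by (rule nearest_frontier_normal[OF U2(2,1) G0 e(1) d(2) e(2)]) (subst dist_commute, use near xy(1) in auto)
 \<comment> \<open>Multiplication by \<open>m'\<close> gives a function whose gradient points along
   \<open>+ e\<close> on whichever side of its frontier \<open>M\<close> lies; domain membership may
   thereby be reversed, but crossings of the frontier are still detected.\<close>
 define H where "H z = m' * G z" for z
 have H: "smooth_on V H" unfolding H_def[abs_def] by (rule smooth_on_mult[OF V(2) smooth_on_const V(3)])
 have Hn: "nderiv vs H z = m' * nderiv vs G z" if "z \<in> V" for vs z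
 unfolding H_def[abs_def] by (rule nderiv_cmult[OF V(2,3) that])
 have H0: "H (y, t0) = 0" by (simp add: H_def G0)
 define mux where "mux = m' * m'"
 have mux: "mux > 0" unfolding mux_def zero_less_mult_iff using m'(1) by linarith
 have Hgr: "gradient (%z. H (z, t0)) y = mux *# e"
 proof -
 have "gradient (%z. H (z, t0)) y *. v = (mux *# e) *. v" for v
 unfolding slice_gradient[OF V(2) H V(1)] Hn[OF V(1)] using slice_gradient[OF V(2,3,1), of v] m'(2) by (simp add: mux_def)
 then show ?thesis using vector_eq_rdot by blast
 qed
 have opp: "(p \<in> M s) ~= (p' \<in> M s)" "p' \<notin> frontier (M s)"
 if "(p, s) \<in> V" "(p', s) \<in> V" "s \<in> I" "H (p, s) < 0" "H (p', s) > 0" for p p' s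
 proof -
 show "(p \<in> M s) ~= (p' \<in> M s)"
 using V(4)[OF that(1,3)] V(4)[OF that(2,3)] that(4,5) unfolding H_def
 by (cases "m' > 0") (auto simp: mult_less_0_iff zero_less_mult_iff not_le)
 show "p' \<notin> frontier (M s)"
 using chart_frontier[OF V(2,3) that(2) V(4)[OF _ that(3)] V(5)[OF that(2,3)]] that(5) by (auto simp: H_def)
 qed
 note SW = slice_smooth[OF W(2,3), where s=t0] and SV = slice_smooth[OF V(2) H, where s=t0]
 have xW: "x \<in> {y. (y, t0) \<in> W}" and yV: "y \<in> {y. (y, t0) \<in> V}" using W(1) V(1) by simp_all
 have "gradient (%z. H (z, t0)) y *. (- e) < 0" using Fr mux by (simp add: Hgr)
 then have "\<forall>\<^sub>F s in at_right 0. H (y + s *# (- e), t0) < 0"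
 using H0 by (intro eventually_descent[OF SV(2) yV]) simp_all
 moreover have "\<forall>\<^sub>F s in at_right 0. s > 0 & s < d" unfolding eventually_at_right_field using d(2) by blast
 ultimately have "\<forall>\<^sub>F s in at_right 0. (y + s *# (- e), t0) \<in> V & H (y + s *# (- e), t0) < 0 & 0 < s & s < d"
 using eventually_line_in[OF SV(1) yV, of "- e"] by eventually_elim simp
 then have "EX s. (y + s *# (- e), t0) \<in> V & H (y + s *# (- e), t0) < 0 & 0 < s & s < d"
 by (rule eventually_happens'[rotated]) simp
 \<comment> \<open>An anchor on the segment from \<open>x\<close> to \<open>y\<close>, just before
   \<open>y\<close>. \<open>H\<close> stays negative around it for nearby times, so wherever
   \<open>H\<close> is positive beyond it the frontier is crossed in between.\<close>
 then obtain de where de: "(y - de *# e, t0) \<in> V" "H (y - de *# e, t0) < 0" "0 < de" "de < d" by auto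
 obtain r where r: "r > 0" "!!p. dist p (y - de *# e, t0) < r ==> p \<in> V & H p < 0"
 by (rule smooth_neg_nbhd[OF V(2) H de(1,2)]) (rule that)
 \<comment> \<open>Were the inequality violated, one parabola with an intermediate \<open>k\<close>
   could start at both \<open>x\<close> and \<open>y\<close>: it runs inside \<open>N\<close> from
   \<open>x\<close> and beyond the frontier of \<open>M\<close> from \<open>y\<close>, which leaves
   less than the distance \<open>d\<close> between them.\<close>
 have space: "nderiv [(v, 0), (v, 0)] H (y, t0) / mux <= nderiv [(v, 0), (v, 0)] F (x, t0) / m" if ve: "v *. e = 0" for v
 proof (rule ccontr)
 assume "\<not> ?thesis"
 then obtain k where k: "nderiv [(v, 0), (v, 0)] F (x, t0) / m < k" "k < nderiv [(v, 0), (v, 0)] H (y, t0) / mux"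
 using dense not_le by blast
 have gF: "gradient (%y. F (y, t0)) x *. v = 0" "gradient (%y. F (y, t0)) x *. e = m" using m(2) ve Fr by (simp_all add: inner_commute)
 have gH: "gradient (%y. H (y, t0)) y *. v = 0" "gradient (%y. H (y, t0)) y *. e = mux" using Hgr ve Fr by (simp_all add: inner_commute)
 have "nderiv [v, v] (%y. F (y, t0)) x < k * (gradient (%y. F (y, t0)) x *. e)"
 using k(1) m(1) unfolding gF SW(3)[OF W(1)] by (simp add: field_simps del: nderiv.simps)
 note eF = parabola_sign(1)[OF SW(1,2) xW F0 gF(1) this]
 have "nderiv [v, v] (%y. H (y, t0)) y > k * (gradient (%y. H (y, t0)) y *. e)"
 using k(2) mux unfolding gH SV(3)[OF V(1)] by (simp add: field_simps del: nderiv.simps)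
 note eH = parabola_sign(2)[OF SV(1,2) yV H0 gH(1) this]
 define q where "q s = s *# v - (k * s\<^sup>2 / 2) *# e" for s
 have lq: "((%s. z + q s) \<longlongrightarrow> z) (at_right 0)" for z
 proof -
 have "((%s. z + (s *# v - (k * s\<^sup>2 / 2) *# e)) \<longlongrightarrow> z + (0 *# v - (k * 0\<^sup>2 / 2) *# e)) (at_right 0)" by (intro tendsto_intros) simp
 then show ?thesis by (simp add: q_def)
 qed
 have "\<forall>\<^sub>F s in at_right (0::real). False"
 using eF eH topological_tendstoD[OF lq SW(1) xW] topological_tendstoD[OF lq SV(1) yV] tendstoD[OF lq r(1), of "y - de *# e"]
 proof eventually_elim
 case (elim s)
 have xs: "x + q s \<in> N t0" using elim(1,3) W(4)[of "x + q s" t0] t0(1) by (simp add: q_def algebra_simps)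
 have "dist (y - de *# e + q s, t0) (y - de *# e, t0) < r" using elim(5) by (simp add: dist_Pair_Pair)
 from r(2)[OF this] have p: "(y - de *# e + q s, t0) \<in> V" "H (y - de *# e + q s, t0) < 0" by auto
 have p': "(y + q s, t0) \<in> V" "H (y + q s, t0) > 0" using elim(2,4) by (simp_all add: q_def algebra_simps)
 have yx: "y = x + d *# e" using e(1) by (simp add: algebra_simps)
 have e1: "y - de *# e + q s = (x + q s) + (d - de) *# e" "y + q s = (x + q s) + d *# e" unfolding yx by (simp_all add: algebra_simps)
 note o = opp[OF p(1) p'(1) t0(1) p(2) p'(2)]
 obtain c where c: "d - de <= c" "c <= d" "(x + q s) + c *# e \<in> frontier (M t0)"
 by (rule frontier_between[OF o(1)[unfolded e1]]) (use de in auto)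
 have "c ~= d" using c(3) o(2) e1(2) by auto
 have "d <= dist (x + q s) ((x + q s) + c *# e)" by (rule near[OF xs c(3)])
 also have "... = c" using c(1) de(4) e(2) by (simp add: dist_norm)
 finally show False using c(2) \<open>c ~= d\<close> by simp
 qed
 then show False by simp
 qed
 \<comment> \<open>\<open>c\<close> and \<open>c'\<close> are slightly worse than the actual normal
   speeds. Shortly before \<open>t0\<close> the shifted \<open>x\<close> is still in
   \<open>N\<close>, and the frontier of \<open>M\<close> is met within
   \<open>d + (c' - c) tax\<close> of it, whereas the margin asks for more than
   \<open>d + epx tax\<close>.\<close>
 have time: "epx < c' - c" if c: "c < nderiv [(0, 1)] F (x, t0) / m" and c': "c' > nderiv [(0, 1)] H (y, t0) / mux" for c c'
 proof -
 have lin: "nderiv [(w, -1)] f z = nderiv [(w, 0)] f z - nderiv [(0, 1)] f z" if "smooth_on X f" "z \<in> X" for f :: "R3 \<times> real => real" and X w z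
 proof -
 interpret bl: bounded_linear "%v. nderiv [v] f z" by (rule linear_nderiv[OF that])
 show ?thesis using bl.diff[of "(w, 0)" "(0, 1)"] by (simp del: nderiv.simps)
 qed
 have sc: "nderiv [(k *# e, 0)] f (z, s) = k * (gradient (%y. f (y, s)) z *. e)" if "open X" "smooth_on X f" "(z, s) \<in> X" for f :: "R3 \<times> real => real" and X z s k
 using slice_gradient[OF that, of "k *# e"] by (simp del: nderiv.simps)
 have cv: "((%tax. (z + (k * tax) *# e, t0 - tax)) has_vector_derivative (k *# e, -1)) (at 0)" for z k
 unfolding has_vector_derivative_def by (auto intro!: derivative_eq_intros simp: algebra_simps)
 have DF: "((%tax. F (x + (c * tax) *# e, t0 - tax)) has_real_derivative (c * m - nderiv [(0, 1)] F (x, t0))) (at 0)"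
 using nderiv_curve[OF W(3) cv[of x c], of "[]"] W(1) lin[OF W(3,1), of "c *# e"] sc[OF W(2,3,1), of c] m(2) Fr
 by (simp del: nderiv.simps(2))
 have DH: "((%tax. H (y + (c' * tax) *# e, t0 - tax)) has_real_derivative (c' * mux - nderiv [(0, 1)] H (y, t0))) (at 0)"
 using nderiv_curve[OF H cv[of y c'], of "[]"] V(1) lin[OF H V(1), of "c' *# e"] sc[OF V(2) H V(1), of c'] Hgr Fr
 by (simp del: nderiv.simps(2))
 have "c * m - nderiv [(0, 1)] F (x, t0) < 0" using c m(1) by (simp add: field_simps del: nderiv.simps)
 from DERIV_neg_dec_right[OF DF this] F0 obtain d1 where d1: "d1 > 0" "!!h. 0 < h ==> h < d1 ==> F (x + (c * h) *# e, t0 - h) < 0" by auto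
 have "c' * mux - nderiv [(0, 1)] H (y, t0) > 0" using c' mux by (simp add: field_simps del: nderiv.simps)
 from DERIV_pos_inc_right[OF DH this] H0 obtain d2 where d2: "d2 > 0" "!!h. 0 < h ==> h < d2 ==> H (y + (c' * h) *# e, t0 - h) > 0" by auto
 have lt: "((%tax. (z + (k * tax) *# e, t0 - tax)) \<longlongrightarrow> (z, t0)) (at_right 0)" for z k
 proof -
 have "((%tax. (z + (k * tax) *# e, t0 - tax)) \<longlongrightarrow> (z + (k * 0) *# e, t0 - 0)) (at_right 0)" by (intro tendsto_intros)
 then show ?thesis by simp
 qed
 define B where "B = min (min d1 d2) (min (min (t0 - a) r) ((d - de) / (\<bar>c\<bar> + \<bar>c'\<bar> + 1)))"
 have B: "B > 0" using d1 d2 t0(2) r(1) de by (auto simp: B_def intro!: divide_pos_pos add_nonneg_pos)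
 have eB: "\<forall>\<^sub>F tax in at_right 0. 0 < tax & tax < B" unfolding eventually_at_right_field using B by blast
 have "((%tax. de + c' * tax) \<longlongrightarrow> de + c' * 0) (at_right 0)" by (intro tendsto_intros)
 then have eD: "\<forall>\<^sub>F tax in at_right 0. 0 < de + c' * tax" using de(3) by (intro order_tendstoD(1)) simp_all
 have "\<forall>\<^sub>F tax in at_right (0::real). epx < c' - c"
 using eB topological_tendstoD[OF lt W(2,1), of c] topological_tendstoD[OF lt V(2,1), of c'] eD
 proof eventually_elim
 case (elim tax)
 let ?s = "t0 - tax"
 have sI: "?s \<in> I" "a <= ?s" "?s < t0" using elim(1) t0(3) by (auto simp: B_def)
 let ?x = "x + (c * tax) *# e"
 have xs: "?x \<in> N ?s" using W(4)[OF elim(2) sI(1)] d1(2)[of tax] elim(1) by (simp add: B_def)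
 have "dist (y - de *# e, ?s) (y - de *# e, t0) < r" using elim(1) by (simp add: dist_Pair_Pair dist_real_def B_def)
 from r(2)[OF this] have p: "(y - de *# e, ?s) \<in> V" "H (y - de *# e, ?s) < 0" by auto
 have p': "H (y + (c' * tax) *# e, ?s) > 0" using d2(2)[of tax] elim(1) by (simp add: B_def)
 note o = opp[OF p(1) elim(3) sI(1) p(2) p']
 have ee: "y - de *# e = y + (- de) *# e" by simp
 obtain b where b: "- de <= b" "b <= c' * tax" "y + b *# e \<in> frontier (M ?s)"
 by (rule frontier_between[OF o(1)[unfolded ee]]) (use elim(4) in auto)
 have "d + epx * (t0 - ?s) < dist ?x (y + b *# e)" by (rule before[OF sI(2,3) xs b(3)])
 also have "?x - (y + b *# e) = (c * tax - d - b) *# e" using e(1) by (simp add: algebra_simps)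
 then have "dist ?x (y + b *# e) = \<bar>c * tax - d - b\<bar>" using e(2) by (simp add: dist_norm)
 also have "... <= d + c' * tax - c * tax"
 proof -
 have "\<bar>c\<bar> * tax <= (\<bar>c\<bar> + \<bar>c'\<bar> + 1) * tax" using elim(1) by (intro mult_right_mono) auto
 also have "... < d - de" using elim(1) by (simp add: B_def field_simps)
 finally have "c * tax <= d - de" using mult_right_mono[OF abs_ge_self[of c], of tax] elim(1) by linarith
 then show ?thesis using b by auto
 qed
 finally have "epx * tax < (c' - c) * tax" by (simp add: algebra_simps)
 then show ?case using elim(1) by simp
 qed
 then show ?thesis by simp
 qed
 have "nderiv [(0, 1)] F (x, t0) / m = nderiv [(e1, 0), (e1, 0)] F (x, t0) / m + nderiv [(e2, 0), (e2, 0)] F (x, t0) / m"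
 unfolding W(6)[OF W(1) t0(1) F0 fr m(2)] by (rule add_divide_distrib)
 also have "... >= nderiv [(e1, 0), (e1, 0)] H (y, t0) / mux + nderiv [(e2, 0), (e2, 0)] H (y, t0) / mux"
 by (intro add_mono space Fr)
 also (xtrans) have "nderiv [(e1, 0), (e1, 0)] H (y, t0) / mux + nderiv [(e2, 0), (e2, 0)] H (y, t0) / mux = nderiv [(0, 1)] H (y, t0) / mux"
 unfolding Hn[OF V(1)] V(6)[OF V(1) t0(1) G0 fr m'(2)] by (simp only: add_divide_distrib distrib_left)
 finally have le: "nderiv [(0, 1)] F (x, t0) / m >= nderiv [(0, 1)] H (y, t0) / mux" .
 have "epx < (nderiv [(0, 1)] H (y, t0) / mux + epx / 4) - (nderiv [(0, 1)] F (x, t0) / m - epx / 4)"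
 by (rule time; use epx in linarith)
 then show False using le epx by linarith
qed

lemma smooth_avoidance:
 assumes N: "smooth_mcf {a..b} N" and M: "smooth_mcf {a..b} M"
 and bd: "bounded (\<Union>t\<in>{a..b}. N t)" "bounded (\<Union>t\<in>{a..b}. M t)"
 and dis: "N a \<inter> frontier (M a) = {}" and t: "t \<in> {a..b}"
 shows "N t \<inter> frontier (M t) = {}"
proof (rule ccontr)
 assume "N t \<inter> frontier (M t) ~= {}"
 then obtain z where z: "z \<in> N t" "z \<in> frontier (M t)" by blast
 have ab: "a <= b" "a \<in> {a..b}" using t by auto
 have "compact (N a)"
 unfolding compact_eq_bounded_closed using closed_mcf[OF N ab(2)] bounded_subset[OF bd(1)] ab(2) by blast
 from separate_compact_closed[OF this frontier_closed dis]
 obtain d0 where d0: "d0 > 0" "!!x y. x \<in> N a ==> y \<in> frontier (M a) ==> d0 <= dist x y" by blast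
 define epx where "epx = d0 / (4 * (b - a + 1))"
 have epx: "epx > 0" using d0 ab by (simp add: epx_def)
 \<comment> \<open>The threshold starts at half of the initial distance and decreases so slowly that
   it stays positive. Its slope provides the strict margin \<open>epx * (t0 - s)\<close> before the
   first time at which it is reached.\<close>
 define R where "R s = d0 / 2 - epx * (s - a)" for s
 have Rpos: "R s > 0" if "s \<in> {a..b}" for s
 proof -
 have "epx * (s - a) <= epx * (b - a + 1)" using that epx by (intro mult_left_mono) auto
 also have "... = d0 / 4" using ab by (simp add: epx_def field_simps)
 finally show ?thesis using d0 by (simp add: R_def)
 qed
 define S where "S = {(s, x, y). s \<in> {a..b} & x \<in> N s & y \<in> frontier (M s) & dist x y <= R s}"
 have "bounded S"
 proof (rule bounded_subset)
 show "bounded ({a..b} \<times> (\<Union>t\<in>{a..b}. N t) \<times> (\<Union>t\<in>{a..b}. M t))" by (intro bounded_Times bd bounded_closed_interval)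
 show "S <= {a..b} \<times> (\<Union>t\<in>{a..b}. N t) \<times> (\<Union>t\<in>{a..b}. M t)"
 using closed_mcf[OF M] frontier_subset_closed unfolding S_def by fastforce
 qed
 moreover have "closed S"
 unfolding closed_sequential_limits
 proof (intro allI impI, elim conjE)
 fix f l assume f: "ALL n. f n \<in> S" and lim: "f ----> l"
 obtain s x y where l: "l = (s, x, y)" by (cases l)
 define fs fx fy where "fs n = fst (f n)" and "fx n = fst (snd (f n))" and "fy n = snd (snd (f n))" for n
 have L: "fs ----> s" "fx ----> x" "fy ----> y"
 using tendsto_fst[OF lim] tendsto_fst[OF tendsto_snd[OF lim]] tendsto_snd[OF tendsto_snd[OF lim]]
 unfolding l fs_def fx_def fy_def by simp_all
 have F: "fs n \<in> {a..b}" "fx n \<in> N (fs n)" "fy n \<in> frontier (M (fs n))" "dist (fx n) (fy n) <= R (fs n)" for n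
 using f unfolding S_def fs_def fx_def fy_def by (auto simp: case_prod_beta)
 have s: "s \<in> {a..b}" by (rule closed_sequentially[OF closed_real_atLeastAtMost _ L(1)]) (use F in blast)
 have "(%n. dist (fx n) (fy n)) ----> dist x y" "(%n. R (fs n)) ----> R s"
 unfolding R_def by (intro tendsto_intros L)+
 then have "dist x y <= R s" by (rule LIMSEQ_le) (use F in auto)
 then show "l \<in> S"
 using mcf_track_closed(1)[OF N s F(1) L(2,1) F(2)] mcf_track_closed(2)[OF M s F(1) L(3,1) F(3)] s by (simp add: S_def l)
 qed
 ultimately have "compact S" by (simp add: compact_eq_bounded_closed)
 moreover have "(t, z, z) \<in> S" using z t Rpos[OF t] by (simp add: S_def)
 then have "S ~= {}" by blast
 ultimately obtain m where m: "m \<in> S" "!!q. q \<in> S ==> fst m <= fst q"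
 using continuous_attains_inf[of S fst] continuous_on_fst[OF continuous_on_id] by blast
 obtain t0 x y where mm: "m = (t0, x, y)" by (cases m)
 have xy: "t0 \<in> {a..b}" "x \<in> N t0" "y \<in> frontier (M t0)" "dist x y <= R t0" using m(1) by (auto simp: S_def mm)
 have "t0 ~= a" using d0(2)[of x y] xy d0(1) by (auto simp: R_def)
 then have t0: "a < t0" using xy(1) by simp
 have before: "R t0 + epx * (t0 - s) < dist x' y'" if "a <= s" "s < t0" "x' \<in> N s" "y' \<in> frontier (M s)" for s x' y'
 proof -
 have "(s, x', y') \<notin> S" using m(2)[of "(s, x', y')"] that by (auto simp: mm)
 then have "R s < dist x' y'" using that xy(1) by (simp add: S_def)
 then show ?thesis by (simp add: R_def algebra_simps)
 qed
 \<comment> \<open>A pair closer than the threshold at \<open>t0\<close> would persist to slightly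
   earlier times, when no such pair exists yet.\<close>
 have near: "R t0 <= dist x' y'" if p: "x' \<in> N t0" "y' \<in> frontier (M t0)" for x' y'
 proof (rule ccontr)
 assume "\<not> R t0 <= dist x' y'"
 then have et: "(R t0 - dist x' y') / 2 > 0" by simp
 obtain th1 where th1: "th1 > 0" "!!s. s \<in> {a..b} ==> \<bar>s - t0\<bar> < th1 ==> \<exists>w\<in>N s. dist w x' < (R t0 - dist x' y') / 2"
 using mcf_persist(1)[OF N xy(1) p(1) et] by blast
 have y'M: "y' \<in> M t0" using p(2) closed_mcf[OF M xy(1)] frontier_subset_closed by blast
 obtain th2 where th2: "th2 > 0" "!!s. s \<in> {a..b} ==> \<bar>s - t0\<bar> < th2 ==> \<exists>w\<in>frontier (M s). dist w y' < (R t0 - dist x' y') / 2"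
 using mcf_persist(2)[OF M xy(1) y'M et p(2)] by blast
 define s where "s = max a (t0 - min th1 th2 / 2)"
 have s: "a <= s" "s < t0" "s \<in> {a..b}" "\<bar>s - t0\<bar> < th1" "\<bar>s - t0\<bar> < th2"
 using t0 th1(1) th2(1) xy(1) by (auto simp: s_def max_def min_def)
 obtain u w where u: "u \<in> N s" "dist u x' < (R t0 - dist x' y') / 2" and w: "w \<in> frontier (M s)" "dist w y' < (R t0 - dist x' y') / 2"
 using th1(2)[OF s(3,4)] th2(2)[OF s(3,5)] by blast
 have "dist u w <= dist u x' + dist x' y' + dist w y'"
 using dist_triangle[of u w x'] dist_triangle[of x' w y'] by (simp add: dist_commute)
 then have "dist u w < R t0" using u(2) w(2) by (simp add: field_simps)
 moreover have "R t0 + epx * (t0 - s) < dist u w" by (rule before[OF s(1,2) u(1) w(1)])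
 moreover have "epx * (t0 - s) > 0" using epx s(2) by simp
 ultimately show False by linarith
 qed
 have deq: "dist x y = R t0" using near[OF xy(2,3)] xy(4) by simp
 show False
 by (rule touching_contradiction[OF N M xy(1) t0 _ epx xy(2,3) deq Rpos[OF xy(1)] near before]) (use xy(1) in auto)
qed

section \<open>Surgery flows as weak set flows\<close>

lemma stime_flow:
 assumes "delta_H_flow P de HH K"
 shows "1 <= num_flows K" "i <= j ==> j <= num_flows K ==> stime K i <= stime K j" "i < j ==> j <= num_flows K ==> stime K i < stime K j"
 "stime K 0 = 0" "stime K (num_flows K) = \<infinity>" "surgery_time K 0 = 0"
 "i < num_flows K ==> stime K i = ereal (surgery_time K i)" "i < num_flows K ==> 0 <= surgery_time K i"
proof -
 have D: "delta_flow P de K" "stime K 0 = 0" "stime K (num_flows K) = \<infinity>" using assms by (auto simp: delta_H_flow_def)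
 then show "stime K 0 = 0" "stime K (num_flows K) = \<infinity>" "surgery_time K 0 = 0" by (auto simp: surgery_time_def)
 show "1 <= num_flows K" using D(1) by (simp add: delta_flow_def)
 have st: "stime K i < stime K (Suc i)" if "Suc i <= num_flows K" for i
 using D(1) that unfolding delta_flow_def by (auto dest!: bspec[of _ _ "Suc i"])
 show lt: "stime K i < stime K j" if "i < j" "j <= num_flows K" for i j
 using that
 proof (induction j)
 case (Suc j)
 then show ?case using st[of j] by (cases "i = j") (auto intro: less_trans)
 qed simp
 show "stime K i <= stime K j" if "i <= j" "j <= num_flows K" for i j
 using lt[of i j] that by (cases "i = j") auto
 show e: "stime K i = ereal (surgery_time K i)" if "i < num_flows K" for i
 using lt[of i "num_flows K"] lt[of 0 i] D(2,3) that by (cases "i = 0"; cases "stime K i") (auto simp: surgery_time_def)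
 show "0 <= surgery_time K i" if "i < num_flows K" for i
 using e[OF that] lt[of 0 i] D(2) that by (cases "i = 0") (auto simp: surgery_time_def intro!: real_of_ereal_pos)
qed

lemma piece_interval_iff:
 assumes "delta_H_flow P de HH K" and i: "i \<in> {1..num_flows K}"
 shows "t \<in> piece_interval K i \<longleftrightarrow> surgery_time K (i - 1) <= t & (i < num_flows K --> t <= surgery_time K i)"
proof -
 have "stime K (i - 1) = ereal (surgery_time K (i - 1))" using stime_flow(7)[OF assms(1), of "i - 1"] i by auto
 then show ?thesis
 using stime_flow(7)[OF assms(1), of i] stime_flow(5)[OF assms(1)] i by (cases "i < num_flows K") (auto simp: piece_interval_def)
qed

lemma is_interval_piece: "is_interval (piece_interval K i)"
 unfolding is_interval_1 piece_interval_def
 by (auto intro: order_trans[OF _ ereal_less_eq(3)[THEN iffD2]] order_trans[OF ereal_less_eq(3)[THEN iffD2]])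

lemma domain_at_slice:
 assumes F: "delta_H_flow P de HH K" and i: "i \<in> {1..num_flows K}" and t: "t \<in> piece_interval K i" "surgery_time K (i - 1) < t | i = 1"
 shows "domain_at K t = slice K i t"
proof -
 have "(LEAST j. 1 <= j & ereal t <= stime K j) = i"
 proof (rule Least_equality)
 show "1 <= i & ereal t <= stime K i" using i t by (simp add: piece_interval_def)
 fix j assume j: "1 <= j & ereal t <= stime K j"
 show "i <= j"
 proof (rule ccontr)
 assume "\<not> i <= j"
 then have ji: "j <= i - 1" "i ~= 1" using j by auto
 have "stime K j <= stime K (i - 1)" using stime_flow(2)[OF F ji(1)] i by auto
 also have "... = ereal (surgery_time K (i - 1))" using stime_flow(7)[OF F, of "i - 1"] i by auto
 also have "... < ereal t" using t ji by simp
 finally show False using j leD by blast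
 qed
 qed
 then show ?thesis by (simp add: domain_at_def)
qed

lemma domain_at_cases:
 assumes F: "delta_H_flow P de HH K" and t: "0 <= t"
 obtains i where "i \<in> {1..num_flows K}" "t \<in> piece_interval K i" "surgery_time K (i - 1) < t | i = 1" "domain_at K t = slice K i t"
proof -
 let ?Q = "%j. 1 <= j & ereal t <= stime K j"
 define i where "i = (LEAST j. ?Q j)"
 have n: "?Q (num_flows K)" using stime_flow(1,5)[OF F] by simp
 have i: "?Q i" unfolding i_def by (rule LeastI[of ?Q, OF n])
 have le: "i <= num_flows K" unfolding i_def by (rule Least_le[of ?Q, OF n])
 have lt: "stime K (i - 1) < ereal t" if "i ~= 1"
 using not_less_Least[of "i - 1" ?Q] i that unfolding i_def[symmetric] by auto
 have *: "surgery_time K (i - 1) < t | i = 1"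
 using lt stime_flow(7)[OF F, of "i - 1"] i le by auto
 have "stime K (i - 1) <= ereal t" using lt t stime_flow(4)[OF F] by (cases "i = 1") (auto simp: zero_ereal_def)
 then have "t \<in> piece_interval K i" using i by (simp add: piece_interval_def)
 then show ?thesis using that[of i] * i le domain_at_slice[OF F _ _ *] by auto
qed

lemma domain_at_0: "delta_H_flow P de HH K ==> domain_at K 0 = slice K 1 0"
 using domain_at_slice[of P de HH K 1 0] stime_flow(1,4)[of P de HH K] stime_flow(2)[of P de HH K 0 1]
 by (simp add: piece_interval_def zero_ereal_def)

text \<open>The common pattern of three arguments below: monotonicity, avoidance and depth. At a
  surgery time the property is needed for both the presurgery and the postsurgery domain, so it is
  stated for slices and only then for \<open>domain_at\<close>.\<close>

lemma flow_slices_induct: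
 assumes F: "delta_H_flow P de HH K" and init: "Ph 0 (domain_at K 0)"
 and flow: "!!i t. i \<in> {1..num_flows K} ==> Ph (surgery_time K (i - 1)) (slice K i (surgery_time K (i - 1))) ==> t \<in> piece_interval K i ==> Ph t (slice K i t)"
 and surg: "!!i. i \<in> {1..<num_flows K} ==> Ph (surgery_time K i) (pre_domain K i) ==> Ph (surgery_time K i) (post_domain K i)"
 shows "i \<in> {1..num_flows K} ==> t \<in> piece_interval K i ==> Ph t (slice K i t)" and "0 <= t ==> Ph t (domain_at K t)"
proof -
 show *: "Ph t (slice K i t)" if "i \<in> {1..num_flows K}" "t \<in> piece_interval K i" for i t
 using that
 proof (induction i arbitrary: t)
 case (Suc i)
 have "Ph (surgery_time K i) (slice K (Suc i) (surgery_time K i))"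
 proof (cases "i = 0")
 case True
 then show ?thesis using init stime_flow(6)[OF F] domain_at_0[OF F] by simp
 next
 case False
 then have i: "i \<in> {1..num_flows K}" "i \<in> {1..<num_flows K}" using Suc.prems(1) by auto
 have "stime K (i - 1) < stime K i" using stime_flow(3)[OF F, of "i - 1" i] i by simp
 then have "surgery_time K i \<in> piece_interval K i"
 using stime_flow(7)[OF F, of i] i by (simp add: piece_interval_def)
 from Suc.IH[OF i(1) this] surg[OF i(2)] show ?thesis by (simp add: pre_domain_def post_domain_def)
 qed
 then show ?case using flow[OF Suc.prems(1), of t] Suc.prems(2) by simp
 qed simp
 show "Ph t (domain_at K t)" if "0 <= t"
 by (rule domain_at_cases[OF F that]) (use * in simp)
qed

lemma delta_flow_pieces:
 assumes F: "delta_H_flow P de HH K"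
 shows "i \<in> {1..num_flows K} ==> smooth_mcf (piece_interval K i) (slice K i)"
 "i \<in> {1..num_flows K} ==> t \<in> piece_interval K i ==> mean_convex (slice K i t)"
 "i \<in> {1..<num_flows K} ==> replaced_by_caps P de (necks K i) (pre_domain K i) (sharp K i)"
 "i \<in> {1..<num_flows K} ==> post_domain K i <= sharp K i"
 "i \<in> {1..<num_flows K} ==> sharp K i <= pre_domain K i"
 "i \<in> {1..<num_flows K} ==> (p, r) \<in> necks K i ==> strong_neck K de p r (surgery_time K i)"
proof -
 have D: "delta_flow P de K" using F by (simp add: delta_H_flow_def)
 show "i \<in> {1..num_flows K} ==> smooth_mcf (piece_interval K i) (slice K i)"
 "i \<in> {1..num_flows K} ==> t \<in> piece_interval K i ==> mean_convex (slice K i t)"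
 "i \<in> {1..<num_flows K} ==> (p, r) \<in> necks K i ==> strong_neck K de p r (surgery_time K i)"
 using D unfolding delta_flow_def by blast+
 show r: "i \<in> {1..<num_flows K} ==> replaced_by_caps P de (necks K i) (pre_domain K i) (sharp K i)"
 using D unfolding delta_flow_def by blast
 show "i \<in> {1..<num_flows K} ==> sharp K i <= pre_domain K i" using r unfolding replaced_by_caps_def by blast
 show "post_domain K i <= sharp K i" if i: "i \<in> {1..<num_flows K}"
 proof -
 obtain CC where "CC <= components (sharp K i)" "post_domain K i = \<Union>CC" using D i unfolding delta_flow_def by meson
 then show ?thesis using Union_components[of "sharp K i"] by blast
 qed
qed

lemma surgery_flow_decreases:
 assumes F: "delta_H_flow P de HH K" and j: "j \<in> {1..num_flows K}" and r: "r \<in> piece_interval K j"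
 shows "slice K j r <= domain_at K 0"
proof (rule flow_slices_induct(1)[OF F, where Ph="%t X. X <= domain_at K 0"], goal_cases)
 case (2 i t)
 have "slice K i t <= slice K i (surgery_time K (i - 1))"
 proof
 fix x assume x: "x \<in> slice K i t"
 note pi = piece_interval_iff[OF F 2(1)]
 have st: "surgery_time K (i - 1) \<in> piece_interval K i" "surgery_time K (i - 1) <= t"
 using 2(3) unfolding pi by auto
 \<comment> \<open>Monotonicity is \<open>mcf_speed\<close> with velocity zero.\<close>
 have "x + (t - surgery_time K (i - 1)) *# 0 \<in> slice K i (surgery_time K (i - 1))"
 by (rule mcf_speed[OF delta_flow_pieces(1)[OF F 2(1)] is_interval_piece _ st(1) 2(3) st(2) _ x, of 0])
 (use delta_flow_pieces(2)[OF F 2(1)] in \<open>auto simp: mean_convex_def\<close>)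
 then show "x \<in> slice K i (surgery_time K (i - 1))" by simp
 qed
 then show ?case using 2 by blast
next
 case (3 i)
 then show ?case using delta_flow_pieces(4,5)[OF F 3(1)] by blast
qed (use j r in simp_all)

lemma surgery_flow_weak_set_flow:
 assumes F: "delta_H_flow P de HH K"
 shows "weak_set_flow_from (domain_at K 0) (domain_at K)"
 unfolding weak_set_flow_from_def
proof (intro conjI allI impI)
 have K0: "bounded (domain_at K 0)" using F by (simp add: delta_H_flow_def compact_imp_bounded)
 show "closed (domain_at K t)" if "0 <= t" for t
 by (rule domain_at_cases[OF F that]) (use closed_mcf delta_flow_pieces(1)[OF F] in metis)
 show "avoids_smooth_flows (domain_at K)"
 unfolding avoids_smooth_flows_def
 proof (intro allI impI ballI, elim conjE)
 fix a b M t
 assume a: "0 <= a" and ab: "a <= b" and M: "smooth_mcf {a..b} M" and bd: "bounded (\<Union>t\<in>{a..b}. M t)"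
 and dis: "domain_at K a \<inter> frontier (M a) = {}" and t: "t \<in> {a..b}"
 have "t \<in> {a..b} --> domain_at K t \<inter> frontier (M t) = {}"
 proof (rule flow_slices_induct(2)[OF F, where Ph="%t X. t \<in> {a..b} --> X \<inter> frontier (M t) = {}"], goal_cases)
 case 1
 then show ?case using dis a by auto
 next
 case (2 i t)
 show ?case
 proof
 assume tab: "t \<in> {a..b}"
 note pi = piece_interval_iff[OF F 2(1)]
 let ?T = "surgery_time K (i - 1)"
 \<comment> \<open>The barrier may begin in the middle of a piece. The test \<open>?T < a\<close> is
   strict because at \<open>a = ?T\<close> the slice of this piece is the postsurgery domain whereas
   \<open>domain_at\<close> is the presurgery one; that case is left to the induction
   hypothesis.\<close>
 define a' where "a' = max a ?T"
 have J: "{a'..t} <= piece_interval K i" "{a'..t} <= {a..b}" "a' <= t"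
 using 2(3) tab unfolding pi a'_def by (auto simp: pi)
 have d: "slice K i a' \<inter> frontier (M a') = {}"
 proof (cases "?T < a")
 case True
 then have "a' = a" by (simp add: a'_def)
 moreover have "domain_at K a = slice K i a"
 by (rule domain_at_slice[OF F 2(1)]) (use J True \<open>a' = a\<close> in auto)
 ultimately show ?thesis using dis by simp
 next
 case False
 then have "a' = ?T" by (simp add: a'_def)
 then show ?thesis using 2(2) J by auto
 qed
 show "slice K i t \<inter> frontier (M t) = {}"
 proof (rule smooth_avoidance[OF smooth_mcf_subset[OF delta_flow_pieces(1)[OF F 2(1)] J(1)] smooth_mcf_subset[OF M J(2)] _ _ d])
 have "(\<Union>s\<in>{a'..t}. slice K i s) <= domain_at K 0"
 by (rule UN_least, rule surgery_flow_decreases[OF F 2(1) subsetD[OF J(1)]])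
 then show "bounded (\<Union>s\<in>{a'..t}. slice K i s)" by (rule bounded_subset[OF K0])
 have "(\<Union>s\<in>{a'..t}. M s) <= (\<Union>s\<in>{a..b}. M s)" by (rule UN_mono[OF J(2)]) simp
 then show "bounded (\<Union>s\<in>{a'..t}. M s)" by (rule bounded_subset[OF bd])
 qed (use J in simp)
 qed
 next
 case (3 i)
 then show ?case using delta_flow_pieces(4,5)[OF F 3(1)] by blast
 next
 case 4
 then show ?case using a t by simp
 qed
 then show "domain_at K t \<inter> frontier (M t) = {}" using t by blast
 qed
qed simp

section \<open>Depth of the level set flow inside the surgery flow\<close>

lemma mcf_track_compact:
 assumes K: "smooth_mcf {a..b} K" and bd: "bounded (\<Union>t\<in>{a..b}. K t)"
 shows "compact {(t, x). t \<in> {a..b} & x \<in> K t}" "compact {(t, x). t \<in> {a..b} & x \<in> frontier (K t)}"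
proof -
 have sub: "frontier (K t) <= K t" if "t \<in> {a..b}" for t using closed_mcf[OF K that] by (rule frontier_subset_closed)
 have B: "bounded ({a..b} \<times> (\<Union>t\<in>{a..b}. K t))" by (intro bounded_Times bd bounded_closed_interval)
 have C: "closed {(t, x). t \<in> {a..b} & x \<in> Z t}"
 if Z: "!!t tax X x. t \<in> {a..b} ==> (!!n. tax n \<in> {a..b}) ==> X ----> x ==> tax ----> t ==> (!!n::nat. X n \<in> Z (tax n)) ==> x \<in> Z t" for Z :: "real => R3 set"
 unfolding closed_sequential_limits
 proof (intro allI impI, elim conjE)
 fix f l assume f: "ALL n. f n \<in> {(t, x). t \<in> {a..b} & x \<in> Z t}" and lim: "f ----> l"
 have F: "fst (f n) \<in> {a..b}" "snd (f n) \<in> Z (fst (f n))" for n using f by (auto simp: case_prod_beta)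
 have t: "fst l \<in> {a..b}" by (rule closed_sequentially[OF closed_real_atLeastAtMost _ tendsto_fst[OF lim]]) (use F in blast)
 show "l \<in> {(t, x). t \<in> {a..b} & x \<in> Z t}"
 using Z[OF t F(1) tendsto_snd[OF lim] tendsto_fst[OF lim] F(2)] t by (simp add: case_prod_beta)
 qed
 show "compact {(t, x). t \<in> {a..b} & x \<in> K t}" "compact {(t, x). t \<in> {a..b} & x \<in> frontier (K t)}"
 unfolding compact_eq_bounded_closed
 by (intro conjI bounded_subset[OF B]; (rule C, rule mcf_track_closed[OF K], assumption+)?; use sub in fastforce)+
qed

lemma mcf_uniform_persist:
 assumes K: "smooth_mcf {a..b} K" and bd: "bounded (\<Union>t\<in>{a..b}. K t)" and et: "et > 0"
 obtains h where "h > 0" "!!s t x. s \<in> {a..b} ==> t \<in> {a..b} ==> \<bar>s - t\<bar> < h ==> x \<in> K s ==> \<exists>y\<in>K t. dist y x < et"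
proof -
 have "\<exists>h>0. ALL s t x. s \<in> {a..b} --> t \<in> {a..b} --> \<bar>s - t\<bar> < h --> x \<in> K s --> (\<exists>y\<in>K t. dist y x < et)"
 proof (rule ccontr)
 assume neg: "\<not> ?thesis"
 have "EX s t x. s \<in> {a..b} & t \<in> {a..b} & \<bar>s - t\<bar> < 1 / real (Suc n) & x \<in> K s & (\<forall>y\<in>K t. \<not> dist y x < et)" for n
 proof -
 have "(0::real) < 1 / real (Suc n)" by simp
 with neg show ?thesis by meson
 qed
 then obtain S T X where STX: "!!n. S n \<in> {a..b}" "!!n. T n \<in> {a..b}" "!!n. \<bar>S n - T n\<bar> < 1 / real (Suc n)" "!!n. X n \<in> K (S n)"
 "!!n y. y \<in> K (T n) ==> \<not> dist y (X n) < et"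
 by metis
 have "ALL n. (S n, X n) \<in> {(t, x). t \<in> {a..b} & x \<in> K t}" using STX by simp
 then obtain l r where l: "l \<in> {(t, x). t \<in> {a..b} & x \<in> K t}" "strict_mono (r::nat=>nat)" "((%n. (S n, X n)) \<circ> r) ----> l"
 using mcf_track_compact(1)[OF K bd] unfolding compact_def by meson
 obtain s x where sx: "l = (s, x)" "s \<in> {a..b}" "x \<in> K s" using l(1) by auto
 have lS: "(%n. S (r n)) ----> s" and lX: "(%n. X (r n)) ----> x"
 using tendsto_fst[OF l(3)] tendsto_snd[OF l(3)] by (simp_all add: sx o_def)
 have d0: "(%n. S n - T n) ----> 0"
 by (rule Lim_null_comparison[OF _ LIMSEQ_inverse_real_of_nat]) (use STX(3) in \<open>auto simp: inverse_eq_divide intro!: always_eventually less_imp_le\<close>)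
 have "(%n. S (r n) - (S (r n) - T (r n))) ----> s - 0"
 by (rule tendsto_diff[OF lS LIMSEQ_subseq_LIMSEQ[OF d0 l(2), unfolded o_def]])
 then have lT: "(%n. T (r n)) ----> s" by simp
 have "et / 2 > 0" using et by simp
 from mcf_persist(1)[OF K sx(2,3) this] obtain thx where thx: "thx > 0" "!!u. u \<in> {a..b} ==> \<bar>u - s\<bar> < thx ==> \<exists>y\<in>K u. dist y x < et / 2" by blast
 have "\<forall>\<^sub>F n in sequentially. False"
 using tendstoD[OF lT thx(1)] tendstoD[OF lX \<open>et / 2 > 0\<close>]
 proof eventually_elim
 case (elim n)
 obtain y where y: "y \<in> K (T (r n))" "dist y x < et / 2" using thx(2)[OF STX(2)] elim(1) by (auto simp: dist_real_def)
 have "dist y (X (r n)) < et" using y(2) elim(2) dist_triangle2[of y "X (r n)" x] by simp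
 then show False using STX(5)[OF y(1)] by blast
 qed
 then show False by simp
 qed
 then show ?thesis using that by blast
qed

text \<open>The step length is uniform, so finitely many steps of length \<open>h / 2\<close> reach
  every time.\<close>

lemma real_step_induct:
 fixes a b :: real
 assumes h: "h > 0" and t: "t \<in> {a..b}" and init: "Q a" and step: "!!s t. Q s ==> a <= s ==> s <= t ==> t <= b ==> t - s < h ==> Q t"
 shows "Q t"
proof -
 have *: "\<forall>t\<in>{a..b}. t <= a + real n * (h / 2) --> Q t" for n
 proof (induction n)
 case 0
 then show ?case using init by auto
 next
 case (Suc n)
 show ?case
 proof (intro ballI impI)
 fix t assume t: "t \<in> {a..b}" "t <= a + real (Suc n) * (h / 2)"
 define s where "s = max a (t - h / 2)"
 have s: "a <= s" "s <= t" "s <= b" "t - s < h" using t h by (auto simp: s_def)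
 have "s <= a + real n * (h / 2)" using t(2) h mult_nonneg_nonneg[of h "real n"] by (simp add: s_def field_simps max_def)
 then have "Q s" using Suc s by auto
 then show "Q t" using step s t by simp
 qed
 qed
 obtain n where "(t - a) / (h / 2) <= real n" using real_arch_simple by blast
 then have "t <= a + real n * (h / 2)" using h by (simp add: field_simps)
 then show ?thesis using * t by blast
qed

lemma ball_subset_or_disjoint:
 fixes K :: "'a::real_normed_vector set"
 assumes "ball x d \<inter> frontier K = {}" shows "ball x d <= K | ball x d \<inter> K = {}"
 using connected_Int_frontier[OF connected_ball, of x d K] assms by blast

text \<open>Translates of the flow by vectors shorter than \<open>d\<close> serve as barriers.\<close>
lemma depth_preserved:
 assumes L: "avoids_smooth_flows L" and K: "smooth_mcf {a..b} K" and bd: "bounded (\<Union>t\<in>{a..b}. K t)"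
 and a: "0 <= a + tax" and d: "d > 0" and init: "!!x. x \<in> L (a + tax) ==> ball x d <= K a" and t: "t \<in> {a..b}" and x: "x \<in> L (t + tax)"
 shows "ball x d <= K t"
proof -
 \<comment> \<open>The translate by \<open>v\<close>, delayed by \<open>tax\<close>, is disjoint
   from \<open>L\<close> at the start because points of \<open>L\<close> have depth \<open>d\<close>
   and \<open>v\<close> is shorter than \<open>d\<close>.\<close>
 have avoid: "L (s + tax) \<inter> (+) v ` frontier (K s) = {}" if v: "norm v < d" and s: "s \<in> {a..b}" for v s
 proof -
 let ?M = "%t. (+) v ` K (t - tax)"
 have I: "{t. t - tax \<in> {a..b}} = {a + tax..b + tax}" by auto
 have M: "smooth_mcf {a + tax..b + tax} ?M" using mcf_translate[OF K, of tax v] unfolding I .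
 have fr: "frontier (?M r) = (+) v ` frontier (K (r - tax))" for r by (rule frontier_translation)
 have "(\<Union>t\<in>{a + tax..b + tax}. ?M t) <= (+) v ` (\<Union>t\<in>{a..b}. K t)" by fastforce
 then have bM: "bounded (\<Union>t\<in>{a + tax..b + tax}. ?M t)" by (rule bounded_subset[OF bounded_translation[OF bd]])
 have i: "L (a + tax) \<inter> frontier (?M (a + tax)) = {}"
 proof (rule ccontr)
 assume "\<not> ?thesis"
 then obtain y where y: "v + y \<in> L (a + tax)" "y \<in> frontier (K a)" unfolding fr by auto
 have "y \<in> ball (v + y) d" using v by (simp add: dist_norm)
 then have "y \<in> interior (K a)" using interior_maximal[OF init[OF y(1)] open_ball] by blast
 then show False using y(2) by (simp add: frontier_def)
 qed
 have "a + tax <= b + tax" "s + tax \<in> {a + tax..b + tax}" using s by auto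
 then have "L (s + tax) \<inter> frontier (?M (s + tax)) = {}"
 using L[unfolded avoids_smooth_flows_def, rule_format, of "a + tax" "b + tax" ?M "s + tax"] a M bM i by blast
 then show ?thesis unfolding fr by simp
 qed
 \<comment> \<open>A frontier point in the ball would put \<open>x\<close> on a translated frontier.
   So each ball is entirely inside or entirely outside, and it remains to exclude a switch.\<close>
 have dich: "ball x d <= K s | ball x d \<inter> K s = {}" if s: "s \<in> {a..b}" and x: "x \<in> L (s + tax)" for s x
 proof (rule ball_subset_or_disjoint, rule ccontr)
 assume "ball x d \<inter> frontier (K s) ~= {}"
 then obtain y where y: "dist x y < d" "y \<in> frontier (K s)" by auto
 then have "x \<in> (+) (x - y) ` frontier (K s)" by (intro image_eqI[of _ _ y]) simp_all
 then show False using avoid[of "x - y" s] y(1) s x by (auto simp: dist_norm)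
 qed
 have d2: "d / 2 > 0" using d by simp
 obtain h where h: "h > 0" "!!s t x. s \<in> {a..b} ==> t \<in> {a..b} ==> \<bar>s - t\<bar> < h ==> x \<in> K s ==> \<exists>y\<in>K t. dist y x < d / 2"
 by (rule mcf_uniform_persist[OF K bd d2]) (rule that)
 \<comment> \<open>During such a short step a point \<open>x\<close> of \<open>L\<close> at the end
   has a predecessor within \<open>d / 2\<close>, hence belonged to \<open>K\<close> at the
   beginning, and \<open>K\<close> still has a point within \<open>d / 2\<close> of
   \<open>x\<close>. So the ball cannot have become disjoint from \<open>K\<close>.\<close>
 define h' where "h' = min h ((d / 40)\<^sup>2)"
 have h': "h' > 0" using h(1) d by (simp add: h'_def)
 have main: "\<forall>x\<in>L (t + tax). ball x d <= K t"
 proof (rule real_step_induct[OF h' t, where Q="%t. \<forall>x\<in>L (t + tax). ball x d <= K t"])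
 show "\<forall>x\<in>L (a + tax). ball x d <= K a" using init by blast
 fix s t assume Q: "\<forall>x\<in>L (s + tax). ball x d <= K s" and st: "a <= s" "s <= t" "t <= b" "t - s < h'"
 show "\<forall>x\<in>L (t + tax). ball x d <= K t"
 proof (rule ballI, rule ccontr)
 fix x assume x: "x \<in> L (t + tax)" "\<not> ball x d <= K t"
 have T: "t \<in> {a..b}" "s \<in> {a..b}" using st by auto
 have dj: "ball x d \<inter> K t = {}" using dich[OF T(1) x(1)] x(2) by blast
 have "sqrt (t - s) < sqrt ((d / 40)\<^sup>2)" using st(4) by (intro real_sqrt_less_mono) (simp add: h'_def)
 then have sq: "10 * sqrt (t - s) < d / 2" using d by simp
 have e: "s + tax + (t - s) = t + tax" by simp
 have "L (s + tax) \<inter> ball x (d / 2) ~= {}"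
 using avoids_no_jump[OF L _ _ sq, of "s + tax" x x] a st(1,2) d x(1) unfolding e by auto
 then obtain z where z: "z \<in> L (s + tax)" "dist x z < d / 2" by auto
 have "x \<in> ball z d" using z(2) d by (simp add: dist_commute)
 then have "x \<in> K s" using Q z(1) by blast
 then obtain y where y: "y \<in> K t" "dist y x < d / 2" using h(2)[OF T(2,1)] st by (auto simp: h'_def)
 have "y \<in> ball x d" using y(2) zero_le_dist[of y x] unfolding mem_ball dist_commute[of x y] by linarith
 then show False using dj y(1) by blast
 qed
 qed
 then show ?thesis using x by blast
qed

section \<open>Depth across surgeries\<close>

lemma closed_sharp:
 assumes "delta_H_flow P de HH K" "i \<in> {1..<num_flows K}"
 shows "closed (sharp K i)" "smooth_domain (sharp K i)"
 using delta_flow_pieces(3)[OF assms] by (simp_all add: replaced_by_caps_def smooth_domain_def)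

text \<open>A large ball cannot enter a neck: it would contain a point far from the axis of the neck.\<close>
lemma ball_misses_neck:
 assumes F: "delta_H_flow P de HH K" and i: "i \<in> {1..<num_flows K}" and n: "(p, r) \<in> necks K i"
 and de: "de <= 1 / 100" and B: "ball x d <= pre_domain K i" and d: "d >= 20 * r"
 shows "ball x d \<inter> ball p (5 * cap_sep P * r) = {}"
proof (rule ccontr)
 assume "\<not> ?thesis"
 then obtain z where z: "dist x z < d" "dist p z < 5 * cap_sep P * r" by auto
 have i1: "i \<in> {1..num_flows K}" using i by simp
 have sti: "stime K (i - 1) < stime K i" "stime K i = ereal (surgery_time K i)"
 using stime_flow(3)[OF F, of "i - 1" i] stime_flow(7)[OF F, of i] i by auto
 have pre: "domain_at K (surgery_time K i) = pre_domain K i"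
 unfolding pre_domain_def
 proof (rule domain_at_slice[OF F i1])
 show "surgery_time K i \<in> piece_interval K i" using sti by (simp add: piece_interval_def)
 have "stime K (i - 1) = ereal (surgery_time K (i - 1))" using stime_flow(7)[OF F, of "i - 1"] i by auto
 then have "ereal (surgery_time K (i - 1)) < ereal (surgery_time K i)" using sti by simp
 then show "surgery_time K (i - 1) < surgery_time K i | i = 1" by simp
 qed
 have Ga: "de <= 1 / (100 * cap_sep P)" using delta_flow_pieces(3)[OF F i] n unfolding replaced_by_caps_def by auto
 have de0: "de > 0" using F by (simp add: delta_H_flow_def delta_flow_def)
 have SN: "strong_neck K de p r (surgery_time K i)" by (rule delta_flow_pieces(6)[OF F i n])
 then have r: "r > 0" by (simp add: strong_neck_def)
 obtain e where e: "norm e = 1" and FC: "flow_close de (nat \<lfloor>1 / de\<rfloor>) (1 / de) (%t. rescale p r (domain_at K (surgery_time K i + r\<^sup>2 * t))) (%t. round_cylinder e (sqrt (1 - 2 * t)))"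
 using SN unfolding strong_neck_def by blast
 obtain W and phx :: "R3 \<times> real => R3" where
 ck: "Ck_norm_le (nat \<lfloor>1 / de\<rfloor>) de (ball 0 (1 / de) \<times> {-1<..0}) (%z. phx z - fst z)"
 and iff: "!!t x. t \<in> {-1<..0} ==> x \<in> ball 0 (1 / de) ==> x \<in> rescale p r (domain_at K (surgery_time K i + r\<^sup>2 * t)) \<longleftrightarrow> phx (x, t) \<in> round_cylinder e (sqrt (1 - 2 * t))"
 using FC unfolding flow_close_def by blast
 have iff0: "x \<in> rescale p r (pre_domain K i) \<longleftrightarrow> phx (x, 0) \<in> round_cylinder e 1" if "norm x < 1 / de" for x
 using iff[of 0 x] that by (simp add: pre)
 have close: "norm (phx (x, 0) - x) <= de" if "norm x < 1 / de" for x
 using ck[unfolded Ck_norm_le_def, rule_format, of "[]" "(x, 0)"] that by simp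
 have d0: "d > 0" using r d by linarith
 \<comment> \<open>\<open>y\<close> is \<open>z\<close> pushed towards the centre \<open>x\<close>,
   just far enough that the ball of radius \<open>10 * r\<close> about \<open>y\<close> fits into
   the large ball; it is still less than \<open>10 * r\<close> away from \<open>z\<close>, hence
   near the neck.\<close>
 define lam where "lam = 10 * r / d"
 have lam: "0 < lam" "lam <= 1" using r d d0 by (auto simp: lam_def)
 define y where "y = z + lam *# (x - z)"
 have yz: "dist y z < 10 * r"
 proof -
 have "dist y z = lam * dist x z" using lam by (simp add: y_def dist_norm)
 also have "... < lam * d" using z(1) lam by (intro mult_strict_left_mono)
 also have "... = 10 * r" using d0 by (simp add: lam_def)
 finally show ?thesis .
 qed
 have yx: "dist y x <= d - 10 * r"
 proof -
 have "y - x = (1 - lam) *# (z - x)" by (simp add: y_def algebra_simps)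
 then have "dist y x = (1 - lam) * dist x z" using lam by (simp add: dist_norm norm_minus_commute)
 also have "... <= (1 - lam) * d" using z(1) lam by (intro mult_left_mono) auto
 also have "... = d - 10 * r" using d0 by (simp add: lam_def algebra_simps)
 finally show ?thesis .
 qed
 define u where "u = (1 / r) *# (y - p)"
 obtain w0 b where fr0: "orthoframe w0 b e" by (rule orthoframe_exists[OF e])
 \<comment> \<open>A direction orthogonal to the axis, with its sign chosen such that moving along
   it from \<open>u\<close> increases the distance from the axis.\<close>
 define w where "w = (if w0 *. u >= 0 then w0 else - w0)"
 have w: "norm w = 1" "w *. e = 0" "w *. u >= 0" "w *. w = 1" using orthoframeD[OF fr0] by (auto simp: w_def)
 have D100: "1 / de >= 100" using de de0 by (simp add: field_simps)
 have "100 * cap_sep P * de <= 1"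
 proof (cases "cap_sep P > 0")
 case True
 then show ?thesis using Ga by (simp add: field_simps)
 next
 case False
 then show ?thesis using mult_nonpos_nonneg[of "cap_sep P" de] de0 by simp
 qed
 then have G: "5 * cap_sep P <= (1 / de) / 20" using de0 by (simp add: field_simps)
 have "norm u = dist y p / r" using r by (simp add: u_def dist_norm)
 also have "... <= (10 * r + 5 * cap_sep P * r) / r"
 using dist_triangle[of y p z] yz z(2) r by (intro divide_right_mono) (simp_all add: dist_commute)
 also have "... = 10 + 5 * cap_sep P" using r by (simp add: field_simps)
 finally have nu: "norm u <= 10 + (1 / de) / 20" using G by simp
 \<comment> \<open>Any length above \<open>1 + de\<close> and below 10 would do:
   \<open>p + r q\<close> stays in the large ball, \<open>q\<close> stays where the neck is close to
   a cylinder, and the image of \<open>q\<close> would have to lie farther from the axis than the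
   radius 1 of the cylinder at the final time.\<close>
 define q where "q = u + (29 / 10) *# w"
 have "norm q <= norm u + 29 / 10" unfolding q_def using w(1) norm_triangle_ineq[of u "(29 / 10) *# w"] by simp
 moreover define Dl where "Dl = 1 / de"
 ultimately have "norm q < Dl" using nu D100 unfolding Dl_def[symmetric] by linarith
 then have nq: "norm q < 1 / de" by (simp only: Dl_def)
 have "p + r *# q \<in> ball x d"
 proof -
 have "p + r *# q = y + (29 / 10 * r) *# w" using r by (simp add: q_def u_def algebra_simps)
 then have "dist (p + r *# q) y = 29 / 10 * r" using r w(1) by (simp add: dist_norm)
 then show ?thesis using yx r dist_triangle[of "p + r *# q" x y] by (simp add: dist_commute)
 qed
 then have "p + r *# q \<in> pre_domain K i" using B by blast
 then have "q \<in> rescale p r (pre_domain K i)" unfolding rescale_def using r by (intro image_eqI[of _ _ "p + r *# q"]) simp_all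
 then have cyl: "norm (phx (q, 0) - (phx (q, 0) *. e) *# e) <= 1" using iff0[OF nq] by (simp add: round_cylinder_def)
 have "w *. (phx (q, 0)) = w *. (phx (q, 0) - (phx (q, 0) *. e) *# e)" using w by (simp add: inner_diff_right)
 also have "... <= 1" using norm_cauchy_schwarz[of w "phx (q, 0) - (phx (q, 0) *. e) *# e"] w(1) cyl by simp
 finally have "w *. phx (q, 0) <= 1" .
 moreover have "w *. (q - phx (q, 0)) <= de" using norm_cauchy_schwarz[of w "q - phx (q, 0)"] w(1) close[OF nq] by (simp add: norm_minus_commute)
 moreover have "w *. q >= 29 / 10" using w by (simp add: q_def inner_add_right)
 ultimately show False using de by (simp add: inner_diff_right)
qed

text \<open>Comparison with the sphere that touches from inside: the outer normals agree at
  \<open>q\<close>, and the second fundamental form is at most \<open>1 / rh\<close> in each tangent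
  direction.\<close>

lemma mean_curv_inner_ball:
 assumes S: "smooth_domain S" and q: "q \<in> frontier S" "dist x q = rh" "rh > 0" and B: "ball x rh <= S"
 shows "mean_curv S q <= 2 / rh"
proof -
 obtain f U where U: "q \<in> U" "local_def S U f" using S q(1) unfolding smooth_domain_def defining_function_iff by blast
 note L = local_defD[OF U(2)]
 have fq: "f q = 0" using frontier_local_def[OF U(2,1)] q(1) by simp
 define e where "e = (1 / rh) *# (q - x)"
 have e: "norm e = 1" "x - q = rh *# (- e)" using q by (auto simp: e_def dist_norm norm_minus_commute)
 have sq: "(dist (q + u) x)\<^sup>2 = rh\<^sup>2 + 2 * rh * (e *. u) + u *. u" for u
 using dist_line_sq[OF e(2), of u] e(1) by simp
 have inside: "f (q + u) <= 0" if "2 * rh * (e *. u) + u *. u < 0" "q + u \<in> U" for u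
 proof -
 have "(dist (q + u) x)\<^sup>2 < rh\<^sup>2" using sq[of u] that(1) by simp
 then have "dist (q + u) x < rh" using q(3) by (simp add: power2_less_imp_less)
 then show ?thesis using B L(3)[OF that(2)] by (auto simp: dist_commute)
 qed
 have c: "gradient f q *. u <= 0" if u: "e *. u < 0" for u
 proof (rule ccontr)
 assume "\<not> ?thesis"
 then have "\<forall>\<^sub>F s in at_right 0. f (q + s *# u) > 0" using fq by (intro eventually_ascent[OF L(2) U(1)]) simp_all
 moreover have un: "u *. u + 1 > 0" by (simp add: add_nonneg_pos)
 have "\<forall>\<^sub>F s in at_right 0. 0 < s & s < 2 * rh * (- (e *. u)) / (u *. u + 1)"
 unfolding eventually_at_right_field using u q(3) un by (intro exI[of _ "2 * rh * (- (e *. u)) / (u *. u + 1)"] conjI divide_pos_pos mult_pos_pos) auto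
 moreover note eventually_line_in[OF L(1) U(1), of u]
 ultimately have "\<forall>\<^sub>F s in at_right (0::real). False"
 proof eventually_elim
 case (elim s)
 have "s * (u *. u) <= s * (u *. u + 1)" using elim by simp
 also have "... < 2 * rh * (- (e *. u))" using elim un by (simp add: field_simps)
 finally have "s * (2 * rh * (e *. u) + s * (u *. u)) < 0" using elim by (simp add: mult_less_0_iff)
 then have "f (q + s *# u) <= 0" by (intro inside) (use elim in \<open>simp_all add: algebra_simps\<close>)
 then show False using elim by simp
 qed
 then show False by simp
 qed
 have g0: "gradient f q ~= 0" "e ~= 0" using L(4)[OF U(1)] e(1) by auto
 obtain m where m: "m > 0" "e = m *# gradient f q" by (rule cone_normal[OF g0(2,1) c])
 define n where "n = 1 / m"
 have n: "n > 0" "gradient f q = n *# e" using m by (simp_all add: n_def)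
 obtain e1 e2 where fr: "orthoframe e1 e2 e" by (rule orthoframe_exists[OF e(1)])
 note Fr = orthoframeD[OF fr]
 have *: "nderiv [v, v] f q <= n / rh" if v: "v *. e = 0" "v *. v = 1" for v
 proof (rule ccontr)
 assume "\<not> ?thesis"
 then obtain k where k: "n / rh < k" "k < nderiv [v, v] f q" using dense not_le by blast
 have gv: "gradient f q *. v = 0" "gradient f q *. e = n" using v n Fr by (simp_all add: inner_commute)
 have "nderiv [v, v] f q > (k / n) * (gradient f q *. e)" using k(2) n(1) gv by (simp del: nderiv.simps)
 note ev = parabola_sign(2)[OF L(1,2) U(1) fq gv(1) this]
 \<comment> \<open>A parabola bending more than the sphere, that is with \<open>j > 1 / rh\<close>,
   runs inside the ball; if the surface bent even more, the parabola would leave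
   \<open>S\<close>.\<close>
 define j where "j = k / n"
 have j: "j * rh > 1" using k(1) n(1) q(3) by (simp add: j_def field_simps)
 define g where "g s = s *# v - (j * s\<^sup>2 / 2) *# e" for s
 have ge: "e *. g s = - (j * s\<^sup>2 / 2)" "g s *. g s = s\<^sup>2 + (j * s\<^sup>2 / 2)\<^sup>2" for s
 using v Fr by (simp_all add: g_def inner_diff_left inner_diff_right inner_commute power2_eq_square algebra_simps)
 have "((%s. q + g s) \<longlongrightarrow> q + (0 *# v - (j * 0\<^sup>2 / 2) *# e)) (at_right 0)" unfolding g_def by (intro tendsto_intros) simp
 then have "((%s. q + g s) \<longlongrightarrow> q) (at_right 0)" by simp
 note inU = topological_tendstoD[OF this L(1) U(1)]
 have "((%s. 1 + (j * s / 2)\<^sup>2 - j * rh) \<longlongrightarrow> 1 + (j * 0 / 2)\<^sup>2 - j * rh) (at_right 0)" by (intro tendsto_intros) simp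
 then have "\<forall>\<^sub>F s in at_right 0. 1 + (j * s / 2)\<^sup>2 - j * rh < 0" by (rule order_tendstoD(2)) (use j in \<open>simp, linarith?\<close>)
 moreover have "\<forall>\<^sub>F s in at_right (0::real). s > 0" by (rule eventually_at_right_less)
 ultimately have "\<forall>\<^sub>F s in at_right (0::real). False" using ev inU
 proof eventually_elim
 case (elim s)
 have "2 * rh * (e *. g s) + g s *. g s = s\<^sup>2 * (1 + (j * s / 2)\<^sup>2 - j * rh)"
 unfolding ge by (simp add: power2_eq_square algebra_simps)
 also have "... < 0" using elim by (simp add: mult_less_0_iff)
 finally have "f (q + g s) <= 0" by (rule inside) (use elim in simp)
 then show False using elim(3) by (simp add: g_def j_def add_diff_eq)
 qed
 then show False by simp
 qed
 have "mean_curv S q = (nderiv [e1, e1] f q + nderiv [e2, e2] f q) / norm (gradient f q)"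
 by (rule mean_curv_frame[OF U(2,1) fq fr n(2)])
 also have "... <= (n / rh + n / rh) / norm (gradient f q)" using Fr by (intro divide_right_mono add_mono *) auto
 also have "... = 2 / rh" using n e(1) by simp
 finally show ?thesis .
qed

lemma delta_H_surgery:
 assumes F: "delta_H_flow P de HH K" and i: "i \<in> {1..<num_flows K}"
 shows "(p, r) \<in> necks K i ==> r = 1 / H_neck HH"
 "post_domain K i = \<Union>{A \<in> components (sharp K i). \<not> (\<forall>x\<in>A \<inter> frontier (sharp K i). mean_curv (sharp K i) x > H_neck HH / 10)}"
proof -
 note D = bspec[OF F[unfolded delta_H_flow_def, THEN conjunct2, THEN conjunct2, THEN conjunct2, THEN conjunct2, THEN conjunct2, THEN conjunct2, THEN conjunct2, THEN conjunct2, THEN conjunct2, THEN conjunct2, THEN conjunct2] i]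
 show "r = 1 / H_neck HH" if "(p, r) \<in> necks K i" using bspec[OF D[THEN conjunct1] that] by simp
 show "post_domain K i = \<Union>{A \<in> components (sharp K i). \<not> (\<forall>x\<in>A \<inter> frontier (sharp K i). mean_curv (sharp K i) x > H_neck HH / 10)}"
 by (rule D[THEN conjunct2, THEN conjunct2, THEN conjunct1])
qed

text \<open>The ball avoids the necks and so lies in the domain after the cuts. Enlarged until it
  touches the frontier at \<open>q\<close>, it has radius \<open>rh >= d\<close>, and the mean
  curvature at \<open>q\<close> is at most \<open>2 / rh <= H_neck / 10\<close>. Hence its component
  is not discarded.\<close>

lemma depth_surgery:
 assumes F: "delta_H_flow P de HH K" and i: "i \<in> {1..<num_flows K}" and de: "de <= 1 / 100"
 and B: "ball x d <= pre_domain K i" and d: "d >= 20 / H_neck HH"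
 shows "ball x d <= post_domain K i"
proof -
 let ?S = "sharp K i"
 have H: "H_neck HH > 0" using F by (simp add: delta_H_flow_def)
 then have "20 / H_neck HH > 0" by simp
 then have d0: "d > 0" using d by linarith
 have rr: "r = 1 / H_neck HH" if "(p, r) \<in> necks K i" for p r by (rule delta_H_surgery(1)[OF F i that])
 have out: "ball x d \<inter> (\<Union>(p, r)\<in>necks K i. ball p (5 * cap_sep P * r)) = {}"
 using ball_misses_neck[OF F i _ de B] rr d by fastforce
 have "?S - (\<Union>(p, r)\<in>necks K i. ball p (5 * cap_sep P * r)) = pre_domain K i - (\<Union>(p, r)\<in>necks K i. ball p (5 * cap_sep P * r))"
 using delta_flow_pieces(3)[OF F i] unfolding replaced_by_caps_def by blast
 then have BS: "ball x d <= ?S" using B out by blast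
 have "?S <= domain_at K 0"
 proof -
 have "surgery_time K i \<in> piece_interval K i"
 using stime_flow(3)[OF F, of "i - 1" i] stime_flow(7)[OF F, of i] i by (simp add: piece_interval_def)
 then have "pre_domain K i <= domain_at K 0"
 unfolding pre_domain_def using surgery_flow_decreases[OF F, of i] i by simp
 then show ?thesis using delta_flow_pieces(5)[OF F i] by blast
 qed
 moreover have "bounded (domain_at K 0)" using F by (simp add: delta_H_flow_def compact_imp_bounded)
 ultimately have bS: "bounded ?S" using bounded_subset by blast
 have xS: "x \<in> ?S" using BS d0 by auto
 have "?S ~= UNIV" using bS not_bounded_UNIV[where 'a=R3] by metis
 then have frne: "frontier ?S ~= {}" using frontier_not_empty[of ?S] xS by blast
 obtain q where q: "q \<in> frontier ?S" "!!y. y \<in> frontier ?S ==> dist x q <= dist x y"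
 using distance_attains_inf[OF frontier_closed frne, of x] by blast
 define rh where "rh = dist x q"
 have rh: "rh >= d"
 proof (rule ccontr)
 assume "\<not> ?thesis"
 then have "q \<in> interior ?S" using interior_maximal[OF BS open_ball] by (auto simp: rh_def)
 then show False using q(1) by (simp add: frontier_def)
 qed
 have "ball x rh \<inter> frontier ?S = {}" using q(2) by (force simp: rh_def)
 moreover have "x \<in> ball x rh" using rh d0 by simp
 ultimately have Brh: "ball x rh <= ?S" using ball_subset_or_disjoint[of x rh ?S] xS by blast
 have "closure (ball x rh) <= ?S" by (rule closure_minimal[OF Brh closed_sharp(1)[OF F i]])
 then have C: "cball x rh <= ?S" using rh d0 by simp
 obtain A where A: "A \<in> components ?S" "cball x rh <= A"
 using exists_component_superset[OF C _ connected_cball] xS by blast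
 have qA: "q \<in> A" using A(2) by (auto simp: rh_def)
 have "mean_curv ?S q <= 2 / rh"
 by (rule mean_curv_inner_ball[OF closed_sharp(2)[OF F i] q(1) rh_def[symmetric] _ Brh]) (use rh d0 in simp)
 also have "... <= 2 / (20 / H_neck HH)" using rh d d0 H by (intro divide_left_mono) auto
 also have "... = H_neck HH / 10" by simp
 finally have "\<not> (\<forall>x\<in>A \<inter> frontier ?S. mean_curv ?S x > H_neck HH / 10)" using qA q(1) by (auto simp: not_less)
 moreover note delta_H_surgery(2)[OF F i]
 ultimately have "A <= post_domain K i" using A(1) by blast
 moreover have "ball x d <= cball x rh" using rh by auto
 ultimately show ?thesis using A(2) by blast
qed

text \<open>Compactness of the track of frontiers. Continuity is used for the time derivative of
  \<open>F\<close>, which equals the gradient norm times the mean curvature, together with the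
  continuous bound \<open>G\<close> for the gradient norm; a sequence with curvatures tending to 0
  would give a limit point where it vanishes.\<close>

lemma mcf_curvature_bound:
 assumes K: "smooth_mcf {a..b} K" and bd: "bounded (\<Union>t\<in>{a..b}. K t)" and H: "!!t. t \<in> {a..b} ==> mean_convex (K t)"
 obtains h where "h > 0" "!!t x. t \<in> {a..b} ==> x \<in> frontier (K t) ==> mean_curv (K t) x > h"
proof -
 have "\<exists>h>0. ALL t x. t \<in> {a..b} --> x \<in> frontier (K t) --> mean_curv (K t) x > h"
 proof (rule ccontr)
 assume neg: "\<not> ?thesis"
 have "EX t x. t \<in> {a..b} & x \<in> frontier (K t) & mean_curv (K t) x <= 1 / real (Suc n)" for n
 proof -
 have "(0::real) < 1 / real (Suc n)" by simp
 with neg show ?thesis by (meson not_less)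
 qed
 then obtain T X where TX: "!!n. T n \<in> {a..b}" "!!n. X n \<in> frontier (K (T n))" "!!n. mean_curv (K (T n)) (X n) <= 1 / real (Suc n)"
 by metis
 have "ALL n. (T n, X n) \<in> {(t, x). t \<in> {a..b} & x \<in> frontier (K t)}" using TX by simp
 then obtain l r where l: "l \<in> {(t, x). t \<in> {a..b} & x \<in> frontier (K t)}" "strict_mono (r::nat=>nat)" "((%n. (T n, X n)) \<circ> r) ----> l"
 using mcf_track_compact(2)[OF K bd] unfolding compact_def by meson
 obtain t x where tx: "l = (t, x)" "t \<in> {a..b}" "x \<in> frontier (K t)" using l(1) by auto
 have lT: "(%n. T (r n)) ----> t" and lX: "(%n. X (r n)) ----> x"
 using tendsto_fst[OF l(3)] tendsto_snd[OF l(3)] by (simp_all add: tx o_def)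
 obtain W F where W: "(x, t) \<in> W" "open W" "smooth_on W F"
 "!!x s. (x, s) \<in> W ==> s \<in> {a..b} ==> x \<in> K s \<longleftrightarrow> F (x, s) <= 0"
 "!!x s. (x, s) \<in> W ==> s \<in> {a..b} ==> x \<in> frontier (K s) \<longleftrightarrow> F (x, s) = 0"
 "!!x s. (x, s) \<in> W ==> s \<in> {a..b} ==> F (x, s) = 0 ==> gradient (%y. F (y, s)) x ~= 0"
 "!!x s. (x, s) \<in> W ==> s \<in> {a..b} ==> F (x, s) = 0 ==> nderiv [(0, 1)] F (x, s) = norm (gradient (%y. F (y, s)) x) * mean_curv (K s) x"
 by (rule chart_rate[OF K tx(2), of x]) (rule that)
 define G where "G z = (\<Sum>b\<in>(Basis::R3 set). \<bar>nderiv [(b, 0)] F z\<bar>)" for z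
 have gG: "norm (gradient (%y. F (y, s)) y) <= G (y, s)" if "(y, s) \<in> W" for y s
 using norm_le_l1[of "gradient (%y. F (y, s)) y"] slice_gradient[OF W(2,3) that] by (simp add: G_def del: nderiv.simps)
 have lim: "(%n. (X (r n), T (r n))) ----> (x, t)" by (intro tendsto_Pair lX lT)
 have ND: "(%n. nderiv vs F (X (r n), T (r n))) ----> nderiv vs F (x, t)" for vs
 by (rule isCont_tendsto_compose[OF continuous_nderiv[OF W(3,1)] lim])
 have lG: "(%n. G (X (r n), T (r n)) * inverse (real (Suc (r n)))) ----> G (x, t) * 0"
 unfolding G_def by (intro tendsto_mult tendsto_sum tendsto_rabs ND LIMSEQ_subseq_LIMSEQ[OF LIMSEQ_inverse_real_of_nat l(2), unfolded o_def])
 have "nderiv [(0, 1)] F (x, t) <= G (x, t) * 0"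
 proof (rule tendsto_le[OF sequentially_bot lG ND])
 show "\<forall>\<^sub>F n in sequentially. nderiv [(0, 1)] F (X (r n), T (r n)) <= G (X (r n), T (r n)) * inverse (real (Suc (r n)))"
 using topological_tendstoD[OF lim W(2,1)]
 proof eventually_elim
 case (elim n)
 have F0: "F (X (r n), T (r n)) = 0" using W(5)[OF elim TX(1)] TX(2) by blast
 have "nderiv [(0, 1)] F (X (r n), T (r n)) = norm (gradient (%y. F (y, T (r n))) (X (r n))) * mean_curv (K (T (r n))) (X (r n))"
 by (rule W(7)[OF elim TX(1) F0])
 also have "... <= norm (gradient (%y. F (y, T (r n))) (X (r n))) * (1 / real (Suc (r n)))" by (intro mult_left_mono TX(3)) simp
 also have "... <= G (X (r n), T (r n)) * (1 / real (Suc (r n)))" by (intro mult_right_mono gG[OF elim]) simp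
 finally show ?case by (simp only: inverse_eq_divide)
 qed
 qed
 moreover have F0: "F (x, t) = 0" using W(5)[OF W(1) tx(2)] tx(3) by blast
 have "nderiv [(0, 1)] F (x, t) > 0"
 unfolding W(7)[OF W(1) tx(2) F0] using W(6)[OF W(1) tx(2) F0] H[OF tx(2)] tx(3) by (simp add: mean_convex_def)
 ultimately show False by simp
 qed
 then show ?thesis using that by blast
qed

text \<open>Each point \<open>y\<close> of the ball is reached from \<open>x\<close> by the constant
  velocity \<open>(y - x) / (t - a)\<close>, which is short enough for
  \<open>mcf_speed\<close>.\<close>

lemma mcf_depth:
 assumes K: "smooth_mcf {a..b} K" and H: "!!t x. t \<in> {a..b} ==> x \<in> frontier (K t) ==> mean_curv (K t) x > h"
 and t: "t \<in> {a..b}" and x: "x \<in> K t"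
 shows "ball x (h * (t - a)) <= K a"
proof (cases "t = a")
 case False
 then have ta: "t - a > 0" using t by simp
 show ?thesis
 proof
 fix y assume "y \<in> ball x (h * (t - a))"
 then have y: "norm (y - x) <= h * (t - a)" by (simp add: dist_norm norm_minus_commute)
 have "x + (t - a) *# ((1 / (t - a)) *# (y - x)) \<in> K a"
 proof (rule mcf_speed[OF K is_interval_cc H _ t _ _ x])
 have "norm ((1 / (t - a)) *# (y - x)) = norm (y - x) / (t - a)" using ta by simp
 also have "... <= h * (t - a) / (t - a)" using y ta by (intro divide_right_mono) auto
 also have "... = h" using ta by simp
 finally show "norm ((1 / (t - a)) *# (y - x)) <= h" .
 qed (use ta t in auto)
 then show "y \<in> K a" using ta by simp
 qed
qed simp

section \<open>Rotationally symmetric barriers\<close>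

lemma polar_nonneg:
 fixes x y :: real obtains rh thx where "0 <= rh" "x = rh * cos thx" "y = rh * sin thx"
proof -
 obtain r a where ra: "x = r * cos a" "y = r * sin a" using polar_Ex by blast
 show ?thesis
 proof (cases "r >= 0")
 case False
 then show ?thesis using that[of "- r" "a + pi"] ra by simp
 qed (use that ra in blast)
qed

lemma arctan_polar:
 fixes A B :: real assumes "A > 0"
 shows "sqrt (A\<^sup>2 + B\<^sup>2) * cos (arctan (B / A)) = A" "sqrt (A\<^sup>2 + B\<^sup>2) * sin (arctan (B / A)) = B"
proof -
 have "1 + (B / A)\<^sup>2 = (A\<^sup>2 + B\<^sup>2) / A\<^sup>2" using assms by (simp add: field_simps)
 then have e: "sqrt (1 + (B / A)\<^sup>2) = sqrt (A\<^sup>2 + B\<^sup>2) / A" using assms by (simp add: real_sqrt_divide)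
 have p: "sqrt (A\<^sup>2 + B\<^sup>2) > 0" using assms by (simp add: add_pos_nonneg)
 show "sqrt (A\<^sup>2 + B\<^sup>2) * cos (arctan (B / A)) = A" "sqrt (A\<^sup>2 + B\<^sup>2) * sin (arctan (B / A)) = B"
 unfolding cos_arctan sin_arctan e using assms p by (simp_all add: field_simps)
qed

text \<open>The output of \<open>profile_evolution\<close> for \<open>ka = 1 / R\<close>, with
  \<open>E3\<close> the axis of rotation and \<open>R\<close> the core radius. Smoothness and the
  evolution equation hold for \<open>0 < t < T\<close> only, while the bounds on \<open>q\<close>
  hold at time 0 as well.\<close>

locale torus_flow =
 fixes E1 E2 E3 :: R3 and R T :: real and q q1 q2 :: "real => real => real"
 assumes frame: "orthoframe E1 E2 E3" and R: "R >= 1000" and T: "0 < T"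
 and q_smooth: "smooth_on (UNIV \<times> {0<..<T}) (%(s,t). q s t)"
 and q_periodic: "!!s t. q (s + 2 * pi) t = q s t" and q_bounds: "!!s t. 1/2 <= q s t & q s t <= 2"
 and q_deriv: "!!s t. ((%s. q s t) has_real_derivative q1 s t) (at s)" "!!s t. ((%s. q1 s t) has_real_derivative q2 s t) (at s)"
 and q_evolution: "!!s t. 0 < t ==> t < T ==> ((%t. q s t) has_real_derivative
 (q s t ^ 4 * (q s t + q2 s t) / ((q s t)\<^sup>2 + (q1 s t)\<^sup>2)
 + (1/R) * (q s t)\<^sup>2 * (q s t * cos s - q1 s t * sin s) / (q s t + (1/R) * cos s))) (at t)"
begin

definition pt :: "real => real => real => R3" where
 "pt rh thx phx = (R + rh * cos thx) *# (cos phx *# E1 + sin phx *# E2) + (rh * sin thx) *# E3"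

definition rad :: "R3 => real" where "rad x = sqrt ((x *. E1)\<^sup>2 + (x *. E2)\<^sup>2)"

text \<open>No polar angle function is selected. By periodicity of \<open>q\<close> the condition
  does not depend on which angle represents the point, and on the core circle, where the angle is
  arbitrary, it holds trivially.\<close>

definition torus :: "real => R3 set" where
 "torus t = {x. EX rh thx. 0 <= rh & rad x = R + rh * cos thx & x *. E3 = rh * sin thx & rh * q thx t <= 1}"

lemma q_pos: "q s t > 0" using q_bounds[of s t] by linarith

lemma pt_inner: "pt rh thx phx *. E1 = (R + rh * cos thx) * cos phx" "pt rh thx phx *. E2 = (R + rh * cos thx) * sin phx" "pt rh thx phx *. E3 = rh * sin thx"
 using orthoframeD[OF frame] by (simp_all add: pt_def inner_add_left)

lemma rad_pt: "0 <= R + rh * cos thx ==> rad (pt rh thx phx) = R + rh * cos thx"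
proof -
 assume a: "0 <= R + rh * cos thx"
 have "((R + rh * cos thx) * cos phx)\<^sup>2 + ((R + rh * cos thx) * sin phx)\<^sup>2 = (R + rh * cos thx)\<^sup>2 * ((cos phx)\<^sup>2 + (sin phx)\<^sup>2)"
 by (simp only: power_mult_distrib distrib_left)
 then show ?thesis using a unfolding rad_def pt_inner by simp
qed

lemma rad_nonneg: "0 <= rad x" by (simp add: rad_def)

lemma pt_of:
 assumes "rad x = R + rh * cos thx" "x *. E3 = rh * sin thx"
 obtains phx where "x = pt rh thx phx"
proof -
 obtain r phx where r: "0 <= r" "x *. E1 = r * cos phx" "x *. E2 = r * sin phx" by (rule polar_nonneg)
 have "(x *. E1)\<^sup>2 + (x *. E2)\<^sup>2 = r\<^sup>2 * ((cos phx)\<^sup>2 + (sin phx)\<^sup>2)" unfolding r by (simp only: power_mult_distrib distrib_left)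
 then have "rad x = r" using r(1) by (simp add: rad_def)
 then have "x = pt rh thx phx" using orthoframe_expand[OF frame, of x] assms r by (simp add: pt_def scaleR_add_right)
 then show ?thesis by (rule that)
qed

lemma polar_of:
 obtains rh thx where "0 <= rh" "rad x = R + rh * cos thx" "x *. E3 = rh * sin thx" "rh\<^sup>2 = (rad x - R)\<^sup>2 + (x *. E3)\<^sup>2"
proof -
 obtain rh thx where r: "0 <= rh" "rad x - R = rh * cos thx" "x *. E3 = rh * sin thx" by (rule polar_nonneg)
 have "(rad x - R)\<^sup>2 + (x *. E3)\<^sup>2 = rh\<^sup>2 * ((cos thx)\<^sup>2 + (sin thx)\<^sup>2)" unfolding r by (simp only: power_mult_distrib distrib_left)
 then show ?thesis using that[OF r(1) _ r(3)] r(2) by simp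
qed

lemma q_angle: "cos a = cos b ==> sin a = sin b ==> q a t = q b t"
proof -
 have nat_per: "q (s + 2 * pi * real n) t = q s t" for s n
 proof (induction n)
 case (Suc n)
 have "s + 2 * pi * real (Suc n) = (s + 2 * pi * real n) + 2 * pi" by (simp add: algebra_simps)
 then show ?case using q_periodic[of "s + 2 * pi * real n" t] Suc by (simp only:)
 qed simp
 have int_per: "q (s + 2 * pi * of_int n) t = q s t" for s and n :: int
 proof (cases n)
 case (nonneg m)
 then show ?thesis using nat_per[of s m] by simp
 next
 case (neg m)
 have "s + 2 * pi * of_int n + 2 * pi * real (Suc m) = s" unfolding neg by (simp add: algebra_simps)
 then show ?thesis using nat_per[of "s + 2 * pi * of_int n" "Suc m"] by (simp only:)
 qed
 assume "cos a = cos b" "sin a = sin b"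
 then obtain n :: int where "a = b + 2 * pi * n" using sin_cos_eq_iff[of a b] by blast
 then show ?thesis using int_per by simp
qed

lemma torus_iff:
 assumes "0 <= rh" "rad x = R + rh * cos thx" "x *. E3 = rh * sin thx"
 shows "x \<in> torus t \<longleftrightarrow> rh * q thx t <= 1"
proof
 assume "x \<in> torus t"
 then obtain rh' th' where o: "0 <= rh'" "rad x = R + rh' * cos th'" "x *. E3 = rh' * sin th'" "rh' * q th' t <= 1"
 unfolding torus_def by blast
 have e: "rh' * cos th' = rh * cos thx" "rh' * sin th' = rh * sin thx" using o assms by simp_all
 have "rh'\<^sup>2 * ((cos th')\<^sup>2 + (sin th')\<^sup>2) = rh\<^sup>2 * ((cos thx)\<^sup>2 + (sin thx)\<^sup>2)"
 unfolding distrib_left power_mult_distrib[symmetric] e ..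
 then have r: "rh' = rh" using o(1) assms(1) by simp
 show "rh * q thx t <= 1"
 proof (cases "rh = 0")
 case False
 then have "q th' t = q thx t" using e r by (intro q_angle) simp_all
 then show ?thesis using o(4) r by simp
 qed simp
qed (use assms in \<open>auto simp: torus_def\<close>)

lemma continuous_rad: "continuous_on UNIV rad"
 unfolding rad_def[abs_def] by (intro continuous_intros)

text \<open>\<open>F\<close> is known only through its polar form. The Hessian is therefore read off
  from two curves in the torus, the parallel circle and the meridian through \<open>x\<close>, and
  the gradient from the tangents of these curves and of the radial ray.\<close>

lemma torus_curvature:
 assumes W: "open W" "smooth_on W F" "(x, s) \<in> W" and s: "0 < s" "s < T"
 and K: "!!y. (y, s) \<in> W ==> y \<in> torus s \<longleftrightarrow> F (y, s) <= 0"
 and polar: "\<forall>\<^sub>F (r, a) in nhds (1 / q thx s, thx). ALL p. F (pt r a p, s) = r * q a s - 1"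
 and time: "\<forall>\<^sub>F tax in nhds s. F (x, tax) = 1 / q thx s * q thx tax - 1"
 and x: "x = pt (1 / q thx s) thx phx"
 shows "gradient (%y. F (y, s)) x ~= 0"
 "deriv (%tax. F (x, tax)) s = norm (gradient (%y. F (y, s)) x) * mean_curv (torus s) x"
proof -
 define Q Q1 Q2 u c d where "Q = q thx s" and "Q1 = q1 thx s" and "Q2 = q2 thx s" and "u = 1 / Q" and "c = cos thx" and "d = sin thx"
 have Q: "1/2 <= Q" "Q <= 2" "Q > 0" using q_bounds[of thx s] by (auto simp: Q_def)
 have cd: "c\<^sup>2 + d\<^sup>2 = 1" by (simp add: c_def d_def)
 define f where "f y = F (y, s)" for y
 define U where "U = {y. (y, s) \<in> W}"
 have U: "open U" "smooth_on U f" unfolding U_def f_def[abs_def] by (rule slice_smooth[OF W(1,2)])+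
 have xU: "x \<in> U" using W(3) by (simp add: U_def)
 define er ep where "er = cos phx *# E1 + sin phx *# E2" and "ep = - sin phx *# E1 + cos phx *# E2"
 note Fr = orthoframeD[OF frame]
 have cs: "cos phx * cos phx + sin phx * sin phx = 1" using sin_cos_squared_add3[of phx] by simp
 have o: "er *. er = 1" "ep *. ep = 1" "er *. ep = 0" "er *. E3 = 0" "ep *. E3 = 0" "E3 *. er = 0" "E3 *. ep = 0" "ep *. er = 0" "E3 *. E3 = 1"
 using Fr cs by (simp_all add: er_def ep_def inner_add_left inner_add_right algebra_simps)
 define g where "g = gradient f x"
 define r where "r = R + u * c"
 have u: "0 < u" "u <= 2" using Q by (auto simp: u_def field_simps)
 have r: "r > 0"
 proof -
 have "\<bar>u * c\<bar> <= 2 * 1" unfolding abs_mult using u by (intro mult_mono) (auto simp: c_def)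
 then show ?thesis using R by (simp add: r_def)
 qed
 have xp: "x = pt u thx phx" using x by (simp add: u_def Q_def)
 have polar0: "!!p. F (pt u thx p, s) = u * Q - 1" using eventually_nhds_x_imp_x[OF polar] by (simp add: u_def Q_def)
 have uQ: "u * Q = 1" using Q by (simp add: u_def)
 have g1: "((%h. pt u thx (phx + h)) has_vector_derivative (r *# (- sin (phx + h) *# E1 + cos (phx + h) *# E2))) (at h)" for h
 unfolding pt_def r_def c_def has_vector_derivative_def
 by (auto intro!: derivative_eq_intros simp: algebra_simps)
 have g1': "((%h. r *# (- sin (phx + h) *# E1 + cos (phx + h) *# E2)) has_vector_derivative (- r *# er)) (at 0)"
 unfolding er_def has_vector_derivative_def by (auto intro!: derivative_eq_intros simp: algebra_simps)
 have z1: "\<forall>\<^sub>F h in nhds 0. f (pt u thx (phx + h)) = 0" using polar0 uQ by (simp add: f_def)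
 have x0: "pt u thx (phx + 0) \<in> U" using xU xp by simp
 note L1 = nderiv_curve_on_level[OF U g1 g1' x0 z1]
 have G1: "g *. ep = 0" and N1: "nderiv [r *# ep, r *# ep] f x = r * (g *. er)"
 using L1 r unfolding g_def ep_def by (simp_all add: xp[symmetric] del: nderiv.simps)
 define V V1 where "V h = 1 / q (thx + h) s" and "V1 h = - q1 (thx + h) s / (q (thx + h) s)\<^sup>2" for h
 have dq: "((%h. q (thx + h) s) has_real_derivative q1 (thx + h) s) (at h)" "((%h. q1 (thx + h) s) has_real_derivative q2 (thx + h) s) (at h)" for h
 using DERIV_shift[of "%a. q a s" "q1 (thx + h) s" h thx] DERIV_shift[of "%a. q1 a s" "q2 (thx + h) s" h thx] q_deriv
 by (simp_all add: add.commute)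
 have qn: "q a s ~= 0" for a using q_pos[of a s] by simp
 have dV: "(V has_real_derivative V1 h) (at h)" for h
 unfolding V_def[abs_def] V1_def by (rule derivative_eq_intros dq qn refl)+ (simp add: power2_eq_square)
 define U2 where "U2 = - Q2 / Q\<^sup>2 + 2 * Q1\<^sup>2 / Q ^ 3"
 have dV1: "(V1 has_real_derivative U2) (at 0)"
 proof -
 have "(V1 has_real_derivative ((- q2 (thx + 0) s) * (q (thx + 0) s)\<^sup>2 - (- q1 (thx + 0) s) * (2 * q (thx + 0) s * q1 (thx + 0) s)) / ((q (thx + 0) s)\<^sup>2 * (q (thx + 0) s)\<^sup>2)) (at 0)"
 unfolding V1_def[abs_def]
 proof (rule DERIV_divide)
 show "((%h. (q (thx + h) s)\<^sup>2) has_real_derivative 2 * q (thx + 0) s * q1 (thx + 0) s) (at 0)"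
 by (rule DERIV_cong[OF DERIV_power[OF dq(1)]]) simp
 qed (use qn DERIV_minus[OF dq(2)[of 0]] in simp_all)
 then show ?thesis by (rule DERIV_cong) (use Q in \<open>simp add: U2_def Q_def[symmetric] Q1_def[symmetric] Q2_def[symmetric] field_simps power2_eq_square power3_eq_cube\<close>)
 qed
 have V0: "V 0 = u" "V1 0 = - Q1 / Q\<^sup>2" by (simp_all add: V_def V1_def u_def Q_def Q1_def)
 define g2 where "g2 h = (V1 h * cos (thx + h) - V h * sin (thx + h)) *# er + (V1 h * sin (thx + h) + V h * cos (thx + h)) *# E3" for h
 have dc: "((%h. cos (thx + h)) has_real_derivative - sin (thx + h)) (at h)" "((%h. sin (thx + h)) has_real_derivative cos (thx + h)) (at h)" for h
 by (auto intro!: derivative_eq_intros)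
 have m1: "((%h. pt (V h) (thx + h) phx) has_vector_derivative g2 h) (at h)" for h
 proof -
 have "((%h. (R + V h * cos (thx + h)) *# er + (V h * sin (thx + h)) *# E3) has_vector_derivative g2 h) (at h)"
 unfolding g2_def
 by (rule derivative_eq_intros has_vector_derivative_scaleR dV dc refl | simp add: has_real_derivative_iff_has_vector_derivative[symmetric] mult.commute)+
 then show ?thesis by (simp add: pt_def er_def)
 qed
 have m2: "(g2 has_vector_derivative ((U2 * c - 2 * (V1 0 * d) - u * c) *# er + (U2 * d + 2 * (V1 0 * c) - u * d) *# E3)) (at 0)"
 proof -
 have a: "((%h. V1 h * cos (thx + h) - V h * sin (thx + h)) has_real_derivative (U2 * c - 2 * (V1 0 * d) - u * c)) (at 0)"
 by (rule DERIV_cong[OF DERIV_diff[OF DERIV_mult[OF dV1 dc(1)] DERIV_mult[OF dV dc(2)]]]) (simp add: V0 c_def d_def)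
 have b: "((%h. V1 h * sin (thx + h) + V h * cos (thx + h)) has_real_derivative (U2 * d + 2 * (V1 0 * c) - u * d)) (at 0)"
 by (rule DERIV_cong[OF DERIV_add[OF DERIV_mult[OF dV1 dc(2)] DERIV_mult[OF dV dc(1)]]]) (simp add: V0 c_def d_def)
 show ?thesis unfolding g2_def[abs_def]
 using has_vector_derivative_add[OF has_vector_derivative_scaleR[OF a has_vector_derivative_const] has_vector_derivative_scaleR[OF b has_vector_derivative_const]] by simp
 qed
 have "isCont (%h. (V h, thx + h)) 0" by (intro continuous_intros DERIV_isCont[OF dV])
 then have "((%h. (V h, thx + h)) \<longlongrightarrow> (1 / q thx s, thx)) (nhds 0)"
 unfolding isCont_def using tendsto_at_iff_tendsto_nhds[of "%h. (V h, thx + h)" 0] by (simp add: V_def)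
 then have "\<forall>\<^sub>F h in nhds 0. ALL p. F (pt (V h) (thx + h) p, s) = V h * q (thx + h) s - 1"
 using polar unfolding filterlim_iff by auto
 then have z2: "\<forall>\<^sub>F h in nhds 0. f (pt (V h) (thx + h) phx) = 0"
 by eventually_elim (simp add: f_def V_def qn)
 have x02: "pt (V 0) (thx + 0) phx \<in> U" using xU xp V0 by simp
 note L2 = nderiv_curve_on_level[OF U m1 m2 x02 z2]
 \<comment> \<open>Radial and angular unit vectors of the meridian plane, centred at the core
   circle.\<close>
 define erh ech where "erh = c *# er + d *# E3" and "ech = - d *# er + c *# E3"
 have cd': "c * c + d * d = 1" using cd by (simp add: power2_eq_square)
 have o2: "erh *. erh = 1" "ech *. ech = 1" "erh *. ech = 0" "ech *. erh = 0" "ep *. erh = 0" "ep *. ech = 0" "erh *. ep = 0" "ech *. ep = 0"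
 using o cd' by (simp_all add: erh_def ech_def inner_add_left inner_add_right algebra_simps)
 have g20: "g2 0 = (1 / Q\<^sup>2) *# (- Q1 *# erh + Q *# ech)"
 proof -
 have "u = Q / Q\<^sup>2" using Q by (simp add: u_def power2_eq_square)
 then show ?thesis unfolding g2_def V0 erh_def ech_def c_def[symmetric] d_def[symmetric] by (simp add: c_def d_def algebra_simps add_divide_distrib diff_divide_distrib)
 qed
 have er': "er = c *# erh - d *# ech"
 proof -
 have "c *# erh - d *# ech = (c * c + d * d) *# er" by (simp add: erh_def ech_def algebra_simps)
 then show ?thesis using cd' by simp
 qed
 have rayd: "((%h. pt (u + h) thx phx) has_vector_derivative erh) (at h)" for h
 unfolding pt_def erh_def er_def c_def d_def has_vector_derivative_def by (auto intro!: derivative_eq_intros simp: algebra_simps)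
 have Gq: "g *. erh = Q"
 proof -
 have "((%h. f (pt (u + h) thx phx)) has_real_derivative nderiv [erh] f (pt (u + 0) thx phx)) (at 0)"
 using nderiv_curve[OF U(2) rayd[of 0], of "[]"] xU xp by simp
 moreover have "((%h. f (pt (u + h) thx phx)) has_real_derivative Q) (at 0)"
 proof -
 have "isCont (%h. (u + h, thx)) 0" by (intro continuous_intros)
 then have "((%h. (u + h, thx)) \<longlongrightarrow> (1 / q thx s, thx)) (nhds 0)"
 unfolding isCont_def using tendsto_at_iff_tendsto_nhds[of "%h. (u + h, thx)" 0] by (simp add: u_def Q_def)
 then have "\<forall>\<^sub>F h in nhds 0. ALL p. F (pt (u + h) thx p, s) = (u + h) * q thx s - 1"
 using polar unfolding filterlim_iff by auto
 then have "\<forall>\<^sub>F h in nhds 0. f (pt (u + h) thx phx) = (u + h) * Q - 1" by eventually_elim (simp add: f_def Q_def)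
 moreover have "((%h. (u + h) * Q - 1) has_real_derivative Q) (at 0)" by (auto intro!: derivative_eq_intros)
 ultimately show ?thesis by (simp only: DERIV_cong_ev[OF refl _ refl])
 qed
 ultimately have "nderiv [erh] f (pt (u + 0) thx phx) = Q" by (rule DERIV_unique)
 then show ?thesis unfolding g_def gradient_smooth[OF U(2) xU] by (simp add: xp del: nderiv.simps)
 qed
 have L21: "g *. g2 0 = 0" and L22: "nderiv [g2 0, g2 0] f x = - (g *. ((U2 * c - 2 * (V1 0 * d) - u * c) *# er + (U2 * d + 2 * (V1 0 * c) - u * d) *# E3))"
 using L2 unfolding g_def by (simp_all add: V0 xp[symmetric] del: nderiv.simps)
 have Gch: "g *. ech = Q1"
 proof -
 have "(1 / Q\<^sup>2) * (- Q1 * Q + Q * (g *. ech)) = 0"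
 using L21 Gq unfolding g20 by (simp only: inner_scaleR_right inner_add_right)
 then have "Q * (g *. ech) = Q * Q1" using Q by simp
 then show ?thesis using Q by simp
 qed
 define N where "N = sqrt (Q\<^sup>2 + Q1\<^sup>2)"
 have N2: "N\<^sup>2 = Q\<^sup>2 + Q1\<^sup>2" by (simp add: N_def)
 have N: "N > 0" using Q by (simp add: N_def add_pos_nonneg)
 define e tax where "e = (1 / N) *# (Q *# erh + Q1 *# ech)" and "tax = (1 / N) *# (- Q1 *# erh + Q *# ech)"
 have NN: "Q * Q + Q1 * Q1 = N * N" using N2 by (simp add: power2_eq_square)
 have fr: "orthoframe ep tax e"
 proof -
 have "Q * Q / (N * N) + Q1 * Q1 / (N * N) = 1" using NN N by (simp add: add_divide_distrib[symmetric])
 then show ?thesis unfolding orthoframe_def e_def tax_def using o o2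
 by (simp add: inner_add_left inner_add_right inner_diff_left inner_diff_right add_divide_distrib add.commute mult.commute)
 qed
 have frp: "orthoframe ep erh ech" using o o2 by (simp add: orthoframe_def)
 have gN: "g = N *# e"
 using orthoframe_expand[OF frp, of g] G1 Gq Gch N by (simp add: e_def)
 have g0: "g ~= 0" using Gq Q by auto
 then show "gradient (%y. F (y, s)) x ~= 0" by (simp add: g_def f_def[abs_def])
 have bil: "nderiv [k *# v, k *# v] f x = k\<^sup>2 * nderiv [v, v] f x" for k v
 proof -
 interpret b1: bounded_linear "%a. nderiv [a, k *# v] f x" by (rule linear_nderiv[OF U(2) xU])
 interpret b2: bounded_linear "%a. nderiv [v, a] f x" by (rule linear_nderiv2[OF U xU])
 show ?thesis using b1.scaleR[of k v] b2.scaleR[of k v] by (simp add: power2_eq_square del: nderiv.simps)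
 qed
 have S1: "nderiv [ep, ep] f x = (Q * c - Q1 * d) / r"
 proof -
 have "g *. er = Q * c - Q1 * d" unfolding er' using Gq Gch by (simp add: inner_diff_right mult.commute)
 then show ?thesis using N1 r unfolding bil by (simp add: field_simps power2_eq_square del: nderiv.simps)
 qed
 have S2: "nderiv [tax, tax] f x = Q ^ 3 * (Q + Q2) / N\<^sup>2"
 proof -
 have "tax = (Q\<^sup>2 / N) *# g2 0" unfolding g20 tax_def using Q by simp
 then have "nderiv [tax, tax] f x = (Q\<^sup>2 / N)\<^sup>2 * nderiv [g2 0, g2 0] f x" using bil[of "Q\<^sup>2 / N" "g2 0"] by (simp only:)
 also have "nderiv [g2 0, g2 0] f x = - (g *. ((U2 - u) *# erh + (2 * V1 0) *# ech))"
 unfolding L22 erh_def ech_def by (simp add: algebra_simps)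
 also have "... = - (Q * (U2 - u) + 2 * V1 0 * Q1)" using Gq Gch by (simp add: inner_add_right algebra_simps)
 also have "... = (Q + Q2) / Q" using Q unfolding V0 U2_def u_def by (simp add: field_simps power2_eq_square power3_eq_cube)
 also have "(Q\<^sup>2 / N)\<^sup>2 * ((Q + Q2) / Q) = Q ^ 3 * (Q + Q2) / N\<^sup>2" using Q by (simp add: power_divide eval_nat_numeral)
 finally show ?thesis .
 qed
 have Fx: "F (x, s) = 0" using polar0[of phx] uQ xp by simp
 have mc: "norm g * mean_curv (torus s) x = nderiv [ep, ep] f x + nderiv [tax, tax] f x"
 using slice_mean_curv[OF W K Fx _ fr, of N] g0 gN slice_smooth(3)[OF W, of "[ep, ep]"] slice_smooth(3)[OF W, of "[tax, tax]"]
 unfolding g_def f_def[abs_def] by (simp del: nderiv.simps)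
 define Y where "Y = q thx s ^ 4 * (q thx s + q2 thx s) / ((q thx s)\<^sup>2 + (q1 thx s)\<^sup>2)
 + (1/R) * (q thx s)\<^sup>2 * (q thx s * cos thx - q1 thx s * sin thx) / (q thx s + (1/R) * cos thx)"
 have "((%tax. 1 / q thx s * q thx tax - 1) has_real_derivative (1 / q thx s * Y - 0)) (at s)"
 unfolding Y_def by (intro DERIV_diff DERIV_cmult DERIV_const q_evolution s)
 then have "((%tax. F (x, tax)) has_real_derivative (1 / q thx s * Y - 0)) (at s)"
 by (simp only: DERIV_cong_ev[OF refl time refl])
 then have dF: "deriv (%tax. F (x, tax)) s = u * Y" using DERIV_imp_deriv by (simp add: u_def Q_def)
 \<comment> \<open>The term with \<open>1 / R\<close> in the evolution equation is the contribution
   of the parallel circle, the other one that of the meridian.\<close>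
 have "u * Y = (Q * c - Q1 * d) / r + Q ^ 3 * (Q + Q2) / N\<^sup>2"
 proof -
 have Y': "Y = Q ^ 4 * (Q + Q2) / N\<^sup>2 + (1/R) * Q\<^sup>2 * (Q * c - Q1 * d) / (Q + (1/R) * c)"
 by (simp add: Y_def N2 Q_def Q1_def Q2_def c_def d_def)
 have rQ: "r * Q = R * Q + c" using uQ by (simp add: r_def algebra_simps)
 have R0: "R > 0" using R by simp
 have "Q + (1/R) * c = r * Q / R" unfolding rQ using R0 by (simp add: field_simps)
 then have "u * ((1/R) * Q\<^sup>2 * (Q * c - Q1 * d) / (Q + (1/R) * c)) = (Q * c - Q1 * d) / r"
 using R0 Q r by (simp add: u_def field_simps power2_eq_square)
 moreover have "u * (Q ^ 4 * (Q + Q2) / N\<^sup>2) = Q ^ 3 * (Q + Q2) / N\<^sup>2" using Q by (simp add: u_def eval_nat_numeral)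
 ultimately show ?thesis unfolding Y' by (simp add: distrib_left)
 qed
 then show "deriv (%tax. F (x, tax)) s = norm (gradient (%y. F (y, s)) x) * mean_curv (torus s) x"
 using dF mc S1 S2 by (simp add: g_def f_def[abs_def] del: nderiv.simps)
qed

end

lemma rotate_back:
 fixes c s v w :: real assumes "c * c + s * s = 1"
 shows "(v * c + w * s) * c - (w * c - v * s) * s = v" "(v * c + w * s) * s + (w * c - v * s) * c = w"
proof -
 have "(v * c + w * s) * c - (w * c - v * s) * s = v * (c * c + s * s)" "(v * c + w * s) * s + (w * c - v * s) * c = w * (c * c + s * s)"
 by (simp_all add: algebra_simps)
 then show "(v * c + w * s) * c - (w * c - v * s) * s = v" "(v * c + w * s) * s + (w * c - v * s) * c = w" using assms by simp_all
qed

lemma (in torus_flow) torus_chart: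
 assumes t: "0 < t" "t < T"
 obtains W F where "(p, t) \<in> W" "open W" "smooth_on W F"
 "!!x s. (x, s) \<in> W ==> 0 < s & s < T"
 "!!x s. (x, s) \<in> W ==> x \<in> torus s \<longleftrightarrow> F (x, s) <= 0"
 "!!x s. (x, s) \<in> W ==> F (x, s) = 0 \<longleftrightarrow> (EX thx phx. x = pt (1 / q thx s) thx phx)"
 "!!x s. (x, s) \<in> W ==> F (x, s) = 0 ==> gradient (%y. F (y, s)) x ~= 0 &
 deriv (%tax. F (x, tax)) s = norm (gradient (%y. F (y, s)) x) * mean_curv (torus s) x"
proof -
 have q1le: "1/2 <= 1 / q a s" "1 / q a s <= 2" for a s using q_bounds[of a s] q_pos[of a s] by (simp_all add: field_simps)
 have radp: "rad (pt (1 / q a s) a f) = R + 1 / q a s * cos a" for a s f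
 proof (rule rad_pt)
 have "\<bar>1 / q a s * cos a\<bar> <= 2 * 1" unfolding abs_mult using q1le[of a s] by (intro mult_mono) auto
 then show "0 <= R + 1 / q a s * cos a" using R by linarith
 qed
 define D where "D x = (rad x - R)\<^sup>2 + (x *. E3)\<^sup>2" for x
 have contD: "continuous_on UNIV (%z::R3 \<times> real. D (fst z))"
 unfolding D_def by (intro continuous_intros continuous_on_compose2[OF continuous_rad continuous_on_fst[OF continuous_on_id]]) auto
 have Dp: "1/4 <= D (pt (1 / q a s) a f) & D (pt (1 / q a s) a f) <= 4" for a s f
 proof -
 have "D (pt (1 / q a s) a f) = (1 / q a s)\<^sup>2 * ((cos a)\<^sup>2 + (sin a)\<^sup>2)"
 unfolding D_def radp pt_inner by (simp only: power_mult_distrib distrib_left add_diff_cancel_left')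
 moreover have "(1/2)\<^sup>2 <= (1 / q a s)\<^sup>2" "(1 / q a s)\<^sup>2 <= 2\<^sup>2" using q1le[of a s] by (intro power_mono; linarith)+
 ultimately show ?thesis by (simp add: power2_eq_square)
 qed
 note intro = that
 \<comment> \<open>Away from the shell between the radii 1/2 and 2 around the core circle a constant
   serves as chart. These regions contain the rotation axis, where \<open>rad\<close> is not smooth,
   and the core circle, where the polar angle is singular.\<close>
 have const: thesis if V: "open V" "(p, t) \<in> V" and c: "c ~= 0" "!!x s. (x, s) \<in> V ==> 0 < s & s < T & \<not> (1/4 <= D x & D x <= 4) & (x \<in> torus s \<longleftrightarrow> c <= 0)" for V and c :: real
 proof (rule intro[OF V(2,1) smooth_on_const[of V c]])
 fix x s assume "(x, s) \<in> V"
 from c(2)[OF this] show "0 < s & s < T" "x \<in> torus s \<longleftrightarrow> c <= 0" "c = 0 \<longleftrightarrow> (EX thx phx. x = pt (1 / q thx s) thx phx)"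
 using Dp c(1) by auto
 qed (use c(1) in simp)
 have tm: "open {z::R3 \<times> real. 0 < snd z & snd z < T}" by (intro open_Collect_conj open_Collect_less continuous_intros)
 consider "D p < 1/4" | "D p > 4" | "1/4 <= D p" "D p <= 4" by linarith
 then show ?thesis
 proof cases
 case 1
 show ?thesis
 proof (rule const[of "{z. D (fst z) < 1/4} \<inter> {z. 0 < snd z & snd z < T}" "-1"])
 show "open ({z. D (fst z) < 1/4} \<inter> {z::R3 \<times> real. 0 < snd z & snd z < T})"
 by (intro open_Int tm open_Collect_less contD continuous_intros)
 fix x s assume xs: "(x, s) \<in> {z. D (fst z) < 1/4} \<inter> {z. 0 < snd z & snd z < T}"
 obtain rh thx where r: "0 <= rh" "rad x = R + rh * cos thx" "x *. E3 = rh * sin thx" "rh\<^sup>2 = D x" unfolding D_def by (rule polar_of)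
 have "rh\<^sup>2 < (1/2)\<^sup>2" using r xs by (simp add: power2_eq_square)
 then have "rh < 1/2" by (rule power2_less_imp_less) simp
 then have "rh * q thx s <= (1/2) * 2" using r(1) q_bounds[of thx s] q_pos[of thx s] by (intro mult_mono) auto
 then show "0 < s & s < T & \<not> (1/4 <= D x & D x <= 4) & (x \<in> torus s \<longleftrightarrow> (- 1::real) <= 0)"
 using xs torus_iff[OF r(1-3)] by simp
 qed (use 1 t in simp_all)
 next
 case 2
 show ?thesis
 proof (rule const[of "{z. 4 < D (fst z)} \<inter> {z. 0 < snd z & snd z < T}" 1])
 show "open ({z. 4 < D (fst z)} \<inter> {z::R3 \<times> real. 0 < snd z & snd z < T})"
 by (intro open_Int tm open_Collect_less contD continuous_intros)
 fix x s assume xs: "(x, s) \<in> {z. 4 < D (fst z)} \<inter> {z. 0 < snd z & snd z < T}"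
 obtain rh thx where r: "0 <= rh" "rad x = R + rh * cos thx" "x *. E3 = rh * sin thx" "rh\<^sup>2 = D x" unfolding D_def by (rule polar_of)
 have "2\<^sup>2 < rh\<^sup>2" using r xs by simp
 then have "2 < rh" using r(1) by (rule power2_less_imp_less)
 then have "2 * (1/2) < rh * q thx s" using q_bounds[of thx s] q_pos[of thx s] by (intro mult_less_le_imp_less) auto
 then show "0 < s & s < T & \<not> (1/4 <= D x & D x <= 4) & (x \<in> torus s \<longleftrightarrow> (1::real) <= 0)"
 using xs torus_iff[OF r(1-3)] by simp
 qed (use 2 t in simp_all)
 next
 case 3
 obtain rh0 ch0 where p0: "0 <= rh0" "rad p = R + rh0 * cos ch0" "p *. E3 = rh0 * sin ch0" "rh0\<^sup>2 = D p" unfolding D_def by (rule polar_of)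
 have rh0: "rh0 > 0" using p0(1,4) 3 by (cases "rh0 = 0") auto
 have "rh0\<^sup>2 <= 2\<^sup>2" using p0(4) 3 by simp
 then have "rh0 <= 2" by (rule power2_le_imp_le) simp
 have "\<bar>rh0 * cos ch0\<bar> <= 2 * 1" unfolding abs_mult using rh0 \<open>rh0 <= 2\<close> by (intro mult_mono) auto
 then have rp: "rad p > 0" using p0(2) R by linarith
 \<comment> \<open>Meridian coordinates rotated by the polar angle \<open>ch0\<close> of
   \<open>p\<close>. On the half-plane \<open>A > 0\<close> the angle is
   \<open>ch0 + arctan (B / A)\<close>, a smooth branch around \<open>p\<close>.\<close>
 define A B where "A x = (rad x - R) * cos ch0 + (x *. E3) * sin ch0" and "B x = (x *. E3) * cos ch0 - (rad x - R) * sin ch0" for x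
 define S where "S x = sqrt ((A x)\<^sup>2 + (B x)\<^sup>2)" for x
 define X where "X x = ch0 + arctan (B x / A x)" for x
 define F where "F z = S (fst z) * q (X (fst z)) (snd z) - 1" for z :: "R3 \<times> real"
 define W where "W = {z::R3 \<times> real. 0 < (fst z *. E1)\<^sup>2 + (fst z *. E2)\<^sup>2 & 0 < A (fst z) & 0 < snd z & snd z < T}"
 have cr: "continuous_on UNIV (%z::R3 \<times> real. rad (fst z))"
 by (rule continuous_on_compose2[OF continuous_rad continuous_on_fst[OF continuous_on_id]]) auto
 have oW: "open W"
 unfolding W_def A_def by (intro open_Collect_conj open_Collect_less continuous_intros cr)
 have pW: "(p, t) \<in> W"
 proof -
 have "A p = rh0 * (cos ch0 * cos ch0) + rh0 * (sin ch0 * sin ch0)" unfolding A_def p0(2,3) by (simp add: algebra_simps)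
 also have "... = rh0 * (cos ch0 * cos ch0 + sin ch0 * sin ch0)" by (simp only: distrib_left)
 finally have "A p = rh0" by simp
 moreover have "0 < (p *. E1)\<^sup>2 + (p *. E2)\<^sup>2" using rp unfolding rad_def by simp
 ultimately show ?thesis using rh0 t by (simp add: W_def)
 qed
 have polar: "rad x - R = S x * cos (X x)" "x *. E3 = S x * sin (X x)" "S x > 0" if "A x > 0" for x
 proof -
 note ap = arctan_polar[OF that, of "B x", folded S_def]
 have cs: "cos ch0 * cos ch0 + sin ch0 * sin ch0 = 1" using sin_cos_squared_add3[of ch0] by simp
 have "S x * cos (X x) = (S x * cos (arctan (B x / A x))) * cos ch0 - (S x * sin (arctan (B x / A x))) * sin ch0"
 unfolding X_def cos_add by (simp add: algebra_simps)
 also have "... = A x * cos ch0 - B x * sin ch0" unfolding ap ..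
 also have "... = rad x - R" unfolding A_def B_def by (rule rotate_back(1)[OF cs])
 finally show "rad x - R = S x * cos (X x)" ..
 have "S x * sin (X x) = (S x * cos (arctan (B x / A x))) * sin ch0 + (S x * sin (arctan (B x / A x))) * cos ch0"
 unfolding X_def sin_add by (simp add: algebra_simps)
 also have "... = A x * sin ch0 + B x * cos ch0" unfolding ap ..
 also have "... = x *. E3" unfolding A_def B_def by (rule rotate_back(2)[OF cs])
 finally show "x *. E3 = S x * sin (X x)" ..
 show "S x > 0" using that by (simp add: S_def add_pos_nonneg)
 qed
 have Apt: "A (pt r a f) = r * cos (a - ch0)" "B (pt r a f) = r * sin (a - ch0)" if "0 <= R + r * cos a" for r a f
 unfolding A_def B_def rad_pt[OF that] pt_inner cos_diff sin_diff by (simp_all add: algebra_simps)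
 have Spt: "S (pt r a f) = r" "cos (X (pt r a f)) = cos a" "sin (X (pt r a f)) = sin a"
 if "0 <= R + r * cos a" "0 < r" "0 < A (pt r a f)" for r a f
 proof -
 have "(S (pt r a f))\<^sup>2 = r\<^sup>2 * ((cos (a - ch0))\<^sup>2 + (sin (a - ch0))\<^sup>2)"
 unfolding S_def Apt[OF that(1)] by (simp only: power_mult_distrib distrib_left) simp
 then have "(S (pt r a f))\<^sup>2 = r\<^sup>2" by simp
 then show s: "S (pt r a f) = r" using that(2) polar(3)[OF that(3)] power2_eq_iff_nonneg[of "S (pt r a f)" r] by simp
 show "cos (X (pt r a f)) = cos a" "sin (X (pt r a f)) = sin a"
 using polar(1,2)[OF that(3)] that(2) unfolding s rad_pt[OF that(1)] pt_inner by simp_all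
 qed
 have lin: "smooth_on W (%z. fst z *. v)" for v :: R3
 by (intro smooth_on_linear oW bounded_linear_compose[OF bounded_linear_inner_left bounded_linear_fst])
 have srad: "smooth_on W (%z. rad (fst z))"
 unfolding rad_def power2_eq_square
 by (intro smooth_on_sqrt smooth_on_add smooth_on_mult oW lin) (simp add: W_def power2_eq_square)
 have sA: "smooth_on W (%z. A (fst z))" "smooth_on W (%z. B (fst z))"
 unfolding A_def B_def by (intro smooth_on_add smooth_on_diff smooth_on_mult smooth_on_const oW lin srad)+
 have sS: "smooth_on W (%z. S (fst z))"
 unfolding S_def power2_eq_square by (intro smooth_on_sqrt smooth_on_add smooth_on_mult oW sA)
 (auto simp: W_def intro: add_pos_nonneg)
 have sX: "smooth_on W (%z. X (fst z))"
 unfolding X_def by (intro smooth_on_add smooth_on_const smooth_on_arctan smooth_on_divide oW sA) (auto simp: W_def)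
 have sp: "smooth_on W (%z. (X (fst z), snd z))"
 proof -
 have "smooth_on W (%z. X (fst z) *# (1::real, 0::real) + snd z *# (0, 1))"
 by (intro smooth_on_add smooth_on_scaleR smooth_on_const oW sX smooth_on_linear bounded_linear_snd)
 then show ?thesis by simp
 qed
 have sF: "smooth_on W F"
 proof -
 have "smooth_on W (%z. case (X (fst z), snd z) of (s, t) => q s t)"
 by (rule smooth_on_compose[OF oW sp q_smooth]) (auto simp: W_def)
 then show ?thesis unfolding F_def[abs_def] by (intro smooth_on_diff smooth_on_mult smooth_on_const oW sS) simp
 qed
 have iff: "x \<in> torus s \<longleftrightarrow> F (x, s) <= 0" if "(x, s) \<in> W" for x s
 using torus_iff[of "S x" x "X x" s] polar[of x] that by (simp add: W_def F_def)
 have zero: "F (x, s) = 0 \<longleftrightarrow> (EX thx phx. x = pt (1 / q thx s) thx phx)" if xs: "(x, s) \<in> W" for x s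
 proof
 assume "F (x, s) = 0"
 then have "S x = 1 / q (X x) s" using q_pos[of "X x" s] by (simp add: F_def field_simps)
 then have "rad x = R + 1 / q (X x) s * cos (X x)" "x *. E3 = 1 / q (X x) s * sin (X x)" using polar[of x] xs by (simp_all add: W_def)
 from pt_of[OF this] show "EX thx phx. x = pt (1 / q thx s) thx phx" by metis
 next
 assume "EX thx phx. x = pt (1 / q thx s) thx phx"
 then obtain thx phx where x: "x = pt (1 / q thx s) thx phx" by blast
 have nn: "0 <= R + 1 / q thx s * cos thx" using radp[of thx s phx] rad_nonneg[of "pt (1 / q thx s) thx phx"] by simp
 have Ap: "0 < A (pt (1 / q thx s) thx phx)" using xs x by (simp add: W_def)
 have up: "0 < 1 / q thx s" using q_pos by simp
 note sp = Spt[OF nn up Ap]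
 show "F (x, s) = 0" using sp(1) q_angle[OF sp(2,3), of s] q_pos[of thx s] unfolding F_def x by simp
 qed
 show ?thesis
 proof (rule that[OF pW oW sF _ iff zero])
 show "(x, s) \<in> W ==> 0 < s & s < T" for x s by (simp add: W_def)
 fix x s assume xs: "(x, s) \<in> W" and F0: "F (x, s) = 0"
 define thx where "thx = X x"
 have Ax: "A x > 0" using xs by (simp add: W_def)
 have Sx: "S x = 1 / q thx s" using F0 q_pos[of "X x" s] by (simp add: F_def thx_def field_simps)
 have px: "rad x = R + 1 / q thx s * cos thx" "x *. E3 = 1 / q thx s * sin thx" using polar(1,2)[OF Ax] Sx by (simp_all add: thx_def)
 obtain phx where x: "x = pt (1 / q thx s) thx phx" by (rule pt_of[OF px])
 have nn: "0 < R + 1 / q thx s * cos thx"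
 proof -
 have "0 < rad x" using xs unfolding W_def rad_def by simp
 then show ?thesis using px(1) by simp
 qed
 have ca: "0 < cos (thx - ch0)" using Apt(1)[of "1 / q thx s" thx phx] nn Ax q_pos[of thx s] x by (simp add: zero_less_divide_iff)
 have "open {z::real \<times> real. 0 < fst z & 0 < cos (snd z - ch0) & 0 < R + fst z * cos (snd z)}"
 by (intro open_Collect_conj open_Collect_less continuous_intros)
 from eventually_nhds_in_open[OF this, of "(1 / q thx s, thx)"]
 have ev: "\<forall>\<^sub>F z in nhds (1 / q thx s, thx). z \<in> {z. 0 < fst z & 0 < cos (snd z - ch0) & 0 < R + fst z * cos (snd z)}"
 using nn ca q_pos by simp
 have "\<forall>\<^sub>F (r, a) in nhds (1 / q thx s, thx). ALL f. F (pt r a f, s) = r * q a s - 1"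
 using ev
 proof eventually_elim
 case (elim z)
 obtain r a where z: "z = (r, a)" by (cases z)
 have h: "0 <= R + r * cos a" "0 < r" using elim by (simp_all add: z)
 have "0 < A (pt r a f)" for f using Apt(1)[OF h(1)] elim by (simp add: z)
 note sp = Spt[OF h this]
 show ?case unfolding z using sp(1) q_angle[OF sp(2,3)] by (simp add: F_def)
 qed
 note tc = torus_curvature[OF oW sF xs _ _ iff this _ x]
 have "\<forall>\<^sub>F tax in nhds s. F (x, tax) = 1 / q thx s * q thx tax - 1" by (simp add: F_def Sx thx_def[symmetric])
 from tc[OF _ _ _ this] xs
 show "gradient (%y. F (y, s)) x ~= 0 & deriv (%tax. F (x, tax)) s = norm (gradient (%y. F (y, s)) x) * mean_curv (torus s) x"
 by (simp add: W_def)
 qed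
 qed
qed

lemma (in torus_flow) torus_mcf: "I <= {0<..<T} ==> smooth_mcf I torus"
 unfolding smooth_mcf_def
proof (intro ballI allI)
 fix t p assume I: "I <= {0<..<T}" and "t \<in> I"
 then have t: "0 < t" "t < T" by auto
 obtain W F where W: "(p, t) \<in> W" "open W" "smooth_on W F"
 "!!x s. (x, s) \<in> W ==> 0 < s & s < T"
 "!!x s. (x, s) \<in> W ==> x \<in> torus s \<longleftrightarrow> F (x, s) <= 0"
 "!!x s. (x, s) \<in> W ==> F (x, s) = 0 \<longleftrightarrow> (EX thx phx. x = pt (1 / q thx s) thx phx)"
 "!!x s. (x, s) \<in> W ==> F (x, s) = 0 ==> gradient (%y. F (y, s)) x ~= 0 &
 deriv (%tax. F (x, tax)) s = norm (gradient (%y. F (y, s)) x) * mean_curv (torus s) x"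
 by (rule torus_chart[OF t, of p]) (rule that)
 show "EX W F. open W & (p, t) \<in> W & smooth_on W F &
 (ALL x s. (x, s) \<in> W & s \<in> I -->
 (x \<in> torus s \<longleftrightarrow> F (x, s) <= 0) &
 (F (x, s) = 0 -->
 gradient (%y. F (y, s)) x ~= 0 &
 deriv (%tax. F (x, tax)) s = norm (gradient (%y. F (y, s)) x) * mean_curv (torus s) x))"
 proof (intro exI conjI allI impI, (elim conjE)?)
 fix x s assume "(x, s) \<in> W & s \<in> I"
 then have xs: "(x, s) \<in> W" by simp
 show "x \<in> torus s \<longleftrightarrow> F (x, s) <= 0" by (rule W(5)[OF xs])
 assume "F (x, s) = 0"
 from W(7)[OF xs this] show "gradient (%y. F (y, s)) x ~= 0"
 "deriv (%tax. F (x, tax)) s = norm (gradient (%y. F (y, s)) x) * mean_curv (torus s) x" by simp_all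
 qed (fact W)+
qed

lemma (in torus_flow) torus_frontier:
 assumes t: "0 < t" "t < T"
 shows "x \<in> frontier (torus t) \<longleftrightarrow> (EX thx phx. x = pt (1 / q thx t) thx phx)"
proof -
 obtain W F where W: "(x, t) \<in> W" "open W" "smooth_on W F"
 "!!x s. (x, s) \<in> W ==> 0 < s & s < T"
 "!!x s. (x, s) \<in> W ==> x \<in> torus s \<longleftrightarrow> F (x, s) <= 0"
 "!!x s. (x, s) \<in> W ==> F (x, s) = 0 \<longleftrightarrow> (EX thx phx. x = pt (1 / q thx s) thx phx)"
 "!!x s. (x, s) \<in> W ==> F (x, s) = 0 ==> gradient (%y. F (y, s)) x ~= 0 &
 deriv (%tax. F (x, tax)) s = norm (gradient (%y. F (y, s)) x) * mean_curv (torus s) x"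
 by (rule torus_chart[OF t, of x]) (rule that)
 have "x \<in> frontier (torus t) \<longleftrightarrow> F (x, t) = 0"
 by (rule chart_frontier[OF W(2,3,1,5) conjunct1[OF W(7)[OF W(1)]]])
 then show ?thesis using W(6)[OF W(1)] by simp
qed

section \<open>Shape and initial position of the dented torus\<close>

lemma abs_sin_multiple: "\<bar>sin (real n * x)\<bar> <= real n * \<bar>sin x\<bar>"
proof (induction n)
 case (Suc n)
 have "\<bar>sin (real (Suc n) * x)\<bar> = \<bar>sin (real n * x) * cos x + cos (real n * x) * sin x\<bar>"
 unfolding of_nat_Suc distrib_right add.commute[of 1] mult_1 sin_add ..
 also have "... <= \<bar>sin (real n * x)\<bar> * \<bar>cos x\<bar> + \<bar>cos (real n * x)\<bar> * \<bar>sin x\<bar>"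
 by (intro order_trans[OF abs_triangle_ineq]) (simp add: abs_mult)
 also have "... <= \<bar>sin (real n * x)\<bar> * 1 + 1 * \<bar>sin x\<bar>" by (intro add_mono mult_left_mono mult_right_mono) auto
 finally show ?case using Suc by (simp add: algebra_simps)
qed simp

text \<open>With \<open>x = 1 - cos \<psi>\<close> the bound \<open>|sin m\<psi>| \<le> m |sin \<psi>|\<close> reads
 \<open>1 - cos k\<psi> \<le> k\<^sup>2 x - k\<^sup>2 x\<^sup>2 / 2\<close> for \<open>k = 2m\<close>.\<close>
lemma dent_shape:
 fixes b ps :: real
 assumes b: "0 <= b" "b <= 1" and g: "g = (1 + b) / (4000\<^sup>2 - 1)" and qq: "qq = 1 + g * cos (4000 * ps)"
 shows "1 / (1 + g) - (1 / qq) * cos ps >= - (b / 2) * ((1 / qq) * sin ps)\<^sup>2"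
proof -
 define x y where "x = 1 - cos ps" and "y = 1 - cos (4000 * ps)"
 have x: "0 <= x" by (simp add: x_def)
 have y: "0 <= y" "y <= 2" using cos_ge_minus_one[of "4000 * ps"] by (simp_all add: y_def)
 have g0: "0 <= g" "g <= 1/1000000" using b by (simp_all add: g field_simps)
 have s2: "(sin ps)\<^sup>2 = 2 * x - x\<^sup>2" using sin_squared_eq[of ps] by (simp add: x_def power2_eq_square algebra_simps)
 have y1: "y <= 4000\<^sup>2 * x - (4000\<^sup>2 / 2) * x\<^sup>2"
 proof -
 have "cos (4000 * ps) = 1 - 2 * (sin (real 2000 * ps))\<^sup>2" using cos_double_sin[of "2000 * ps"] by simp
 then have "y = 2 * \<bar>sin (real 2000 * ps)\<bar>\<^sup>2" by (simp add: y_def)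
 also have "... <= 2 * (real 2000 * \<bar>sin ps\<bar>)\<^sup>2" using power_mono[OF abs_sin_multiple[of 2000 ps], of 2] by simp
 also have "... = 8000000 * (sin ps)\<^sup>2" by (simp add: power_mult_distrib)
 also have "... = 4000\<^sup>2 * x - (4000\<^sup>2 / 2) * x\<^sup>2" unfolding s2 by simp
 finally show ?thesis .
 qed
 define q0 where "q0 = 1 + g"
 have qq': "qq = q0 - g * y" by (simp add: qq q0_def y_def algebra_simps)
 \<comment> \<open>The choice of the amplitude: to second order the ripple outweighs the bending of
   the circle by exactly \<open>b\<close>.\<close>
 have gk: "g * 4000\<^sup>2 = q0 + b" using b by (simp add: q0_def g field_simps)
 have gy: "0 <= g * y" "g * y <= 1/500000" using g0 y mult_mono[of g "1/1000000" y 2] by simp_all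
 have qq1: "qq <= q0" "qq > 0" "qq >= 1/2" using gy g0 by (auto simp: qq' q0_def)
 have "g * y <= g * (4000\<^sup>2 * x - (4000\<^sup>2 / 2) * x\<^sup>2)" by (rule mult_left_mono[OF y1 g0(1)])
 also have "... = (g * 4000\<^sup>2) * x - (g * 4000\<^sup>2) / 2 * x\<^sup>2" by (simp only: right_diff_distrib mult.assoc) simp
 finally have gyx: "g * y <= (q0 + b) * x - (q0 + b) / 2 * x\<^sup>2" unfolding gk .
 have "qq * (- b * x + (q0 + b) / 2 * x\<^sup>2) <= qq * (q0 * x - g * y)" using gyx qq1 by (intro mult_left_mono) (auto simp: algebra_simps)
 moreover have "0 <= qq * (- b * x + (q0 + b) / 2 * x\<^sup>2) + (b / 2) * q0 * (2 * x - x\<^sup>2)"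
 proof -
 have "qq * (- b * x + (q0 + b) / 2 * x\<^sup>2) + (b / 2) * q0 * (2 * x - x\<^sup>2) = b * x * (q0 - qq) + x\<^sup>2 / 2 * (qq * q0 - b * (q0 - qq))"
 by (simp add: field_simps)
 moreover have "0 <= b * x * (q0 - qq)" using b x qq1 by simp
 moreover have "b * (q0 - qq) <= 1 * (1/500000)" using b gy by (intro mult_mono) (auto simp: qq')
 moreover have "1/2 * 1 <= qq * q0" using qq1 g0 by (intro mult_mono) (auto simp: q0_def)
 ultimately show ?thesis by simp
 qed
 ultimately have key: "0 <= qq * (q0 * x - g * y) + (b / 2) * q0 * (sin ps)\<^sup>2" unfolding s2 by linarith
 have e: "qq - cos ps * q0 = q0 * x - g * y" by (simp add: qq' x_def algebra_simps)
 have q0: "q0 > 0" using g0 by (simp add: q0_def)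
 have "1 / q0 - (1 / qq) * cos ps + (b / 2) * ((1 / qq) * sin ps)\<^sup>2 = (qq * (qq - cos ps * q0) + (b / 2) * q0 * (sin ps)\<^sup>2) / (q0 * qq\<^sup>2)"
 using qq1 q0 by (simp add: field_simps power2_eq_square)
 also have "... >= 0" unfolding e using key q0 by simp
 finally show ?thesis unfolding q0_def by linarith
qed

text \<open>Coordinates at the bottom of the dent, where \<open>- e\<close> is the outer normal of
  the torus. The dent accounts for the term in \<open>Y\<close>. The term in \<open>X\<close> comes
  from rotating about a tilted axis: \<open>S\<close> is just large enough to pay for
  \<open>X^2 <= 2 (R + 2) w\<close> and for the error \<open>4 w\<close> made by replacing
  \<open>Ym^2\<close> by \<open>Y^2\<close>.\<close>

lemma (in torus_flow) initial_shape:
 assumes g: "g = (1 + epx * bex) / (4000\<^sup>2 - 1)" and init: "!!s. q s 0 = 1 + g * cos (4000 * (s - ch0))"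
 and epx: "0 < epx" "0 < al" "0 < bex" "epx * bex <= 1" and S: "cos ch0 = S" "sin ch0 = - C" "S = epx * (al * (R + 2) + 2 * bex)" "0 <= C"
 and abe: "orthoframe a b e" "E1 = C *# b - S *# e" "E2 = a" "E3 = S *# b + C *# e"
 and x: "x = pt (1 / q thx 0) thx phx"
 obtains X Y Z where "x = R *# E1 - (1 / (1 + g)) *# e + X *# a + Y *# b + Z *# e" "epx * (al * X\<^sup>2 - bex * Y\<^sup>2) / 2 <= Z"
 "X\<^sup>2 + Y\<^sup>2 + Z\<^sup>2 <= (2 * R + 8)\<^sup>2"
proof -
 define u ps where "u = 1 / q thx 0" and "ps = thx - ch0"
 define r w Ym Zm where "r = R + u * cos thx" and "w = r * (1 - cos phx)" and "Ym = u * sin ps" and "Zm = 1 / (1 + g) - u * cos ps"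
 have u: "1/2 <= u" "u <= 2" "u > 0" using q_bounds[of thx 0] q_pos[of thx 0] by (simp_all add: u_def field_simps)
 have uc: "\<bar>u * cos t\<bar> <= 2" "\<bar>u * sin t\<bar> <= 2" for t
 using u mult_mono[of u 2 "\<bar>cos t\<bar>" 1] mult_mono[of u 2 "\<bar>sin t\<bar>" 1] by (simp_all add: abs_mult)
 have r: "0 < r" "r <= R + 2" using uc(1)[of thx] R by (auto simp: r_def)
 have w: "0 <= w" using r by (simp add: w_def)
 have SC: "S * S + C * C = 1" using sin_cos_squared_add3[of ch0] S(1,2) by simp
 have S0: "0 <= S" using S(3) epx R by simp
 have "C * C <= 1 * 1" "S * S <= 1 * 1" using SC zero_le_square[of S] zero_le_square[of C] by linarith+
 moreover have "v <= 1" if "v * v <= 1 * 1" for v :: real using that mult_strict_mono[of 1 v 1 v] by (cases "v <= 1") auto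
 ultimately have C1: "C <= 1" "S <= 1" by blast+
 have th: "cos thx = S * cos ps + C * sin ps" "sin thx = - C * cos ps + S * sin ps"
 using cos_add[of ch0 ps] sin_add[of ch0 ps] S(1,2) by (simp_all add: ps_def)
 note A = orthoframeD[OF abe(1)]
 \<comment> \<open>Rotation by \<open>phx\<close> sets the point back by \<open>w\<close> along
   \<open>E1 = C b - S e\<close>; this shifts \<open>Y\<close> by \<open>- C * w\<close> and raises
   \<open>Z\<close> by \<open>S * w\<close>.\<close>
 define X Y Z where "X = r * sin phx" and "Y = Ym - C * w" and "Z = Zm + S * w"
 have wr: "r * cos phx = r - w" by (simp add: w_def algebra_simps)
 have eb: "C * (r - w) + S * (u * sin thx) = R * C + Y"
 proof -
 have "C * (r - w) + S * (u * sin thx) = R * C - C * w + u * ((C * S) * cos ps + (C * C) * sin ps - (S * C) * cos ps + (S * S) * sin ps)"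
 unfolding r_def th by (simp add: algebra_simps)
 also have "(C * S) * cos ps + (C * C) * sin ps - (S * C) * cos ps + (S * S) * sin ps = (S * S + C * C) * sin ps" by (simp add: algebra_simps)
 finally show ?thesis unfolding SC by (simp add: Y_def Ym_def)
 qed
 have ee: "- S * (r - w) + C * (u * sin thx) = - R * S - 1 / (1 + g) + Z"
 proof -
 have "- S * (r - w) + C * (u * sin thx) = - R * S + S * w + u * (- (S * S) * cos ps - (S * C) * sin ps - (C * C) * cos ps + (C * S) * sin ps)"
 unfolding r_def th by (simp add: algebra_simps)
 also have "- (S * S) * cos ps - (S * C) * sin ps - (C * C) * cos ps + (C * S) * sin ps = - ((S * S + C * C) * cos ps)" by (simp add: algebra_simps)
 finally show ?thesis unfolding SC by (simp add: Z_def Zm_def)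
 qed
 have x0: "x = r *# (cos phx *# E1 + sin phx *# E2) + (u * sin thx) *# E3" unfolding x pt_def u_def r_def ..
 have x1: "x = X *# a + (C * (r - w) + S * (u * sin thx)) *# b + (- S * (r - w) + C * (u * sin thx)) *# e"
 unfolding x0 abe(2-4) wr[symmetric] X_def by (simp add: algebra_simps)
 have rep: "x = R *# E1 - (1 / (1 + g)) *# e + X *# a + Y *# b + Z *# e"
 unfolding x1 eb ee unfolding abe(2) by (simp add: algebra_simps)
 have Zm: "Zm >= - (epx * bex / 2) * Ym\<^sup>2"
 using dent_shape[OF _ epx(4) g refl, of ps] epx init[of thx] by (simp add: Zm_def Ym_def u_def ps_def)
 have Ym2: "Ym\<^sup>2 <= Y\<^sup>2 + 4 * w"
 proof -
 have "Ym * (C * w) <= 2 * (1 * w)"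
 using uc(2)[of ps] C1 S(4) w by (intro mult_mono mult_right_mono) (auto simp: Ym_def)
 moreover have "Y\<^sup>2 = Ym\<^sup>2 - 2 * (Ym * (C * w)) + (C * w)\<^sup>2" by (simp add: Y_def power2_eq_square algebra_simps)
 ultimately show ?thesis using zero_le_power2[of "C * w"] by linarith
 qed
 have X2: "X\<^sup>2 <= 2 * (R + 2) * w"
 proof -
 have "(sin phx)\<^sup>2 = (1 - cos phx) * (1 + cos phx)" using sin_squared_eq[of phx] by (simp add: power2_eq_square algebra_simps)
 also have "... <= (1 - cos phx) * 2" by (intro mult_left_mono) auto
 finally have "X\<^sup>2 <= r\<^sup>2 * ((1 - cos phx) * 2)" unfolding X_def power_mult_distrib by (intro mult_left_mono) auto
 also have "... = r * (2 * w)" by (simp add: w_def power2_eq_square)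
 also have "... <= (R + 2) * (2 * w)" using r w by (intro mult_right_mono) auto
 finally show ?thesis by (simp only: mult.assoc mult.commute mult.left_commute)
 qed
 have Zb: "epx * (al * X\<^sup>2 - bex * Y\<^sup>2) / 2 <= Z"
 proof -
 have "(epx * bex / 2) * Ym\<^sup>2 <= (epx * bex / 2) * (Y\<^sup>2 + 4 * w)" using Ym2 epx by (intro mult_left_mono) auto
 moreover have "(epx * al / 2) * X\<^sup>2 <= (epx * al / 2) * (2 * (R + 2) * w)" using X2 epx by (intro mult_left_mono) auto
 moreover have "S * w = (epx * al / 2) * (2 * (R + 2) * w) + (epx * bex / 2) * (4 * w)" by (simp add: S(3) field_simps)
 ultimately show ?thesis using Zm by (simp add: Z_def algebra_simps)
 qed
 have nb: "X\<^sup>2 + Y\<^sup>2 + Z\<^sup>2 <= (2 * R + 8)\<^sup>2"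
 proof -
 have xe: "x - (R *# E1 - (1 / (1 + g)) *# e) = X *# a + Y *# b + Z *# e" unfolding rep by (simp add: algebra_simps)
 have nE: "norm E1 = 1" "norm E2 = 1" "norm E3 = 1" using orthoframeD[OF frame] by simp_all
 have "norm x <= norm (r *# (cos phx *# E1 + sin phx *# E2)) + norm ((u * sin thx) *# E3)"
 unfolding x0 by (rule norm_triangle_ineq)
 also have "... <= r * 1 + 2"
 proof (rule add_mono)
 have "(norm (cos phx *# E1 + sin phx *# E2))\<^sup>2 = 1"
 unfolding power2_norm_eq_inner using orthoframeD[OF frame] sin_cos_squared_add3[of phx] by (simp add: inner_add_left inner_add_right)
 then have "norm (cos phx *# E1 + sin phx *# E2) = 1" by (simp add: power2_eq_1_iff) (smt (verit) norm_ge_zero)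
 then show "norm (r *# (cos phx *# E1 + sin phx *# E2)) <= r * 1" using r by simp
 show "norm ((u * sin thx) *# E3) <= 2" using uc(2)[of thx] nE by simp
 qed
 finally have nx: "norm x <= R + 4" using r by simp
 have g0: "0 <= g" using epx by (simp add: g)
 have "norm (R *# E1 - (1 / (1 + g)) *# e) <= norm (R *# E1) + norm ((1 / (1 + g)) *# e)" by (rule norm_triangle_ineq4)
 also have "... <= R + 1" using nE A R g0 by (simp add: field_simps)
 finally have "norm (x - (R *# E1 - (1 / (1 + g)) *# e)) <= 2 * R + 8" using nx norm_triangle_ineq4[of x "R *# E1 - (1 / (1 + g)) *# e"] by linarith
 then have "(norm (X *# a + Y *# b + Z *# e))\<^sup>2 <= (2 * R + 8)\<^sup>2" unfolding xe by (intro power_mono) auto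
 moreover have "(norm (X *# a + Y *# b + Z *# e))\<^sup>2 = X\<^sup>2 + Y\<^sup>2 + Z\<^sup>2"
 unfolding power2_norm_eq_inner using A by (simp add: inner_add_left inner_add_right power2_eq_square)
 ultimately show ?thesis by simp
 qed
 show ?thesis by (rule that[OF rep Zb nb])
qed

text \<open>Reduced modulo \<open>2 * pi\<close>, the two angles range over a compact square, and
  \<open>q\<close> is continuous up to time 0.\<close>

lemma (in torus_flow) initial_limit:
 assumes cont: "continuous_on UNIV (%(s,t). q s t)" and t: "t ----> 0" and x: "!!n. EX thx phx. x n = pt (1 / q thx (t n)) thx phx"
 obtains thx phx k where "strict_mono (k :: nat => nat)" "(x \<circ> k) ----> pt (1 / q thx 0) thx phx"
proof -
 have "\<exists>thx\<in>{0..2*pi}. \<exists>phx\<in>{0..2*pi}. x n = pt (1 / q thx (t n)) thx phx" for n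
 proof -
 obtain thx phx where xn: "x n = pt (1 / q thx (t n)) thx phx" using x by blast
 obtain a where a: "0 <= a" "a <= 2 * pi" "cos thx = cos a" "sin thx = sin a" using sincos_total_2pi_le[of "cos thx" "sin thx"] by auto
 obtain f where f: "0 <= f" "f <= 2 * pi" "cos phx = cos f" "sin phx = sin f" using sincos_total_2pi_le[of "cos phx" "sin phx"] by auto
 have "x n = pt (1 / q a (t n)) a f" using xn q_angle[OF a(3,4)] unfolding pt_def a(3,4) f(3,4) by simp
 then show ?thesis using a(1,2) f(1,2) by (intro bexI[of _ a] bexI[of _ f]) simp_all
 qed
 then obtain A B where AB: "!!n. A n \<in> {0..2*pi}" "!!n. B n \<in> {0..2*pi}" "!!n. x n = pt (1 / q (A n) (t n)) (A n) (B n)" by metis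
 have "compact ({0..2*pi} \<times> {0..2*pi})" by (intro compact_Times compact_Icc)
 moreover have "ALL n. (A n, B n) \<in> {0..2*pi} \<times> {0..2*pi}" using AB by blast
 ultimately obtain l k where l: "strict_mono (k::nat=>nat)" "((%n. (A n, B n)) \<circ> k) ----> l" unfolding compact_def by meson
 have lA: "(%n. A (k n)) ----> fst l" and lB: "(%n. B (k n)) ----> snd l"
 using tendsto_fst[OF l(2)] tendsto_snd[OF l(2)] by (simp_all add: o_def)
 have lt: "(%n. t (k n)) ----> 0" using LIMSEQ_subseq_LIMSEQ[OF t l(1)] by (simp add: o_def)
 have "(%n. (%(s,t). q s t) (A (k n), t (k n))) ----> (%(s,t). q s t) (fst l, 0)"
 by (rule continuous_on_tendsto_compose[OF cont tendsto_Pair[OF lA lt]]) auto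
 then have lq: "(%n. q (A (k n)) (t (k n))) ----> q (fst l) 0" by simp
 have "q (fst l) 0 ~= 0" using q_pos[of "fst l" 0] by simp
 then have "(%n. pt (1 / q (A (k n)) (t (k n))) (A (k n)) (B (k n))) ----> pt (1 / q (fst l) 0) (fst l) (snd l)"
 unfolding pt_def by (intro tendsto_intros lq lA lB)
 then have "(x \<circ> k) ----> pt (1 / q (fst l) 0) (fst l) (snd l)" using AB(3) by (simp add: o_def)
 then show ?thesis by (rule that[OF l(1)])
qed

text \<open>Weak set flows have closed time slices by definition; that limits of points at times
  tending to 0 belong to the initial slice is a consequence of the sphere barriers.\<close>

lemma avoids_initial_closed:
 assumes L: "avoids_smooth_flows L" and c: "closed (L 0)" and t: "t ----> 0" "!!n. 0 <= t n" and y: "!!n. y n \<in> L (t n)" "y ----> z"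
 shows "z \<in> L 0"
proof (rule ccontr)
 assume "z \<notin> L 0"
 then have "z \<in> - L 0" by simp
 then obtain r where r: "r > 0" "ball z r <= - L 0" using openE[OF open_Compl[OF c]] by blast
 have r20: "(r / 20)\<^sup>2 > 0" "r / 2 > 0" using r by simp_all
 have "\<forall>\<^sub>F n in sequentially. False"
 using tendstoD[OF t(1) r20(1)] tendstoD[OF y(2) r20(2)]
 proof eventually_elim
 case (elim n)
 have "t n < (r / 20)\<^sup>2" using elim(1) t(2)[of n] by (simp add: dist_real_def)
 then have "sqrt (t n) < sqrt ((r / 20)\<^sup>2)" by (rule real_sqrt_less_mono)
 then have "10 * sqrt (t n) < r" using r(1) by simp
 then have "y n \<notin> L (0 + t n)" using r elim(2) t(2) by (intro avoids_no_jump[OF L _ _ _, of 0 "t n" r z]) (auto simp: dist_commute)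
 then show False using y(1) by simp
 qed
 then show False by simp
qed

lemma frontier_affine_preimage:
 fixes v :: "'a::real_normed_vector" assumes l: "l > 0"
 shows "frontier {x. l *# x + v \<in> K} = {x. l *# x + v \<in> frontier K}"
proof -
 have pre: "{x. l *# x + v \<in> S} = (*\<^sub>R) (1 / l) ` ((+) (- v) ` S)" for S
 proof (intro equalityI subsetI)
 fix x assume "x \<in> {x. l *# x + v \<in> S}"
 then show "x \<in> (*\<^sub>R) (1 / l) ` ((+) (- v) ` S)" unfolding image_image by (intro image_eqI[of _ _ "l *# x + v"]) (use l in simp_all)
 next
 fix x assume "x \<in> (*\<^sub>R) (1 / l) ` ((+) (- v) ` S)"
 then obtain s where "s \<in> S" "x = (1 / l) *# (- v + s)" by auto
 then show "x \<in> {x. l *# x + v \<in> S}" using l by simp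
 qed
 have cl: "closure {x. l *# x + v \<in> S} = {x. l *# x + v \<in> closure S}" for S
 unfolding pre by (simp only: closure_scaleR[symmetric] closure_translation)
 have "- {x. l *# x + v \<in> K} = {x. l *# x + v \<in> - K}" by auto
 then show ?thesis unfolding frontier_closures by (simp only: cl) auto
qed

lemma (in torus_flow) bounded_torus: "torus t <= cball 0 (2 * R + 6)"
proof
 fix x assume "x \<in> torus t"
 then obtain rh thx where r: "0 <= rh" "rad x = R + rh * cos thx" "x *. E3 = rh * sin thx" "rh * q thx t <= 1" unfolding torus_def by blast
 have "rh * (1/2) <= rh * q thx t" using r(1) q_bounds[of thx t] by (intro mult_left_mono) auto
 then have rh: "rh <= 2" using r(4) by simp
 have uc: "\<bar>rh * cos thx\<bar> <= 2 * 1" "\<bar>rh * sin thx\<bar> <= 2 * 1" unfolding abs_mult using rh r(1) by (intro mult_mono; simp)+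
 obtain phx where x: "x = pt rh thx phx" by (rule pt_of[OF r(2,3)])
 have nE: "norm E1 = 1" "norm E2 = 1" "norm E3 = 1" using orthoframeD[OF frame] by simp_all
 have "norm x <= norm ((R + rh * cos thx) *# (cos phx *# E1 + sin phx *# E2)) + norm ((rh * sin thx) *# E3)"
 unfolding x pt_def by (rule norm_triangle_ineq)
 also have "... <= (R + 2) * 2 + 2"
 proof (rule add_mono)
 have "norm (cos phx *# E1 + sin phx *# E2) <= \<bar>cos phx\<bar> + \<bar>sin phx\<bar>" using norm_triangle_ineq[of "cos phx *# E1" "sin phx *# E2"] nE by simp
 also have "... <= 1 + 1" by (intro add_mono) auto
 finally show "norm ((R + rh * cos thx) *# (cos phx *# E1 + sin phx *# E2)) <= (R + 2) * 2"
 unfolding norm_scaleR using uc(1) R by (intro mult_mono) auto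
 show "norm ((rh * sin thx) *# E3) <= 2" using uc(2) nE by simp
 qed
 finally show "x \<in> cball 0 (2 * R + 6)" by simp
qed

text \<open>The barrier is a torus of revolution evolving by mean curvature flow, placed outside the domain.
 Its meridian has a dent: at the bottom the torus is a saddle with principal curvatures
 \<open>\<alpha> < \<beta>\<close> of opposite sign, so it moves towards \<open>p\<close> immediately, and its
 translates in direction \<open>e\<close> sweep the normal ray from \<open>p\<close>.\<close>
lemma torus_barrier:
 assumes ab: "0 < al" "al < bex" "0 < r0"
 obtains s1 si1 where "0 < s1" "0 < si1"
 "!!L p a b e s et. avoids_smooth_flows L ==> closed (L 0) ==> orthoframe a b e ==>
 (!!X Y Z. X\<^sup>2 + Y\<^sup>2 + Z\<^sup>2 <= r0\<^sup>2 ==> (al * X\<^sup>2 - bex * Y\<^sup>2) / 2 < Z ==> p + X *# a + Y *# b + Z *# e \<notin> L 0) ==>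
 0 < s ==> s <= s1 ==> 0 <= et ==> et <= si1 ==> p + et *# e \<notin> L s"
proof -
 have bex: "0 < bex" using ab by simp
 \<comment> \<open>So large that \<open>al * (R + 2) + 2 * bex < bex * R\<close>, which is possible
   because \<open>al < bex\<close>. It makes the tilt needed for the shape too weak to stop the
   dent.\<close>
 define R where "R = max 1000 ((2 * al + 2 * bex) / (bex - al) + 1)"
 have R: "R >= 1000" "(2 * al + 2 * bex) / (bex - al) < R" by (auto simp: R_def)
 define M where "M = al * (R + 2) + 2 * bex"
 have M: "M > 0" using ab bex R by (simp add: M_def add_pos_pos)
 have MR: "M < bex * R" using R(2) ab by (simp add: M_def field_simps)
 \<comment> \<open>The factor by which the torus is shrunk. The three bounds keep the strength
   \<open>bb\<close> of the dent at most 1, make \<open>S\<close> a cosine, and place the shrunken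
   torus within distance \<open>r0\<close> of \<open>p\<close>.\<close>
 define epx where "epx = min (min (1 / bex) (1 / M)) (r0 / (8 * (2 * R + 8)))"
 have epx: "0 < epx" using ab bex M R by (simp add: epx_def)
 have "epx <= 1 / bex" "epx <= 1 / M" "epx <= r0 / (8 * (2 * R + 8))" by (simp_all add: epx_def)
 then have e1: "epx * bex <= 1" and e2: "epx * M <= 1" and e3: "epx * (2 * R + 8) <= r0 / 8" using bex M R by (simp_all add: field_simps)
 have e4: "2 * epx <= r0 / 8"
 proof -
 have "epx * 2 <= epx * (2 * R + 8)" using epx R by (intro mult_left_mono) auto
 then show ?thesis using e3 by simp
 qed
 \<comment> \<open>Cosine and, up to sign, sine of the polar angle \<open>ch0\<close> at which the
   dent sits; they tilt the rotation axis against the normal \<open>e\<close> as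
   \<open>initial_shape\<close> demands.\<close>
 define S C where "S = epx * M" and "C = sqrt (1 - S\<^sup>2)"
 have S: "0 < S" "S <= 1" using epx M e2 by (simp_all add: S_def)
 have "S\<^sup>2 <= 1" using S power_mono[of S 1 2] by simp
 then have C: "0 <= C" "S\<^sup>2 + C\<^sup>2 = 1" by (simp_all add: C_def)
 then have "S\<^sup>2 + (- C)\<^sup>2 = 1" by simp
 from sincos_total_2pi_le[OF this] obtain ch0 where ch: "cos ch0 = S" "sin ch0 = - C" by metis
 define ka bb where "ka = 1 / R" and "bb = epx * bex"
 have ka: "0 <= ka" "ka <= 1/1000" using R(1) by (simp_all add: ka_def field_simps)
 have bb: "0 <= bb" "bb <= 1" using epx bex e1 by (simp_all add: bb_def)
 obtain T q q1 q2 where T: "0 < T" and qs: "smooth_on (UNIV \<times> {0<..<T}) (%(s,t). q s t)"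
 and qc: "continuous_on UNIV (%(s,t). q s t)" "continuous_on UNIV (%(s,t). q1 s t)" "continuous_on UNIV (%(s,t). q2 s t)"
 and qp: "!!s t. q (s + 2 * pi) t = q s t" "!!s t. 1/2 <= q s t & q s t <= 2"
 and q0: "!!s. q s 0 = 1 + (1 + bb) / (4000\<^sup>2 - 1) * cos (4000 * (s - ch0))"
 and q10: "!!s. q1 s 0 = - 4000 * (1 + bb) / (4000\<^sup>2 - 1) * sin (4000 * (s - ch0))"
 and q20: "!!s. q2 s 0 = - 4000\<^sup>2 * (1 + bb) / (4000\<^sup>2 - 1) * cos (4000 * (s - ch0))"
 and qd: "!!s t. ((%s. q s t) has_real_derivative q1 s t) (at s)" "!!s t. ((%s. q1 s t) has_real_derivative q2 s t) (at s)"
 and qe: "!!s t. 0 < t ==> t < T ==> ((%t. q s t) has_real_derivative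
 (q s t ^ 4 * (q s t + q2 s t) / ((q s t)\<^sup>2 + (q1 s t)\<^sup>2)
 + ka * (q s t)\<^sup>2 * (q s t * cos s - q1 s t * sin s) / (q s t + ka * cos s))) (at t)"
 by (rule profile_evolution[OF ka bb, of ch0]) (rule that)
 define g where "g = (1 + bb) / (4000\<^sup>2 - 1)"
 have g: "0 <= g" using bb by (simp add: g_def)
 define rhs where "rhs t = q ch0 t ^ 4 * (q ch0 t + q2 ch0 t) / ((q ch0 t)\<^sup>2 + (q1 ch0 t)\<^sup>2)
 + ka * (q ch0 t)\<^sup>2 * (q ch0 t * cos ch0 - q1 ch0 t * sin ch0) / (q ch0 t + ka * cos ch0)" for t
 have qpos: "q s t > 0" for s t using qp(2)[of s t] by linarith
 have ct: "continuous_on UNIV (%t. f ch0 t)" if "continuous_on UNIV (%(s,t). f s t)" for f :: "real => real => real"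
 proof -
 have "continuous_on UNIV (%t. (%(s,t). f s t) (ch0, t))"
 by (rule continuous_on_compose2[OF that]) (auto intro!: continuous_intros)
 then show ?thesis by simp
 qed
 have dn: "(q ch0 t)\<^sup>2 + (q1 ch0 t)\<^sup>2 ~= 0" "q ch0 t + ka * cos ch0 ~= 0" for t
 using qpos[of ch0 t] ka S(1) ch(1) by (auto simp: sum_power2_eq_zero_iff add_pos_nonneg less_imp_neq[symmetric])
 have "continuous_on UNIV rhs" unfolding rhs_def[abs_def] by (intro continuous_intros ct[OF qc(1)] ct[OF qc(2)] ct[OF qc(3)]) (use dn in auto)
 then have "isCont rhs 0" by (simp add: continuous_on_eq_continuous_at)
 then have lim: "(rhs \<longlongrightarrow> rhs 0) (at_right 0)" by (simp add: isCont_def filterlim_at_split)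
 have v0: "q ch0 0 = 1 + g" "q1 ch0 0 = 0" "q ch0 0 + q2 ch0 0 = - bb"
 using q0[of ch0] q10[of ch0] q20[of ch0] by (simp_all add: g_def field_simps)
 \<comment> \<open>Up to the common factor \<open>(1 + g)^2\<close>, the dent contributes
   \<open>- bb = - epx * bex\<close> and the rotation at most \<open>ka * S = epx * M / R\<close>,
   which is smaller by the choice of \<open>R\<close>. So \<open>q\<close> decreases, the radius
   \<open>1 / q\<close> grows, and the torus advances at its dent.\<close>
 have "rhs 0 < 0"
 proof -
 have "rhs 0 = (1 + g) ^ 4 * (- bb) / (1 + g)\<^sup>2 + ka * (1 + g)\<^sup>2 * ((1 + g) * S) / ((1 + g) + ka * S)"
 unfolding rhs_def v0(3) unfolding v0(1,2) ch by simp
 also have "(1 + g) ^ 4 * (- bb) / (1 + g)\<^sup>2 = (1 + g)\<^sup>2 * (- bb)" using g by (simp add: eval_nat_numeral)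
 also have "ka * (1 + g)\<^sup>2 * ((1 + g) * S) / ((1 + g) + ka * S) = (1 + g)\<^sup>2 * ((ka * S) * ((1 + g) / ((1 + g) + ka * S)))" by simp
 also have "... <= (1 + g)\<^sup>2 * ((ka * S) * 1)" using g ka S by (intro mult_left_mono) (auto simp: divide_le_eq_1 add_pos_nonneg)
 also have "(1 + g)\<^sup>2 * (- bb) + (1 + g)\<^sup>2 * ((ka * S) * 1) = (1 + g)\<^sup>2 * (ka * S - bb)" by (simp add: algebra_simps)
 also have "... < 0"
 proof -
 have "ka * S = epx * (M / R)" by (simp add: ka_def S_def)
 also have "... < epx * bex" using MR R(1) epx by (simp add: field_simps)
 finally have "ka * S - bb < 0" by (simp add: bb_def)
 then show ?thesis using g by (simp add: mult_less_0_iff)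
 qed
 finally show ?thesis by simp
 qed
 then have "\<forall>\<^sub>F t in at_right 0. rhs t < 0" by (rule order_tendstoD(2)[OF lim])
 then obtain d where d: "d > 0" "!!t. 0 < t ==> t < d ==> rhs t < 0" unfolding eventually_at_right_field by blast
 define tm where "tm = min d T / 2"
 have tm: "0 < tm" "tm < d" "tm < T" using d T by (auto simp: tm_def)
 have dec: "q ch0 t < q ch0 0" if "0 < t" "t <= tm" for t
 proof (rule DERIV_neg_imp_decreasing_open[OF that(1)])
 fix x assume "0 < x" "x < t"
 then have "rhs x < 0" "((%t. q ch0 t) has_real_derivative rhs x) (at x)" unfolding rhs_def
 using d(2)[of x] qe[of x ch0] that tm by (auto simp: rhs_def)
 then show "EX y. ((%t. q ch0 t) has_real_derivative y) (at x) & y < 0" by blast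
 qed (rule continuous_on_subset[OF ct[OF qc(1)]], simp)
 show ?thesis
 proof (rule that[of "epx\<^sup>2 * tm" "r0 / 4"])
 show "0 < epx\<^sup>2 * tm" "0 < r0 / 4" using epx tm ab by simp_all
 fix L p a b e s et
 assume L: "avoids_smooth_flows L" "closed (L 0)" and abe: "orthoframe a b e"
 and out: "!!X Y Z. X\<^sup>2 + Y\<^sup>2 + Z\<^sup>2 <= r0\<^sup>2 ==> (al * X\<^sup>2 - bex * Y\<^sup>2) / 2 < Z ==> p + X *# a + Y *# b + Z *# e \<notin> L 0"
 and s: "0 < s" "s <= epx\<^sup>2 * tm" and et: "0 <= et" "et <= r0 / 4"
 show "p + et *# e \<notin> L s"
 proof
 assume inL: "p + et *# e \<in> L s"
 note A = orthoframeD[OF abe]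
 define E1 E2 E3 where "E1 = C *# b - S *# e" and "E2 = a" and "E3 = S *# b + C *# e"
 have SC: "S * S + C * C = 1" "C * C + S * S = 1" using C(2) by (simp_all add: power2_eq_square)
 have frE: "orthoframe E1 E2 E3"
 unfolding orthoframe_def E1_def E2_def E3_def using A SC by (simp add: inner_add_left inner_add_right inner_diff_left inner_diff_right mult.commute)
 interpret torus_flow E1 E2 E3 R T q q1 q2
 by unfold_locales (use frE R T qs qp qd qe in \<open>auto simp: ka_def\<close>)
 define l where "l = 1 / epx"
 have l: "l > 0" "epx * l = 1" "l * epx = 1" using epx by (simp_all add: l_def)
 have ls: "0 < l\<^sup>2 * s" "l\<^sup>2 * s <= tm" using s epx by (simp_all add: l_def power_divide field_simps)
 define u rh0 where "u = 1 / q ch0 (l\<^sup>2 * s)" and "rh0 = 1 / (1 + g)"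
 have u: "rh0 < u" "u <= 2" "u > 0"
 using dec[OF ls] qpos[of ch0 "l\<^sup>2 * s"] qp(2)[of ch0 "l\<^sup>2 * s"] v0(1) by (simp_all add: u_def rh0_def field_simps)
 have rh0: "rh0 > 0" using g by (simp add: rh0_def)
 \<comment> \<open>The initial height of the bottom of the dent above \<open>p\<close>: positive, so
   that the torus starts off \<open>L 0\<close>, and such that the advance
   \<open>epx * (u - rh0)\<close> brings the bottom to \<open>p + et e\<close> exactly at time
   \<open>s\<close>.\<close>
 define si where "si = et + epx * (u - rh0)"
 have "epx * (u - rh0) <= epx * 2" using u rh0 epx by (intro mult_left_mono) auto
 then have "si <= 3 * r0 / 8" unfolding si_def using et(2) e4 by linarith
 moreover have "0 < si" using u epx et by (simp add: si_def add_nonneg_pos)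
 ultimately have si: "0 < si" "si <= 3 * r0 / 8" by simp_all
 define v where "v = R *# E1 - rh0 *# e - l *# (p + si *# e)"
 define N where "N t = {x. l *# x + v \<in> torus (l\<^sup>2 * t)}" for t
 have Nm: "smooth_mcf {t. l\<^sup>2 * t \<in> {0<..<T}} N"
 using mcf_similarity[OF torus_mcf[OF order_refl] orthogonal_transformation_id l(1), of 0 v] by (simp add: N_def[abs_def])
 have Nf: "x \<in> frontier (N t) \<longleftrightarrow> (EX thx phx. l *# x + v = pt (1 / q thx (l\<^sup>2 * t)) thx phx)" if "0 < l\<^sup>2 * t" "l\<^sup>2 * t < T" for x t
 unfolding N_def frontier_affine_preimage[OF l(1)] using torus_frontier[OF that] by simp
 have xe: "x = epx *# ((l *# x + v) - v)" for x :: R3 using l by simp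
 have Nb: "bounded (\<Union>t\<in>J. N t)" for J
 proof (rule bounded_subset)
 show "bounded ((*\<^sub>R) epx ` ((+) (- v) ` cball 0 (2 * R + 6)))" by (intro bounded_scaling bounded_translation bounded_cball)
 show "(\<Union>t\<in>J. N t) <= (*\<^sub>R) epx ` ((+) (- v) ` cball 0 (2 * R + 6))"
 proof
 fix x assume "x \<in> (\<Union>t\<in>J. N t)"
 then have "l *# x + v \<in> cball 0 (2 * R + 6)" using bounded_torus unfolding N_def by blast
 then show "x \<in> (*\<^sub>R) epx ` ((+) (- v) ` cball 0 (2 * R + 6))"
 unfolding image_image by (rule rev_image_eqI) (use l in simp)
 qed
 qed
 \<comment> \<open>The torus flow is smooth at positive times only, so the barrier has to start at
   some \<open>t1 > 0\<close>. If its frontier met \<open>L\<close> at times tending to 0, a limit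
   point would lie on the initial torus and in \<open>L 0\<close>, against
   \<open>out\<close>.\<close>
 have "EX t1. 0 < t1 & t1 < s & L t1 \<inter> frontier (N t1) = {}"
 proof (rule ccontr)
 assume neg: "\<not> ?thesis"
 define t where "t n = s * inverse (real (Suc (Suc n)))" for n
 have t: "0 < t n" "t n < s" for n
 proof -
 show "0 < t n" using s(1) by (simp add: t_def)
 have "s * inverse (real (Suc (Suc n))) < s * 1" using s(1) by (intro mult_strict_left_mono) (simp_all add: inverse_less_1_iff)
 then show "t n < s" by (simp add: t_def)
 qed
 have "EX y. y \<in> L (t n) & y \<in> frontier (N (t n))" for n using neg t[of n] by blast
 then obtain y where y: "!!n. y n \<in> L (t n)" "!!n. y n \<in> frontier (N (t n))" by metis
 have "(%n. inverse (real (Suc (Suc n)))) ----> 0" using LIMSEQ_Suc[OF LIMSEQ_inverse_real_of_nat] .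
 then have t0: "t ----> 0" unfolding t_def[abs_def] using tendsto_mult_right_zero by blast
 have lt: "0 < l\<^sup>2 * t n" "l\<^sup>2 * t n < T" for n
 proof -
 show "0 < l\<^sup>2 * t n" using t[of n] l by simp
 have "l\<^sup>2 * t n < l\<^sup>2 * s" using t(2)[of n] l by simp
 then show "l\<^sup>2 * t n < T" using ls tm by simp
 qed
 have lt0: "(%n. l\<^sup>2 * t n) ----> 0" using tendsto_mult_right_zero[OF t0] .
 obtain thx phx k where k: "strict_mono (k :: nat => nat)" "((%n. l *# y n + v) \<circ> k) ----> pt (1 / q thx 0) thx phx"
 by (rule initial_limit[OF qc(1) lt0, of "%n. l *# y n + v"]) (use y(2) Nf[OF lt] in blast)+
 define z where "z = pt (1 / q thx 0) thx phx"
 have "(%n. epx *# ((l *# y (k n) + v) - v)) ----> epx *# (z - v)"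
 using k(2) by (intro tendsto_intros) (simp add: o_def z_def)
 then have yz: "(%n. y (k n)) ----> epx *# (z - v)" unfolding xe[symmetric] .
 have "(%n. t (k n)) ----> 0" using LIMSEQ_subseq_LIMSEQ[OF t0 k(1)] by (simp add: o_def)
 from avoids_initial_closed[OF L this less_imp_le[OF t(1)] y(1) yz] have zL: "epx *# (z - v) \<in> L 0" .
 obtain X Y Z where XYZ: "z = R *# E1 - (1 / (1 + g)) *# e + X *# a + Y *# b + Z *# e"
 "epx * (al * X\<^sup>2 - bex * Y\<^sup>2) / 2 <= Z" "X\<^sup>2 + Y\<^sup>2 + Z\<^sup>2 <= (2 * R + 8)\<^sup>2"
 by (rule initial_shape[OF g_def[unfolded bb_def] q0[folded g_def] epx ab(1) bex e1 ch S_def[unfolded M_def] C(1) abe E1_def E2_def E3_def z_def]) (rule that)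
 have "epx *# (z - v) = epx *# (X *# a + Y *# b + Z *# e) + (epx * l) *# (p + si *# e)"
 unfolding XYZ(1) v_def rh0_def by (simp add: algebra_simps)
 then have zr: "epx *# (z - v) = p + (epx * X) *# a + (epx * Y) *# b + (epx * Z + si) *# e"
 unfolding l(2) by (simp add: algebra_simps)
 have "p + (epx * X) *# a + (epx * Y) *# b + (epx * Z + si) *# e \<notin> L 0"
 proof (rule out)
 have "epx * (epx * (al * X\<^sup>2 - bex * Y\<^sup>2) / 2) <= epx * Z" using XYZ(2) epx by (intro mult_left_mono) auto
 moreover have "epx * (epx * (al * X\<^sup>2 - bex * Y\<^sup>2) / 2) = (al * (epx * X)\<^sup>2 - bex * (epx * Y)\<^sup>2) / 2" by (simp add: power2_eq_square algebra_simps)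
 ultimately show "(al * (epx * X)\<^sup>2 - bex * (epx * Y)\<^sup>2) / 2 < epx * Z + si" using si(1) by linarith
 have lin: "w <= 2 * z + 2 * s ==> x + y + z <= r / 64 ==> s <= 9 * r / 64 ==> 0 <= x ==> 0 <= y ==> 0 <= z ==> 0 <= r ==> x + y + w <= r"
 for w x y z s r :: real by linarith
 have n1: "(epx * X)\<^sup>2 + (epx * Y)\<^sup>2 + (epx * Z)\<^sup>2 <= r0\<^sup>2 / 64"
 proof -
 have "(epx * X)\<^sup>2 + (epx * Y)\<^sup>2 + (epx * Z)\<^sup>2 = epx\<^sup>2 * (X\<^sup>2 + Y\<^sup>2 + Z\<^sup>2)" by (simp add: power_mult_distrib distrib_left)
 also have "... <= epx\<^sup>2 * (2 * R + 8)\<^sup>2" using XYZ(3) by (intro mult_left_mono) auto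
 also have "... = (epx * (2 * R + 8))\<^sup>2" by (simp only: power_mult_distrib)
 also have "... <= (r0 / 8)\<^sup>2" using e3 epx R by (intro power_mono) auto
 finally show ?thesis by (simp add: power_divide)
 qed
 have n2: "si\<^sup>2 <= 9 * r0\<^sup>2 / 64"
 proof -
 have "si\<^sup>2 <= (3 * r0 / 8)\<^sup>2" using si by (intro power_mono) auto
 then show ?thesis by (simp add: power_divide power_mult_distrib)
 qed
 have n3: "(epx * Z + si)\<^sup>2 <= 2 * (epx * Z)\<^sup>2 + 2 * si\<^sup>2"
 using zero_le_power2[of "epx * Z - si"] by (simp add: power2_sum power2_diff)
 show "(epx * X)\<^sup>2 + (epx * Y)\<^sup>2 + (epx * Z + si)\<^sup>2 <= r0\<^sup>2"
 by (rule lin[OF n3 n1 n2]) simp_all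
 qed
 then show False using zL zr by simp
 qed
 then obtain t1 where t1: "0 < t1" "t1 < s" "L t1 \<inter> frontier (N t1) = {}" by blast
 have "smooth_mcf {t1..s} N"
 proof (rule smooth_mcf_subset[OF Nm], rule subsetI)
 fix t assume t: "t \<in> {t1..s}"
 have "l\<^sup>2 * t <= l\<^sup>2 * s" using t by (intro mult_left_mono) auto
 moreover have "0 < l\<^sup>2 * t" using t t1 l by simp
 ultimately show "t \<in> {t. l\<^sup>2 * t \<in> {0<..<T}}" using ls tm by simp
 qed
 then have "L s \<inter> frontier (N s) = {}"
 using L(1)[unfolded avoids_smooth_flows_def, rule_format, of t1 s N s] t1 Nb[of "{t1..s}"] by simp
 moreover have "p + et *# e \<in> frontier (N s)"
 proof -
 have "l *# (p + et *# e) + v = R *# E1 - (rh0 + l * (si - et)) *# e" by (simp add: v_def algebra_simps)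
 also have "l * (si - et) = u - rh0" using l by (simp add: si_def mult.assoc[symmetric])
 also have "R *# E1 - (rh0 + (u - rh0)) *# e = R *# E1 - (u * (S * S + C * C)) *# e" using SC by simp
 also have "... = pt u ch0 0" unfolding pt_def ch by (simp add: E1_def E3_def algebra_simps)
 finally show ?thesis using Nf[of s] ls tm unfolding u_def by auto
 qed
 ultimately show False using inL by blast
 qed
 qed
qed

section \<open>The initial instant\<close>

text \<open>Diagonalising a symmetric form by a rotation through half of the polar angle of
  \<open>((A - C) / 2, B)\<close>; swapping the two vectors arranges the order of the
  eigenvalues.\<close>

lemma eigenframe:
 assumes l1: "!!v. bounded_linear (D v)" and l2: "!!w. bounded_linear (%v. D v w)" and sym: "!!v w. D v w = (D w v :: real)"
 and fr: "orthoframe e1 e2 e"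
 obtains a b where "orthoframe a b e" "D a b = 0" "D a a <= D b b"
proof -
 define A B C where "A = D e1 e1" and "B = D e1 e2" and "C = D e2 e2"
 obtain rh om where p: "(A - C) / 2 = rh * cos om" "B = rh * sin om" using polar_Ex by blast
 define c s where "c = cos (om / 2)" and "s = sin (om / 2)"
 have c2: "cos om = c * c - s * s" "sin om = 2 * (s * c)"
 using cos_double[of "om / 2"] sin_double[of "om / 2"] by (simp_all add: c_def s_def power2_eq_square)
 have cs: "c * c + s * s = 1" using sin_cos_squared_add3[of "om / 2"] by (simp add: c_def s_def)
 define a b where "a = c *# e1 + s *# e2" and "b = c *# e2 - s *# e1"
 note Fr = orthoframeD[OF fr]
 have o1: "orthoframe a b e"
 unfolding orthoframe_def a_def b_def using Fr cs by (simp add: inner_add_left inner_add_right inner_diff_left inner_diff_right mult.commute add.commute)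
 then have o2: "orthoframe b a e" by (simp add: orthoframe_def inner_commute)
 have ex1: "D v b = c * D v e2 - s * D v e1" for v
 proof -
 interpret bounded_linear "D v" by (rule l1)
 show ?thesis unfolding b_def by (simp add: diff scaleR)
 qed
 have ex2: "D a w = c * D e1 w + s * D e2 w" for w
 proof -
 interpret bounded_linear "%v. D v w" by (rule l2)
 show ?thesis unfolding a_def by (simp add: add scaleR)
 qed
 have "D a b = B * (c * c - s * s) - (A - C) * (s * c)"
 unfolding ex2 ex1 using sym[of e2 e1] by (simp add: A_def B_def C_def algebra_simps)
 also have "... = 0"
 proof -
 have AC: "A - C = 2 * (rh * (c * c - s * s))" and B: "B = rh * (2 * (s * c))" using p unfolding c2 by simp_all
 show ?thesis unfolding AC unfolding B by (simp add: algebra_simps)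
 qed
 finally have ab: "D a b = 0" .
 show ?thesis
 proof (cases "D a a <= D b b")
 case True then show ?thesis by (rule that[OF o1 ab])
 next
 case False
 show ?thesis by (rule that[OF o2]) (use False ab sym in auto)
 qed
qed

lemma second_derivative_local_bounds:
 fixes f :: "R3 => real"
 assumes U: "open U" and f: "smooth_on U f" and p: "p0 \<in> U" and ka: "ka > 0"
 obtains r B where "r > 0" "B >= 0" "ball p0 r <= U" "!!x v w. x \<in> ball p0 r ==> \<bar>nderiv [v, w] f x\<bar> <= B * (norm v * norm w)"
 "!!x y v. x \<in> ball p0 r ==> y \<in> ball p0 r ==> \<bar>nderiv [v, v] f x - nderiv [v, v] f y\<bar> <= ka * (norm v)\<^sup>2"
proof -
 define m where "m = real (card (Basis :: R3 set))"
 have m: "m > 0" unfolding m_def using DIM_positive[where 'a=R3] by simp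
 \<comment> \<open>Between two points of the ball each of the \<open>m^2\<close> entries of the
   Hessian changes by at most \<open>2 * k\<close>, which adds up to \<open>ka\<close>.\<close>
 define k where "k = ka / (2 * m\<^sup>2)"
 have k: "k > 0" using ka m by (simp add: k_def)
 have "\<forall>\<^sub>F x in nhds p0. \<forall>i\<in>Basis. \<forall>j\<in>Basis. dist (nderiv [i, j] f x) (nderiv [i, j] f p0) < k"
 proof (intro eventually_ball_finite finite_Basis ballI)
 fix i j :: R3
 have "isCont (nderiv [i, j] f) p0" by (rule continuous_nderiv[OF f p])
 then have "(nderiv [i, j] f \<longlongrightarrow> nderiv [i, j] f p0) (nhds p0)"
 unfolding isCont_def using tendsto_at_iff_tendsto_nhds[of "nderiv [i, j] f" p0] by (simp del: nderiv.simps)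
 then show "\<forall>\<^sub>F x in nhds p0. dist (nderiv [i, j] f x) (nderiv [i, j] f p0) < k" using k by (rule tendstoD)
 qed
 moreover have "\<forall>\<^sub>F x in nhds p0. x \<in> U" by (rule eventually_nhds_in_open[OF U p])
 ultimately have "\<forall>\<^sub>F x in nhds p0. x \<in> U & (\<forall>i\<in>Basis. \<forall>j\<in>Basis. dist (nderiv [i, j] f x) (nderiv [i, j] f p0) < k)" by eventually_elim blast
 then obtain r where r: "r > 0" "!!x. dist x p0 < r ==> x \<in> U & (\<forall>i\<in>Basis. \<forall>j\<in>Basis. dist (nderiv [i, j] f x) (nderiv [i, j] f p0) < k)"
 unfolding eventually_nhds_metric by blast
 have ex: "nderiv [v, w] f x = (\<Sum>i\<in>Basis. \<Sum>j\<in>Basis. (v *. i) * (w *. j) * nderiv [i, j] f x)" if "x \<in> U" for v w x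
 proof -
 interpret b1: bounded_linear "%y. nderiv [y, z] f x" for z by (rule linear_nderiv[OF f that])
 interpret b2: bounded_linear "%y. nderiv [z, y] f x" for z by (rule linear_nderiv2[OF U f that])
 have "nderiv [v, w] f x = nderiv [\<Sum>i\<in>Basis. (v *. i) *# i, w] f x" by (simp only: euclidean_representation)
 also have "... = (\<Sum>i\<in>Basis. (v *. i) * nderiv [i, w] f x)" unfolding b1.sum b1.scaleR by simp
 also have "... = (\<Sum>i\<in>Basis. (v *. i) * nderiv [i, \<Sum>j\<in>Basis. (w *. j) *# j] f x)" by (simp only: euclidean_representation)
 also have "... = (\<Sum>i\<in>Basis. (v *. i) * (\<Sum>j\<in>Basis. (w *. j) * nderiv [i, j] f x))" unfolding b2.sum b2.scaleR by simp
 finally show ?thesis by (simp only: sum_distrib_left mult.assoc)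
 qed
 have bd: "\<bar>\<Sum>i\<in>Basis. \<Sum>j\<in>Basis. (v *. i) * (w *. j) * c i j\<bar> <= (\<Sum>i\<in>Basis. \<Sum>j\<in>Basis. C i j) * (norm v * norm w)"
 if c: "!!i j. i \<in> Basis ==> j \<in> Basis ==> \<bar>c i j\<bar> <= C i j" for v w :: R3 and c C :: "R3 => R3 => real"
 unfolding sum_distrib_right
 proof (intro order_trans[OF sum_abs] sum_mono)
 fix i j :: R3 assume ij: "i \<in> Basis" "j \<in> Basis"
 have "\<bar>(v *. i) * (w *. j) * c i j\<bar> = (\<bar>v *. i\<bar> * \<bar>w *. j\<bar>) * \<bar>c i j\<bar>" by (simp add: abs_mult)
 also have "... <= (norm v * norm w) * C i j" using ij c[OF ij] by (intro mult_mono Basis_le_norm) auto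
 finally show "\<bar>(v *. i) * (w *. j) * c i j\<bar> <= C i j * (norm v * norm w)" by (simp add: mult.commute)
 qed
 define B where "B = (\<Sum>i\<in>(Basis::R3 set). \<Sum>j\<in>(Basis::R3 set). \<bar>nderiv [i, j] f p0\<bar> + k)"
 show ?thesis
 proof (rule that[of r B])
 show "r > 0" by (rule r)
 show "B >= 0" unfolding B_def using k by (intro sum_nonneg) auto
 show "ball p0 r <= U" using r(2) by (auto simp: dist_commute)
 fix x v w :: R3 assume x: "x \<in> ball p0 r"
 note rx = r(2)[of x, unfolded dist_commute[of x p0]]
 show "\<bar>nderiv [v, w] f x\<bar> <= B * (norm v * norm w)"
 proof -
 have "x \<in> U" using rx x by simp
 show ?thesis unfolding ex[OF \<open>x \<in> U\<close>, of v w] B_def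
 proof (rule bd)
 fix i j :: R3 assume "i \<in> Basis" "j \<in> Basis"
 then have "\<bar>nderiv [i, j] f x - nderiv [i, j] f p0\<bar> < k" using rx x by (simp add: dist_real_def del: nderiv.simps)
 then show "\<bar>nderiv [i, j] f x\<bar> <= \<bar>nderiv [i, j] f p0\<bar> + k" by linarith
 qed
 qed
 next
 fix x y v :: R3 assume x: "x \<in> ball p0 r" and y: "y \<in> ball p0 r"
 have rx: "x \<in> U" "!!i j. i \<in> Basis ==> j \<in> Basis ==> \<bar>nderiv [i, j] f x - nderiv [i, j] f p0\<bar> < k"
 using r(2)[of x] x by (simp_all add: dist_real_def dist_commute[of x p0] del: nderiv.simps)
 have ry: "y \<in> U" "!!i j. i \<in> Basis ==> j \<in> Basis ==> \<bar>nderiv [i, j] f y - nderiv [i, j] f p0\<bar> < k"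
 using r(2)[of y] y by (simp_all add: dist_real_def dist_commute[of y p0] del: nderiv.simps)
 have "nderiv [v, v] f x - nderiv [v, v] f y = (\<Sum>i\<in>Basis. \<Sum>j\<in>Basis. (v *. i) * (v *. j) * (nderiv [i, j] f x - nderiv [i, j] f y))"
 unfolding ex[OF rx(1), of v v] ex[OF ry(1), of v v] by (simp only: sum_subtractf right_diff_distrib)
 also have "\<bar>...\<bar> <= (\<Sum>i\<in>(Basis::R3 set). \<Sum>j\<in>(Basis::R3 set). 2 * k) * (norm v * norm v)"
 proof (rule bd)
 fix i j :: R3 assume ij: "i \<in> Basis" "j \<in> Basis"
 show "\<bar>nderiv [i, j] f x - nderiv [i, j] f y\<bar> <= 2 * k" using rx(2)[OF ij] ry(2)[OF ij] by linarith
 qed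
 also have "(\<Sum>i\<in>(Basis::R3 set). \<Sum>j\<in>(Basis::R3 set). 2 * k) = m * (m * (2 * k))" by (simp only: sum_constant m_def)
 also have "m * (m * (2 * k)) = ka" using m by (simp add: k_def power2_eq_square)
 finally show "\<bar>nderiv [v, v] f x - nderiv [v, v] f y\<bar> <= ka * (norm v)\<^sup>2" by (simp only: power2_eq_square)
 qed
qed

section \<open>Local comparison of the domain with a saddle\<close>

lemma taylor_second:
 fixes f :: "'a::euclidean_space => real"
 assumes f: "smooth_on U f" and B: "ball c r <= U" and x: "p \<in> ball c r" "p + h \<in> ball c r"
 obtains xix where "xix \<in> ball c r" "f (p + h) = f p + gradient f p *. h + nderiv [h, h] f xix / 2"
proof -
 have seg: "p + t *# h \<in> ball c r" if "0 <= t" "t <= 1" for t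
 proof -
 have "(1 - t) *# p + t *# (p + h) \<in> ball c r" using convex_ball[of c r] x that unfolding convex_def by auto
 then show ?thesis by (simp add: algebra_simps)
 qed
 define df where "df m t = nderiv (replicate m h) f (p + t *# h)" for m t
 have "EX t. 0 < t & t < 1 & df 0 1 = (\<Sum>m<2. df m 0 / fact m * 1 ^ m) + df 2 t / fact 2 * 1 ^ 2"
 proof (rule Maclaurin)
 show "ALL m t. m < 2 & 0 <= t & t <= 1 --> (df m has_real_derivative df (Suc m) t) (at t)"
 unfolding df_def[abs_def] replicate_Suc using nderiv_line[OF f] seg B by blast
 qed simp_all
 then obtain t where t: "0 < t" "t < 1" "df 0 1 = (\<Sum>m<2. df m 0 / fact m * 1 ^ m) + df 2 t / fact 2 * 1 ^ 2" by blast
 have pU: "p \<in> U" using x B by blast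
 show ?thesis
 by (rule that[OF seg[of t]]) (use t gradient_smooth[OF f pU, of h] in \<open>simp_all add: df_def numeral_2_eq_2 del: nderiv.simps(2)\<close>)
qed

lemma frontier_of_nearest:
 fixes x p :: "'a::real_normed_vector"
 assumes p: "p \<in> K" "!!z. z \<in> K ==> dist x p <= dist x z" and x: "x \<notin> interior K"
 shows "p \<in> frontier K"
proof (rule ccontr)
 assume "p \<notin> frontier K"
 then have "p \<in> interior K" using p(1) closure_subset unfolding frontier_def by blast
 then obtain d where d: "d > 0" "ball p d <= K" unfolding mem_interior by blast
 have px: "p ~= x" using \<open>p \<in> interior K\<close> x by blast
 then have n: "dist x p > 0" by simp
 define t where "t = min 1 (d / (2 * dist x p))"
 have t: "0 < t" "t <= 1" using d n by (auto simp: t_def)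
 have "t <= d / (2 * dist x p)" by (simp add: t_def)
 then have td: "t * dist x p < d" using d n by (simp add: field_simps)
 let ?z = "p + t *# (x - p)"
 have "dist p ?z = t * dist x p" using t by (simp add: dist_norm)
 then have "?z \<in> K" using d td by auto
 then have "dist x p <= dist x ?z" by (rule p)
 also have "x - ?z = (1 - t) *# (x - p)" by (simp add: algebra_simps)
 then have "dist x ?z = (1 - t) * dist x p" using t by (simp add: dist_norm)
 finally show False using mult_pos_pos[OF t(1) n] by (simp add: algebra_simps)
qed

text \<open>\<open>mux1\<close> and \<open>mux2\<close> stand for the principal curvatures, and
  \<open>thx * |Z|\<close> for the Taylor terms that contain \<open>Z\<close>. According to the sign
  of \<open>Z\<close>, its total coefficient is \<open>1 - thx\<close> or \<open>1 + thx\<close>;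
  the margin \<open>2 * u\<close> in both curvature conditions covers either case.\<close>

lemma quadratic_barrier_gap:
 fixes X Y Z al bex mux1 mux2 u thx :: real
 assumes Z: "(al * X\<^sup>2 - bex * Y\<^sup>2) / 2 < Z" and thx: "0 <= thx" "thx < 1" "thx * al <= u" "thx * bex <= u" and ab: "0 < al" "0 < bex"
 and m: "0 <= al + mux1 - 2 * u" "0 <= mux2 - bex - 2 * u" and u: "0 <= u"
 shows "0 < Z - thx * \<bar>Z\<bar> + ((mux1 - u) * X\<^sup>2 + (mux2 - u) * Y\<^sup>2) / 2"
proof -
 define m where "m = (if Z >= 0 then 1 - thx else 1 + thx)"
 have m0: "m > 0" "Z - thx * \<bar>Z\<bar> = m * Z" using thx by (auto simp: m_def algebra_simps)
 have "m * al >= al - u" "m * bex <= bex + u" using thx ab u mult_nonneg_nonneg[of thx al] mult_nonneg_nonneg[of thx bex] by (auto simp: m_def algebra_simps)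
 then have c: "0 <= m * al + mux1 - u" "0 <= mux2 - u - m * bex" using m by linarith+
 have lt: "a + c = d / 2 ==> 0 <= d ==> a < b ==> 0 < b + c" for a b c d :: real by linarith
 have i1: "m * ((al * X\<^sup>2 - bex * Y\<^sup>2) / 2) < m * Z" using Z m0 by simp
 have i2: "m * ((al * X\<^sup>2 - bex * Y\<^sup>2) / 2) + ((mux1 - u) * X\<^sup>2 + (mux2 - u) * Y\<^sup>2) / 2 = ((m * al + mux1 - u) * X\<^sup>2 + (mux2 - u - m * bex) * Y\<^sup>2) / 2"
 by (simp add: field_simps)
 have i3: "0 <= (m * al + mux1 - u) * X\<^sup>2 + (mux2 - u - m * bex) * Y\<^sup>2" using c by simp
 show ?thesis unfolding m0(2) by (rule lt[OF i2 i3 i1])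
qed

text \<open>Pure arithmetic, separated from its use so that the second derivatives appear as plain
  variables. Here \<open>w\<close> bounds the remaining terms containing \<open>Z\<close>, and
  \<open>uv\<close> the variation of the Hessian.\<close>

lemma taylor_lower_bound:
 fixes kk dv z1 z2 uu kx uv mz w :: real
 assumes "kk = dv + z1 + z2" "- (2 * w) <= z1" "- w <= z2" "kk - uu <= kx" "uu <= uv"
 shows "mz + (dv - 3 * w - uv) / 2 <= 0 + mz + kx / 2"
proof -
 have "dv - 3 * w - uv <= kx" using assms by linarith
 then show ?thesis by simp
qed

lemma taylor_positive:
 fixes a1 a2 b1 b2 w v x :: real
 assumes "a1 + a2 / 2 <= b1 + b2 / 2" "0 < a1 + (a2 - w - v) / 2" "b1 + (b2 - w - v) / 2 <= x"
 shows "0 < x"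
 using assms unfolding diff_divide_distrib by linarith

text \<open>Near a boundary point the domain lies below each of the finitely many saddles
 \<open>Z = (\<alpha> X\<^sup>2 - \<beta> Y\<^sup>2) / 2\<close>, \<open>\<alpha> = (j + 2) u\<close>, \<open>\<beta> = (j + 3) u\<close>, in suitable normal
 coordinates; positivity of the mean curvature leaves room for \<open>\<alpha> < \<beta>\<close>.\<close>
lemma below_saddle:
 assumes K: "smooth_domain K" and p0: "p0 \<in> frontier K" and h: "h > 0" "!!x. x \<in> frontier K ==> mean_curv K x > h"
 obtains r u N r0 where "r > 0" "u > 0" "r0 > 0"
 "!!p. p \<in> frontier K ==> p \<in> ball p0 r ==> EX a b e. \<exists>j\<le>(N::nat). orthoframe a b e &
 (ALL X Y Z. X\<^sup>2 + Y\<^sup>2 + Z\<^sup>2 <= r0\<^sup>2 --> ((real j + 2) * u * X\<^sup>2 - (real j + 3) * u * Y\<^sup>2) / 2 < Z --> p + X *# a + Y *# b + Z *# e \<notin> K) &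
 (ALL y. (\<forall>z\<in>K. dist y p <= dist y z) --> y = p + dist y p *# e)"
proof -
 obtain f U where U: "p0 \<in> U" "local_def K U f" using K p0 unfolding smooth_domain_def defining_function_iff by blast
 note L = local_defD[OF U(2)]
 define n0 where "n0 = norm (gradient f p0) / 2"
 have n0: "n0 > 0" using L(4)[OF U(1)] by (simp add: n0_def)
 \<comment> \<open>The excess \<open>16 * u\<close> of the mean curvature has to pay for a gap of
   \<open>8 * u\<close> between the two principal curvatures, for rounding to multiples of
   \<open>u\<close>, and for the Taylor error.\<close>
 define u where "u = h / 16"
 have u: "u > 0" using h by (simp add: u_def)
 have un: "u * n0 > 0" using u n0 by simp
 obtain r1 B where r1: "r1 > 0" "B >= 0" "ball p0 r1 <= U" "!!x v w. x \<in> ball p0 r1 ==> \<bar>nderiv [v, w] f x\<bar> <= B * (norm v * norm w)"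
 "!!x y v. x \<in> ball p0 r1 ==> y \<in> ball p0 r1 ==> \<bar>nderiv [v, v] f x - nderiv [v, v] f y\<bar> <= (u * n0) * (norm v)\<^sup>2"
 by (rule second_derivative_local_bounds[OF L(1,2) U(1) un]) (rule that)
 have "isCont (%x. norm (gradient f x)) p0" by (intro continuous_intros continuous_gradient[OF L(1,2) U(1)])
 then have "((%x. norm (gradient f x)) \<longlongrightarrow> norm (gradient f p0)) (nhds p0)"
 unfolding isCont_def using tendsto_at_iff_tendsto_nhds[of "%x. norm (gradient f x)" p0] by simp
 moreover have "n0 < norm (gradient f p0)" using n0 by (simp add: n0_def)
 ultimately have "\<forall>\<^sub>F x in nhds p0. n0 < norm (gradient f x)" by (rule order_tendstoD(1))
 then obtain r2 where r2: "r2 > 0" "!!x. dist x p0 < r2 ==> n0 < norm (gradient f x)" unfolding eventually_nhds_metric by blast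
 define r where "r = min (r1 / 2) r2"
 define La where "La = B / n0"
 \<comment> \<open>\<open>La\<close> bounds how negative a principal curvature can be at all
   boundary points near \<open>p0\<close>; hence finitely many saddle shapes suffice for all of
   them.\<close>
 define N where "N = nat \<lceil>La / u\<rceil>"
 define c0 where "c0 = 3 * B / (2 * n0) + u / 2"
 have La: "La >= 0" and c0: "c0 > 0" using r1 n0 u by (simp_all add: La_def c0_def add_nonneg_pos)
 define r0 where "r0 = min (r1 / 4) (min (1/2) (u / (La + 8 * u)) / c0)"
 have r0: "r0 > 0" using r1 c0 u La by (simp add: r0_def add_nonneg_pos)
 have r0c: "c0 * r0 <= 1/2" "c0 * r0 * (La + 8 * u) <= u" "r0 <= r1 / 4"
 proof -
 have "r0 <= min (1/2) (u / (La + 8 * u)) / c0" by (simp add: r0_def)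
 then have q: "c0 * r0 <= min (1/2) (u / (La + 8 * u))" using c0 by (simp add: field_simps)
 then show "c0 * r0 <= 1/2" by simp
 have "c0 * r0 <= u / (La + 8 * u)" using q by simp
 moreover have "La + 8 * u > 0" using La u by simp
 ultimately show "c0 * r0 * (La + 8 * u) <= u" by (simp add: pos_le_divide_eq)
 show "r0 <= r1 / 4" unfolding r0_def by (rule min.cobounded1)
 qed
 show ?thesis
 proof (rule that[of r u r0 N])
 show "r > 0" "u > 0" "r0 > 0" using r1 r2 u r0 by (simp_all add: r_def)
 fix p assume p: "p \<in> frontier K" "p \<in> ball p0 r"
 have pb: "p \<in> ball p0 r1" "dist p p0 < r1 / 2" "dist p p0 < r2" using p(2) r1(1) by (auto simp: r_def dist_commute)
 have pU: "p \<in> U" using pb r1 by blast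
 have fp: "f p = 0" using frontier_local_def[OF U(2) pU] p(1) by simp
 define m where "m = norm (gradient f p)"
 have m: "m > n0" "m > 0" using r2(2)[OF pb(3)] n0 unfolding m_def by linarith+
 obtain e1 e2 where fr0: "orthoframe e1 e2 (sgn (gradient f p))" "gradient f p = norm (gradient f p) *# sgn (gradient f p)"
 by (rule orthoframe_of[OF L(4)[OF pU]])
 define e where "e = sgn (gradient f p)"
 have ge: "gradient f p = m *# e" using fr0(2) by (simp add: m_def e_def)
 obtain a b where fr: "orthoframe a b e" "nderiv [a, b] f p = 0" "nderiv [a, a] f p <= nderiv [b, b] f p"
 by (rule eigenframe[of "%v w. nderiv [v, w] f p", OF linear_nderiv2[OF L(1,2) pU] linear_nderiv[OF L(2) pU] nderiv_commute[OF L(1,2) pU] fr0(1)[folded e_def]])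
 note A = orthoframeD[OF fr(1)]
 define mux1 mux2 where "mux1 = nderiv [a, a] f p / m" and "mux2 = nderiv [b, b] f p / m"
 have mu: "mux1 <= mux2" unfolding mux1_def mux2_def using fr(3) m by (intro divide_right_mono) auto
 have "mean_curv K p = mux1 + mux2"
 unfolding mean_curv_frame[OF U(2) pU fp fr(1) ge] mux1_def mux2_def m_def by (rule add_divide_distrib)
 then have mu2: "mux1 + mux2 > 16 * u" using h(2)[OF p(1)] by (simp add: u_def)
 have mu1: "- mux1 <= La"
 proof -
 have "- nderiv [a, a] f p <= B" using r1(4)[OF pb(1), of a a] A by (simp del: nderiv.simps)
 then have "- mux1 <= B / m" unfolding mux1_def minus_divide_left using m by (intro divide_right_mono) auto
 also have "... <= B / n0" using r1(2) m n0 by (intro divide_left_mono) auto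
 finally show ?thesis by (simp add: La_def)
 qed
 \<comment> \<open>The amount by which the smaller curvature is negative. Since the sum of the two
   exceeds \<open>16 * u\<close>, the larger one is at least \<open>M + 8 * u\<close> whether
   \<open>M\<close> is 0 or not.\<close>
 define M where "M = max (- mux1) 0"
 have M: "0 <= M" "M <= La" "- mux1 <= M" "M + 8 * u <= mux2" using mu1 La mu mu2 u by (auto simp: M_def)
 \<comment> \<open>Rounding \<open>M / u\<close> up gives \<open>al >= M + 2 * u\<close> and
   \<open>bex <= M + 4 * u\<close>. So \<open>al\<close> exceeds \<open>- mux1\<close> by at least
   \<open>2 * u\<close>, and \<open>bex\<close> falls short of \<open>mux2\<close> by at least
   \<open>4 * u\<close>.\<close>
 define j where "j = nat \<lceil>M / u\<rceil>"
 have j: "M / u <= real j" "real j < M / u + 1" using M(1) u by (simp_all add: j_def) (linarith+)?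
 have jN: "j <= N" unfolding j_def N_def using M u by (intro nat_mono ceiling_mono divide_right_mono) auto
 have ju: "M <= real j * u" "real j * u < M + u" using j u by (simp_all add: field_simps)
 define al bex where "al = (real j + 2) * u" and "bex = (real j + 3) * u"
 have al: "al >= M + 2 * u" "al <= La + 8 * u" "al > 0" and bex: "bex <= M + 4 * u" "bex <= La + 8 * u" "bex > 0"
 using ju M u by (simp_all add: al_def bex_def algebra_simps) (linarith+)?
 have outside: "p + X *# a + Y *# b + Z *# e \<notin> K" if sz: "X\<^sup>2 + Y\<^sup>2 + Z\<^sup>2 <= r0\<^sup>2" and Z: "(al * X\<^sup>2 - bex * Y\<^sup>2) / 2 < Z" for X Y Z
 proof -
 define v k where "v = X *# a + Y *# b" and "k = v + Z *# e"
 have k2: "(norm k)\<^sup>2 = X\<^sup>2 + Y\<^sup>2 + Z\<^sup>2" and v2: "(norm v)\<^sup>2 = X\<^sup>2 + Y\<^sup>2"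
 unfolding power2_norm_eq_inner k_def v_def using A by (simp_all add: inner_add_left inner_add_right power2_eq_square)
 have kr: "norm k <= r0" using sz r0 unfolding k2[symmetric] by (rule_tac power2_le_imp_le) auto
 have vk: "norm v <= norm k" by (rule power2_le_imp_le) (simp_all add: k2 v2)
 have zk: "\<bar>Z\<bar> <= norm k" by (rule power2_le_imp_le) (simp_all add: k2)
 have "dist (p + k) p0 <= norm k + dist p p0" using norm_triangle_ineq[of k "p - p0"] by (simp add: dist_norm algebra_simps)
 then have kb: "p + k \<in> ball p0 r1" using kr r0c(3) pb(2) r1(1) by (simp add: dist_commute)
 obtain xix where xix: "xix \<in> ball p0 r1" "f (p + k) = f p + gradient f p *. k + nderiv [k, k] f xix / 2"
 by (rule taylor_second[OF L(2) r1(3) pb(1) kb])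
 have gk: "gradient f p *. k = m * Z" unfolding ge k_def v_def using A by (simp add: inner_add_right)
 interpret b1: bounded_linear "%y. nderiv [y, z] f p" for z by (rule linear_nderiv[OF L(2) pU])
 interpret b2: bounded_linear "%y. nderiv [z, y] f p" for z by (rule linear_nderiv2[OF L(1,2) pU])
 have ba: "nderiv [b, a] f p = 0" using fr(2) nderiv_commute[OF L(1,2) pU, of b a] by (simp only:)
 have Dv: "nderiv [v, v] f p = m * (mux1 * X\<^sup>2 + mux2 * Y\<^sup>2)"
 proof -
 have "nderiv [v, v] f p = X * (X * nderiv [a, a] f p) + Y * (Y * nderiv [b, b] f p)"
 unfolding v_def b1.add b2.add b1.scaleR b2.scaleR fr(2) ba by simp
 moreover have "nderiv [a, a] f p = m * mux1" "nderiv [b, b] f p = m * mux2" unfolding mux1_def mux2_def using m by simp_all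
 ultimately have "nderiv [v, v] f p = X * (X * (m * mux1)) + Y * (Y * (m * mux2))" by (simp only:)
 also have "... = m * (mux1 * X\<^sup>2 + mux2 * Y\<^sup>2)" by (simp add: power2_eq_square algebra_simps)
 finally show ?thesis .
 qed
 have Dk: "nderiv [k, k] f p = nderiv [v, v] f p + 2 * Z * nderiv [v, e] f p + Z\<^sup>2 * nderiv [e, e] f p"
 proof -
 have "nderiv [k, k] f p = nderiv [v, v] f p + Z * nderiv [v, e] f p + (Z * nderiv [e, v] f p + Z * (Z * nderiv [e, e] f p))"
 unfolding k_def b1.add b2.add b1.scaleR b2.scaleR real_scaleR_def by (simp only: distrib_left add.assoc add.left_commute)
 moreover have "nderiv [e, v] f p = nderiv [v, e] f p" by (rule nderiv_commute[OF L(1,2) pU])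
 moreover have "dd + Z * ve + (Z * ve + Z * (Z * ee)) = dd + 2 * Z * ve + Z\<^sup>2 * ee" for dd ve ee by (simp add: power2_eq_square)
 ultimately show ?thesis by (simp only:)
 qed
 have lowb: "\<bar>x\<bar> <= y ==> y = z ==> - z <= x" for x y z :: real by linarith
 have "\<bar>2 * Z * nderiv [v, e] f p\<bar> = 2 * \<bar>Z\<bar> * \<bar>nderiv [v, e] f p\<bar>" by (simp add: abs_mult del: nderiv.simps)
 also have "... <= 2 * \<bar>Z\<bar> * (B * norm k)"
 using r1(4)[OF pb(1), of v e] mult_left_mono[OF vk r1(2)] A by (intro mult_left_mono) (simp_all del: nderiv.simps)
 finally have "\<bar>2 * Z * nderiv [v, e] f p\<bar> <= 2 * \<bar>Z\<bar> * (B * norm k)" .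
 then have t1: "- (2 * (B * \<bar>Z\<bar> * norm k)) <= 2 * Z * nderiv [v, e] f p" by (rule lowb) (simp only: mult.assoc mult.left_commute mult.commute)
 have "\<bar>Z\<^sup>2 * nderiv [e, e] f p\<bar> = \<bar>Z\<bar> * (\<bar>Z\<bar> * \<bar>nderiv [e, e] f p\<bar>)" by (simp add: abs_mult power2_eq_square del: nderiv.simps)
 also have "... <= \<bar>Z\<bar> * (norm k * B)"
 using r1(4)[OF pb(1), of e e] zk A by (intro mult_left_mono mult_mono) (simp_all del: nderiv.simps)
 finally have "\<bar>Z\<^sup>2 * nderiv [e, e] f p\<bar> <= \<bar>Z\<bar> * (norm k * B)" .
 then have t2: "- (B * \<bar>Z\<bar> * norm k) <= Z\<^sup>2 * nderiv [e, e] f p" by (rule lowb) (simp only: mult.assoc mult.left_commute mult.commute)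
 have t3: "nderiv [k, k] f xix >= nderiv [k, k] f p - u * n0 * (norm k)\<^sup>2" using abs_le_D2[OF r1(5)[OF xix(1) pb(1), of k]] by linarith
 have "Z\<^sup>2 <= \<bar>Z\<bar> * norm k" using mult_left_mono[OF zk abs_ge_zero[of Z]] by (simp add: power2_eq_square)
 then have "u * n0 * (norm k)\<^sup>2 <= u * n0 * (X\<^sup>2 + Y\<^sup>2 + \<bar>Z\<bar> * norm k)" unfolding k2 using un by (intro mult_left_mono) auto
 then have F1: "f (p + k) >= m * Z + (m * (mux1 * X\<^sup>2 + mux2 * Y\<^sup>2) - 3 * (B * \<bar>Z\<bar> * norm k) - u * n0 * (X\<^sup>2 + Y\<^sup>2 + \<bar>Z\<bar> * norm k)) / 2"
 unfolding xix(2) fp gk by (intro taylor_lower_bound[OF Dk[unfolded Dv] t1 t2 t3])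
 \<comment> \<open>All Taylor terms containing \<open>Z\<close> are at most a multiple of
   \<open>|Z|\<close> times the length of \<open>k\<close>. By the choice of \<open>r0\<close> this
   stays below 1, and below \<open>u\<close> after multiplication by \<open>al\<close> or
   \<open>bex\<close>.\<close>
 define thx where "thx = c0 * norm k"
 have thx: "0 <= thx" "thx < 1" "thx * (La + 8 * u) <= u"
 proof -
 have q: "thx <= c0 * r0" unfolding thx_def using kr c0 by (intro mult_left_mono) auto
 show "0 <= thx" using c0 by (simp add: thx_def)
 show "thx < 1" using q r0c(1) by linarith
 show "thx * (La + 8 * u) <= u" by (rule order_trans[OF mult_right_mono[OF q] r0c(2)]) (use La u in simp)
 qed
 have F2: "n0 * (Z - thx * \<bar>Z\<bar> + ((mux1 - u) * X\<^sup>2 + (mux2 - u) * Y\<^sup>2) / 2) = n0 * Z + (n0 * (mux1 * X\<^sup>2 + mux2 * Y\<^sup>2) - 3 * (B * \<bar>Z\<bar> * norm k) - u * n0 * (X\<^sup>2 + Y\<^sup>2 + \<bar>Z\<bar> * norm k)) / 2"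
 unfolding thx_def c0_def using n0 by (simp add: field_simps)
 have th: "thx * al <= u" "thx * bex <= u"
 using mult_left_mono[OF al(2) thx(1)] mult_left_mono[OF bex(2) thx(1)] thx(3) by linarith+
 have c1: "0 <= al + mux1 - 2 * u" "0 <= mux2 - bex - 2 * u" using al bex M u by linarith+
 have gap: "0 < Z - thx * \<bar>Z\<bar> + ((mux1 - u) * X\<^sup>2 + (mux2 - u) * Y\<^sup>2) / 2"
 by (rule quadratic_barrier_gap[OF Z thx(1,2) th al(3) bex(3) c1 less_imp_le[OF u]])
 have "0 <= thx * \<bar>Z\<bar> + u * (X\<^sup>2 + Y\<^sup>2) / 2" using thx u by simp
 then have gap2: "0 < Z + (mux1 * X\<^sup>2 + mux2 * Y\<^sup>2) / 2" using gap by (simp add: field_simps)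
 then have "n0 * (Z + (mux1 * X\<^sup>2 + mux2 * Y\<^sup>2) / 2) <= m * (Z + (mux1 * X\<^sup>2 + mux2 * Y\<^sup>2) / 2)" using m by (intro mult_right_mono) auto
 then have F3: "n0 * Z + n0 * (mux1 * X\<^sup>2 + mux2 * Y\<^sup>2) / 2 <= m * Z + m * (mux1 * X\<^sup>2 + mux2 * Y\<^sup>2) / 2"
 unfolding distrib_left[of n0 Z] distrib_left[of m Z] times_divide_eq_right .
 have F4: "0 < n0 * (Z - thx * \<bar>Z\<bar> + ((mux1 - u) * X\<^sup>2 + (mux2 - u) * Y\<^sup>2) / 2)" using gap n0 by simp
 have "0 < f (p + k)" by (rule taylor_positive[OF F3 F4[unfolded F2] F1])
 moreover have "p + k \<in> U" using kb r1(3) by blast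
 ultimately have "p + k \<notin> K" using L(3) by (simp add: not_le)
 then show ?thesis by (simp add: k_def v_def add.assoc)
 qed
 have normal: "y = p + dist y p *# e" if near: "\<forall>z\<in>K. dist y p <= dist y z" for y
 proof (cases "y = p")
 case False
 define d where "d = dist y p"
 have d: "d > 0" using False by (simp add: d_def)
 define w where "w = (1 / d) *# (y - p)"
 have w: "y - p = d *# w" "norm w = 1" using d by (simp_all add: w_def d_def dist_norm)
 obtain m' where m': "m' > 0" "gradient f p = m' *# w"
 by (rule nearest_normal[OF U(2) pU fp w(1) d w(2)]) (use near in \<open>auto simp: d_def dist_commute\<close>)
 have "m = m'" using m' w(2) by (simp add: m_def)
 then have "e = w" using ge m' m by simp
 then show ?thesis using w(1) by (simp add: d_def algebra_simps)
 qed simp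
 show "EX a b e. \<exists>j\<le>N. orthoframe a b e &
 (ALL X Y Z. X\<^sup>2 + Y\<^sup>2 + Z\<^sup>2 <= r0\<^sup>2 --> ((real j + 2) * u * X\<^sup>2 - (real j + 3) * u * Y\<^sup>2) / 2 < Z --> p + X *# a + Y *# b + Z *# e \<notin> K) &
 (ALL y. (\<forall>z\<in>K. dist y p <= dist y z) --> y = p + dist y p *# e)"
 using fr(1) jN outside normal unfolding al_def bex_def by (intro exI[of _ a] exI[of _ b] exI[of _ e] exI[of _ j]) simp
 qed
qed

text \<open>The times and heights from \<open>torus_barrier\<close> depend on the shape of the
  saddle and on \<open>r0\<close>, but not on the boundary point or the frame. As only finitely many
  shapes occur near \<open>p0\<close>, their minima serve all boundary points there.\<close>

lemma initial_instant_local: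
 assumes K: "smooth_domain K" and h: "h > 0" "!!x. x \<in> frontier K ==> mean_curv K x > h"
 and L: "avoids_smooth_flows L" "closed (L 0)" "L 0 = K" and p0: "p0 \<in> frontier K"
 obtains r s1 si1 where "r > 0" "s1 > 0" "si1 > 0"
 "!!p y s. p \<in> frontier K ==> p \<in> ball p0 r ==> (!!z. z \<in> K ==> dist y p <= dist y z) ==> dist y p <= si1 ==> 0 < s ==> s <= s1 ==> y \<notin> L s"
proof (rule below_saddle[OF K p0 h])
 fix r u and N :: nat and r0 assume r: "r > 0" "u > 0" "r0 > 0"
 "!!p. p \<in> frontier K ==> p \<in> ball p0 r ==> EX a b e. \<exists>j\<le>N. orthoframe a b e &
 (ALL X Y Z. X\<^sup>2 + Y\<^sup>2 + Z\<^sup>2 <= r0\<^sup>2 --> ((real j + 2) * u * X\<^sup>2 - (real j + 3) * u * Y\<^sup>2) / 2 < Z --> p + X *# a + Y *# b + Z *# e \<notin> K) &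
 (ALL y. (\<forall>z\<in>K. dist y p <= dist y z) --> y = p + dist y p *# e)"
 define bar where "bar j s1 si1 \<longleftrightarrow> 0 < s1 & 0 < si1 & (ALL p a b e s et. orthoframe a b e -->
 (ALL X Y Z. X\<^sup>2 + Y\<^sup>2 + Z\<^sup>2 <= r0\<^sup>2 --> ((real j + 2) * u * X\<^sup>2 - (real j + 3) * u * Y\<^sup>2) / 2 < Z --> p + X *# a + Y *# b + Z *# e \<notin> K) -->
 0 < s --> s <= s1 --> 0 <= et --> et <= si1 --> p + et *# e \<notin> L s)" for j :: nat and s1 si1
 have "EX s1 si1. bar j s1 si1" for j
 proof (rule torus_barrier[of "(real j + 2) * u" "(real j + 3) * u" r0])
 show "0 < (real j + 2) * u" "(real j + 2) * u < (real j + 3) * u" "0 < r0" using r(2,3) by simp_all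
 fix s1 si1 assume sb: "0 < s1" "0 < si1"
 "!!L p a b e s et. avoids_smooth_flows L ==> closed (L 0) ==> orthoframe a b e ==>
 (!!X Y Z. X\<^sup>2 + Y\<^sup>2 + Z\<^sup>2 <= r0\<^sup>2 ==> ((real j + 2) * u * X\<^sup>2 - (real j + 3) * u * Y\<^sup>2) / 2 < Z ==> p + X *# a + Y *# b + Z *# e \<notin> L 0) ==>
 0 < s ==> s <= s1 ==> 0 <= et ==> et <= si1 ==> p + et *# e \<notin> L s"
 have "bar j s1 si1" unfolding bar_def
 by (intro conjI allI impI sb(1,2)) (rule sb(3)[OF L(1,2)]; (assumption | (unfold L(3), blast)))
 then show "EX s1 si1. bar j s1 si1" by blast
 qed
 then obtain S G where SG: "!!j. bar j (S j) (G j)" by metis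
 have pos: "0 < S j" "0 < G j" for j using SG[of j] by (simp_all add: bar_def)
 show ?thesis
 proof (rule that[of r "Min (S ` {..N})" "Min (G ` {..N})"])
 show "r > 0" "Min (S ` {..N}) > 0" "Min (G ` {..N}) > 0" using r pos by auto
 fix p y s assume p: "p \<in> frontier K" "p \<in> ball p0 r" and near: "!!z. z \<in> K ==> dist y p <= dist y z"
 and dy: "dist y p <= Min (G ` {..N})" and s: "0 < s" "s <= Min (S ` {..N})"
 obtain a b e j where j: "j <= N" "orthoframe a b e"
 "ALL X Y Z. X\<^sup>2 + Y\<^sup>2 + Z\<^sup>2 <= r0\<^sup>2 --> ((real j + 2) * u * X\<^sup>2 - (real j + 3) * u * Y\<^sup>2) / 2 < Z --> p + X *# a + Y *# b + Z *# e \<notin> K"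
 "ALL y. (\<forall>z\<in>K. dist y p <= dist y z) --> y = p + dist y p *# e"
 using r(4)[OF p] by (elim exE conjE)
 have "s <= S j" "dist y p <= G j" using s dy j(1) by auto
 then have "p + dist y p *# e \<notin> L s" using SG[of j, unfolded bar_def, THEN conjunct2, THEN conjunct2, rule_format, OF j(2) j(3)[rule_format] s(1)] by simp
 then show "y \<notin> L s" using j(4)[rule_format, OF near] by simp
 qed
qed

text \<open>A weak set flow starting from a mean convex domain moves strictly inwards at once.\<close>
lemma initial_instant:
 assumes K: "smooth_domain K" "compact K" and h: "h > 0" "!!x. x \<in> frontier K ==> mean_curv K x > h"
 and L: "avoids_smooth_flows L" "closed (L 0)" "L 0 = K"
 obtains s0 where "s0 > 0" "!!s. 0 < s ==> s <= s0 ==> L s <= interior K"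
proof (cases "K = {}")
 case True
 \<comment> \<open>For an empty domain every ball is disjoint from \<open>L 0\<close>, so a
   sufficiently large one excludes any given point.\<close>
 have "y \<notin> L s" if "0 < s" for s y
 using avoids_no_jump[OF L(1), of 0 s "10 * sqrt s + 1" y y] that True L(3) by simp
 then show ?thesis using that[of 1] by auto
next
 case False
 have "EX w. fst w > 0 & fst (snd w) > 0 & snd (snd w) > 0 & (ALL p y s. p \<in> frontier K --> p \<in> ball p0 (fst w) --> (ALL z. z \<in> K --> dist y p <= dist y z) -->
 dist y p <= snd (snd w) --> 0 < s --> s <= fst (snd w) --> y \<notin> L s)" if p0F: "p0 \<in> frontier K" for p0
 proof (rule initial_instant_local[OF K(1) h L p0F])
 fix r s1 si1 assume q: "r > 0" "s1 > 0" "si1 > 0"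
 "!!p y s. p \<in> frontier K ==> p \<in> ball p0 r ==> (!!z. z \<in> K ==> dist y p <= dist y z) ==> dist y p <= si1 ==> 0 < s ==> s <= s1 ==> y \<notin> L s"
 show ?thesis by (rule exI[of _ "(r, s1, si1)"]) (use q in auto)
 qed
 then obtain w where w: "!!p0. p0 \<in> frontier K ==> fst (w p0) > 0 & fst (snd (w p0)) > 0 & snd (snd (w p0)) > 0 & (ALL p y s. p \<in> frontier K --> p \<in> ball p0 (fst (w p0)) --> (ALL z. z \<in> K --> dist y p <= dist y z) -->
 dist y p <= snd (snd (w p0)) --> 0 < s --> s <= fst (snd (w p0)) --> y \<notin> L s)" by metis
 have "compact (frontier K)" using K(2) by (rule compact_frontier)
 moreover have "frontier K <= (\<Union>p\<in>frontier K. ball p (fst (w p)))" using w by (auto intro!: bexI)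
 ultimately obtain F where F: "F <= frontier K" "finite F" "frontier K <= (\<Union>p\<in>F. ball p (fst (w p)))"
 by (rule compactE_image[of "frontier K" "frontier K" "%p. ball p (fst (w p))", OF _ open_ball])
 define si where "si = Min (insert 1 ((%p. snd (snd (w p))) ` F))"
 define s1 where "s1 = Min (insert 1 ((%p. fst (snd (w p))) ` F))"
 have fin: "finite (insert (1::real) ((%p. snd (snd (w p))) ` F))" "finite (insert (1::real) ((%p. fst (snd (w p))) ` F))" using F(2) by simp_all
 have pos: "si > 0" "s1 > 0" unfolding si_def s1_def using F(1,2) w by (auto simp: Min_gr_iff)
 have le: "si <= snd (snd (w p))" "s1 <= fst (snd (w p))" if "p \<in> F" for p
 unfolding si_def s1_def using that fin by (auto intro!: Min_le)
 \<comment> \<open>The square makes \<open>10 * sqrt s < si\<close>: spheres then exclude the points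
   farther than \<open>si\<close> from the domain, and the tori exclude the remaining ones outside
   the interior.\<close>
 define s0 where "s0 = min s1 ((si / 20)\<^sup>2)"
 show ?thesis
 proof (rule that[of s0])
 show "s0 > 0" using pos by (simp add: s0_def)
 fix s assume s: "0 < s" "s <= s0"
 have "sqrt s <= sqrt ((si / 20)\<^sup>2)" using s by (intro real_sqrt_le_mono) (simp add: s0_def)
 then have sq: "10 * sqrt s < si" using pos by simp
 show "L s <= interior K"
 proof (rule subsetI, rule ccontr)
 fix x assume x: "x \<in> L s" "x \<notin> interior K"
 have cK: "closed K" using K(2) by (rule compact_imp_closed)
 define p where "p = closest_point K x"
 have p: "p \<in> K" "!!z. z \<in> K ==> dist x p <= dist x z"
 unfolding p_def using closest_point_in_set[OF cK False] closest_point_le[OF cK] by blast+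
 have pf: "p \<in> frontier K" by (rule frontier_of_nearest[OF p x(2)])
 have dx: "dist x p <= si"
 proof (rule ccontr)
 assume "\<not> ?thesis"
 then have dj: "L 0 \<inter> ball x si = {}" using p(2) L(3) by fastforce
 have "dist x x <= si / 2" using pos(1) by simp
 then have "x \<notin> L (0 + s)" by (rule avoids_no_jump[OF L(1) order_refl less_imp_le[OF s(1)] sq dj])
 then show False using x(1) by simp
 qed
 obtain p0 where p0: "p0 \<in> F" "p \<in> ball p0 (fst (w p0))" using F(3) pf by blast
 have "p0 \<in> frontier K" using p0(1) F(1) by blast
 from w[OF this, THEN conjunct2, THEN conjunct2, THEN conjunct2, rule_format, OF pf p0(2) p(2) _ s(1)] le[OF p0(1)] dx s(2)
 have "x \<notin> L s" by (simp add: s0_def)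
 then show False using x(1) by simp
 qed
 qed
qed

text \<open>At a small time \<open>s\<close> compactness gives \<open>L s\<close> some depth
  \<open>d > 0\<close> of unknown size. Any depth is enough to make the flow delayed by
  \<open>s\<close> a barrier, so \<open>L tax\<close> lies in \<open>K (tax - s)\<close>, whose
  points have depth \<open>h * (tax - s)\<close> in \<open>K 0\<close>. Letting \<open>s\<close>
  tend to 0 leaves a bound independent of \<open>d\<close>.\<close>

lemma initial_depth:
 assumes K: "smooth_mcf {0..T} K" "0 < T" and bd: "bounded (\<Union>t\<in>{0..T}. K t)" and K0: "smooth_domain (K 0)" "compact (K 0)"
 and h: "h > 0" "!!t x. t \<in> {0..T} ==> x \<in> frontier (K t) ==> mean_curv (K t) x > h"
 and L: "avoids_smooth_flows L" "!!t. 0 <= t ==> closed (L t)" "L 0 = K 0" and tax: "0 < tax" "tax <= T" and x: "x \<in> L tax"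
 shows "ball x (h * tax) <= K 0"
proof -
 have h0: "!!x. x \<in> frontier (K 0) ==> mean_curv (K 0) x > h" using h(2)[of 0] K(2) by simp
 obtain s0 where s0: "s0 > 0" "!!s. 0 < s ==> s <= s0 ==> L s <= interior (K 0)"
 by (rule initial_instant[OF K0 h(1) h0 L(1) L(2)[OF order_refl] L(3)]; (assumption | rule that))
 have *: "ball x (h * (tax - s)) <= K 0" if s: "0 < s" "s <= s0" "s < tax" for s
 proof -
 have sub: "L s <= interior (K 0)" by (rule s0(2)[OF s(1,2)])
 have "bounded (L s)" using bounded_subset[OF compact_imp_bounded[OF K0(2)]] sub interior_subset by blast
 then have cL: "compact (L s)" using L(2)[of s] s(1) by (simp add: compact_eq_bounded_closed)
 have "L s \<inter> - interior (K 0) = {}" using sub by blast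
 from separate_compact_closed[OF cL _ this] obtain d where d: "d > 0" "!!x y. x \<in> L s ==> y \<in> - interior (K 0) ==> d <= dist x y"
 by (auto simp: closed_Compl)
 have dep: "ball y d <= K 0" if "y \<in> L (0 + s)" for y
 proof
 fix z assume "z \<in> ball y d"
 then have "z \<in> interior (K 0)" using d(2)[of y z] that by (auto simp: not_le[symmetric])
 then show "z \<in> K 0" using interior_subset by blast
 qed
 have t: "tax - s \<in> {0..T}" using s tax by simp
 have xs: "x \<in> L (tax - s + s)" using x by (simp only: diff_add_cancel)
 have "ball x d <= K (tax - s)"
 by (rule depth_preserved[OF L(1) K(1) bd _ d(1) dep t xs]) (use s in simp_all)
 then have "x \<in> K (tax - s)" using d(1) by auto
 have "ball x (h * (tax - s - 0)) <= K 0" by (rule mcf_depth[OF K(1) h(2) t \<open>x \<in> K (tax - s)\<close>])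
 then show ?thesis by simp
 qed
 show ?thesis
 proof
 fix y assume "y \<in> ball x (h * tax)"
 then have y: "dist x y / h < tax" using h(1) by (simp add: field_simps)
 define s where "s = min s0 ((tax - dist x y / h) / 2)"
 have d0: "0 <= dist x y / h" using h(1) by simp
 have s: "0 < s" "s <= s0" "s < tax" using s0(1) y d0 by (auto simp: s_def min_less_iff_disj)
 have "s < tax - dist x y / h" using y by (auto simp: s_def min_less_iff_disj)
 then have "dist x y < h * (tax - s)" using h(1) by (simp add: field_simps)
 then show "y \<in> K 0" using *[OF s] by auto
 qed
qed

text \<open>The depth \<open>d\<close> is carried along unchanged: through smooth pieces by
  \<open>depth_preserved\<close>, through surgeries by \<open>depth_surgery\<close>. Positive depth
  at the end gives membership.\<close>

lemma level_set_flow_inside: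
 assumes F: "delta_H_flow P de HH K" and de: "de <= 1 / 100" and L: "avoids_smooth_flows L" and tax: "0 <= tax"
 and d: "d >= 20 / H_neck HH" and init: "!!x. x \<in> L tax ==> ball x d <= domain_at K 0" and t: "0 <= t"
 shows "L (t + tax) <= domain_at K t"
proof -
 have "H_neck HH > 0" using F by (simp add: delta_H_flow_def)
 then have "20 / H_neck HH > 0" by simp
 then have d0: "d > 0" using d by linarith
 have K0: "bounded (domain_at K 0)" using F by (simp add: delta_H_flow_def compact_imp_bounded)
 have "\<forall>x\<in>L (t + tax). ball x d <= domain_at K t"
 proof (rule flow_slices_induct(2)[OF F, where Ph="%t X. \<forall>x\<in>L (t + tax). ball x d <= X"], goal_cases)
 case 1
 then show ?case using init by simp
 next
 case (2 i t)
 note pi = piece_interval_iff[OF F 2(1)]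
 let ?T = "surgery_time K (i - 1)"
 have J: "{?T..t} <= piece_interval K i" "?T <= t"
 proof -
 have tp: "?T <= t" "i < num_flows K ==> t <= surgery_time K i" using 2(3) pi[of t] by simp_all
 show "?T <= t" by (rule tp(1))
 show "{?T..t} <= piece_interval K i"
 proof
 fix r assume "r \<in> {?T..t}"
 then show "r \<in> piece_interval K i" unfolding pi[of r] using tp by auto
 qed
 qed
 have T0: "0 <= ?T" using stime_flow(8)[OF F, of "i - 1"] 2(1) by auto
 have "(\<Union>s\<in>{?T..t}. slice K i s) <= domain_at K 0"
 by (rule UN_least, rule surgery_flow_decreases[OF F 2(1) subsetD[OF J(1)]])
 then have b: "bounded (\<Union>s\<in>{?T..t}. slice K i s)" by (rule bounded_subset[OF K0])
 show ?case
 proof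
 fix x assume x: "x \<in> L (t + tax)"
 show "ball x d <= slice K i t"
 by (rule depth_preserved[OF L smooth_mcf_subset[OF delta_flow_pieces(1)[OF F 2(1)] J(1)] b _ d0 _ _ x]) (use T0 tax 2(2) J(2) in auto)
 qed
 next
 case (3 i)
 then show ?case using depth_surgery[OF F 3(1) de _ d] by blast
 qed (use t in simp)
 then show ?thesis using d0 by force
qed

section \<open>The Hausdorff estimate for the space-time tracks\<close>

lemma flow_interval_delta_H: "delta_H_flow P de HH K ==> flow_interval K = {0..}"
 using stime_flow(4,5)[of P de HH K] by (auto simp: flow_interval_def zero_ereal_def)

theorem proposition3p1:
  fixes P :: surgery_data
  assumes "valid_surgery_data P"
  shows "\<exists>\<delta>bar>0. \<forall>K0. smooth_domain K0 \<and> compact K0 \<and> mean_convex K0 \<longrightarrow>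
           (\<exists>C>0. \<forall>\<delta> \<H> K L.
              \<delta> \<le> \<delta>bar \<and> delta_H_flow P \<delta> \<H> K \<and> domain_at K 0 = K0 \<and> H_neck \<H> \<ge> C \<and>
              level_set_flow K0 L \<longrightarrow>
              hausdorff_dist (track (flow_interval K) (domain_at K)) (track {0..} L)
                \<le> ennreal (C / H_neck \<H>))"
proof (rule exI[of _ "1/100"], intro conjI allI impI)
 fix K0 :: "R3 set" assume "smooth_domain K0 & compact K0 & mean_convex K0"
 then have K0: "smooth_domain K0" "compact K0" "mean_convex K0" by simp_all
 show "\<exists>C>0. ALL de HH K L. de <= 1/100 & delta_H_flow P de HH K & domain_at K 0 = K0 & H_neck HH >= C & level_set_flow K0 L -->
 hausdorff_dist (track (flow_interval K) (domain_at K)) (track {0..} L) <= ennreal (C / H_neck HH)"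
 \<comment> \<open>\<open>C\<close> has to be fixed before the surgery flow is given, and its choice
   needs a smooth flow of \<open>K0\<close> for a short time. The first piece of any surgery flow
   starting at \<open>K0\<close> provides one; if there is none, the claim is vacuous.\<close>
 proof (cases "EX de HH K. delta_H_flow P de HH K & domain_at K 0 = K0")
 case False
 then show ?thesis by (intro exI[of _ 1]) auto
 next
 case True
 then obtain de' HH' K' where F': "delta_H_flow P de' HH' K'" "domain_at K' 0 = K0" by blast
 have i1: "1 \<in> {1..num_flows K'}" using stime_flow(1)[OF F'(1)] by simp
 have "0 < stime K' 1" using stime_flow(3)[OF F'(1), of 0 1] stime_flow(4)[OF F'(1)] i1 by simp
 then obtain T where T: "0 < T" "ereal T < stime K' 1" using ereal_dense2[of 0 "stime K' 1"] by (auto simp: zero_ereal_def)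
 have J: "{0..T} <= piece_interval K' 1"
 proof
 fix t assume t: "t \<in> {0..T}"
 then have "ereal t <= ereal T" by simp
 then have "ereal t <= stime K' 1" using T(2) by (meson less_imp_le order_trans)
 then show "t \<in> piece_interval K' 1" using t stime_flow(4)[OF F'(1)] by (simp add: piece_interval_def zero_ereal_def)
 qed
 define M where "M = slice K' 1"
 have M: "smooth_mcf {0..T} M" unfolding M_def by (rule smooth_mcf_subset[OF delta_flow_pieces(1)[OF F'(1) i1] J])
 have M0: "M 0 = K0" using domain_at_0[OF F'(1)] F'(2) by (simp add: M_def)
 have "(\<Union>t\<in>{0..T}. M t) <= K0"
 unfolding M_def F'(2)[symmetric] by (rule UN_least, rule surgery_flow_decreases[OF F'(1) i1 subsetD[OF J]])
 then have bM: "bounded (\<Union>t\<in>{0..T}. M t)" by (rule bounded_subset[OF compact_imp_bounded[OF K0(2)]])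
 obtain h where h: "h > 0" "!!t x. t \<in> {0..T} ==> x \<in> frontier (M t) ==> mean_curv (M t) x > h"
 by (rule mcf_curvature_bound[OF M bM]) (use delta_flow_pieces(2)[OF F'(1) i1 subsetD[OF J]] in \<open>auto simp: M_def\<close>)
 \<comment> \<open>With the delay \<open>tax\<close> below, the first entry gives
   \<open>tax <= C / H_neck HH\<close> and the second \<open>tax <= T\<close>, so that the delay
   fits into the short smooth flow.\<close>
 define C where "C = max (20 / h) (20 / (h * T))"
 show ?thesis
 proof (intro exI[of _ C] conjI allI impI)
 show "C > 0" using h T by (simp add: C_def less_max_iff_disj)
 fix de HH K L
 assume a: "de <= 1/100 & delta_H_flow P de HH K & domain_at K 0 = K0 & H_neck HH >= C & level_set_flow K0 L"
 then have de: "de <= 1/100" and F: "delta_H_flow P de HH K" and KK: "domain_at K 0 = K0" and H: "H_neck HH >= C" and LL: "level_set_flow K0 L"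
 by blast+
 have W: "weak_set_flow_from K0 L" using LL by (simp add: level_set_flow_def)
 then have L: "avoids_smooth_flows L" "!!t. 0 <= t ==> closed (L t)" "L 0 = M 0" by (simp_all add: weak_set_flow_from_def M0)
 have KL: "domain_at K t <= L t" if "0 <= t" for t
 using LL surgery_flow_weak_set_flow[OF F] that unfolding KK level_set_flow_def by blast
 have Hp: "H_neck HH > 0" using F by (simp add: delta_H_flow_def)
 \<comment> \<open>Chosen such that the depth \<open>h * tax\<close> reached after this delay is
   exactly \<open>20 / H_neck HH\<close>, the least depth that survives surgery in
   \<open>depth_surgery\<close>.\<close>
 define tax where "tax = 20 / (h * H_neck HH)"
 have ta0: "0 < tax" using h Hp by (simp add: tax_def)
 have "20 / (h * T) <= H_neck HH" using H by (simp add: C_def)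
 then have taT: "tax <= T" using h Hp T by (simp add: tax_def field_simps)
 have "20 / h <= C" by (simp add: C_def)
 then have "20 / h / H_neck HH <= C / H_neck HH" using Hp by (intro divide_right_mono) auto
 then have taC: "tax <= C / H_neck HH" by (simp add: tax_def)
 have hta: "h * tax = 20 / H_neck HH" using h by (simp add: tax_def)
 note M0' = K0(1,2)[folded M0]
 have depth: "ball x (h * t) <= K0" if "0 < t" "t <= T" "x \<in> L t" for x t
 unfolding M0[symmetric] by (rule initial_depth[OF M T(1) bM M0' h L that])
 have inK0: "x \<in> K0" if "0 <= t" "t <= T" "x \<in> L t" for x t
 proof (cases "t = 0")
 case True
 then show ?thesis using that L(3) M0 by simp
 next
 case False
 then have "0 < t" using that by simp
 from depth[OF this that(2,3)] show ?thesis using h(1) \<open>0 < t\<close> centre_in_ball[of x "h * t"] by auto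
 qed
 have hd: "20 / H_neck HH <= h * tax" by (simp add: hta)
 have inside: "L (t + tax) <= domain_at K t" if "0 <= t" for t
 by (rule level_set_flow_inside[OF F de L(1) less_imp_le[OF ta0] hd _ that]) (use depth[OF ta0 taT] KK in simp)
 have fi: "flow_interval K = {0..}" by (rule flow_interval_delta_H[OF F])
 show "hausdorff_dist (track (flow_interval K) (domain_at K)) (track {0..} L) <= ennreal (C / H_neck HH)"
 unfolding hausdorff_dist_def fi
 proof (intro max.boundedI SUP_least)
 fix z assume z: "z \<in> track {0..} (domain_at K)"
 then have "z \<in> track {0..} L" using KL by (auto simp: track_def)
 then show "(INF b\<in>track {0..} L. ennreal (dist z b)) <= ennreal (C / H_neck HH)" by (rule INF_lower2) simp
 next
 fix z assume z: "z \<in> track {0..} L"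
 obtain x t where xt: "z = (x, t)" "0 <= t" "x \<in> L t" using z by (auto simp: track_def)
 \<comment> \<open>The partner of \<open>(x, t)\<close> has the same place and an earlier time, so
   their distance is at most the delay. Up to time \<open>tax\<close> the initial slice serves,
   because \<open>L\<close> stays in \<open>K0\<close> that long.\<close>
 define t' where "t' = max 0 (t - tax)"
 have "x \<in> domain_at K t'"
 proof (cases "t <= tax")
 case True
 then show ?thesis using inK0[of t x] xt taT KK by (simp add: t'_def)
 next
 case False
 then show ?thesis using inside[of "t - tax"] xt by (auto simp: t'_def)
 qed
 then have m: "(x, t') \<in> track {0..} (domain_at K)" by (simp add: track_def t'_def)
 have "dist (x, t') z <= tax" using xt ta0 by (auto simp: dist_Pair_Pair dist_real_def t'_def)
 then have "ennreal (dist z (x, t')) <= ennreal (C / H_neck HH)" using taC by (intro ennreal_leI) (simp add: dist_commute)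
 then show "(INF a\<in>track {0..} (domain_at K). ennreal (dist a z)) <= ennreal (C / H_neck HH)"
 using m by (intro INF_lower2) (simp_all add: dist_commute)
 qed
 qed
 qed
qed simp

end
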